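(* Let $V(t,x,S,\mu,q)=\sup_{\pi\in\Pi}V^\pi(t,x,S,\mu,q)$ be the optimal value function of the exploratory liquidation problem, with HJB equation $$0=\Big(\partial_t+\tfrac12\sigma^2\partial_{SS}+\mathcal L^\mu\Big)V+\sup_{\pi\in\Pi}\Big\{\int_{\mathcal A}\big[(S-kv)v\,\partial_xV-v\,\partial_qV-bv\,\partial_SV-\gamma\log\pi_t(v)-\varphi(v-\rho\mu)^2\big]\pi_t(v)\,\mathrm dv\Big\}$$ and terminal condition $V(T,x,S,\mu,q)=x+q(S-\alpha q)$. The policy satisfying this HJB equation (i.e. the optimal control in it) and the terminal condition is $$\pi^*(v\mid t,\mathbf y)=\mathcal N\left(\frac{-w_1(t,\mu)-2w_2(t,\mu)q-bq+2\varphi\rho\mu}{2(\varphi+k)},\ \frac{\gamma}{2(\varphi+k)}\right),\qquad \mathbf y=(x,S,\mu,q)^{\mathsf T},$$ which is a Gaussian distribution with mean value $\dfrac{-w_1(t,\mu)-2w_2(t,\mu)q-bq+2\varphi\rho\mu}{2(\varphi+k)}$ and variance $\dfrac{\gamma}{2(\varphi+k)}$, where $$w_2(t,\mu)=-\Big(\frac{T-t}{k+\varphi}+\frac1{\alpha-\frac12b}\Big)^{-1}-\frac12b,\qquad w_1(t,\mu)=l_0(t)+l_1(t)\mu,$$ $$l_1(t)=2\varphi\rho\Big((T-t)+\frac{k+\varphi}{\alpha-\frac12b}\Big)^{-1}\frac{1-e^{-\kappa(T-t)}}{\kappa},$$ $$l_0(t)=2\varphi\rho\lambda\,\mathbb 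E[\eta]\Big((T-t)+\frac{k+\varphi}{\alpha-\frac12b}\Big)^{-1}\frac{e^{-\kappa(T-t)}-1+\kappa(T-t)}{\kappa^2}.$$
   Context: $T$ is the terminal time of the liquidation problem. The constants are: $b\ge0$ (permanent impact), $k\ge0$ (temporary impact), $\sigma$ (volatility of the midprice), $\kappa$ (mean-reversion rate of the market trading speed), $\alpha$ (terminal penalty), $\varphi$ (target penalty), $\rho$ (target percentage of the market trading speed), $\lambda>0$ (jump intensity), and $\gamma\ge0$ (temperature parameter, the level of encouragement for exploration). $W$ is a standard one-dimensional Brownian motion and $N$ a homogeneous Poisson process of intensity $\lambda$, both on a probability space with measure $\mathbb P^{W,N}$ and natural filtration $\{\mathcal F_t^{W,N}\}$ generated by $W$ and $N$; $\mathcal F_t=\mathcal F_t^{W,N}\vee\sigma(Z)$ with $Z$ a random variable independent of $W,N$ (randomization of actions). $\eta_1,\eta_2,\dots$ are non-negative i.i.d. random variables with the same distribution as $\eta$, whose moments are finite. The action space is $\mathcal A\subset\mathbb R$. A policy $\pi$ assigns to $(t,\mathbf y)$ a probability density $\pi(\cdot\mid t,\mathbf y)$ on $\mathcal A$; $\pi_t(v)$ is its value at the current time and state. The exploratory state $\tilde{\mathbf Y}^\pi=(\tilde S^\pi,\tilde X^\pi,\tilde Q^\pi,\mu)^{\mathsf T}$ (midprice, cash, inventory, market trading speed) satisfies $$\mathrm d\tilde Q^\pi_t=-\int_{\mathcal A}v\pi_t(v)\,\mathrm dv\,\mathrm dt,\quad \mathrm d\tilde S^\pi_t=-b\int_{\mathcal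 A}v\pi_t(v)\,\mathrm dv\,\mathrm dt+\sigma\,\mathrm dW_t,\quad \mathrm d\tilde X^\pi_t=\int_{\mathcal A}(\tilde S^\pi_t-kv)v\pi_t(v)\,\mathrm dv\,\mathrm dt,$$ $$\mathrm d\mu_t=-\kappa\mu_t\,\mathrm dt+\eta_{1+N_{t-}}\,\mathrm dN_t .$$ The value function of an admissible policy $\pi$ is $$V^\pi(t,x,S,\mu,q)=\mathbb E^{\mathbb P^{W,N}}\Big[\tilde X^\pi_T+\tilde Q^\pi_T(\tilde S^\pi_T-\alpha\tilde Q^\pi_T)-\int_t^T\!\!\int_{\mathcal A}\big(\varphi(v-\rho\mu_u)^2+\gamma\log\pi_u(v)\big)\pi_u(v)\,\mathrm dv\,\mathrm du\Big]$$ conditional on $(\tilde X^\pi_t,\tilde S^\pi_t,\mu_t,\tilde Q^\pi_t)=(x,S,\mu,q)$. The infinitesimal generator of $\mu$ is $$\mathcal L^\mu V(t,x,S,\mu,q)=-\kappa\mu\,\partial_\mu V+\lambda\,\mathbb E[V(t,x,S,\mu+\eta,q)-V(t,x,S,\mu,q)],$$ with expectation taken with respect to $\eta$. $\Pi$ is the set of admissible policies, i.e. those $\pi$ with: (i) $\pi(\cdot\mid t,\mathbf y)$ is a probability distribution on $\mathcal A$ and is $\mathcal F_t$-measurable; (ii) for every initial $(t,\mathbf y)\in[0,T]\times\mathbb R^4$ the exploratory state equation admits a unique weak solution; (iii) $\pi(\cdot\mid t,\mathbf y)$ is continuous in $(t,\mathbf y)$ and uniformly Lipschitz continuous in $\mathbf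 y$, in the sense that $\int_{\mathcal A}|\pi(v\mid t,\mathbf y)-\pi(v\mid t',\mathbf y')|\,\mathrm dv\to0$ as $(t,\mathbf y)\to(t',\mathbf y')$ and, for some $C>0$, $\int_{\mathcal A}|\pi(v\mid t,\mathbf y)-\pi(v\mid t,\mathbf y')|\,\mathrm dv\le C|\mathbf y-\mathbf y'|$ for all $\mathbf y,\mathbf y'\in\mathbb R^4$; (iv) for some $C>0$, $p\ge1$, $\int_{\mathcal A}|\varphi(v-\rho\mu)^2+\gamma\log\pi(v\mid t,\mathbf y)|\,\pi(v\mid t,\mathbf y)\,\mathrm dv\le C(1+|\mathbf y|^p)$ for all $(t,\mathbf y)\in[0,T]\times\mathbb R^4$.
   Formalization: Assumes T>0, γ>0, φ+k>0, κ≠0, α≠b/2, a nonzero bracket in w₂ on [0,T], and a Borel action space A of full Lebesgue measure; otherwise the Gaussian is not a density on A or the formulas are undefined. Weak solutions are taken over one (arbitrary) sample set. *)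

theory Defs
  imports "HOL-Probability.Probability"
begin

record model =
  T_of :: real
  b_of :: real
  k_of :: real
  \<sigma>_of :: real
  \<kappa>_of :: real
  \<alpha>_of :: real
  \<phi>_of :: real
  \<rho>_of :: real
  rate_of :: real  \<comment> \<open>jump intensity \<open>\<lambda>\<close>\<close>
  \<gamma>_of :: real
  \<nu>_of :: "real measure"  \<comment> \<open>law of the jump size \<open>\<eta>\<close>\<close>
  A_of :: "real set"

text \<open>A state is \<open>(x, S, \<mu>, q)\<close>: cash, midprice, market trading speed, inventory. The norm on
  nested products is the Euclidean norm of \<open>\<real>\<^sup>4\<close>.\<close>

type_synonym state = "real \<times> real \<times> real \<times> real"

definition cash :: "state \<Rightarrow> real" where "cash = (\<lambda>(x, S, \<mu>, q). x)"
definition midprice :: "state \<Rightarrow> real" where "midprice = (\<lambda>(x, S, \<mu>, q). S)"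
definition speed :: "state \<Rightarrow> real" where "speed = (\<lambda>(x, S, \<mu>, q). \<mu>)"
definition inventory :: "state \<Rightarrow> real" where "inventory = (\<lambda>(x, S, \<mu>, q). q)"

text \<open>\<open>\<pi> t y v\<close> is the density \<open>\<pi>(v | t, y)\<close>. Its values for \<open>t\<close> outside \<open>[0, T]\<close> or \<open>v\<close> outside the
  action space are irrelevant.\<close>

type_synonym policy = "real \<Rightarrow> state \<Rightarrow> real \<Rightarrow> real"

text \<open>Integral with values in the extended reals. The Bochner integral is \<open>0\<close> on non-integrable
  functions, which inside a supremum would let a policy of infinite cost count as one of value \<open>0\<close>;
  here such a policy has value \<open>-\<infinity>\<close>. (If both parts are infinite, HOL's convention yields \<open>\<infinity>\<close>.)\<close>

definition ext_integral :: "'b measure \<Rightarrow> ('b \<Rightarrow> real) \<Rightarrow> ereal" where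
  "ext_integral M f =
     enn2ereal (\<integral>\<^sup>+z. ennreal (f z) \<partial>M) - enn2ereal (\<integral>\<^sup>+z. ennreal (- f z) \<partial>M)"


subsection \<open>Driving noise\<close>

definition generated_sets ::
    "'a measure \<Rightarrow> ('i \<Rightarrow> 'a \<Rightarrow> 'b::topological_space) \<Rightarrow> 'i set \<Rightarrow> 'a set set" where
  "generated_sets M X I =
     sigma_sets (space M) (\<Union>i\<in>I. {X i -` B \<inter> space M | B. B \<in> sets borel})"

text \<open>The integral of \<open>\<eta>\<^bsub>1 + N(r-)\<^esub>\<close> with respect to \<open>dN\<^sub>r\<close> over \<open>(s, t]\<close>: as \<open>N\<close> jumps from \<open>i - 1\<close> to \<open>i\<close>, the mark \<open>\<eta>\<^sub>i\<close>
  is added.\<close>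

definition jump_integral :: "(real \<Rightarrow> nat) \<Rightarrow> (nat \<Rightarrow> real) \<Rightarrow> real \<Rightarrow> real \<Rightarrow> real" where
  "jump_integral n e s t = (\<Sum>i = Suc (n s)..n t. e i)"

text \<open>\<open>W\<close> is a Brownian motion and \<open>N\<close> a Poisson process of intensity \<open>\<lambda>\<close>
  with i.i.d. marks \<open>\<eta> 1, \<eta> 2, \<dots>\<close> of law \<open>\<nu>\<close>, all independent, relative to a filtration \<open>F\<close>. The filtration may be larger
  than the one generated by the noise; in particular \<open>F 0\<close> may contain an independent randomization
  variable. The mark \<open>\<eta> i\<close> is revealed at the \<open>i\<close>-th jump of \<open>N\<close>.\<close>

definition driving_noise ::
    "model \<Rightarrow> 'a measure \<Rightarrow> (real \<Rightarrow> 'a measure) \<Rightarrow> (real \<Rightarrow> 'a \<Rightarrow> real) \<Rightarrow> (real \<Rightarrow> 'a \<Rightarrow> nat) \<Rightarrow>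
     (nat \<Rightarrow> 'a \<Rightarrow> real) \<Rightarrow> bool" where
  "driving_noise P M F W N \<eta> \<longleftrightarrow>
     (let J = (\<lambda>t \<omega>. jump_integral (\<lambda>r. N r \<omega>) (\<lambda>i. \<eta> i \<omega>) 0 t) in
     prob_space M \<and>
     filtration (space M) F \<and> (\<forall>t. subalgebra M (F t)) \<and>
     \<comment> \<open>adaptedness\<close>
     (\<forall>t\<ge>0. W t \<in> borel_measurable (F t) \<and> N t \<in> measurable (F t) (count_space UNIV) \<and>
        J t \<in> borel_measurable (F t)) \<and>
     \<comment> \<open>paths\<close>
     (\<forall>\<omega>\<in>space M. W 0 \<omega> = 0 \<and> continuous_on {0..} (\<lambda>t. W t \<omega>)) \<and>
     (\<forall>\<omega>\<in>space M. N 0 \<omega> = 0 \<and> mono_on {0..} (\<lambda>t. N t \<omega>) \<and>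
        (\<forall>t\<ge>0. continuous (at_right t) (\<lambda>s. real (N s \<omega>)))) \<and>
     \<comment> \<open>laws\<close>
     (\<forall>s\<ge>0. \<forall>t>s. distributed M lborel (\<lambda>\<omega>. W t \<omega> - W s \<omega>) (normal_density 0 (sqrt (t - s)))) \<and>
     (\<forall>s\<ge>0. \<forall>t>s. distr M (count_space UNIV) (\<lambda>\<omega>. N t \<omega> - N s \<omega>) =
        measure_pmf (poisson_pmf (rate_of P * (t - s)))) \<and>
     prob_space.indep_vars M (\<lambda>_. borel) \<eta> {1..} \<and>
     (\<forall>i\<ge>1. distr M borel (\<eta> i) = \<nu>_of P) \<and>
     \<comment> \<open>independence\<close>
     prob_space.indep_sets M
       (\<lambda>j. [generated_sets M W {0..},
             generated_sets M (\<lambda>t \<omega>. real (N t \<omega>)) {0..},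
             generated_sets M \<eta> {1..}] ! j) {0, 1, 2} \<and>
     (\<forall>s\<ge>0. \<forall>t>s. prob_space.indep_set M (sets (F s))
        {(\<lambda>\<omega>. (W t \<omega> - W s \<omega>, real (N t \<omega>) - real (N s \<omega>), J t \<omega> - J s \<omega>)) -` B \<inter> space M | B.
           B \<in> sets borel}))"


subsection \<open>Exploratory state equation\<close>

definition mean_rate :: "model \<Rightarrow> policy \<Rightarrow> real \<Rightarrow> state \<Rightarrow> real" where
  "mean_rate P \<pi> t y = (LINT v:A_of P|lborel. v * \<pi> t y v)"

definition cash_rate :: "model \<Rightarrow> policy \<Rightarrow> real \<Rightarrow> state \<Rightarrow> real" where
  "cash_rate P \<pi> t y = (LINT v:A_of P|lborel. (midprice y - k_of P * v) * v * \<pi> t y v)"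

text \<open>The state equation on \<open>[t, T]\<close> from \<open>y\<close> at time \<open>t\<close>, in integral form, along one path \<open>w\<close>, \<open>n\<close>, \<open>e\<close>
  of the noise; the noise is additive, so that no stochastic integral is involved. The first three
  conditions say that the integrals exist.\<close>

definition state_equation ::
    "model \<Rightarrow> policy \<Rightarrow> real \<Rightarrow> state \<Rightarrow> (real \<Rightarrow> real) \<Rightarrow> (real \<Rightarrow> nat) \<Rightarrow> (nat \<Rightarrow> real) \<Rightarrow>
     (real \<Rightarrow> state) \<Rightarrow> bool" where
  "state_equation P \<pi> t y w n e Y \<longleftrightarrow>
     (AE r in lborel. r \<in> {t..T_of P} \<longrightarrow>
        set_integrable lborel (A_of P) (\<lambda>v. v * \<pi> r (Y r) v) \<and>
        set_integrable lborel (A_of P) (\<lambda>v. (midprice (Y r) - k_of P * v) * v * \<pi> r (Y r) v)) \<and>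
     set_integrable lborel {t..T_of P} (\<lambda>r. mean_rate P \<pi> r (Y r)) \<and>
     set_integrable lborel {t..T_of P} (\<lambda>r. cash_rate P \<pi> r (Y r)) \<and>
     (\<forall>u\<in>{t..T_of P}.
        inventory (Y u) = inventory y - (LINT r:{t..u}|lborel. mean_rate P \<pi> r (Y r)) \<and>
        midprice (Y u) = midprice y - b_of P * (LINT r:{t..u}|lborel. mean_rate P \<pi> r (Y r))
                           + \<sigma>_of P * (w u - w t) \<and>
        cash (Y u) = cash y + (LINT r:{t..u}|lborel. cash_rate P \<pi> r (Y r)) \<and>
        speed (Y u) = speed y - \<kappa>_of P * (LINT r:{t..u}|lborel. speed (Y r))
                           + jump_integral n e t u)"

definition cadlag_on :: "real \<Rightarrow> real \<Rightarrow> (real \<Rightarrow> 'b::topological_space) \<Rightarrow> bool" where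
  "cadlag_on s t f \<longleftrightarrow>
     (\<forall>u\<in>{s..<t}. (f \<longlongrightarrow> f u) (at_right u)) \<and> (\<forall>u\<in>{s<..t}. \<exists>l. (f \<longlongrightarrow> l) (at_left u))"

definition weak_solution ::
    "model \<Rightarrow> policy \<Rightarrow> real \<Rightarrow> state \<Rightarrow> 'a measure \<Rightarrow> (real \<Rightarrow> 'a measure) \<Rightarrow> (real \<Rightarrow> 'a \<Rightarrow> real) \<Rightarrow>
     (real \<Rightarrow> 'a \<Rightarrow> nat) \<Rightarrow> (nat \<Rightarrow> 'a \<Rightarrow> real) \<Rightarrow> (real \<Rightarrow> 'a \<Rightarrow> state) \<Rightarrow> bool" where
  "weak_solution P \<pi> t y M F W N \<eta> Y \<longleftrightarrow>
     driving_noise P M F W N \<eta> \<and>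
     (\<forall>u\<in>{t..T_of P}. Y u \<in> borel_measurable (F u)) \<and>
     (\<forall>\<omega>\<in>space M. cadlag_on t (T_of P) (\<lambda>u. Y u \<omega>)) \<and>
     (AE \<omega> in M. state_equation P \<pi> t y (\<lambda>u. W u \<omega>) (\<lambda>u. N u \<omega>) (\<lambda>i. \<eta> i \<omega>) (\<lambda>u. Y u \<omega>))"

definition path_law ::
    "real \<Rightarrow> real \<Rightarrow> 'a measure \<Rightarrow> (real \<Rightarrow> 'a \<Rightarrow> state) \<Rightarrow> (real \<Rightarrow> state) measure" where
  "path_law s t M Y = distr M (\<Pi>\<^sub>M u\<in>{s..t}. borel) (\<lambda>\<omega>. \<lambda>u\<in>{s..t}. Y u \<omega>)"

text \<open>HOL cannot quantify over all probability spaces at once: a weak solution may live on any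
  probability space over the sample type \<open>'a\<close>. This is no restriction once \<open>'a\<close> carries a driving noise,
  because \<open>'a\<close> then has at least the cardinality of the continuum and so carries every law on a standard
  Borel space. Uniqueness is uniqueness in law.\<close>

definition unique_weak_solution :: "'a itself \<Rightarrow> model \<Rightarrow> policy \<Rightarrow> real \<Rightarrow> state \<Rightarrow> bool" where
  "unique_weak_solution TA P \<pi> t y \<longleftrightarrow>
     (\<exists>(M::'a measure) F W N \<eta> Y. weak_solution P \<pi> t y M F W N \<eta> Y) \<and>
     (\<forall>(M::'a measure) F W N \<eta> Y (M'::'a measure) F' W' N' \<eta>' Y'.
        weak_solution P \<pi> t y M F W N \<eta> Y \<longrightarrow> weak_solution P \<pi> t y M' F' W' N' \<eta>' Y' \<longrightarrow>
        path_law t (T_of P) M Y = path_law t (T_of P) M' Y')"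


subsection \<open>Admissible policies\<close>

text \<open>A policy is a deterministic feedback map; joint Borel measurability is what makes
  \<open>\<pi>(v | t, Y\<^sub>t)\<close> measurable with respect to \<open>F\<^sub>t\<close>.\<close>

definition admissible_policies :: "'a itself \<Rightarrow> model \<Rightarrow> policy set" where
  "admissible_policies TA P = {\<pi>.
     (\<lambda>(t, y, v). \<pi> t y v) \<in> borel_measurable (restrict_space borel ({0..T_of P} \<times> UNIV \<times> A_of P)) \<and>
     (\<forall>t\<in>{0..T_of P}. \<forall>y. (\<forall>v\<in>A_of P. 0 \<le> \<pi> t y v) \<and>
        set_integrable lborel (A_of P) (\<pi> t y) \<and> (LINT v:A_of P|lborel. \<pi> t y v) = 1) \<and>
     (\<forall>t\<in>{0..T_of P}. \<forall>y. unique_weak_solution TA P \<pi> t y) \<and>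
     (\<forall>t'\<in>{0..T_of P}. \<forall>y'.
        ((\<lambda>(t, y). LINT v:A_of P|lborel. \<bar>\<pi> t y v - \<pi> t' y' v\<bar>) \<longlongrightarrow> 0)
          (at (t', y') within {0..T_of P} \<times> UNIV)) \<and>
     (\<exists>C>0. \<forall>t\<in>{0..T_of P}. \<forall>y y'.
        (LINT v:A_of P|lborel. \<bar>\<pi> t y v - \<pi> t y' v\<bar>) \<le> C * norm (y - y')) \<and>
     (\<exists>C>0. \<exists>p\<ge>1. \<forall>t\<in>{0..T_of P}. \<forall>y.
        (\<integral>\<^sup>+v\<in>A_of P. ennreal (\<bar>\<phi>_of P * (v - \<rho>_of P * speed y)\<^sup>2 + \<gamma>_of P * ln (\<pi> t y v)\<bar> * \<pi> t y v)
           \<partial>lborel) \<le> ennreal (C * (1 + norm y powr p)))}"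


subsection \<open>Value functions\<close>

definition payoff :: "model \<Rightarrow> policy \<Rightarrow> real \<Rightarrow> (real \<Rightarrow> state) \<Rightarrow> real" where
  "payoff P \<pi> t Y =
     cash (Y (T_of P)) + inventory (Y (T_of P)) *
       (midprice (Y (T_of P)) - \<alpha>_of P * inventory (Y (T_of P)))
     - (LINT u:{t..T_of P}|lborel. LINT v:A_of P|lborel.
          (\<phi>_of P * (v - \<rho>_of P * speed (Y u))\<^sup>2 + \<gamma>_of P * ln (\<pi> u (Y u) v)) * \<pi> u (Y u) v)"

text \<open>The weak solution of an admissible policy is unique in law, so any choice of it will do.\<close>

definition policy_value :: "'a itself \<Rightarrow> model \<Rightarrow> policy \<Rightarrow> real \<Rightarrow> state \<Rightarrow> ereal" where
  "policy_value TA P \<pi> t y =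
     (let (M::'a measure, Y) = (SOME (M, Y). \<exists>F W N \<eta>. weak_solution P \<pi> t y M F W N \<eta> Y)
      in ext_integral M (\<lambda>\<omega>. payoff P \<pi> t (\<lambda>u. Y u \<omega>)))"

definition optimal_value ::
    "'a itself \<Rightarrow> model \<Rightarrow> real \<Rightarrow> real \<Rightarrow> real \<Rightarrow> real \<Rightarrow> real \<Rightarrow> ereal" where
  "optimal_value TA P t x S \<mu> q =
     (SUP \<pi>\<in>admissible_policies TA P. policy_value TA P \<pi> t (x, S, \<mu>, q))"


subsection \<open>The HJB equation\<close>

type_synonym value_fun = "real \<Rightarrow> real \<Rightarrow> real \<Rightarrow> real \<Rightarrow> real \<Rightarrow> real"

text \<open>Functions are only considered on the time interval \<open>[0, T]\<close>, so the time derivative at \<open>0\<close> is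
  one-sided.\<close>

definition D\<^sub>t :: "model \<Rightarrow> value_fun \<Rightarrow> value_fun" where
  "D\<^sub>t P V t x S \<mu> q = vector_derivative (\<lambda>s. V s x S \<mu> q) (at t within {0..T_of P})"
definition D\<^sub>x :: "value_fun \<Rightarrow> value_fun" where
  "D\<^sub>x V t x S \<mu> q = deriv (\<lambda>z. V t z S \<mu> q) x"
definition D\<^sub>S :: "value_fun \<Rightarrow> value_fun" where
  "D\<^sub>S V t x S \<mu> q = deriv (\<lambda>z. V t x z \<mu> q) S"
definition D\<^sub>\<mu> :: "value_fun \<Rightarrow> value_fun" where
  "D\<^sub>\<mu> V t x S \<mu> q = deriv (\<lambda>z. V t x S z q) \<mu>"
definition D\<^sub>q :: "value_fun \<Rightarrow> value_fun" where
  "D\<^sub>q V t x S \<mu> q = deriv (\<lambda>z. V t x S \<mu> z) q"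

definition HJB_regular :: "model \<Rightarrow> value_fun \<Rightarrow> bool" where
  "HJB_regular P V \<longleftrightarrow> (\<forall>t\<in>{0..<T_of P}. \<forall>x S \<mu> q.
     (\<lambda>s. V s x S \<mu> q) differentiable (at t within {0..T_of P}) \<and>
     (\<lambda>z. V t z S \<mu> q) differentiable (at x) \<and>
     (\<lambda>z. V t x z \<mu> q) differentiable (at S) \<and>
     (\<lambda>z. D\<^sub>S V t x z \<mu> q) differentiable (at S) \<and>
     (\<lambda>z. V t x S z q) differentiable (at \<mu>) \<and>
     (\<lambda>z. V t x S \<mu> z) differentiable (at q) \<and>
     integrable (\<nu>_of P) (\<lambda>h. V t x S (\<mu> + h) q))"

definition generator :: "model \<Rightarrow> value_fun \<Rightarrow> value_fun" where
  "generator P V t x S \<mu> q =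
     - \<kappa>_of P * \<mu> * D\<^sub>\<mu> V t x S \<mu> q
     + rate_of P * (\<integral>h. (V t x S (\<mu> + h) q - V t x S \<mu> q) \<partial>\<nu>_of P)"

text \<open>The expression in braces in the HJB equation.\<close>

definition hamiltonian ::
    "model \<Rightarrow> value_fun \<Rightarrow> policy \<Rightarrow> real \<Rightarrow> real \<Rightarrow> real \<Rightarrow> real \<Rightarrow> real \<Rightarrow> ereal" where
  "hamiltonian P V \<pi> t x S \<mu> q = ext_integral lborel (\<lambda>v. indicator (A_of P) v *
     (((S - k_of P * v) * v * D\<^sub>x V t x S \<mu> q - v * D\<^sub>q V t x S \<mu> q - b_of P * v * D\<^sub>S V t x S \<mu> q
       - \<gamma>_of P * ln (\<pi> t (x, S, \<mu>, q) v) - \<phi>_of P * (v - \<rho>_of P * \<mu>)\<^sup>2) * \<pi> t (x, S, \<mu>, q) v))"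

definition solves_HJB :: "'a itself \<Rightarrow> model \<Rightarrow> value_fun \<Rightarrow> bool" where
  "solves_HJB TA P V \<longleftrightarrow> HJB_regular P V \<and> (\<forall>t\<in>{0..<T_of P}. \<forall>x S \<mu> q.
     0 = ereal (D\<^sub>t P V t x S \<mu> q + 1 / 2 * (\<sigma>_of P)\<^sup>2 * D\<^sub>S (D\<^sub>S V) t x S \<mu> q
                  + generator P V t x S \<mu> q)
         + (SUP \<pi>\<in>admissible_policies TA P. hamiltonian P V \<pi> t x S \<mu> q))"

definition terminal_condition :: "model \<Rightarrow> value_fun \<Rightarrow> bool" where
  "terminal_condition P V \<longleftrightarrow> (\<forall>x S \<mu> q. V (T_of P) x S \<mu> q = x + q * (S - \<alpha>_of P * q))"

definition attains_HJB_sup ::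
    "'a itself \<Rightarrow> model \<Rightarrow> value_fun \<Rightarrow> policy \<Rightarrow> real \<Rightarrow> real \<Rightarrow> real \<Rightarrow> real \<Rightarrow> real \<Rightarrow> bool" where
  "attains_HJB_sup TA P V \<pi> t x S \<mu> q \<longleftrightarrow>
     hamiltonian P V \<pi> t x S \<mu> q =
       (SUP \<pi>'\<in>admissible_policies TA P. hamiltonian P V \<pi>' t x S \<mu> q)"


subsection \<open>The Gaussian policy\<close>

definition w\<^sub>2 :: "model \<Rightarrow> real \<Rightarrow> real \<Rightarrow> real" where
  "w\<^sub>2 P t \<mu> =
     - inverse ((T_of P - t) / (k_of P + \<phi>_of P) + 1 / (\<alpha>_of P - 1 / 2 * b_of P)) - 1 / 2 * b_of P"

definition l\<^sub>1 :: "model \<Rightarrow> real \<Rightarrow> real" where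
  "l\<^sub>1 P t = 2 * \<phi>_of P * \<rho>_of P
     * inverse ((T_of P - t) + (k_of P + \<phi>_of P) / (\<alpha>_of P - 1 / 2 * b_of P))
     * ((1 - exp (- \<kappa>_of P * (T_of P - t))) / \<kappa>_of P)"

definition l\<^sub>0 :: "model \<Rightarrow> real \<Rightarrow> real" where
  "l\<^sub>0 P t = 2 * \<phi>_of P * \<rho>_of P * rate_of P * (\<integral>h. h \<partial>\<nu>_of P)
     * inverse ((T_of P - t) + (k_of P + \<phi>_of P) / (\<alpha>_of P - 1 / 2 * b_of P))
     * ((exp (- \<kappa>_of P * (T_of P - t)) - 1 + \<kappa>_of P * (T_of P - t)) / (\<kappa>_of P)\<^sup>2)"

definition w\<^sub>1 :: "model \<Rightarrow> real \<Rightarrow> real \<Rightarrow> real" where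
  "w\<^sub>1 P t \<mu> = l\<^sub>0 P t + l\<^sub>1 P t * \<mu>"

text \<open>The second argument of \<^const>\<open>normal_density\<close> is the standard deviation.\<close>

definition gaussian_policy :: "model \<Rightarrow> policy" where
  "gaussian_policy P = (\<lambda>t (x, S, \<mu>, q). normal_density
     ((- w\<^sub>1 P t \<mu> - 2 * w\<^sub>2 P t \<mu> * q - b_of P * q + 2 * \<phi>_of P * \<rho>_of P * \<mu>)
        / (2 * (\<phi>_of P + k_of P)))
     (sqrt (\<gamma>_of P / (2 * (\<phi>_of P + k_of P)))))"

end

theory Submission
  imports Defs
begin

text \<open>Write \<open>c = k + \<phi>\<close> and let \<open>p\<close> solve \<open>p' = p\<^sup>2 / c\<close>,
  \<open>p(T) = \<alpha> - b / 2\<close>, so that \<open>w\<^sub>2 = - p - b / 2\<close>. For an admissible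
  policy let \<open>u\<close> be its mean trading rate, \<open>Q\<close> the inventory and
  \<open>z = u - p Q / c\<close>.

  The noise enters the state equation additively, so the payoff can be rearranged along single paths, with
  the product rule for absolutely continuous functions (\<open>product_rule_integrals\<close>) in place of
  Ito's formula. Applied to \<open>Q\<^sup>2\<close> and \<open>p Q\<^sup>2\<close> it cancels every
  quadratic term in the inventory but the initial one and leaves (\<open>payoff_identity\<close>,
  \<open>running_cost\<close>, \<open>path_identity\<close>), up to terms independent of the policy, the
  time integral of \<open>z \<zeta> - c z\<^sup>2 - \<gamma> K\<close>. Here \<open>K\<close> is the
  relative entropy of the policy with respect to the normal law of the same mean \<open>u\<close> and of
  variance \<open>\<gamma> / (2 c)\<close>, and \<open>\<zeta>\<close> is an affine functional of the noise
  that looks into the future.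

  As \<open>z\<close> at time \<open>r\<close> is known at time \<open>r\<close> and the increments of the
  noise after \<open>r\<close> are independent of the past, \<open>\<zeta>\<close> may be replaced inside
  the expectation by its prediction \<open>2 \<phi> \<rho> \<mu> - w\<^sub>1\<close>
  (\<open>\<zeta>_predictable\<close>). Completing the square bounds the value of every policy by the value
  for \<open>z = (2 \<phi> \<rho> \<mu> - w\<^sub>1) / (2 c)\<close> and \<open>K = 0\<close>, and this pair
  of conditions describes the Gaussian policy. The bound is a quadratic function of the state,
  \<open>candidate\<close>; its part that depends on \<open>\<mu>\<close> alone is computed from the first
  two moments of the market trading speed (\<open>speed_value_eq\<close>). A policy whose cost is not
  integrable has value \<open>- \<infinity>\<close>, because the payoff has an integrable upper bound
  (\<open>payoff_upper_bound\<close>).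

  The Gaussian policy is admissible because its state equation is linear in speed and inventory: it is
  solved explicitly path by path, so that every weak solution is one measurable functional of the path of
  the noise (\<open>gaussian_path_law\<close>), whose law is determined by its independent increments
  (\<open>noise_path_law_unique\<close>).

  Hence the optimal value is \<open>candidate\<close> (\<open>optimal_value_eq\<close>), whose coefficients
  solve ordinary differential equations that make up the HJB equation (\<open>value_PDE\<close>). The
  expression in braces equals its maximum minus \<open>\<gamma>\<close> times the relative entropy with
  respect to the Gaussian policy (\<open>hamiltonian_gap\<close>), so that its maximizer is unique up to
  null sets.\<close>

abbreviation L1_on :: "real set \<Rightarrow> (real \<Rightarrow> real) \<Rightarrow> bool" where
  "L1_on \<equiv> set_integrable lborel"

abbreviation (in prob_space) "\<E> \<equiv> expectation"

abbreviation jointly_measurable :: "'b measure \<Rightarrow> (real \<Rightarrow> 'b \<Rightarrow> 'c::topological_space) \<Rightarrow> bool" where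
  "jointly_measurable L X \<equiv> (\<lambda>(r, \<omega>). X r \<omega>) \<in> borel_measurable (borel \<Otimes>\<^sub>M L)"

section \<open>Integration on an interval\<close>

lemma set_integral_singleton [simp]: "(LBINT r:{a}. f r) = (0::real)" for a :: real
proof -
  have "(LBINT r:{a}. f r) = (\<integral>r. f a * indicator {a} r \<partial>lborel)"
    unfolding set_lebesgue_integral_def
    by (intro Bochner_Integration.integral_cong) (auto simp: indicator_def)
  then show ?thesis by simp
qed

lemma set_integrable_transfer:
  "set_integrable M A f \<Longrightarrow> (\<And>x. x \<in> A \<Longrightarrow> f x = g x) \<Longrightarrow> set_integrable M A g"
  by (subst set_integrable_cong[OF refl refl]) (auto simp: eq_commute)

lemma integrable_pair_mult:
  fixes f g :: "real \<Rightarrow> real"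
  assumes f: "integrable lborel f" and g: "integrable lborel g"
  shows "integrable (lborel \<Otimes>\<^sub>M lborel) (\<lambda>(x, y). f x * g y)"
proof -
  have [measurable]: "f \<in> borel_measurable borel" "g \<in> borel_measurable borel"
    using f g by (auto dest: borel_measurable_integrable)
  show ?thesis
  proof (rule lborel_pair.Fubini_integrable)
    show "integrable lborel (\<lambda>x. LINT y|lborel. norm (case (x, y) of (x, y) \<Rightarrow> f x * g y))"
      using integrable_mult_left[OF integrable_abs[OF f], of "LINT y|lborel. \<bar>g y\<bar>"] by (simp add: abs_mult)
    show "AE x in lborel. integrable lborel (\<lambda>y. case (x, y) of (x, y) \<Rightarrow> f x * g y)"
      using g by auto
  qed simp
qed

text \<open>Fubini on the triangle \<open>s \<le> r\<close>. The two triangles overlap in the diagonal, a null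
  set, and make up the square; this gives the last identity.\<close>

lemma integral_triangle:
  fixes f g :: "real \<Rightarrow> real"
  assumes f: "integrable lborel f" and g: "integrable lborel g"
  shows "integrable lborel (\<lambda>r. f r * (LINT s|lborel. indicator {..r} s * g s))"
    and "integrable lborel (\<lambda>r. g r * (LINT s|lborel. indicator {..r} s * f s))"
    and "(LINT r|lborel. f r * (LINT s|lborel. indicator {..r} s * g s))
       = (LINT s|lborel. g s * (LINT r|lborel. indicator {s..} r * f r))"
    and "(LINT r|lborel. f r * (LINT s|lborel. indicator {..r} s * g s))
         + (LINT r|lborel. g r * (LINT s|lborel. indicator {..r} s * f s)) = (LINT r|lborel. f r) * (LINT r|lborel. g r)"
proof -
  have 1: "integrable (lborel \<Otimes>\<^sub>M lborel) (\<lambda>(x, y). f x * (indicator {..x} y * g y))"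
    if f: "integrable lborel f" and g: "integrable lborel g" for f g :: "real \<Rightarrow> real"
  proof (rule Bochner_Integration.integrable_bound[OF integrable_pair_mult[OF f g]])
    have [measurable]: "f \<in> borel_measurable borel" "g \<in> borel_measurable borel"
      using f g by (auto dest: borel_measurable_integrable)
    have [measurable]: "Measurable.pred (borel \<Otimes>\<^sub>M borel) (\<lambda>(x, y::real). y \<le> (x::real))" by measurable
    show "(\<lambda>(x, y). f x * (indicator {..x} y * g y)) \<in> borel_measurable (lborel \<Otimes>\<^sub>M lborel)"
      unfolding indicator_def atMost_iff by measurable
  qed (auto simp: indicator_def)
  show a: "integrable lborel (\<lambda>r. f r * (LINT s|lborel. indicator {..r} s * g s))"
    using lborel_pair.integrable_fst'[OF 1[OF f g]] by simp
  show "integrable lborel (\<lambda>r. g r * (LINT s|lborel. indicator {..r} s * f s))"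
    using lborel_pair.integrable_fst'[OF 1[OF g f]] by simp
  have sw: "(LINT r|lborel. f r * (LINT s|lborel. indicator {..r} s * g s))
       = (LINT s|lborel. g s * (LINT r|lborel. indicator {s..} r * f r))"
    if f: "integrable lborel f" and g: "integrable lborel g" for f g :: "real \<Rightarrow> real"
  proof -
    have "(LINT r|lborel. f r * (LINT s|lborel. indicator {..r} s * g s))
       = (LINT r|lborel. LINT s|lborel. f r * (indicator {..r} s * g s))" by simp
    also have "\<dots> = (LINT s|lborel. LINT r|lborel. f r * (indicator {..r} s * g s))"
      using lborel_pair.Fubini_integral[OF 1[OF f g]] by simp
    also have "\<dots> = (LINT s|lborel. LINT r|lborel. g s * (indicator {s..} r * f r))"
      by (intro Bochner_Integration.integral_cong) (auto simp: indicator_def)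
    finally show ?thesis by simp
  qed
  show "(LINT r|lborel. f r * (LINT s|lborel. indicator {..r} s * g s))
       = (LINT s|lborel. g s * (LINT r|lborel. indicator {s..} r * f r))" by (rule sw[OF f g])
  have "(LINT r|lborel. f r * (LINT s|lborel. indicator {..r} s * g s))
         + (LINT r|lborel. g r * (LINT s|lborel. indicator {..r} s * f s))
     = (LINT r|lborel. f r * (LINT s|lborel. indicator {..r} s * g s))
         + (LINT r|lborel. f r * (LINT s|lborel. indicator {r..} s * g s))"
    by (subst sw[OF g f]) simp
  also have "\<dots> = (LINT r|lborel. f r * (LINT s|lborel. indicator {..r} s * g s) + f r * (LINT s|lborel. indicator {r..} s * g s))"
  proof (rule Bochner_Integration.integral_add[symmetric, OF a])
    have 2: "integrable (lborel \<Otimes>\<^sub>M lborel) (\<lambda>(x, y). f x * (indicator {x..} y * g y))"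
      using lborel_pair.integrable_product_swap[OF 1[OF g f]]
      by (rule back_subst[where P="integrable _"]) (auto simp: indicator_def fun_eq_iff)
    show "integrable lborel (\<lambda>r. f r * (LINT s|lborel. indicator {r..} s * g s))"
      using lborel_pair.integrable_fst'[OF 2] by simp
  qed
  also have "\<dots> = (LINT r|lborel. f r * (LINT r|lborel. g r))"
  proof (rule Bochner_Integration.integral_cong[OF refl])
    fix r
    have i: "integrable lborel (\<lambda>s. indicator {..r} s * g s)" "integrable lborel (\<lambda>s. indicator {r..} s * g s)"
      using g by (auto intro!: integrable_real_mult_indicator simp: mult.commute[of _ "g _"])
    have "(LINT s|lborel. indicator {..r} s * g s) + (LINT s|lborel. indicator {r..} s * g s) =
      (LINT s|lborel. indicator {..r} s * g s + indicator {r..} s * g s)"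
      using i by (rule Bochner_Integration.integral_add[symmetric])
    also have "\<dots> = (LINT s|lborel. g s)"
      using g i AE_lborel_singleton[of r]
      by (intro integral_cong_AE) (auto simp: indicator_def elim!: eventually_mono)
    finally show "f r * (LINT s|lborel. indicator {..r} s * g s) + f r * (LINT s|lborel. indicator {r..} s * g s) = f r * (LINT r|lborel. g r)"
      by (simp add: distrib_left[symmetric])
  qed
  finally show "(LINT r|lborel. f r * (LINT s|lborel. indicator {..r} s * g s))
         + (LINT r|lborel. g r * (LINT s|lborel. indicator {..r} s * f s)) = (LINT r|lborel. f r) * (LINT r|lborel. g r)"
    by simp
qed

lemma set_integrable_Icc_subset:
  "L1_on {a..b} f \<Longrightarrow> a \<le> c \<Longrightarrow> d \<le> b \<Longrightarrow> L1_on {c..d} f"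
  for a b :: real and f :: "real \<Rightarrow> real"
  by (rule set_integrable_subset) auto

lemma set_integral_Icc_split:
  fixes g :: "real \<Rightarrow> real"
  assumes g: "L1_on {a..b} g" and "a \<le> r" "r \<le> b"
  shows "(LBINT s:{a..b}. g s) = (LBINT s:{a..r}. g s) + (LBINT s:{r..b}. g s)"
proof -
  have "(LBINT s:{a..b}. g s) = (LINT s:{a..r} \<union> {r..b}|lborel. g s)"
    using assms by (simp add: ivl_disj_un_two_touch)
  also have "\<dots> = (LBINT s:{a..r}. g s) + (LBINT s:{r..b}. g s)"
  proof (rule set_integral_Un_AE)
    show "AE x in lborel. \<not> (x \<in> {a..r} \<and> x \<in> {r..b})"
      using AE_lborel_singleton[of r] by (auto elim!: eventually_mono)
  qed (use assms in \<open>auto intro: set_integrable_Icc_subset[OF g]\<close>)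
  finally show ?thesis .
qed

lemma set_integral_triangle:
  fixes f g :: "real \<Rightarrow> real"
  assumes f: "L1_on {a..b} f" and g: "L1_on {a..b} g"
  shows "L1_on {a..b} (\<lambda>r. f r * (LBINT s:{a..r}. g s))"
    and "(LBINT r:{a..b}. f r * (LBINT s:{a..r}. g s))
       = (LBINT s:{a..b}. g s * (LBINT r:{s..b}. f r))"
    and "(LBINT r:{a..b}. f r * (LBINT s:{a..r}. g s))
         + (LBINT r:{a..b}. g r * (LBINT s:{a..r}. f s))
       = (LBINT r:{a..b}. f r) * (LBINT r:{a..b}. g r)"
    and "L1_on {a..b} (\<lambda>r. f r * (LBINT s:{r..b}. g s))"
proof -
  let ?f = "\<lambda>x. indicator {a..b} x * f x" and ?g = "\<lambda>x. indicator {a..b} x * g x"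
  have i: "integrable lborel ?f" "integrable lborel ?g"
    using f g by (auto simp: set_integrable_def)
  have e: "?f r * (LINT s|lborel. indicator {..r} s * ?g s) = indicator {a..b} r * (f r * (LBINT s:{a..r}. g s))"
    for r
  proof (cases "r \<in> {a..b}")
    case True
    then have "(LINT s|lborel. indicator {..r} s * ?g s) = (LBINT s:{a..r}. g s)"
      unfolding set_lebesgue_integral_def by (intro Bochner_Integration.integral_cong) (auto simp: indicator_def)
    then show ?thesis by simp
  qed simp
  have e2: "?g s * (LINT r|lborel. indicator {s..} r * ?f r) = indicator {a..b} s * (g s * (LBINT r:{s..b}. f r))"
    for s
  proof (cases "s \<in> {a..b}")
    case True
    then have "(LINT r|lborel. indicator {s..} r * ?f r) = (LBINT r:{s..b}. f r)"
      unfolding set_lebesgue_integral_def by (intro Bochner_Integration.integral_cong) (auto simp: indicator_def)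
    then show ?thesis by simp
  qed simp
  have e3: "?g r * (LINT s|lborel. indicator {..r} s * ?f s) = indicator {a..b} r * (g r * (LBINT s:{a..r}. f s))"
    for r
  proof (cases "r \<in> {a..b}")
    case True
    then have "(LINT s|lborel. indicator {..r} s * ?f s) = (LBINT s:{a..r}. f s)"
      unfolding set_lebesgue_integral_def by (intro Bochner_Integration.integral_cong) (auto simp: indicator_def)
    then show ?thesis by simp
  qed simp
  note t = integral_triangle[OF i, unfolded e e2 e3]
  show "L1_on {a..b} (\<lambda>r. f r * (LBINT s:{a..r}. g s))"
    using t(1) by (simp add: set_integrable_def)
  show "(LBINT r:{a..b}. f r * (LBINT s:{a..r}. g s))
       = (LBINT s:{a..b}. g s * (LBINT r:{s..b}. f r))"
    using t(3) by (simp add: set_lebesgue_integral_def)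
  show "(LBINT r:{a..b}. f r * (LBINT s:{a..r}. g s))
         + (LBINT r:{a..b}. g r * (LBINT s:{a..r}. f s))
       = (LBINT r:{a..b}. f r) * (LBINT r:{a..b}. g r)"
    using t(4) by (simp add: set_lebesgue_integral_def)
  let ?h = "\<lambda>r. f r * (LBINT s:{a..b}. g s) - f r * (LBINT s:{a..r}. g s)"
  have "L1_on {a..b} ?h"
    using set_integral_diff(1)[OF set_integrable_mult_left[of "LBINT s:{a..b}. g s", OF f]] t(1)
    by (simp add: set_integrable_def)
  moreover have "?h r = f r * (LBINT s:{r..b}. g s)" if "r \<in> {a..b}" for r
    using set_integral_Icc_split[OF g, of r] that by (simp add: algebra_simps)
  ultimately show "L1_on {a..b} (\<lambda>r. f r * (LBINT s:{r..b}. g s))"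
    by (rule set_integrable_transfer)
qed

text \<open>The cross terms of \<open>F G\<close> form a double integral over a square, which is split along
  the diagonal. No derivatives are involved: \<open>f\<close> and \<open>g\<close> need only be integrable.\<close>

lemma product_rule_integrals:
  fixes f g F G :: "real \<Rightarrow> real"
  assumes ab: "a \<le> b" and f: "L1_on {a..b} f" and g: "L1_on {a..b} g"
    and F: "\<And>r. r \<in> {a..b} \<Longrightarrow> F r = F a + (LBINT s:{a..r}. f s)"
    and G: "\<And>r. r \<in> {a..b} \<Longrightarrow> G r = G a + (LBINT s:{a..r}. g s)"
  shows "L1_on {a..b} (\<lambda>r. f r * G r)"
    and "L1_on {a..b} (\<lambda>r. F r * g r)"
    and "F b * G b = F a * G a + (LBINT r:{a..b}. f r * G r + F r * g r)"
proof -
  note t = set_integral_triangle[OF f g] and t' = set_integral_triangle[OF g f]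
  let ?f = "\<lambda>r. f r * (LBINT s:{a..r}. g s)" and ?g = "\<lambda>r. g r * (LBINT s:{a..r}. f s)"
  have i: "L1_on {a..b} (\<lambda>r. G a * f r + ?f r)" "L1_on {a..b} (\<lambda>r. F a * g r + ?g r)"
    using f g t(1) t'(1) by (auto intro!: set_integral_add)
  have e: "f r * G r = G a * f r + ?f r" "F r * g r = F a * g r + ?g r" if "r \<in> {a..b}" for r
    using F[OF that] G[OF that] by (auto simp: algebra_simps)
  show i1: "L1_on {a..b} (\<lambda>r. f r * G r)" and i2: "L1_on {a..b} (\<lambda>r. F r * g r)"
    using e by (auto intro: set_integrable_transfer[OF i(1)] set_integrable_transfer[OF i(2)])
  have "(LBINT r:{a..b}. f r * G r + F r * g r) = (LBINT r:{a..b}. f r * G r) + (LBINT r:{a..b}. F r * g r)"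
    using i1 i2 by (rule set_integral_add)
  also have "(LBINT r:{a..b}. f r * G r) = (LBINT r:{a..b}. G a * f r + ?f r)"
    using e by (intro set_lebesgue_integral_cong) auto
  also have "\<dots> = G a * (LBINT r:{a..b}. f r) + (LBINT r:{a..b}. ?f r)"
    using f t(1) by (subst set_integral_add) auto
  also have "(LBINT r:{a..b}. F r * g r) = (LBINT r:{a..b}. F a * g r + ?g r)"
    using e by (intro set_lebesgue_integral_cong) auto
  also have "\<dots> = F a * (LBINT r:{a..b}. g r) + (LBINT r:{a..b}. ?g r)"
    using g t'(1) by (subst set_integral_add) auto
  finally show "F b * G b = F a * G a + (LBINT r:{a..b}. f r * G r + F r * g r)"
    using F[of b] G[of b] t(3) ab by (simp add: algebra_simps)
qed

lemma FTC_set_integral: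
  fixes F f :: "real \<Rightarrow> real"
  assumes "a \<le> b" and "\<And>x. x \<in> {a..b} \<Longrightarrow> (F has_real_derivative f x) (at x within {a..b})"
    and "continuous_on {a..b} f"
  shows "L1_on {a..b} f" "F b = F a + (LBINT x:{a..b}. f x)"
proof -
  show "L1_on {a..b} f"
    by (intro borel_integrable_atLeastAtMost' assms)
  have "(LINT x|lborel. indicator {a..b} x *\<^sub>R f x) = F b - F a"
    using assms by (intro integral_FTC_atLeastAtMost) (auto simp: has_real_derivative_iff_has_vector_derivative)
  then show "F b = F a + (LBINT x:{a..b}. f x)"
    by (simp add: set_lebesgue_integral_def)
qed

text \<open>The integral \<open>I\<close> of \<open>m\<close> solves \<open>I' = h - \<kappa> I\<close> almost everywhere; the integrating factor is applied through
  the product rule.\<close>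

lemma linear_integral_equation:
  fixes h m :: "real \<Rightarrow> real"
  assumes "a \<le> b" and m: "L1_on {a..b} m"
    and eq: "\<And>r. r \<in> {a..b} \<Longrightarrow> m r = h r - \<kappa> * (LBINT s:{a..r}. m s)"
  shows "(LBINT s:{a..b}. m s) = (LBINT s:{a..b}. exp (- \<kappa> * (b - s)) * h s)"
proof -
  let ?e = "\<lambda>r. exp (- \<kappa> * (b - r))" and ?I = "\<lambda>r. LBINT s:{a..r}. m s"
  have d: "(?e has_real_derivative \<kappa> * ?e x) (at x within X)" for x X
    by (auto intro!: derivative_eq_intros)
  have c: "continuous_on X (\<lambda>r. \<kappa> * ?e r)" for X by (intro continuous_intros)
  have e: "L1_on {a..b} (\<lambda>r. \<kappa> * ?e r)"
    by (rule FTC_set_integral(1)[OF \<open>a \<le> b\<close> d c])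
  have E: "?e r = ?e a + (LBINT s:{a..r}. \<kappa> * ?e s)" if "r \<in> {a..b}" for r
    using that by (intro FTC_set_integral(2)[OF _ d c]) auto
  have "?e b * ?I b = ?e a * ?I a + (LBINT r:{a..b}. \<kappa> * ?e r * ?I r + ?e r * m r)"
    by (rule product_rule_integrals(3)[OF \<open>a \<le> b\<close> e m E]) simp_all
  also have "(LBINT r:{a..b}. \<kappa> * ?e r * ?I r + ?e r * m r) = (LBINT s:{a..b}. ?e s * h s)"
  proof (intro set_lebesgue_integral_cong allI impI)
    show "\<kappa> * ?e r * ?I r + ?e r * m r = ?e r * h r" if "r \<in> {a..b}" for r
    proof -
      have "\<kappa> * ?e r * ?I r + ?e r * m r = ?e r * (m r + \<kappa> * ?I r)" by (simp add: distrib_left)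
      also have "m r + \<kappa> * ?I r = h r" using eq[OF that] by simp
      finally show ?thesis .
    qed
  qed simp
  finally show ?thesis by simp
qed

lemma linear_integral_equation_solves:
  fixes h :: "real \<Rightarrow> real" and \<kappa> :: real
  assumes "a \<le> b" and h: "L1_on {a..b} h"
  defines "I \<equiv> \<lambda>r. LBINT s:{a..r}. exp (- \<kappa> * (r - s)) * h s"
  shows "L1_on {a..b} (\<lambda>r. h r - \<kappa> * I r)"
    and "I b = (LBINT r:{a..b}. h r - \<kappa> * I r)"
proof -
  let ?e = "\<lambda>r. exp (- \<kappa> * (r - a))" and ?H = "\<lambda>r. LBINT s:{a..r}. exp (\<kappa> * (s - a)) * h s"
  have I: "I r = ?e r * ?H r" for r
  proof -
    have "I r = (LBINT s:{a..r}. ?e r * (exp (\<kappa> * (s - a)) * h s))"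
      unfolding I_def
    proof (intro set_lebesgue_integral_cong allI impI)
      show "exp (- \<kappa> * (r - s)) * h s = ?e r * (exp (\<kappa> * (s - a)) * h s)" for s
        unfolding mult.assoc[symmetric] exp_add[symmetric] by (simp add: algebra_simps)
    qed simp
    then show ?thesis by simp
  qed
  have d: "(?e has_real_derivative - \<kappa> * ?e x) (at x within X)" for x X
    by (auto intro!: derivative_eq_intros)
  have c: "continuous_on X (\<lambda>r. - \<kappa> * ?e r)" for X by (intro continuous_intros)
  have ie: "L1_on {a..b} (\<lambda>r. - \<kappa> * ?e r)"
    by (rule FTC_set_integral(1)[OF \<open>a \<le> b\<close> d c])
  have E: "?e r = ?e a + (LBINT s:{a..r}. - \<kappa> * ?e s)" if "r \<in> {a..b}" for r
    using that by (intro FTC_set_integral(2)[OF _ d c]) auto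
  have hh: "L1_on {a..b} (\<lambda>s. exp (\<kappa> * (s - a)) * h s)"
  proof -
    have K: "exp (\<kappa> * (s - a)) \<le> exp (\<bar>\<kappa>\<bar> * (b - a))" if "s \<in> {a..b}" for s
      using that by (auto intro!: mult_mono abs_ge_self)
    show ?thesis
    proof (rule set_integrable_bound[OF set_integrable_mult_right[of "exp (\<bar>\<kappa>\<bar> * (b - a))", OF h]])
      have "(\<lambda>x. indicator {a..b} x *\<^sub>R h x) \<in> borel_measurable lborel"
        using h unfolding set_integrable_def by auto
      then have "(\<lambda>x. exp (\<kappa> * (x - a)) * (indicator {a..b} x *\<^sub>R h x)) \<in> borel_measurable lborel" by measurable
      then show "set_borel_measurable lborel {a..b} (\<lambda>s. exp (\<kappa> * (s - a)) * h s)"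
        unfolding set_borel_measurable_def by (simp add: algebra_simps)
      show "AE x in lborel. x \<in> {a..b} \<longrightarrow> norm (exp (\<kappa> * (x - a)) * h x) \<le> norm (exp (\<bar>\<kappa>\<bar> * (b - a)) * h x)"
        using K by (auto simp: abs_mult intro!: mult_right_mono)
    qed
  qed
  have H: "?H r = ?H a + ?H r" for r by simp
  note p = product_rule_integrals[OF \<open>a \<le> b\<close> ie hh E H]
  have e: "- \<kappa> * ?e r * ?H r + ?e r * (exp (\<kappa> * (r - a)) * h r) = h r - \<kappa> * I r" for r
    unfolding I by (simp add: mult.assoc[symmetric] exp_add[symmetric])
  show "L1_on {a..b} (\<lambda>r. h r - \<kappa> * I r)"
    using set_integral_add(1)[OF p(1,2)] unfolding e by simp
  show "I b = (LBINT r:{a..b}. h r - \<kappa> * I r)"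
    using p(3) unfolding e by (simp add: I)
qed

text \<open>The Cauchy-Schwarz inequality against the constant \<open>1\<close>.\<close>

lemma set_integral_square_le:
  fixes f :: "real \<Rightarrow> real"
  assumes "a \<le> b" and f: "L1_on {a..b} f" and f2: "L1_on {a..b} (\<lambda>r. (f r)\<^sup>2)"
  shows "(LBINT r:{a..b}. f r)\<^sup>2 \<le> (b - a) * (LBINT r:{a..b}. (f r)\<^sup>2)"
proof (cases "a = b")
  case False
  define L where "L = b - a"
  then have L: "0 < L" using False assms by simp
  define y where "y = (LBINT r:{a..b}. f r) / L"
  have c: "L1_on {a..b} (\<lambda>r. y\<^sup>2)" by (auto intro!: borel_integrable_atLeastAtMost')
  have "(LBINT r:{a..b}. 2 * y * f r) \<le> (LBINT r:{a..b}. (f r)\<^sup>2 + y\<^sup>2)"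
  proof (intro set_integral_mono set_integral_add f2 c)
    show "2 * y * f x \<le> (f x)\<^sup>2 + y\<^sup>2" for x
      using sum_squares_bound[of y "f x"] by (simp add: mult_ac)
  qed (use f in auto)
  also have "\<dots> = (LBINT r:{a..b}. (f r)\<^sup>2) + (LBINT r:{a..b}. y\<^sup>2)"
    using f2 c by (rule set_integral_add)
  also have "(LBINT r:{a..b}. y\<^sup>2) = L * y\<^sup>2"
    using \<open>a \<le> b\<close> by (simp add: L_def set_lebesgue_integral_def)
  also have "(LBINT r:{a..b}. 2 * y * f r) = 2 * y * (L * y)"
    using L by (simp add: y_def)
  finally have "L * y\<^sup>2 \<le> (LBINT r:{a..b}. (f r)\<^sup>2)" by (simp add: power2_eq_square algebra_simps)
  then have "L * (L * y\<^sup>2) \<le> L * (LBINT r:{a..b}. (f r)\<^sup>2)" using L by (intro mult_left_mono) auto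
  then show ?thesis using L unfolding L_def[symmetric] by (simp add: y_def power2_eq_square)
qed (simp)

section \<open>Cadlag processes\<close>

definition clamp_Icc :: "real \<Rightarrow> real \<Rightarrow> real \<Rightarrow> real" where
  "clamp_Icc a b v = max a (min b v)"

lemma clamp_Icc_simp [simp]: "a \<le> v \<Longrightarrow> v \<le> b \<Longrightarrow> clamp_Icc a b v = v"
  by (auto simp: clamp_Icc_def)

lemma clamp_Icc_bounds: "a \<le> b \<Longrightarrow> a \<le> clamp_Icc a b v" "a \<le> b \<Longrightarrow> clamp_Icc a b v \<le> b"
  by (auto simp: clamp_Icc_def)

lemma clamp_Icc_measurable [measurable]: "clamp_Icc a d \<in> borel_measurable borel"
  unfolding clamp_Icc_def[abs_def] by measurable

text \<open>The first point to the right of \<open>v\<close> on the grid of mesh \<open>1 / (n + 1)\<close>.\<close>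

definition grid_above :: "nat \<Rightarrow> real \<Rightarrow> real" where
  "grid_above n v = (real_of_int \<lfloor>real (Suc n) * v\<rfloor> + 1) / real (Suc n)"

lemma grid_above_gt: "v < grid_above n v"
  and grid_above_le: "grid_above n v \<le> v + 1 / real (Suc n)"
proof -
  have "real (Suc n) * v < real_of_int \<lfloor>real (Suc n) * v\<rfloor> + 1"
    "real_of_int \<lfloor>real (Suc n) * v\<rfloor> \<le> real (Suc n) * v" by linarith+
  then show "v < grid_above n v" "grid_above n v \<le> v + 1 / real (Suc n)"
    unfolding grid_above_def by (auto simp add: field_simps simp del: of_nat_Suc)
qed

lemma grid_above_tendsto: "filterlim (\<lambda>n. grid_above n v) (at_right v) sequentially"
proof -
  have "(\<lambda>n. v + 1 / real (Suc n)) \<longlonglongrightarrow> v + 0"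
    by (intro tendsto_intros LIMSEQ_Suc[OF lim_1_over_n])
  then have "(\<lambda>n. grid_above n v) \<longlonglongrightarrow> v"
    by (intro tendsto_sandwich[of "\<lambda>_. v" "\<lambda>n. grid_above n v" _ "\<lambda>n. v + 1 / real (Suc n)"])
      (auto intro!: always_eventually less_imp_le[OF grid_above_gt] grid_above_le simp del: of_nat_Suc)
  then show ?thesis
    using grid_above_gt[of v] by (auto simp: filterlim_at less_imp_neq[THEN not_sym] intro!: always_eventually)
qed

text \<open>The grid points approach \<open>v\<close> strictly from the right. Thus a cadlag path is recovered
  from countably many of its values, which reduces every measurability question below to single times.\<close>

lemma cadlag_grid_tendsto:
  assumes "a \<le> b" and f: "cadlag_on a b f"
  shows "(\<lambda>n. f (clamp_Icc a b (grid_above n v))) \<longlonglongrightarrow> f (clamp_Icc a b v)"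
proof -
  consider "v < a" | "a \<le> v" "v < b" | "b \<le> v" by linarith
  then show ?thesis
  proof cases
    case 1
    have "eventually (\<lambda>x. x < a) (at_right v)"
      using 1 by (auto simp: eventually_at_right intro!: exI[of _ a])
    then have "eventually (\<lambda>n. grid_above n v < a) sequentially"
      using grid_above_tendsto by (rule eventually_compose_filterlim)
    then have "eventually (\<lambda>n. f (clamp_Icc a b (grid_above n v)) = f (clamp_Icc a b v)) sequentially"
      by eventually_elim (use 1 \<open>a \<le> b\<close> in \<open>simp add: clamp_Icc_def\<close>)
    then show ?thesis by (rule tendsto_eventually)
  next
    case 2
    have "eventually (\<lambda>x. x < b) (at_right v)"
      using 2 by (auto simp: eventually_at_right intro!: exI[of _ b])
    then have "eventually (\<lambda>n. grid_above n v < b) sequentially"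
      using grid_above_tendsto by (rule eventually_compose_filterlim)
    then have e: "eventually (\<lambda>n. f (clamp_Icc a b (grid_above n v)) = f (grid_above n v)) sequentially"
    proof eventually_elim
      case (elim n)
      then show ?case using 2 grid_above_gt[of v n] by simp
    qed
    have "(f \<longlongrightarrow> f v) (at_right v)" using f 2 by (auto simp: cadlag_on_def)
    then have "(\<lambda>n. f (grid_above n v)) \<longlonglongrightarrow> f v"
      using grid_above_tendsto by (rule filterlim_compose)
    then show ?thesis
      using e 2 by (simp add: tendsto_cong)
  next
    case 3
    then have "clamp_Icc a b (grid_above n v) = b" "clamp_Icc a b v = b" for n
      using \<open>a \<le> b\<close> grid_above_gt[of v n] by (auto simp: clamp_Icc_def)
    then show ?thesis by simp
  qed
qed

text \<open>The sampling time takes countably many values, on each of which only one coordinate of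
  \<open>Y\<close> is read.\<close>

lemma grid_joint_measurable:
  assumes "a \<le> b" and Y: "\<And>r. r \<in> {a..b} \<Longrightarrow> Y r \<in> measurable M N"
  shows "(\<lambda>(v, \<omega>). Y (clamp_Icc a b (grid_above n v)) \<omega>) \<in> measurable (borel \<Otimes>\<^sub>M M) N"
proof -
  have "(\<lambda>z. Y (clamp_Icc a b ((real_of_int \<lfloor>real (Suc n) * fst z\<rfloor> + 1) / real (Suc n))) (snd z))
      \<in> measurable (borel \<Otimes>\<^sub>M M) N"
  proof (rule measurable_compose_countable[where f="\<lambda>k z. Y (clamp_Icc a b ((real_of_int k + 1) / real (Suc n))) (snd z)"
      and g="\<lambda>z. \<lfloor>real (Suc n) * fst z\<rfloor>"])
    show "(\<lambda>z. \<lfloor>real (Suc n) * fst z\<rfloor>) \<in> measurable (borel \<Otimes>\<^sub>M M) (count_space UNIV)" by measurable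
    show "(\<lambda>z. Y (clamp_Icc a b ((real_of_int k + 1) / real (Suc n))) (snd z)) \<in> measurable (borel \<Otimes>\<^sub>M M) N" for k
      using clamp_Icc_bounds[OF \<open>a \<le> b\<close>] by (intro measurable_compose[OF measurable_snd Y]) auto
  qed
  then show ?thesis by (simp add: grid_above_def case_prod_beta')
qed

lemma cadlag_joint_measurable:
  fixes Y :: "real \<Rightarrow> 'a \<Rightarrow> 'b::{metric_space}"
  assumes "a \<le> b" and Y: "\<And>r. r \<in> {a..b} \<Longrightarrow> Y r \<in> borel_measurable M"
    and cadlag: "\<And>\<omega>. \<omega> \<in> space M \<Longrightarrow> cadlag_on a b (\<lambda>r. Y r \<omega>)"
  shows "(\<lambda>(v, \<omega>). Y (clamp_Icc a b v) \<omega>) \<in> borel_measurable (borel \<Otimes>\<^sub>M M)"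
proof (rule borel_measurable_LIMSEQ_metric)
  show "(\<lambda>(v, \<omega>). Y (clamp_Icc a b (grid_above n v)) \<omega>) \<in> borel_measurable (borel \<Otimes>\<^sub>M M)" for n
    by (rule grid_joint_measurable[OF \<open>a \<le> b\<close> Y])
  show "(\<lambda>n. case z of (v, \<omega>) \<Rightarrow> Y (clamp_Icc a b (grid_above n v)) \<omega>) \<longlonglongrightarrow> (case z of (v, \<omega>) \<Rightarrow> Y (clamp_Icc a b v) \<omega>)"
    if "z \<in> space (borel \<Otimes>\<^sub>M M)" for z
    using that cadlag_grid_tendsto[OF \<open>a \<le> b\<close> cadlag] by (auto simp: space_pair_measure split: prod.split)
qed

lemma cadlag_measurable:
  fixes f :: "real \<Rightarrow> 'b::metric_space"
  assumes "a \<le> b" and f: "cadlag_on a b f"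
  shows "(\<lambda>v. f (clamp_Icc a b v)) \<in> borel_measurable borel"
proof -
  have "(\<lambda>(v, \<omega>::unit). f (clamp_Icc a b v)) \<in> borel_measurable (borel \<Otimes>\<^sub>M count_space UNIV)"
    using cadlag_joint_measurable[of a b "\<lambda>r _. f r" "count_space UNIV"] assms by simp
  from measurable_compose[OF measurable_Pair2' this, of "()"] show ?thesis by simp
qed

lemma cadlag_locally_bounded:
  fixes f :: "real \<Rightarrow> 'b::real_normed_vector"
  assumes f: "cadlag_on a b f" and u: "u \<in> {a..b}"
  shows "\<exists>e>0. \<exists>B. \<forall>v\<in>{a..b}. \<bar>v - u\<bar> < e \<longrightarrow> norm (f v) \<le> B"
proof -
  have *: "eventually (\<lambda>v. norm (f v) \<le> norm l + 1) F" if "(f \<longlongrightarrow> l) F" for l F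
  proof -
    have "eventually (\<lambda>v. dist (f v) l < 1) F" using that by (rule tendstoD) simp
    then show ?thesis
    proof eventually_elim
      case (elim v)
      then show ?case using norm_triangle_ineq2[of "f v" l] by (simp add: dist_norm)
    qed
  qed
  have "\<exists>e>0. \<exists>B. \<forall>v\<in>{a..b}. u < v \<and> v < u + e \<longrightarrow> norm (f v) \<le> B"
  proof (cases "u < b")
    case True
    then have "eventually (\<lambda>v. norm (f v) \<le> norm (f u) + 1) (at_right u)"
      using f u by (intro *) (auto simp: cadlag_on_def)
    then obtain c where "u < c" "\<And>v. u < v \<Longrightarrow> v < c \<Longrightarrow> norm (f v) \<le> norm (f u) + 1"
      by (auto simp: eventually_at_right_field)
    then show ?thesis by (intro exI[of _ "c - u"] conjI exI[of _ "norm (f u) + 1"]) auto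
  qed (auto intro!: exI[of _ 1])
  then obtain e1 B1 where e1: "0 < e1" "\<And>v. v \<in> {a..b} \<Longrightarrow> u < v \<Longrightarrow> v < u + e1 \<Longrightarrow> norm (f v) \<le> B1" by blast
  have "\<exists>e>0. \<exists>B. \<forall>v\<in>{a..b}. v < u \<and> u - e < v \<longrightarrow> norm (f v) \<le> B"
  proof (cases "a < u")
    case True
    then have "u \<in> {a<..b}" using u by simp
    then obtain l where "(f \<longlongrightarrow> l) (at_left u)"
      using f unfolding cadlag_on_def by blast
    then have "eventually (\<lambda>v. norm (f v) \<le> norm l + 1) (at_left u)" by (rule *)
    then obtain c where "c < u" "\<And>v. c < v \<Longrightarrow> v < u \<Longrightarrow> norm (f v) \<le> norm l + 1"
      by (auto simp: eventually_at_left_field)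
    then show ?thesis by (intro exI[of _ "u - c"] conjI exI[of _ "norm l + 1"]) auto
  qed (use u in \<open>auto intro!: exI[of _ 1]\<close>)
  then obtain e2 B2 where e2: "0 < e2" "\<And>v. v \<in> {a..b} \<Longrightarrow> v < u \<Longrightarrow> u - e2 < v \<Longrightarrow> norm (f v) \<le> B2" by blast
  show ?thesis
  proof (rule exI[of _ "min e1 e2"], rule conjI[OF _ exI[of _ "max (norm (f u)) (max B1 B2)"]], goal_cases)
    case 2
    show ?case
    proof (intro ballI impI)
    fix v assume v: "v \<in> {a..b}" "\<bar>v - u\<bar> < min e1 e2"
    consider "v = u" | "u < v" | "v < u" by linarith
    then show "norm (f v) \<le> max (norm (f u)) (max B1 B2)"
    proof cases
      case 2 then show ?thesis using e1(2)[of v] v by auto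
    next
      case 3 then show ?thesis using e2(2)[of v] v by auto
    qed simp
    qed
  qed (use e1 e2 in auto)
qed

text \<open>One-sided limits bound \<open>f\<close> near every point, and the interval is compact.\<close>

lemma cadlag_bounded:
  fixes f :: "real \<Rightarrow> 'b::real_normed_vector"
  assumes f: "cadlag_on a b f"
  obtains B where "\<And>v. v \<in> {a..b} \<Longrightarrow> norm (f v) \<le> B"
proof -
  from cadlag_locally_bounded[OF f] obtain e B where
    e: "\<And>u. u \<in> {a..b} \<Longrightarrow> 0 < e u" and B: "\<And>u v. u \<in> {a..b} \<Longrightarrow> v \<in> {a..b} \<Longrightarrow> \<bar>v - u\<bar> < e u \<Longrightarrow> norm (f v) \<le> B u"
    by metis
  have "{a..b} \<subseteq> (\<Union>u\<in>{a..b}. ball u (e u))" using e by force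
  then obtain D where D: "D \<subseteq> {a..b}" "finite D" "{a..b} \<subseteq> (\<Union>u\<in>D. ball u (e u))"
    by (rule compactE_image[OF compact_Icc, of "{a..b}" "\<lambda>u. ball u (e u)", rotated]) auto
  show ?thesis
  proof (rule that)
    fix v assume v: "v \<in> {a..b}"
    with D(3) obtain u where u: "u \<in> D" "\<bar>v - u\<bar> < e u" by (force simp: dist_real_def)
    then have "norm (f v) \<le> B u" using B D(1) v by auto
    also have "\<dots> \<le> \<bar>B u\<bar>" by simp
    also have "\<dots> \<le> (\<Sum>u\<in>D. \<bar>B u\<bar>)" using u D(2) by (intro member_le_sum) auto
    finally show "norm (f v) \<le> (\<Sum>u\<in>D. \<bar>B u\<bar>)" .
  qed
qed

lemma set_integrable_bounded_Icc:
  fixes f :: "real \<Rightarrow> real"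
  assumes "(\<lambda>v. indicator {a..b} v * f v) \<in> borel_measurable borel"
    and "\<And>v. v \<in> {a..b} \<Longrightarrow> \<bar>f v\<bar> \<le> B"
  shows "L1_on {a..b} f"
proof (rule set_integrable_bound[of lborel "{a..b}" "\<lambda>_. B"])
  show "L1_on {a..b} (\<lambda>_. B)" by (intro borel_integrable_atLeastAtMost' continuous_intros)
  show "set_borel_measurable lborel {a..b} f" using assms(1) by (simp add: set_borel_measurable_def)
  show "AE x in lborel. x \<in> {a..b} \<longrightarrow> norm (f x) \<le> norm B" using assms(2) by (force intro!: AE_I2)
qed

lemma cadlag_set_integrable:
  fixes f :: "real \<Rightarrow> real"
  assumes "a \<le> b" and f: "cadlag_on a b f"
  shows "L1_on {a..b} f"
proof -
  obtain B where "\<And>v. v \<in> {a..b} \<Longrightarrow> norm (f v) \<le> B" using cadlag_bounded[OF f] by blast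
  moreover have "(\<lambda>v. indicator {a..b} v * f v) = (\<lambda>v. indicator {a..b} v * f (clamp_Icc a b v))"
    by (auto simp: indicator_def fun_eq_iff)
  ultimately show ?thesis
    using cadlag_measurable[OF assms] by (intro set_integrable_bounded_Icc[of _ _ _ B]) auto
qed

lemma continuous_imp_cadlag:
  fixes f :: "real \<Rightarrow> 'b::topological_space"
  assumes "continuous_on {a..b} f"
  shows "cadlag_on a b f"
  unfolding cadlag_on_def
proof safe
  fix u assume u: "u \<in> {a..<b}"
  then have "(f \<longlongrightarrow> f u) (at u within {a..b})" using assms by (auto simp: continuous_on)
  then have "(f \<longlongrightarrow> f u) (at u within {u<..<b})" by (rule tendsto_within_subset) (use u in auto)
  moreover have "at u within {u<..<b} = at_right u" using u by (intro at_within_nhd[of _ "{a - 1<..<b}"]) auto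
  ultimately show "(f \<longlongrightarrow> f u) (at_right u)" by simp
next
  fix u assume u: "u \<in> {a<..b}"
  then have "(f \<longlongrightarrow> f u) (at u within {a..b})" using assms by (auto simp: continuous_on)
  then have "(f \<longlongrightarrow> f u) (at u within {a<..<u})" by (rule tendsto_within_subset) (use u in auto)
  moreover have "at u within {a<..<u} = at_left u" using u by (intro at_within_nhd[of _ "{a<..<u + 1}"]) auto
  ultimately show "\<exists>l. (f \<longlongrightarrow> l) (at_left u)" by auto
qed

lemma cadlag_on_compose2:
  fixes f :: "real \<Rightarrow> 'b::t2_space" and g :: "real \<Rightarrow> 'c::t2_space" and h :: "'b \<Rightarrow> 'c \<Rightarrow> 'd::t2_space"
  assumes "cadlag_on a b f" "cadlag_on a b g"
    and "\<And>x y. isCont (\<lambda>z. h (fst z) (snd z)) (x, y)"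
  shows "cadlag_on a b (\<lambda>r. h (f r) (g r))"
proof -
  have *: "((\<lambda>r. h (f r) (g r)) \<longlongrightarrow> h x y) F" if "(f \<longlongrightarrow> x) F" "(g \<longlongrightarrow> y) F" for x y F
    using isCont_tendsto_compose[OF assms(3) tendsto_Pair[OF that]] by simp
  show ?thesis
    using assms(1,2) unfolding cadlag_on_def by (blast intro: *)
qed

lemma cadlag_on_Pair:
  fixes f :: "real \<Rightarrow> 'b::t2_space" and g :: "real \<Rightarrow> 'c::t2_space"
  shows "cadlag_on a b f \<Longrightarrow> cadlag_on a b g \<Longrightarrow> cadlag_on a b (\<lambda>r. (f r, g r))"
  by (rule cadlag_on_compose2[where h=Pair]) auto

lemma cadlag_on_continuous:
  fixes f :: "real \<Rightarrow> 'b::t2_space" and h :: "'b \<Rightarrow> 'c::t2_space"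
  assumes "cadlag_on a b f" and "continuous_on UNIV h"
  shows "cadlag_on a b (\<lambda>r. h (f r))"
proof -
  have *: "((\<lambda>r. h (f r)) \<longlongrightarrow> h x) F" if "(f \<longlongrightarrow> x) F" for x F
    using assms(2) that by (auto intro!: isCont_tendsto_compose[where g=h] simp: continuous_on_eq_continuous_at)
  show ?thesis
    using assms(1) unfolding cadlag_on_def by (blast intro: *)
qed

section \<open>Relative entropy with respect to a normal distribution\<close>

lemma ext_integral_integrable:
  assumes "integrable M f"
  shows "ext_integral M f = ereal (\<integral>z. f z \<partial>M)"
proof -
  have "(\<integral>\<^sup>+z. ennreal (f z) \<partial>M) \<noteq> \<infinity>" "(\<integral>\<^sup>+z. ennreal (- f z) \<partial>M) \<noteq> \<infinity>"
    using assms by (auto simp: real_integrable_def)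
  then show ?thesis
    unfolding ext_integral_def real_lebesgue_integral_def[OF assms]
    by (cases "\<integral>\<^sup>+z. ennreal (f z) \<partial>M"; cases "\<integral>\<^sup>+z. ennreal (- f z) \<partial>M") (auto simp: enn2ereal_ennreal)
qed

text \<open>A function with an integrable upper bound has no infinite positive part, so that its extended
  integral does not fall under the convention for \<open>\<infinity> - \<infinity>\<close>.\<close>

lemma ext_integral_bounded_above:
  fixes f g :: "'a \<Rightarrow> real"
  assumes f: "f \<in> borel_measurable M" and g: "integrable M g" and le: "AE z in M. f z \<le> g z"
  shows "integrable M f \<or> ext_integral M f = - \<infinity>"
proof -
  have "(\<integral>\<^sup>+z. ennreal (f z) \<partial>M) \<le> (\<integral>\<^sup>+z. ennreal (g z) \<partial>M)"
    using le by (intro nn_integral_mono_AE) (auto elim!: eventually_mono intro!: ennreal_leI)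
  also have "\<dots> < \<infinity>" using g by (auto simp: real_integrable_def less_top)
  finally have p: "(\<integral>\<^sup>+z. ennreal (f z) \<partial>M) < \<infinity>" .
  show ?thesis
  proof (cases "(\<integral>\<^sup>+z. ennreal (- f z) \<partial>M) = \<infinity>")
    case True
    have "ext_integral M f = - \<infinity>"
      unfolding ext_integral_def True using p by (cases "\<integral>\<^sup>+z. ennreal (f z) \<partial>M") (auto simp: enn2ereal_ennreal)
    then show ?thesis ..
  next
    case False
    then show ?thesis using p f by (auto simp: real_integrable_def)
  qed
qed

lemma ext_integral_cong_AE:
  assumes "AE z in M. f z = g z"
  shows "ext_integral M f = ext_integral M g"
proof -
  have "(\<integral>\<^sup>+z. ennreal (f z) \<partial>M) = (\<integral>\<^sup>+z. ennreal (g z) \<partial>M)" "(\<integral>\<^sup>+z. ennreal (- f z) \<partial>M) = (\<integral>\<^sup>+z. ennreal (- g z) \<partial>M)"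
    using assms by (auto intro!: nn_integral_cong_AE elim!: eventually_mono)
  then show ?thesis by (simp add: ext_integral_def)
qed

text \<open>The strictly convex function \<open>x ln x\<close> lies above its tangent at \<open>h\<close>.\<close>

lemma xlogx_tangent:
  fixes f h :: real
  assumes "0 \<le> f" "0 < h"
  shows "0 \<le> h - f + f * (ln f - ln h)"
    and "h - f + f * (ln f - ln h) = 0 \<longleftrightarrow> f = h"
proof -
  have "0 \<le> h - f + f * (ln f - ln h) \<and> (h - f + f * (ln f - ln h) = 0 \<longrightarrow> f = h)"
  proof (cases "f = 0")
    case False
    then have f: "0 < f" using assms by simp
    have l: "ln (h / f) \<le> h / f - 1" using f assms by (intro ln_le_minus_one) auto
    have e: "h - f + f * (ln f - ln h) = f * (h / f - 1 - ln (h / f))"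
      using f assms by (simp add: ln_div field_simps)
    have "f * (h / f - 1 - ln (h / f)) = 0 \<Longrightarrow> h / f = 1"
      using f assms by (intro ln_eq_minus_one) auto
    then show ?thesis unfolding e using f l by (auto intro: mult_nonneg_nonneg)
  qed (use assms in auto)
  then show "0 \<le> h - f + f * (ln f - ln h)" "h - f + f * (ln f - ln h) = 0 \<longleftrightarrow> f = h" by auto
qed

text \<open>\<open>kl_integrand\<close> integrates to the relative entropy of the density \<open>f\<close> with respect to the normal
  distribution; the correction \<open>h - f\<close> makes the integrand itself nonnegative.\<close>

definition kl_integrand :: "real \<Rightarrow> real \<Rightarrow> (real \<Rightarrow> real) \<Rightarrow> real \<Rightarrow> real" where
  "kl_integrand m s f v = normal_density m s v - f v + f v * (ln (f v) - ln (normal_density m s v))"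

lemma kl_integrand_nonneg: "0 < s \<Longrightarrow> 0 \<le> f v \<Longrightarrow> 0 \<le> kl_integrand m s f v"
  and kl_integrand_eq_0_iff: "0 < s \<Longrightarrow> 0 \<le> f v \<Longrightarrow> kl_integrand m s f v = 0 \<longleftrightarrow> f v = normal_density m s v"
  unfolding kl_integrand_def using xlogx_tangent[of "f v" "normal_density m s v"] normal_density_pos[of s m v]
  by auto

lemma ln_normal_density:
  assumes "0 < s"
  shows "ln (normal_density m s v) = - ln (sqrt (2 * pi * s\<^sup>2)) - (v - m)\<^sup>2 / (2 * s\<^sup>2)"
  using assms by (simp add: normal_density_def ln_mult ln_div)

text \<open>The quadratic is \<open>- \<gamma>\<close> times the logarithm of a normal density, up to a
  constant, so that both logarithms merge into one relative entropy. The middle term on the right has integral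
  \<open>0\<close> for every density \<open>f\<close>.\<close>

lemma quadratic_plus_entropy:
  assumes "0 < c" "0 < \<gamma>"
  shows "(c * (v - m)\<^sup>2 + \<gamma> * ln (f v)) * f v =
     - \<gamma> * ln (sqrt (2 * pi * (\<gamma> / (2 * c)))) * f v
     + \<gamma> * (f v - normal_density m (sqrt (\<gamma> / (2 * c))) v) + \<gamma> * kl_integrand m (sqrt (\<gamma> / (2 * c))) f v"
proof -
  have s: "0 < sqrt (\<gamma> / (2 * c))" "(sqrt (\<gamma> / (2 * c)))\<^sup>2 = \<gamma> / (2 * c)" using assms by auto
  have "ln (normal_density m (sqrt (\<gamma> / (2 * c))) v) = - ln (sqrt (2 * pi * (\<gamma> / (2 * c)))) - c * (v - m)\<^sup>2 / \<gamma>"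
    unfolding ln_normal_density[OF s(1)] s(2) using assms by (simp add: field_simps)
  then have "c * (v - m)\<^sup>2 = - \<gamma> * ln (sqrt (2 * pi * (\<gamma> / (2 * c)))) - \<gamma> * ln (normal_density m (sqrt (\<gamma> / (2 * c))) v)"
    using assms by (simp add: field_simps)
  then show ?thesis
    unfolding kl_integrand_def by (simp only:) (simp add: algebra_simps)
qed

lemma normal_second_moment:
  assumes "0 < s"
  shows "integrable lborel (\<lambda>v. (v - m)\<^sup>2 * normal_density m s v)"
    and "(\<integral>v. (v - m)\<^sup>2 * normal_density m s v \<partial>lborel) = s\<^sup>2"
  using integrable_normal_moment[OF assms, of m 2] integral_normal_moment_even[OF assms, of m 1]
  by (simp_all add: mult.commute power2_eq_square)

lemma normal_first_moment:
  assumes "0 < s"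
  shows "integrable lborel (\<lambda>v. v * normal_density m s v)"
    and "(\<integral>v. v * normal_density m s v \<partial>lborel) = m"
  using integrable_normal_moment_nz_1[OF assms, of m] integral_normal_moment_nz_1[OF assms, of m]
  by (simp_all add: mult.commute)

lemma normal_abs_moment:
  assumes "0 < s"
  shows "integrable lborel (\<lambda>v. \<bar>v - m\<bar> * normal_density m s v)"
    and "(\<integral>v. \<bar>v - m\<bar> * normal_density m s v \<partial>lborel) \<le> s"
proof -
  show i: "integrable lborel (\<lambda>v. \<bar>v - m\<bar> * normal_density m s v)"
    using integrable_normal_moment_abs[OF assms, of m 1] by (simp add: mult.commute)
  have "(\<integral>v. 2 * s * (\<bar>v - m\<bar> * normal_density m s v) \<partial>lborel)
     \<le> (\<integral>v. s\<^sup>2 * normal_density m s v + (v - m)\<^sup>2 * normal_density m s v \<partial>lborel)"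
  proof (rule integral_mono)
    fix v
    have "2 * s * \<bar>v - m\<bar> \<le> s\<^sup>2 + \<bar>v - m\<bar>\<^sup>2" by (rule sum_squares_bound)
    then have "2 * s * \<bar>v - m\<bar> * normal_density m s v \<le> (s\<^sup>2 + (v - m)\<^sup>2) * normal_density m s v"
      by (intro mult_right_mono) auto
    then show "2 * s * (\<bar>v - m\<bar> * normal_density m s v) \<le> s\<^sup>2 * normal_density m s v + (v - m)\<^sup>2 * normal_density m s v"
      by (simp add: algebra_simps)
  qed (use i normal_second_moment(1)[OF assms] assms in auto)
  also have "\<dots> = s\<^sup>2 + s\<^sup>2"
    using normal_second_moment[OF assms] assms by (subst Bochner_Integration.integral_add) auto
  finally show "(\<integral>v. \<bar>v - m\<bar> * normal_density m s v \<partial>lborel) \<le> s"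
    using assms by (simp add: power2_eq_square)
qed

text \<open>Only the mean of the Gaussian policy depends on the state; this bound turns Lipschitz continuity
  of the mean into that of the policy. Means at a distance of at most \<open>1\<close> are compared through
  the Lipschitz estimate for \<open>exp\<close>; for others the trivial bound \<open>2\<close> suffices.\<close>

lemma normal_density_shift_L1:
  assumes s: "0 < s"
  shows "integrable lborel (\<lambda>v. \<bar>normal_density m s v - normal_density m' s v\<bar>)"
    and "(\<integral>v. \<bar>normal_density m s v - normal_density m' s v\<bar> \<partial>lborel) \<le> (2 + 2 / s + 1 / s\<^sup>2) * \<bar>m - m'\<bar>"
proof -
  let ?g = "\<lambda>m. normal_density m s" and ?D = "\<lambda>v. \<bar>normal_density m s v - normal_density m' s v\<bar>"
  show i: "integrable lborel ?D" using s by auto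
  have one: "(\<integral>v. ?D v \<partial>lborel) \<le> (2 / s + 1 / s\<^sup>2) * \<bar>m - m'\<bar>" if "\<bar>m - m'\<bar> \<le> 1"
  proof -
    define C where "C = 1 / (2 * s\<^sup>2)"
    have C: "0 < C" using s by (simp add: C_def)
    have ex: "\<bar>exp (- a) - exp (- b)\<bar> \<le> \<bar>a - b\<bar> * (exp (- a) + exp (- b))" for a b :: real
    proof -
      have *: "\<bar>exp (- a) - exp (- b)\<bar> \<le> \<bar>a - b\<bar> * (exp (- a) + exp (- b))" if "a \<le> b" for a b :: real
      proof -
        have "exp (- a) * (1 - (b - a)) \<le> exp (- a) * exp (- (b - a))"
          using exp_ge_add_one_self[of "a - b"] by (intro mult_left_mono) (auto simp: algebra_simps)
        also have "\<dots> = exp (- b)" by (simp add: exp_add[symmetric])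
        finally have "exp (- a) - exp (- b) \<le> exp (- a) * (b - a)" by (simp add: algebra_simps)
        also have "\<dots> \<le> (exp (- a) + exp (- b)) * (b - a)" using that by (intro mult_right_mono) auto
        finally show ?thesis using that by (simp add: mult.commute)
      qed
      show ?thesis using *[of a b] *[of b a] by (cases "a \<le> b") (auto simp: abs_minus_commute add.commute)
    qed
    have p: "?D v \<le> C * \<bar>m - m'\<bar> * ((2 * (\<bar>v - m\<bar> * ?g m v) + ?g m v) + (2 * (\<bar>v - m'\<bar> * ?g m' v) + ?g m' v))" for v
    proof -
      define K where "K = 1 / sqrt (2 * pi * s\<^sup>2)"
      define a where "a = (v - m)\<^sup>2 / (2 * s\<^sup>2)"
      define b where "b = (v - m')\<^sup>2 / (2 * s\<^sup>2)"
      have K: "0 \<le> K" by (simp add: K_def)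
      have g: "?g m v = K * exp (- a)" "?g m' v = K * exp (- b)" by (auto simp: normal_density_def K_def a_def b_def)
      have "?D v = K * \<bar>exp (- a) - exp (- b)\<bar>" unfolding g using K by (simp add: abs_mult right_diff_distrib[symmetric])
      also have "\<dots> \<le> K * (\<bar>a - b\<bar> * (exp (- a) + exp (- b)))" using K ex by (intro mult_left_mono)
      also have "\<dots> = \<bar>a - b\<bar> * (?g m v + ?g m' v)" unfolding g by (simp add: algebra_simps)
      also have "a - b = C * ((m' - m) * ((v - m) + (v - m')))"
      proof -
        have "a - b = C * ((v - m)\<^sup>2 - (v - m')\<^sup>2)" by (simp add: a_def b_def C_def diff_divide_distrib)
        also have "(v - m)\<^sup>2 - (v - m')\<^sup>2 = (m' - m) * ((v - m) + (v - m'))"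
          by (simp add: power2_eq_square algebra_simps)
        finally show ?thesis .
      qed
      also have "\<bar>\<dots>\<bar> = C * (\<bar>m - m'\<bar> * \<bar>(v - m) + (v - m')\<bar>)" using C by (simp add: abs_mult abs_minus_commute)
      also have "C * (\<bar>m - m'\<bar> * \<bar>(v - m) + (v - m')\<bar>) * (?g m v + ?g m' v)
         = C * \<bar>m - m'\<bar> * (\<bar>(v - m) + (v - m')\<bar> * ?g m v + \<bar>(v - m) + (v - m')\<bar> * ?g m' v)"
        by (simp add: algebra_simps)
      also have "\<dots> \<le> C * \<bar>m - m'\<bar> * ((2 * \<bar>v - m\<bar> + 1) * ?g m v + (2 * \<bar>v - m'\<bar> + 1) * ?g m' v)"
      proof -
        have "\<bar>(v - m) + (v - m')\<bar> \<le> 2 * \<bar>v - m\<bar> + 1" "\<bar>(v - m) + (v - m')\<bar> \<le> 2 * \<bar>v - m'\<bar> + 1"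
          using that by (auto simp: abs_if split: if_splits)
        then show ?thesis using C by (intro mult_left_mono add_mono mult_right_mono) auto
      qed
      finally show ?thesis by (simp add: algebra_simps)
    qed
    have ii: "integrable lborel (\<lambda>v. 2 * (\<bar>v - m\<bar> * ?g m v) + ?g m v)" for m
      using normal_abs_moment(1)[OF s] s by auto
    have "(\<integral>v. ?D v \<partial>lborel) \<le> (\<integral>v. C * \<bar>m - m'\<bar> * ((2 * (\<bar>v - m\<bar> * ?g m v) + ?g m v) + (2 * (\<bar>v - m'\<bar> * ?g m' v) + ?g m' v)) \<partial>lborel)"
      using i ii by (intro integral_mono p) auto
    also have "\<dots> = C * \<bar>m - m'\<bar> * ((2 * (\<integral>v. \<bar>v - m\<bar> * ?g m v \<partial>lborel) + 1) + (2 * (\<integral>v. \<bar>v - m'\<bar> * ?g m' v \<partial>lborel) + 1))"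
      using normal_abs_moment(1)[OF s] s by (simp add: ii)
    also have "\<dots> \<le> C * \<bar>m - m'\<bar> * ((2 * s + 1) + (2 * s + 1))"
      using normal_abs_moment(2)[OF s] C by (intro mult_left_mono add_mono) auto
    also have "\<dots> = (2 / s + 1 / s\<^sup>2) * \<bar>m - m'\<bar>" using s by (simp add: C_def field_simps power2_eq_square)
    finally show ?thesis .
  qed
  have sp: "0 \<le> 2 / s + 1 / s\<^sup>2" using s by auto
  show "(\<integral>v. ?D v \<partial>lborel) \<le> (2 + 2 / s + 1 / s\<^sup>2) * \<bar>m - m'\<bar>"
  proof (cases "\<bar>m - m'\<bar> \<le> 1")
    case True
    have "(2 / s + 1 / s\<^sup>2) * \<bar>m - m'\<bar> \<le> (2 + 2 / s + 1 / s\<^sup>2) * \<bar>m - m'\<bar>" by (intro mult_right_mono) auto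
    then show ?thesis using one[OF True] by linarith
  next
    case False
    have "(\<integral>v. ?D v \<partial>lborel) \<le> (\<integral>v. ?g m v + ?g m' v \<partial>lborel)"
    proof (rule integral_mono[OF i])
      fix v show "?D v \<le> ?g m v + ?g m' v"
        using normal_density_nonneg[of m s v] normal_density_nonneg[of m' s v] by linarith
    qed (use s in auto)
    also have "\<dots> = 2 * 1" using s by simp
    also have "\<dots> \<le> (2 + 2 / s + 1 / s\<^sup>2) * \<bar>m - m'\<bar>"
      using False sp by (intro mult_mono) auto
    finally show ?thesis .
  qed
qed

section \<open>The candidate value function\<close>

lemma real_derivative_transform:
  assumes "x \<in> S" and "\<And>y. y \<in> S \<Longrightarrow> g y = f y" and "(f has_real_derivative d) (at x within S)"
  shows "(g has_real_derivative d) (at x within S)"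
  using has_vector_derivative_transform[of x S g f d] assms
  by (simp add: has_real_derivative_iff_has_vector_derivative)

text \<open>The hypothesis on \<open>(T - t) / c + 1 / (\<alpha> - b / 2)\<close> says that the Riccati
  function \<open>p\<close> below does not explode on \<open>[0, T]\<close>.\<close>

locale liquidation_model =
  fixes P :: model
  assumes T_pos: "0 < T_of P" and rate_pos: "0 < rate_of P" and \<gamma>_pos: "0 < \<gamma>_of P"
    and \<kappa>_nz: "\<kappa>_of P \<noteq> 0" and c_pos': "0 < k_of P + \<phi>_of P"
    and riccati_nz': "\<And>t. t \<in> {0..T_of P} \<Longrightarrow> (T_of P - t) / (k_of P + \<phi>_of P) + 1 / (\<alpha>_of P - b_of P / 2) \<noteq> 0"
    and A_borel [measurable]: "A_of P \<in> sets borel" and A_full: "AE v in lborel. v \<in> A_of P"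
    and \<nu>_prob: "prob_space (\<nu>_of P)" and \<nu>_sets [measurable_cong, simp]: "sets (\<nu>_of P) = sets borel"
    and \<nu>_nonneg: "AE h in \<nu>_of P. 0 \<le> h"
    and \<nu>_moments: "\<And>n::nat. integrable (\<nu>_of P) (\<lambda>h. h ^ n)"
begin

abbreviation "T \<equiv> T_of P"
abbreviation "b \<equiv> b_of P"
abbreviation "k \<equiv> k_of P"
abbreviation "\<sigma> \<equiv> \<sigma>_of P"
abbreviation "\<kappa> \<equiv> \<kappa>_of P"
abbreviation "\<alpha> \<equiv> \<alpha>_of P"
abbreviation "\<phi> \<equiv> \<phi>_of P"
abbreviation "\<rho> \<equiv> \<rho>_of P"
abbreviation "lam \<equiv> rate_of P"
abbreviation "\<gamma> \<equiv> \<gamma>_of P"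
abbreviation "\<nu> \<equiv> \<nu>_of P"
abbreviation "\<A> \<equiv> A_of P"
definition c :: real where "c = k + \<phi>"
abbreviation "sd \<equiv> sqrt (\<gamma> / (2 * c))"
abbreviation "\<eta>1 \<equiv> (\<integral>h. h \<partial>\<nu>)"
abbreviation "\<eta>2 \<equiv> (\<integral>h. h\<^sup>2 \<partial>\<nu>)"

lemma c_pos: "0 < c" using c_pos' by (simp add: c_def)

lemma riccati_nz: "t \<in> {0..T} \<Longrightarrow> (T - t) / c + 1 / (\<alpha> - b / 2) \<noteq> 0"
  using riccati_nz' by (simp add: c_def)

text \<open>The solution of the Riccati equation \<open>p' = p\<^sup>2 / c\<close>; it carries the coefficient
  of \<open>q\<^sup>2\<close> in the value function.\<close>

definition p :: "real \<Rightarrow> real" where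
  "p t = inverse ((T - t) / c + 1 / (\<alpha> - b / 2))"

text \<open>Given \<open>\<mu>\<^sub>t\<close>, the expected integral of \<open>\<mu>\<close> over
  \<open>[t, T]\<close> is \<open>speed_weight t * \<mu>\<^sub>t + jump_weight t\<close>.\<close>

definition speed_weight :: "real \<Rightarrow> real" where
  "speed_weight t = (1 - exp (- \<kappa> * (T - t))) / \<kappa>"

definition jump_weight :: "real \<Rightarrow> real" where
  "jump_weight t = lam * \<eta>1 * ((exp (- \<kappa> * (T - t)) - 1 + \<kappa> * (T - t)) / \<kappa>\<^sup>2)"

text \<open>The least value of the integral of \<open>(c (v - m)\<^sup>2 + \<gamma> ln f(v)) f(v)\<close> over
  all densities \<open>f\<close>.\<close>

definition entropy_const :: real where
  "entropy_const = - \<gamma> * ln (sqrt (2 * pi * (\<gamma> / (2 * c))))"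

text \<open>The linear reward, per unit of trading rate beyond \<open>p q / c\<close>, that is predicted from
  the present.\<close>

definition drift_gain :: "real \<Rightarrow> real \<Rightarrow> real" where
  "drift_gain t \<mu> = 2 * \<phi> * \<rho> * \<mu> - w\<^sub>1 P t \<mu>"

definition mean_speed :: "real \<Rightarrow> real \<Rightarrow> real \<Rightarrow> real" where
  "mean_speed t \<mu> q = p t * q / c + drift_gain t \<mu> / (2 * c)"

lemma sd_pos: "0 < sd" and sd_sq: "sd\<^sup>2 = \<gamma> / (2 * c)"
  using \<gamma>_pos c_pos by auto

lemma p_T: "p T = \<alpha> - b / 2" by (simp add: p_def)

lemma p_nz: "t \<in> {0..T} \<Longrightarrow> p t \<noteq> 0"
  using riccati_nz[of t] by (simp add: p_def)

lemma p_deriv: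
  assumes "t \<in> {0..T}"
  shows "(p has_real_derivative (p t)\<^sup>2 / c) (at t within X)"
proof -
  have "((\<lambda>t. (T - t) / c + 1 / (\<alpha> - b / 2)) has_real_derivative - 1 / c) (at t within X)"
    using c_pos by (auto intro!: derivative_eq_intros)
  from DERIV_inverse_fun[OF this riccati_nz[OF assms]]
  show ?thesis by (simp add: p_def[abs_def] power2_eq_square)
qed

lemma p_continuous: "X \<subseteq> {0..T} \<Longrightarrow> continuous_on X p"
  by (intro continuous_at_imp_continuous_on ballI DERIV_isCont[OF p_deriv]) auto

lemma p_measurable [measurable]: "p \<in> borel_measurable borel"
  unfolding p_def by measurable

lemma inverse_shift: "inverse ((T - t) + c / (\<alpha> - 1 / 2 * b)) = p t / c"
proof -
  have "(T - t) + c / (\<alpha> - 1 / 2 * b) = c * ((T - t) / c + 1 / (\<alpha> - b / 2))"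
    using c_pos by (simp add: distrib_left)
  then show ?thesis by (simp only: p_def inverse_mult_distrib) (simp add: field_simps)
qed

lemma l1_eq: "l\<^sub>1 P t = 2 * \<phi> * \<rho> * (p t / c) * speed_weight t"
  unfolding l\<^sub>1_def c_def[symmetric] inverse_shift speed_weight_def by simp

lemma l0_eq: "l\<^sub>0 P t = 2 * \<phi> * \<rho> * (p t / c) * jump_weight t"
  unfolding l\<^sub>0_def c_def[symmetric] inverse_shift jump_weight_def by simp

lemma w1_eq: "w\<^sub>1 P t \<mu> = 2 * \<phi> * \<rho> * (p t / c) * (speed_weight t * \<mu> + jump_weight t)"
proof -
  define y where "y = p t / c"
  show ?thesis unfolding w\<^sub>1_def l0_eq l1_eq y_def[symmetric] by (simp add: algebra_simps)
qed

lemma w2_eq: "w\<^sub>2 P t \<mu> = - p t - b / 2"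
  unfolding w\<^sub>2_def p_def c_def[symmetric] by simp

lemma gaussian_policy_eq:
  "gaussian_policy P t (x, S, \<mu>, q) = normal_density (mean_speed t \<mu> q) sd"
proof -
  have c: "\<phi> + k = c" by (simp add: c_def)
  have "(- w\<^sub>1 P t \<mu> - 2 * w\<^sub>2 P t \<mu> * q - b * q + 2 * \<phi> * \<rho> * \<mu>) / (2 * c) = mean_speed t \<mu> q"
  proof -
    define y where "y = 1 / c"
    have y: "x / c = x * y" "x / (2 * c) = x * y / 2" for x by (simp_all add: y_def)
    show ?thesis unfolding mean_speed_def drift_gain_def w2_eq y by algebra
  qed
  then show ?thesis unfolding gaussian_policy_def c by simp
qed

lemma speed_weight_deriv: "(speed_weight has_real_derivative \<kappa> * speed_weight t - 1) (at t within X)"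
  unfolding speed_weight_def[abs_def] using \<kappa>_nz
  by (auto intro!: derivative_eq_intros simp: field_simps)

lemma jump_weight_deriv: "(jump_weight has_real_derivative - lam * \<eta>1 * speed_weight t) (at t within X)"
  unfolding jump_weight_def[abs_def] speed_weight_def using \<kappa>_nz
  by (auto intro!: derivative_eq_intros simp: field_simps power2_eq_square)

lemma weights_continuous: "continuous_on X speed_weight" "continuous_on X jump_weight"
  by (auto intro!: continuous_at_imp_continuous_on DERIV_isCont[OF speed_weight_deriv] DERIV_isCont[OF jump_weight_deriv])

lemma weights_measurable [measurable]:
  "speed_weight \<in> borel_measurable borel" "jump_weight \<in> borel_measurable borel"
  unfolding speed_weight_def[abs_def] jump_weight_def[abs_def] by measurable

lemma l_continuous: "continuous_on {0..T} (l\<^sub>1 P)" "continuous_on {0..T} (l\<^sub>0 P)"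
  unfolding l1_eq[abs_def] l0_eq[abs_def] using c_pos
  by (auto intro!: continuous_intros weights_continuous p_continuous)

lemma l_measurable [measurable]: "l\<^sub>1 P \<in> borel_measurable borel" "l\<^sub>0 P \<in> borel_measurable borel"
  unfolding l1_eq[abs_def] l0_eq[abs_def] by measurable

lemma drift_gain_eq: "drift_gain t \<mu> = (2 * \<phi> * \<rho> - l\<^sub>1 P t) * \<mu> - l\<^sub>0 P t"
  unfolding drift_gain_def w\<^sub>1_def by (simp add: algebra_simps)

lemma drift_gain_measurable [measurable (raw)]:
  assumes [measurable]: "f \<in> borel_measurable M" "g \<in> borel_measurable M"
  shows "(\<lambda>x. drift_gain (f x) (g x)) \<in> borel_measurable M"
  unfolding drift_gain_eq by measurable

lemma mean_speed_measurable [measurable (raw)]: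
  assumes [measurable]: "f \<in> borel_measurable M" "g \<in> borel_measurable M" "h \<in> borel_measurable M"
  shows "(\<lambda>x. mean_speed (f x) (g x) (h x)) \<in> borel_measurable M"
  unfolding mean_speed_def by measurable

text \<open>The coefficient of \<open>q\<close> in the HJB equation.\<close>

lemma w1_deriv:
  assumes t: "t \<in> {0..T}"
  shows "((\<lambda>t. w\<^sub>1 P t \<mu>) has_real_derivative
    \<kappa> * \<mu> * l\<^sub>1 P t - lam * \<eta>1 * l\<^sub>1 P t - p t * drift_gain t \<mu> / c) (at t within X)"
proof -
  let ?w = "speed_weight t * \<mu> + jump_weight t"
  have "((\<lambda>t. 2 * \<phi> * \<rho> * (p t / c) * (speed_weight t * \<mu> + jump_weight t)) has_real_derivative
     2 * \<phi> * \<rho> * ((p t)\<^sup>2 / c / c) * ?w + 2 * \<phi> * \<rho> * (p t / c) * ((\<kappa> * speed_weight t - 1) * \<mu> + - lam * \<eta>1 * speed_weight t)) (at t within X)"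
  proof -
    have "((\<lambda>t. 2 * \<phi> * \<rho> * (p t / c) * (speed_weight t * \<mu> + jump_weight t)) has_real_derivative
      (2 * \<phi> * \<rho> * ((p t)\<^sup>2 / c / c)) * ?w
      + ((\<kappa> * speed_weight t - 1) * \<mu> + - lam * \<eta>1 * speed_weight t) * (2 * \<phi> * \<rho> * (p t / c))) (at t within X)"
      by (intro DERIV_mult DERIV_add DERIV_cmult DERIV_cdivide DERIV_cmult_right p_deriv[OF t] speed_weight_deriv jump_weight_deriv)
    then show ?thesis by (simp add: mult_ac)
  qed
  moreover have "2 * \<phi> * \<rho> * ((p t)\<^sup>2 / c / c) * ?w + 2 * \<phi> * \<rho> * (p t / c) * ((\<kappa> * speed_weight t - 1) * \<mu> + - lam * \<eta>1 * speed_weight t)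
    = \<kappa> * \<mu> * l\<^sub>1 P t - lam * \<eta>1 * l\<^sub>1 P t - p t * drift_gain t \<mu> / c"
  proof -
    define y where "y = p t / c"
    have "(p t)\<^sup>2 / c / c = y\<^sup>2" "p t * x / c = y * x" for x by (simp_all add: y_def power2_eq_square)
    then show ?thesis unfolding drift_gain_def w1_eq l1_eq y_def[symmetric]
      by (simp only: y_def[symmetric]) (simp add: algebra_simps power2_eq_square)
  qed
  ultimately show ?thesis by (simp add: w1_eq[abs_def])
qed

text \<open>The quadratic function of \<open>\<mu>\<close> that remains as running reward under the optimal policy.\<close>

definition "g2 t = (2 * \<phi> * \<rho> - l\<^sub>1 P t)\<^sup>2 / (4 * c) - \<phi> * \<rho>\<^sup>2"
definition "g1 t = - (2 * \<phi> * \<rho> - l\<^sub>1 P t) * l\<^sub>0 P t / (2 * c)"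
definition "g0 t = (l\<^sub>0 P t)\<^sup>2 / (4 * c) - entropy_const"

lemma g_eq: "(drift_gain t \<mu>)\<^sup>2 / (4 * c) - \<phi> * \<rho>\<^sup>2 * \<mu>\<^sup>2 - entropy_const = g2 t * \<mu>\<^sup>2 + g1 t * \<mu> + g0 t"
proof -
  define y where "y = 1 / c"
  have y: "x / (2 * c) = x * y / 2" "x / (4 * c) = x * y / 4" for x by (simp_all add: y_def)
  define X where "X = 2 * \<phi> * \<rho> - l\<^sub>1 P t"
  show ?thesis unfolding drift_gain_eq g2_def g1_def g0_def y X_def[symmetric]
    by (simp add: power2_eq_square ring_distribs)
qed

text \<open>Variation of constants for \<open>a' = r a - g\<close> with \<open>a(T) = 0\<close>.\<close>

definition backward :: "real \<Rightarrow> (real \<Rightarrow> real) \<Rightarrow> real \<Rightarrow> real" where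
  "backward r g t = exp (r * t) * integral {t..T} (\<lambda>s. exp (- r * s) * g s)"

lemma backward_T: "backward r g T = 0" by (simp add: backward_def)

lemma backward_deriv:
  assumes g: "continuous_on {0..T} g" and t: "t \<in> {0..T}"
  shows "(backward r g has_real_derivative r * backward r g t - g t) (at t within {0..T})"
proof -
  let ?f = "\<lambda>s. exp (- r * s) * g s"
  have f: "continuous_on {0..T} ?f" by (intro continuous_intros g)
  have e: "integral {s..T} ?f = integral {0..T} ?f - integral {0..s} ?f" if "s \<in> {0..T}" for s
    using Henstock_Kurzweil_Integration.integral_combine[of 0 s T ?f] that integrable_continuous_interval[OF f] by auto
  have d1: "((\<lambda>s. exp (r * s)) has_real_derivative r * exp (r * t)) (at t within {0..T})"
    by (auto intro!: derivative_eq_intros)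
  have d2: "((\<lambda>s. integral {0..T} ?f - integral {0..s} ?f) has_real_derivative 0 - ?f t) (at t within {0..T})"
    by (intro DERIV_diff DERIV_const integral_has_real_derivative[OF f t])
  have "exp (r * t) * ?f t = g t" by (simp add: mult.assoc[symmetric] exp_add[symmetric])
  then have "r * exp (r * t) * (integral {0..T} ?f - integral {0..t} ?f) + (0 - ?f t) * exp (r * t) = r * backward r g t - g t"
    unfolding backward_def e[OF t] by (simp add: mult_ac)
  with DERIV_mult[OF d1 d2] have "((\<lambda>s. exp (r * s) * (integral {0..T} ?f - integral {0..s} ?f)) has_real_derivative
     r * backward r g t - g t) (at t within {0..T})" by simp
  then show ?thesis
    by (rule real_derivative_transform[OF t, rotated]) (simp only: backward_def e)
qed

lemma backward_continuous: "continuous_on {0..T} g \<Longrightarrow> continuous_on {0..T} (backward r g)"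
  by (rule DERIV_continuous_on[OF backward_deriv])

text \<open>The coefficients of \<open>\<mu>\<^sup>2\<close>, \<open>\<mu>\<close> and \<open>1\<close> in the
  value function. Jumps of \<open>\<mu>\<close> couple each of them to those of higher degree, hence the
  triangular system.\<close>

definition "a2 = backward (2 * \<kappa>) g2"
definition "a1 = backward \<kappa> (\<lambda>t. g1 t + 2 * lam * \<eta>1 * a2 t)"
definition "a0 = backward 0 (\<lambda>t. g0 t + lam * \<eta>1 * a1 t + lam * \<eta>2 * a2 t)"

lemma g_continuous: "continuous_on {0..T} g2" "continuous_on {0..T} g1" "continuous_on {0..T} g0"
  unfolding g2_def[abs_def] g1_def[abs_def] g0_def[abs_def] using c_pos
  by (auto intro!: continuous_intros l_continuous)

lemma a_deriv:
  assumes t: "t \<in> {0..T}"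
  shows "(a2 has_real_derivative 2 * \<kappa> * a2 t - g2 t) (at t within {0..T})"
    and "(a1 has_real_derivative \<kappa> * a1 t - (g1 t + 2 * lam * \<eta>1 * a2 t)) (at t within {0..T})"
    and "(a0 has_real_derivative - (g0 t + lam * \<eta>1 * a1 t + lam * \<eta>2 * a2 t)) (at t within {0..T})"
proof -
  have 2: "continuous_on {0..T} a2" unfolding a2_def by (intro backward_continuous g_continuous)
  have 1: "continuous_on {0..T} a1" unfolding a1_def
    by (intro backward_continuous continuous_intros g_continuous 2)
  show "(a2 has_real_derivative 2 * \<kappa> * a2 t - g2 t) (at t within {0..T})"
    unfolding a2_def by (intro backward_deriv g_continuous t)
  show "(a1 has_real_derivative \<kappa> * a1 t - (g1 t + 2 * lam * \<eta>1 * a2 t)) (at t within {0..T})"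
    unfolding a1_def by (intro backward_deriv continuous_intros g_continuous 2 t)
  have "(a0 has_real_derivative 0 * a0 t - (g0 t + lam * \<eta>1 * a1 t + lam * \<eta>2 * a2 t)) (at t within {0..T})"
    unfolding a0_def by (intro backward_deriv continuous_intros g_continuous 1 2 t)
  then show "(a0 has_real_derivative - (g0 t + lam * \<eta>1 * a1 t + lam * \<eta>2 * a2 t)) (at t within {0..T})" by simp
qed

lemma a_T: "a2 T = 0" "a1 T = 0" "a0 T = 0"
  by (simp_all add: a2_def a1_def a0_def backward_T)

definition speed_value :: "real \<Rightarrow> real \<Rightarrow> real" where
  "speed_value t \<mu> = a2 t * \<mu>\<^sup>2 + a1 t * \<mu> + a0 t"

definition candidate :: value_fun where
  "candidate t x S \<mu> q = x + q * S + speed_value t \<mu> + w\<^sub>1 P t \<mu> * q + w\<^sub>2 P t \<mu> * q\<^sup>2"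

lemma candidate_terminal: "candidate T x S \<mu> q = x + q * (S - \<alpha> * q)"
proof -
  have "w\<^sub>1 P T \<mu> = 0" "w\<^sub>2 P T \<mu> = - \<alpha>"
    by (simp_all add: w1_eq w2_eq p_T speed_weight_def jump_weight_def)
  then show ?thesis
    by (simp add: candidate_def speed_value_def a_T ring_distribs power2_eq_square)
qed

lemma \<nu>_integrable: "integrable \<nu> (\<lambda>h. h)" "integrable \<nu> (\<lambda>h. h\<^sup>2)"
  using \<nu>_moments[of 1] \<nu>_moments[of 2] by auto

text \<open>The candidate is quadratic in \<open>\<mu>\<close>, so that only two moments of the jump size
  enter.\<close>

lemma candidate_jump:
  shows "integrable \<nu> (\<lambda>h. candidate t x S (\<mu> + h) q)"
  and "(\<integral>h. candidate t x S (\<mu> + h) q - candidate t x S \<mu> q \<partial>\<nu>)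
     = a2 t * (2 * \<mu> * \<eta>1 + \<eta>2) + a1 t * \<eta>1 + l\<^sub>1 P t * \<eta>1 * q"
proof -
  interpret prob_space \<nu> by (rule \<nu>_prob)
  define L where "L = 2 * \<mu> * a2 t + a1 t + l\<^sub>1 P t * q"
  have e: "candidate t x S (\<mu> + h) q = candidate t x S \<mu> q + (L * h + a2 t * h\<^sup>2)" for h
    unfolding candidate_def speed_value_def w\<^sub>1_def w2_eq L_def by (simp add: ring_distribs power2_eq_square)
  have i: "integrable \<nu> (\<lambda>h. L * h + a2 t * h\<^sup>2)"
    by (intro Bochner_Integration.integrable_add integrable_mult_right \<nu>_integrable)
  have "integrable \<nu> (\<lambda>h. candidate t x S \<mu> q + (L * h + a2 t * h\<^sup>2))"
    by (intro Bochner_Integration.integrable_add integrable_const i)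
  then show "integrable \<nu> (\<lambda>h. candidate t x S (\<mu> + h) q)" unfolding e .
  have "(\<integral>h. candidate t x S (\<mu> + h) q - candidate t x S \<mu> q \<partial>\<nu>) = (\<integral>h. L * h + a2 t * h\<^sup>2 \<partial>\<nu>)"
    by (intro Bochner_Integration.integral_cong refl) (simp only: e add_diff_cancel_left')
  also have "\<dots> = L * \<eta>1 + a2 t * \<eta>2"
    by (subst Bochner_Integration.integral_add) (simp_all add: \<nu>_integrable)
  finally show "(\<integral>h. candidate t x S (\<mu> + h) q - candidate t x S \<mu> q \<partial>\<nu>)
     = a2 t * (2 * \<mu> * \<eta>1 + \<eta>2) + a1 t * \<eta>1 + l\<^sub>1 P t * \<eta>1 * q"
    by (simp add: L_def ring_distribs)
qed

lemma candidate_deriv_t: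
  assumes t: "t \<in> {0..T}"
  shows "((\<lambda>s. candidate s x S \<mu> q) has_real_derivative
    (2 * \<kappa> * a2 t - g2 t) * \<mu>\<^sup>2 + (\<kappa> * a1 t - (g1 t + 2 * lam * \<eta>1 * a2 t)) * \<mu>
    - (g0 t + lam * \<eta>1 * a1 t + lam * \<eta>2 * a2 t)
    + (\<kappa> * \<mu> * l\<^sub>1 P t - lam * \<eta>1 * l\<^sub>1 P t - p t * drift_gain t \<mu> / c) * q - (p t)\<^sup>2 / c * q\<^sup>2) (at t within {0..T})"
  unfolding candidate_def speed_value_def w2_eq
proof (rule DERIV_cong)
  show "((\<lambda>s. x + q * S + (a2 s * \<mu>\<^sup>2 + a1 s * \<mu> + a0 s) + w\<^sub>1 P s \<mu> * q + (- p s - b / 2) * q\<^sup>2) has_real_derivative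
    0 + ((2 * \<kappa> * a2 t - g2 t) * \<mu>\<^sup>2 + (\<kappa> * a1 t - (g1 t + 2 * lam * \<eta>1 * a2 t)) * \<mu>
    + - (g0 t + lam * \<eta>1 * a1 t + lam * \<eta>2 * a2 t))
    + (\<kappa> * \<mu> * l\<^sub>1 P t - lam * \<eta>1 * l\<^sub>1 P t - p t * drift_gain t \<mu> / c) * q + (- ((p t)\<^sup>2 / c) - 0) * q\<^sup>2) (at t within {0..T})"
    by (intro DERIV_add DERIV_const DERIV_cmult_right DERIV_diff DERIV_minus a_deriv[OF t] w1_deriv[OF t] p_deriv[OF t])
qed simp

lemma candidate_derivs:
  "((\<lambda>z. candidate t z S \<mu> q) has_real_derivative 1) (at x)"
  "((\<lambda>z. candidate t x z \<mu> q) has_real_derivative q) (at S)"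
  "((\<lambda>z. candidate t x S z q) has_real_derivative 2 * a2 t * \<mu> + a1 t + l\<^sub>1 P t * q) (at \<mu>)"
  "((\<lambda>z. candidate t x S \<mu> z) has_real_derivative S + w\<^sub>1 P t \<mu> + 2 * w\<^sub>2 P t \<mu> * q) (at q)"
  unfolding candidate_def speed_value_def w\<^sub>1_def w2_eq
  by (auto intro!: derivative_eq_intros simp: algebra_simps)

text \<open>The maximum over all densities of the expression in braces in the HJB equation.\<close>

definition max_hamiltonian :: "real \<Rightarrow> real \<Rightarrow> real \<Rightarrow> real" where
  "max_hamiltonian t \<mu> q = c * (mean_speed t \<mu> q)\<^sup>2 - \<phi> * \<rho>\<^sup>2 * \<mu>\<^sup>2 - entropy_const"

text \<open>Sorted by powers of \<open>q\<close>, for comparison with the time derivative of the candidate.\<close>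

lemma max_hamiltonian_eq:
  "max_hamiltonian t \<mu> q = (p t)\<^sup>2 / c * q\<^sup>2 + p t * drift_gain t \<mu> / c * q + (g2 t * \<mu>\<^sup>2 + g1 t * \<mu> + g0 t)"
proof -
  have "c * (mean_speed t \<mu> q)\<^sup>2 = (p t)\<^sup>2 / c * q\<^sup>2 + p t * drift_gain t \<mu> / c * q + (drift_gain t \<mu>)\<^sup>2 / (4 * c)"
  proof -
    define y where "y = 1 / c"
    have y: "x / c = x * y" "x / (2 * c) = x * y / 2" "x / (4 * c) = x * y / 4" for x by (simp_all add: y_def)
    have "c * y = 1" using c_pos by (simp add: y_def)
    have "c * (p t * q * y + drift_gain t \<mu> * y / 2)\<^sup>2 = (c * y) * (y * (p t * q + drift_gain t \<mu> / 2)\<^sup>2)"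
    proof -
      have "p t * q * y + drift_gain t \<mu> * y / 2 = y * (p t * q + drift_gain t \<mu> / 2)" by (simp add: ring_distribs)
      then show ?thesis by (simp add: power2_eq_square)
    qed
    also have "\<dots> = (p t)\<^sup>2 * y * q\<^sup>2 + p t * drift_gain t \<mu> * y * q + (drift_gain t \<mu>)\<^sup>2 * y / 4"
      unfolding \<open>c * y = 1\<close> by (simp add: power2_eq_square field_simps)
    finally have "c * (p t * q * y + drift_gain t \<mu> * y / 2)\<^sup>2 = (p t)\<^sup>2 * y * q\<^sup>2 + p t * drift_gain t \<mu> * y * q + (drift_gain t \<mu>)\<^sup>2 * y / 4" .
    then show ?thesis unfolding mean_speed_def y .
  qed
  then show ?thesis unfolding max_hamiltonian_def g_eq[symmetric] by simp
qed

context
  fixes V :: value_fun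
  assumes V: "\<And>t x S \<mu> q. t \<in> {0..T} \<Longrightarrow> V t x S \<mu> q = candidate t x S \<mu> q"
begin

lemma candidate_ext: "t \<in> {0..T} \<Longrightarrow> V t = candidate t"
  using V by (auto simp: fun_eq_iff)

lemma value_deriv_t:
  assumes t: "t \<in> {0..T}"
  shows "((\<lambda>s. V s x S \<mu> q) has_real_derivative
    (2 * \<kappa> * a2 t - g2 t) * \<mu>\<^sup>2 + (\<kappa> * a1 t - (g1 t + 2 * lam * \<eta>1 * a2 t)) * \<mu>
    - (g0 t + lam * \<eta>1 * a1 t + lam * \<eta>2 * a2 t)
    + (\<kappa> * \<mu> * l\<^sub>1 P t - lam * \<eta>1 * l\<^sub>1 P t - p t * drift_gain t \<mu> / c) * q - (p t)\<^sup>2 / c * q\<^sup>2) (at t within {0..T})"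
  by (rule real_derivative_transform[OF t _ candidate_deriv_t[OF t]]) (simp add: V)

lemma value_partials:
  assumes t: "t \<in> {0..T}"
  shows "D\<^sub>x V t x S \<mu> q = 1" "D\<^sub>S V t x S \<mu> q = q"
    "D\<^sub>\<mu> V t x S \<mu> q = 2 * a2 t * \<mu> + a1 t + l\<^sub>1 P t * q"
    "D\<^sub>q V t x S \<mu> q = S + w\<^sub>1 P t \<mu> + 2 * w\<^sub>2 P t \<mu> * q"
    "D\<^sub>S (D\<^sub>S V) t x S \<mu> q = 0"
proof -
  show "D\<^sub>x V t x S \<mu> q = 1" "D\<^sub>\<mu> V t x S \<mu> q = 2 * a2 t * \<mu> + a1 t + l\<^sub>1 P t * q"
    "D\<^sub>q V t x S \<mu> q = S + w\<^sub>1 P t \<mu> + 2 * w\<^sub>2 P t \<mu> * q"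
    unfolding D\<^sub>x_def D\<^sub>\<mu>_def D\<^sub>q_def candidate_ext[OF t] by (intro DERIV_imp_deriv candidate_derivs)+
  have S: "D\<^sub>S V t x S \<mu> q = q" for S
    unfolding D\<^sub>S_def candidate_ext[OF t] by (intro DERIV_imp_deriv candidate_derivs)
  then show "D\<^sub>S V t x S \<mu> q = q" .
  show "D\<^sub>S (D\<^sub>S V) t x S \<mu> q = 0" unfolding D\<^sub>S_def[of "D\<^sub>S V"] S by simp
qed

lemma value_HJB_regular: "HJB_regular P V"
  unfolding HJB_regular_def
proof (intro ballI allI conjI)
  fix t x S \<mu> q assume "t \<in> {0..<T}"
  then have t: "t \<in> {0..T}" by auto
  show "(\<lambda>s. V s x S \<mu> q) differentiable at t within {0..T}"
    unfolding real_differentiable_def by (rule exI, rule value_deriv_t[OF t])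
  show "(\<lambda>z. V t z S \<mu> q) differentiable at x" "(\<lambda>z. V t x z \<mu> q) differentiable at S"
    "(\<lambda>z. V t x S z q) differentiable at \<mu>" "(\<lambda>z. V t x S \<mu> z) differentiable at q"
    unfolding candidate_ext[OF t] real_differentiable_def by (rule exI, rule candidate_derivs)+
  show "(\<lambda>z. D\<^sub>S V t x z \<mu> q) differentiable at S" unfolding value_partials[OF t] by simp
  show "integrable \<nu> (\<lambda>h. V t x S (\<mu> + h) q)" unfolding candidate_ext[OF t] by (rule candidate_jump)
qed

lemma value_PDE:
  assumes t: "t \<in> {0..<T}"
  shows "D\<^sub>t P V t x S \<mu> q + 1 / 2 * \<sigma>\<^sup>2 * D\<^sub>S (D\<^sub>S V) t x S \<mu> q + generator P V t x S \<mu> q + max_hamiltonian t \<mu> q = 0"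
proof -
  have t': "t \<in> {0..T}" using t by auto
  have "t islimpt {0..T}" using t by (intro islimpt_Icc[THEN iffD2]) auto
  then have "at t within {0..T} \<noteq> bot" by (simp add: trivial_limit_within)
  then have Dt: "D\<^sub>t P V t x S \<mu> q = (2 * \<kappa> * a2 t - g2 t) * \<mu>\<^sup>2 + (\<kappa> * a1 t - (g1 t + 2 * lam * \<eta>1 * a2 t)) * \<mu>
    - (g0 t + lam * \<eta>1 * a1 t + lam * \<eta>2 * a2 t)
    + (\<kappa> * \<mu> * l\<^sub>1 P t - lam * \<eta>1 * l\<^sub>1 P t - p t * drift_gain t \<mu> / c) * q - (p t)\<^sup>2 / c * q\<^sup>2"
    unfolding D\<^sub>t_def
    by (rule vector_derivative_within)
      (use value_deriv_t[OF t', unfolded has_real_derivative_iff_has_vector_derivative] in auto)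
  show ?thesis
    unfolding Dt max_hamiltonian_eq generator_def value_partials[OF t'] unfolding candidate_ext[OF t'] candidate_jump(2)
    by (simp add: ring_distribs power2_eq_square)
qed

end

end

section \<open>Increments of the driving noise\<close>

text \<open>The law of a sum of \<open>n\<close> independent marks.\<close>

primrec convolution_power :: "real measure \<Rightarrow> nat \<Rightarrow> real measure" where
  "convolution_power \<nu> 0 = return borel 0"
| "convolution_power \<nu> (Suc n) = (convolution_power \<nu> n \<star> \<nu>)"

definition compound_poisson :: "real measure \<Rightarrow> real \<Rightarrow> real measure" where
  "compound_poisson \<nu> \<Lambda> = measure_pmf (poisson_pmf \<Lambda>) \<bind> convolution_power \<nu>"

lemma sets_convolution_power [simp, measurable_cong]: "sets (convolution_power \<nu> n) = sets borel"
  by (cases n) auto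

lemma prob_space_convolution_power:
  assumes "prob_space \<nu>" "sets \<nu> = sets borel"
  shows "prob_space (convolution_power \<nu> n)"
proof (induction n)
  case 0
  show ?case by (simp add: prob_space_return)
next
  case (Suc n)
  interpret \<nu>: prob_space \<nu> by fact
  interpret C: prob_space "convolution_power \<nu> n" by fact
  interpret pair_prob_space "convolution_power \<nu> n" \<nu> ..
  have [measurable_cong]: "sets \<nu> = sets borel" by fact
  show ?case
    unfolding convolution_power.simps convolution_def by (rule prob_space_distr) measurable
qed

text \<open>The first two factorial moments of the Poisson law in the combination that occurs for a compound
  Poisson law; non-negative weights permit to work without integrability.\<close>

lemma poisson_moments:
  fixes \<Lambda> x y :: real
  assumes "0 < \<Lambda>" "0 \<le> x" "0 \<le> y"
  shows "(\<integral>\<^sup>+n. ennreal (real n * x + real n * (real n - 1) * y) \<partial>measure_pmf (poisson_pmf \<Lambda>)) = ennreal (\<Lambda> * x + \<Lambda>\<^sup>2 * y)"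
proof -
  let ?e = "\<lambda>n. \<Lambda> ^ n / fact n * exp (- \<Lambda>)"
  have e: "?e sums 1"
    using sums_mult2[OF exp_converges[of \<Lambda>], of "exp (- \<Lambda>)"] by (simp add: exp_minus scaleR_conv_of_real field_simps)
  have s1: "(\<lambda>n. ?e n * real n) sums \<Lambda>"
  proof -
    have "(\<lambda>n. ?e (Suc n) * real (Suc n)) sums (\<Lambda> * 1)"
      using sums_mult[OF e, of \<Lambda>] by (simp add: field_simps del: of_nat_Suc)
    then show ?thesis by (subst (asm) sums_Suc_iff) simp
  qed
  have s2: "(\<lambda>n. ?e n * (real n * (real n - 1))) sums \<Lambda>\<^sup>2"
  proof -
    have "(\<lambda>n. ?e (Suc n) * (real (Suc n) * (real (Suc n) - 1))) sums (\<Lambda> * \<Lambda>)"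
    proof -
      have e: "?e (Suc n) * (real (Suc n) * (real (Suc n) - 1)) = \<Lambda> * (?e n * real n)" for n
      proof -
        have "?e (Suc n) * real (Suc n) = \<Lambda> * ?e n" by (simp add: field_simps del: of_nat_Suc)
        then have "?e (Suc n) * real (Suc n) * real n = \<Lambda> * ?e n * real n" by simp
        then show ?thesis by (simp add: mult_ac)
      qed
      show ?thesis unfolding e by (rule sums_mult[OF s1])
    qed
    then show ?thesis by (subst (asm) sums_Suc_iff) (simp add: power2_eq_square)
  qed
  have s: "(\<lambda>n. ?e n * (real n * x + real n * (real n - 1) * y)) sums (\<Lambda> * x + \<Lambda>\<^sup>2 * y)"
    using sums_add[OF sums_mult2[OF s1, of x] sums_mult2[OF s2, of y]] by (simp only: distrib_left mult.assoc)
  have nn: "0 \<le> real n * x + real n * (real n - 1) * y" for n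
    using assms by (cases n) auto
  have "(\<integral>\<^sup>+n. ennreal (real n * x + real n * (real n - 1) * y) \<partial>measure_pmf (poisson_pmf \<Lambda>))
      = (\<Sum>n. ennreal (pmf (poisson_pmf \<Lambda>) n) * ennreal (real n * x + real n * (real n - 1) * y))"
    by (simp only: nn_integral_measure_pmf nn_integral_count_space_nat)
  also have "\<dots> = (\<Sum>n. ennreal (?e n * (real n * x + real n * (real n - 1) * y)))"
    unfolding pmf_poisson[OF assms(1)] using assms nn by (intro suminf_cong ennreal_mult[symmetric]) auto
  also have "\<dots> = ennreal (\<Lambda> * x + \<Lambda>\<^sup>2 * y)"
    using s assms nn by (intro suminf_ennreal_eq) auto
  finally show ?thesis .
qed

lemma (in prob_space) indep_set_subsets:
  "indep_set A B \<Longrightarrow> A' \<subseteq> A \<Longrightarrow> B' \<subseteq> B \<Longrightarrow> indep_set A' B'"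
  unfolding indep_set_def by (rule indep_sets_mono_sets) (auto split: bool.split)

lemma (in prob_space) integral_quadratic:
  fixes X :: "'a \<Rightarrow> real"
  assumes "integrable M X" "integrable M (\<lambda>x. (X x)\<^sup>2)"
  shows "integrable M (\<lambda>x. r * (X x)\<^sup>2 + s * X x + t)"
    and "\<E> (\<lambda>x. r * (X x)\<^sup>2 + s * X x + t) = r * \<E> (\<lambda>x. (X x)\<^sup>2) + s * \<E> X + t"
  using assms by (auto simp: prob_space)

context liquidation_model
begin

lemma eta1_nonneg: "0 \<le> \<eta>1" and eta2_nonneg: "0 \<le> \<eta>2"
  using \<nu>_nonneg by (auto intro!: integral_nonneg_AE)

lemma convolution_power_moments:
  "(AE x in convolution_power \<nu> n. 0 \<le> x)
   \<and> (integrable (convolution_power \<nu> n) (\<lambda>x. x) \<and> (\<integral>x. x \<partial>convolution_power \<nu> n) = n * \<eta>1)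
   \<and> (integrable (convolution_power \<nu> n) (\<lambda>x. x\<^sup>2) \<and> (\<integral>x. x\<^sup>2 \<partial>convolution_power \<nu> n) = n * \<eta>2 + n * (real n - 1) * \<eta>1\<^sup>2)"
proof (induction n)
  case 0
  have i: "integrable (return borel 0) f" if "f \<in> borel_measurable borel" for f :: "real \<Rightarrow> real"
    using that by (intro integrableI_bounded) (auto simp: nn_integral_return)
  show ?case
  proof (intro conjI)
    have "AE x in return borel (0::real). 0 \<le> x" by (subst AE_return) auto
    then show "AE x in convolution_power \<nu> 0. 0 \<le> x" unfolding convolution_power.simps .
  qed (auto simp: i integral_return)
next
  case (Suc n)
  let ?C = "convolution_power \<nu> n"
  interpret \<nu>: prob_space \<nu> by (rule \<nu>_prob)
  interpret C: prob_space ?C by (intro prob_space_convolution_power \<nu>_prob \<nu>_sets)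
  have C: "AE x in ?C. 0 \<le> x" "integrable ?C (\<lambda>x. x)" "(\<integral>x. x \<partial>?C) = n * \<eta>1"
    "integrable ?C (\<lambda>x. x\<^sup>2)" "(\<integral>x. x\<^sup>2 \<partial>?C) = n * \<eta>2 + n * (real n - 1) * \<eta>1\<^sup>2"
    using Suc by auto
  have conv: "(\<integral>\<^sup>+x. f x \<partial>(?C \<star> \<nu>)) = (\<integral>\<^sup>+x. \<integral>\<^sup>+y. f (x + y) \<partial>\<nu> \<partial>?C)" if "f \<in> borel_measurable borel" for f :: "real \<Rightarrow> ennreal"
    using that by (intro nn_integral_convolution) (auto intro: \<nu>.finite_measure_axioms C.finite_measure_axioms)
  have nonneg: "AE x in ?C \<star> \<nu>. 0 \<le> x"
  proof -
    have "(\<integral>\<^sup>+x. indicator {..<0} x \<partial>(?C \<star> \<nu>)) = (\<integral>\<^sup>+x. \<integral>\<^sup>+y. indicator {..<0::real} (x + y) \<partial>\<nu> \<partial>?C)"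
      by (rule conv) auto
    also have "\<dots> = (\<integral>\<^sup>+x. \<integral>\<^sup>+y. 0 \<partial>\<nu> \<partial>?C)"
    proof (intro nn_integral_cong_AE)
      show "AE x in ?C. (\<integral>\<^sup>+y. indicator {..<0::real} (x + y) \<partial>\<nu>) = (\<integral>\<^sup>+y. 0 \<partial>\<nu>)"
        using C(1)
      proof eventually_elim
        case (elim x)
        show ?case
          using \<nu>_nonneg by (intro nn_integral_cong_AE) (use elim in \<open>auto elim!: eventually_mono simp: indicator_def\<close>)
      qed
    qed
    finally have "emeasure (?C \<star> \<nu>) {..<0} = 0" by (simp add: nn_integral_indicator)
    then have "AE x in ?C \<star> \<nu>. x \<notin> {..<0}" by (intro AE_not_in) (auto simp: null_sets_def)
    then show ?thesis by (auto elim!: eventually_mono)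
  qed
  have m1: "(\<integral>\<^sup>+x. ennreal x \<partial>(?C \<star> \<nu>)) = ennreal (Suc n * \<eta>1)"
  proof -
    have "(\<integral>\<^sup>+x. ennreal x \<partial>(?C \<star> \<nu>)) = (\<integral>\<^sup>+x. \<integral>\<^sup>+y. ennreal (x + y) \<partial>\<nu> \<partial>?C)" by (rule conv) auto
    also have "\<dots> = (\<integral>\<^sup>+x. ennreal (x + \<eta>1) \<partial>?C)"
    proof (intro nn_integral_cong_AE)
      show "AE x in ?C. (\<integral>\<^sup>+y. ennreal (x + y) \<partial>\<nu>) = ennreal (x + \<eta>1)"
        using C(1)
      proof eventually_elim
        case (elim x)
        have "(\<integral>\<^sup>+y. ennreal (x + y) \<partial>\<nu>) = ennreal (\<integral>y. x + y \<partial>\<nu>)"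
          using \<nu>_nonneg elim \<nu>_integrable by (intro nn_integral_eq_integral) (auto elim!: eventually_mono)
        then show ?case using \<nu>_integrable by (simp add: \<nu>.prob_space)
      qed
    qed
    also have "\<dots> = ennreal (\<integral>x. x + \<eta>1 \<partial>?C)"
      using C eta1_nonneg by (intro nn_integral_eq_integral) (auto elim!: eventually_mono)
    also have "(\<integral>x. x + \<eta>1 \<partial>?C) = Suc n * \<eta>1"
      using C by (simp add: C.prob_space algebra_simps)
    finally show ?thesis .
  qed
  have m2: "(\<integral>\<^sup>+x. ennreal (x\<^sup>2) \<partial>(?C \<star> \<nu>)) = ennreal (Suc n * \<eta>2 + Suc n * (real (Suc n) - 1) * \<eta>1\<^sup>2)"
  proof -
    have "(\<integral>\<^sup>+x. ennreal (x\<^sup>2) \<partial>(?C \<star> \<nu>)) = (\<integral>\<^sup>+x. \<integral>\<^sup>+y. ennreal ((x + y)\<^sup>2) \<partial>\<nu> \<partial>?C)" by (rule conv) auto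
    also have "\<dots> = (\<integral>\<^sup>+x. ennreal (1 * x\<^sup>2 + (2 * \<eta>1) * x + \<eta>2) \<partial>?C)"
    proof (intro nn_integral_cong)
      fix x :: real
      have e: "(x + y)\<^sup>2 = 1 * y\<^sup>2 + (2 * x) * y + x\<^sup>2" for y by (simp add: power2_sum)
      have "(\<integral>\<^sup>+y. ennreal ((x + y)\<^sup>2) \<partial>\<nu>) = ennreal (\<integral>y. (x + y)\<^sup>2 \<partial>\<nu>)"
        unfolding e by (intro nn_integral_eq_integral \<nu>.integral_quadratic(1) \<nu>_integrable) (simp only: e[symmetric], simp)
      also have "(\<integral>y. (x + y)\<^sup>2 \<partial>\<nu>) = 1 * \<eta>2 + (2 * x) * \<eta>1 + x\<^sup>2"
        unfolding e by (intro \<nu>.integral_quadratic(2) \<nu>_integrable)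
      finally show "(\<integral>\<^sup>+y. ennreal ((x + y)\<^sup>2) \<partial>\<nu>) = ennreal (1 * x\<^sup>2 + (2 * \<eta>1) * x + \<eta>2)"
        by (simp add: ac_simps)
    qed
    also have "\<dots> = ennreal (\<integral>x. 1 * x\<^sup>2 + (2 * \<eta>1) * x + \<eta>2 \<partial>?C)"
    proof (intro nn_integral_eq_integral C.integral_quadratic(1) C)
      show "AE x in ?C. 0 \<le> 1 * x\<^sup>2 + (2 * \<eta>1) * x + \<eta>2"
        using C(1) by eventually_elim (use eta1_nonneg eta2_nonneg in auto)
    qed
    also have "(\<integral>x. 1 * x\<^sup>2 + (2 * \<eta>1) * x + \<eta>2 \<partial>?C) = Suc n * \<eta>2 + Suc n * (real (Suc n) - 1) * \<eta>1\<^sup>2"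
    proof -
      have "(\<integral>x. 1 * x\<^sup>2 + (2 * \<eta>1) * x + \<eta>2 \<partial>?C) = 1 * (\<integral>x. x\<^sup>2 \<partial>?C) + (2 * \<eta>1) * (\<integral>x. x \<partial>?C) + \<eta>2"
        by (rule C.integral_quadratic(2)[OF C(2,4)])
      also have "\<dots> = Suc n * \<eta>2 + Suc n * (real (Suc n) - 1) * \<eta>1\<^sup>2"
        unfolding C(3,5) by (simp add: algebra_simps power2_eq_square[of \<eta>1])
      finally show ?thesis .
    qed
    finally show ?thesis .
  qed
  have [measurable]: "(\<lambda>x. x) \<in> borel_measurable (?C \<star> \<nu>)" by (simp add: measurable_def)
  show ?case
    unfolding convolution_power.simps
  proof (intro conjI nonneg)
    have "integrable (?C \<star> \<nu>) (\<lambda>x. x) \<and> (\<integral>x. x \<partial>(?C \<star> \<nu>)) = Suc n * \<eta>1"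
      using m1 nonneg eta1_nonneg by (intro nn_integral_eq_integrable[THEN iffD1]) auto
    then show "integrable (?C \<star> \<nu>) (\<lambda>x. x)" "(\<integral>x. x \<partial>(?C \<star> \<nu>)) = Suc n * \<eta>1" by auto
    have "integrable (?C \<star> \<nu>) (\<lambda>x. x\<^sup>2) \<and> (\<integral>x. x\<^sup>2 \<partial>(?C \<star> \<nu>)) = Suc n * \<eta>2 + Suc n * (real (Suc n) - 1) * \<eta>1\<^sup>2"
      using m2 eta2_nonneg by (intro nn_integral_eq_integrable[THEN iffD1]) auto
    then show "integrable (?C \<star> \<nu>) (\<lambda>x. x\<^sup>2)" "(\<integral>x. x\<^sup>2 \<partial>(?C \<star> \<nu>)) = Suc n * \<eta>2 + Suc n * (real (Suc n) - 1) * \<eta>1\<^sup>2" by auto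
  qed
qed

lemma convolution_power_kernel: "convolution_power \<nu> \<in> measurable (measure_pmf q) (subprob_algebra borel)"
proof -
  have "convolution_power \<nu> n \<in> space (subprob_algebra borel)" for n
    using prob_space_imp_subprob_space[OF prob_space_convolution_power[OF \<nu>_prob \<nu>_sets]]
    by (simp add: space_subprob_algebra)
  then show ?thesis by (simp add: measurable_def space_subprob_algebra)
qed

lemma sets_compound_poisson [simp, measurable_cong]: "sets (compound_poisson \<nu> \<Lambda>) = sets borel"
  unfolding compound_poisson_def by (rule sets_bind[OF sets_kernel[OF convolution_power_kernel]]) auto

lemma nn_integral_compound_poisson:
  assumes "f \<in> borel_measurable borel"
  shows "(\<integral>\<^sup>+x. f x \<partial>compound_poisson \<nu> \<Lambda>) = (\<integral>\<^sup>+n. \<integral>\<^sup>+x. f x \<partial>convolution_power \<nu> n \<partial>measure_pmf (poisson_pmf \<Lambda>))"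
  unfolding compound_poisson_def using assms by (intro nn_integral_bind[where B=borel] convolution_power_kernel)

lemma prob_space_compound_poisson: "prob_space (compound_poisson \<nu> \<Lambda>)"
proof
  have "emeasure (compound_poisson \<nu> \<Lambda>) (space (compound_poisson \<nu> \<Lambda>)) = (\<integral>\<^sup>+x. 1 \<partial>compound_poisson \<nu> \<Lambda>)" by simp
  also have "\<dots> = (\<integral>\<^sup>+n. \<integral>\<^sup>+x. 1 \<partial>convolution_power \<nu> n \<partial>measure_pmf (poisson_pmf \<Lambda>))"
    by (rule nn_integral_compound_poisson) simp
  also have "\<dots> = 1"
    using prob_space.emeasure_space_1[OF prob_space_convolution_power[OF \<nu>_prob \<nu>_sets]]
    by (simp add: measure_pmf.emeasure_space_1)
  finally show "emeasure (compound_poisson \<nu> \<Lambda>) (space (compound_poisson \<nu> \<Lambda>)) = 1" .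
qed

lemma compound_poisson_moments:
  assumes "0 < \<Lambda>"
  shows "integrable (compound_poisson \<nu> \<Lambda>) (\<lambda>x. x)" "(\<integral>x. x \<partial>compound_poisson \<nu> \<Lambda>) = \<Lambda> * \<eta>1"
    "integrable (compound_poisson \<nu> \<Lambda>) (\<lambda>x. x\<^sup>2)" "(\<integral>x. x\<^sup>2 \<partial>compound_poisson \<nu> \<Lambda>) = \<Lambda> * \<eta>2 + (\<Lambda> * \<eta>1)\<^sup>2"
proof -
  note cp = convolution_power_moments
  have [measurable]: "(\<lambda>x. x) \<in> borel_measurable (compound_poisson \<nu> \<Lambda>)" by (simp add: measurable_def)
  have nonneg: "AE x in compound_poisson \<nu> \<Lambda>. 0 \<le> x"
  proof -
    have "(\<integral>\<^sup>+x. indicator {..<0} x \<partial>compound_poisson \<nu> \<Lambda>) = (\<integral>\<^sup>+n. \<integral>\<^sup>+x. indicator {..<0} x \<partial>convolution_power \<nu> n \<partial>measure_pmf (poisson_pmf \<Lambda>))"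
      by (rule nn_integral_compound_poisson) simp
    also have "\<dots> = (\<integral>\<^sup>+n. \<integral>\<^sup>+x. 0 \<partial>convolution_power \<nu> n \<partial>measure_pmf (poisson_pmf \<Lambda>))"
      by (rule nn_integral_cong, rule nn_integral_cong_AE)
        (auto intro!: eventually_mono[OF cp[THEN conjunct1]] simp: indicator_def)
    finally have "emeasure (compound_poisson \<nu> \<Lambda>) {..<0} = 0" by (simp add: nn_integral_indicator)
    then have "AE x in compound_poisson \<nu> \<Lambda>. x \<notin> {..<0}" by (intro AE_not_in) (auto simp: null_sets_def)
    then show ?thesis by (auto elim!: eventually_mono)
  qed
  have "(\<integral>\<^sup>+x. ennreal x \<partial>compound_poisson \<nu> \<Lambda>) = (\<integral>\<^sup>+n. \<integral>\<^sup>+x. ennreal x \<partial>convolution_power \<nu> n \<partial>measure_pmf (poisson_pmf \<Lambda>))"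
    by (rule nn_integral_compound_poisson) simp
  also have "\<dots> = (\<integral>\<^sup>+n. ennreal (real n * \<eta>1 + real n * (real n - 1) * 0) \<partial>measure_pmf (poisson_pmf \<Lambda>))"
    using cp by (intro nn_integral_cong) (subst nn_integral_eq_integral, auto)
  also have "\<dots> = ennreal (\<Lambda> * \<eta>1)"
    using poisson_moments[OF assms eta1_nonneg, of 0] by simp
  finally have "integrable (compound_poisson \<nu> \<Lambda>) (\<lambda>x. x) \<and> (\<integral>x. x \<partial>compound_poisson \<nu> \<Lambda>) = \<Lambda> * \<eta>1"
    using nonneg assms eta1_nonneg by (intro nn_integral_eq_integrable[THEN iffD1]) auto
  then show "integrable (compound_poisson \<nu> \<Lambda>) (\<lambda>x. x)" "(\<integral>x. x \<partial>compound_poisson \<nu> \<Lambda>) = \<Lambda> * \<eta>1" by auto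
  have "(\<integral>\<^sup>+x. ennreal (x\<^sup>2) \<partial>compound_poisson \<nu> \<Lambda>) = (\<integral>\<^sup>+n. \<integral>\<^sup>+x. ennreal (x\<^sup>2) \<partial>convolution_power \<nu> n \<partial>measure_pmf (poisson_pmf \<Lambda>))"
    by (rule nn_integral_compound_poisson) simp
  also have "\<dots> = (\<integral>\<^sup>+n. ennreal (real n * \<eta>2 + real n * (real n - 1) * \<eta>1\<^sup>2) \<partial>measure_pmf (poisson_pmf \<Lambda>))"
    using cp by (intro nn_integral_cong) (subst nn_integral_eq_integral, auto)
  also have "\<dots> = ennreal (\<Lambda> * \<eta>2 + (\<Lambda> * \<eta>1)\<^sup>2)"
    using poisson_moments[OF assms eta2_nonneg, of "\<eta>1\<^sup>2"] by (simp add: power_mult_distrib)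
  finally have "integrable (compound_poisson \<nu> \<Lambda>) (\<lambda>x. x\<^sup>2) \<and> (\<integral>x. x\<^sup>2 \<partial>compound_poisson \<nu> \<Lambda>) = \<Lambda> * \<eta>2 + (\<Lambda> * \<eta>1)\<^sup>2"
    using assms eta2_nonneg by (intro nn_integral_eq_integrable[THEN iffD1]) auto
  then show "integrable (compound_poisson \<nu> \<Lambda>) (\<lambda>x. x\<^sup>2)" "(\<integral>x. x\<^sup>2 \<partial>compound_poisson \<nu> \<Lambda>) = \<Lambda> * \<eta>2 + (\<Lambda> * \<eta>1)\<^sup>2" by auto
qed

end

text \<open>Independence of the three sources of noise is given for the generated families of events; this
  makes it available for any statistic of one source.\<close>

lemma generated_sets_preimage:
  assumes "\<And>i. i \<in> I \<Longrightarrow> X i \<in> measurable M borel"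
    and "\<And>K. sets K = generated_sets M X I \<Longrightarrow> space K = space M \<Longrightarrow> (\<And>i. i \<in> I \<Longrightarrow> X i \<in> measurable K borel) \<Longrightarrow> Y \<in> measurable K L"
    and "B \<in> sets L"
  shows "Y -` B \<inter> space M \<in> generated_sets M X I"
proof -
  let ?G = "\<Union>i\<in>I. {X i -` B \<inter> space M | B. B \<in> sets borel}"
  let ?K = "sigma (space M) ?G"
  have s: "sets ?K = generated_sets M X I" "space ?K = space M"
    unfolding generated_sets_def by (auto intro!: sets_measure_of space_measure_of)
  have "X i \<in> measurable ?K borel" if "i \<in> I" for i
    using that by (auto simp: measurable_def s generated_sets_def intro!: sigma_sets.Basic)
  from measurable_sets[OF assms(2)[OF s this] assms(3)] show ?thesis by (simp add: s)
qed

locale liquidation_noise = liquidation_model P for P :: model +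
  fixes M :: "'a measure" and F :: "real \<Rightarrow> 'a measure" and W :: "real \<Rightarrow> 'a \<Rightarrow> real"
    and N :: "real \<Rightarrow> 'a \<Rightarrow> nat" and \<eta> :: "nat \<Rightarrow> 'a \<Rightarrow> real"
  assumes noise: "driving_noise P M F W N \<eta>"
begin

definition J :: "real \<Rightarrow> 'a \<Rightarrow> real" where
  "J t \<omega> = jump_integral (\<lambda>r. N r \<omega>) (\<lambda>i. \<eta> i \<omega>) 0 t"

lemmas noise' = noise[unfolded driving_noise_def Let_def, folded J_def]

sublocale prob_space M using noise' by blast

lemma filt: "filtration (space M) F" and subalg: "subalgebra M (F t)"
  using noise' by blast+

lemma space_F [simp]: "space (F t) = space M"
  using filtration.space_F[OF filt] .

lemma F_mono: "s \<le> t \<Longrightarrow> sets (F s) \<subseteq> sets (F t)"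
  using filtration.sets_F_mono[OF filt] .

lemma F_mono_measurable: "f \<in> measurable (F s) L \<Longrightarrow> s \<le> t \<Longrightarrow> f \<in> measurable (F t) L"
  using F_mono[of s t] by (auto simp: measurable_def)

lemma F_measurable: "f \<in> measurable (F s) L \<Longrightarrow> f \<in> measurable M L"
  using measurable_from_subalg[OF subalg] .

lemma adapted_F: "0 \<le> t \<Longrightarrow> W t \<in> borel_measurable (F t)"
  "0 \<le> t \<Longrightarrow> N t \<in> measurable (F t) (count_space UNIV)"
  "0 \<le> t \<Longrightarrow> J t \<in> borel_measurable (F t)"
  using noise' by blast+

lemma adapted: "0 \<le> t \<Longrightarrow> W t \<in> borel_measurable M"
  "0 \<le> t \<Longrightarrow> N t \<in> measurable M (count_space UNIV)"
  "0 \<le> t \<Longrightarrow> J t \<in> borel_measurable M"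
  using adapted_F by (auto intro: F_measurable)

lemma N_mono: "\<omega> \<in> space M \<Longrightarrow> 0 \<le> s \<Longrightarrow> s \<le> t \<Longrightarrow> N s \<omega> \<le> N t \<omega>"
  using noise' by (auto simp: mono_on_def)

lemma J_diff:
  assumes "\<omega> \<in> space M" "0 \<le> s" "s \<le> t"
  shows "J t \<omega> - J s \<omega> = jump_integral (\<lambda>r. N r \<omega>) (\<lambda>i. \<eta> i \<omega>) s t"
proof -
  have "{Suc (N 0 \<omega>)..N t \<omega>} = {Suc (N 0 \<omega>)..N s \<omega>} \<union> {Suc (N s \<omega>)..N t \<omega>}"
    using N_mono[OF assms] N_mono[OF assms(1), of 0 s] assms(2) by auto
  then show ?thesis
    unfolding J_def jump_integral_def by (simp add: sum.union_disjoint)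
qed

lemma eta_measurable: "1 \<le> i \<Longrightarrow> \<eta> i \<in> borel_measurable M"
proof -
  have "indep_vars (\<lambda>_. borel) \<eta> {1..}" using noise' by blast
  then show "1 \<le> i \<Longrightarrow> \<eta> i \<in> borel_measurable M" by (auto simp: indep_vars_def)
qed

text \<open>Makes the increments of \<open>J\<close> stationary although the index of the next mark is random:
  only the length of a block of marks matters.\<close>

lemma eta_sum_law: "distr M borel (\<lambda>\<omega>. \<Sum>i = Suc n..n + d. \<eta> i \<omega>) = convolution_power \<nu> d"
proof (induction d)
  case 0
  have "distr M borel (\<lambda>\<omega>. 0::real) = return borel 0"
  proof (rule measure_eqI)
    fix A assume "A \<in> sets (distr M borel (\<lambda>\<omega>. 0::real))"
    then show "emeasure (distr M borel (\<lambda>\<omega>. 0::real)) A = emeasure (return borel 0) A"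
      by (cases "0 \<in> A") (auto simp: emeasure_distr emeasure_space_1)
  qed simp
  then show ?case by simp
next
  case (Suc d)
  have iv: "indep_vars (\<lambda>_. borel) \<eta> {1..}" and law: "\<And>i. 1 \<le> i \<Longrightarrow> distr M borel (\<eta> i) = \<nu>" using noise' by blast+
  have "indep_var borel (\<eta> (Suc (n + d))) borel (\<lambda>\<omega>. \<Sum>i = Suc n..n + d. \<eta> i \<omega>)"
    by (intro indep_vars_sum indep_vars_subset[OF iv]) auto
  note ind = this
  have rv: "(\<lambda>\<omega>. \<Sum>i = Suc n..n + d. \<eta> i \<omega>) \<in> borel_measurable M"
    by (intro borel_measurable_sum eta_measurable) auto
  have "distr M borel (\<lambda>\<omega>. \<eta> (Suc (n + d)) \<omega> + (\<Sum>i = Suc n..n + d. \<eta> i \<omega>)) = (\<nu> \<star> convolution_power \<nu> d)"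
    using sum_indep_random_variable[OF ind eta_measurable rv] law Suc by simp
  also have "\<dots> = (convolution_power \<nu> d \<star> \<nu>)"
    using prob_space_convolution_power[OF \<nu>_prob \<nu>_sets, of d] \<nu>_prob
    by (intro convolution_commutative prob_space.finite_measure) (auto intro: prob_space.finite_measure)
  finally show ?case by (simp add: add.commute)
qed

lemma N_increment_law:
  assumes "0 \<le> s" "s < t"
  shows "emeasure M {\<omega>\<in>space M. N t \<omega> - N s \<omega> = d} = ennreal (pmf (poisson_pmf (lam * (t - s))) d)"
proof -
  have law: "distr M (count_space UNIV) (\<lambda>\<omega>. N t \<omega> - N s \<omega>) = measure_pmf (poisson_pmf (lam * (t - s)))"
    using noise' assms by blast
  have [measurable]: "N t \<in> measurable M (count_space UNIV)" "N s \<in> measurable M (count_space UNIV)"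
    using assms adapted by auto
  have "emeasure (distr M (count_space UNIV) (\<lambda>\<omega>. N t \<omega> - N s \<omega>)) {d} = emeasure M ((\<lambda>\<omega>. N t \<omega> - N s \<omega>) -` {d} \<inter> space M)"
    by (rule emeasure_distr) auto
  also have "(\<lambda>\<omega>. N t \<omega> - N s \<omega>) -` {d} \<inter> space M = {\<omega>\<in>space M. N t \<omega> - N s \<omega> = d}" by auto
  finally show ?thesis unfolding law by (simp add: emeasure_pmf_single)
qed

lemma noise_indep:
  assumes "E0 \<in> generated_sets M W {0..}" "E1 \<in> generated_sets M (\<lambda>t \<omega>. real (N t \<omega>)) {0..}" "E2 \<in> generated_sets M \<eta> {1..}"
  shows "emeasure M (E0 \<inter> E1 \<inter> E2) = emeasure M E0 * emeasure M E1 * emeasure M E2"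
proof -
  let ?G = "\<lambda>j. [generated_sets M W {0..}, generated_sets M (\<lambda>t \<omega>. real (N t \<omega>)) {0..}, generated_sets M \<eta> {1..}] ! j"
  have "indep_sets ?G {0, 1, 2}" using noise' by blast
  from indep_setsD[OF this, of "{0,1,2}" "\<lambda>j. [E0, E1, E2] ! j"] assms
  have "prob (E0 \<inter> E1 \<inter> E2) = prob E0 * prob E1 * prob E2" by (simp add: Int_assoc mult.assoc)
  then show ?thesis by (simp add: emeasure_eq_measure ennreal_mult)
qed

text \<open>The event is decomposed according to the number \<open>n\<close> of jumps before \<open>s\<close>
  and the number \<open>d\<close> of jumps in \<open>(s, t]\<close>: then the increment of \<open>J\<close> is
  a sum of \<open>d\<close> fixed marks, and \<open>W\<close>, \<open>N\<close> and the marks are independent.\<close>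

lemma jump_increment_joint:
  assumes "0 \<le> s" "s < t" and B1: "B1 \<in> sets borel" and B2: "B2 \<in> sets borel"
  shows "emeasure M {\<omega>\<in>space M. W t \<omega> - W s \<omega> \<in> B1 \<and> J t \<omega> - J s \<omega> \<in> B2}
     = emeasure M {\<omega>\<in>space M. W t \<omega> - W s \<omega> \<in> B1} * emeasure (compound_poisson \<nu> (lam * (t - s))) B2"
proof -
  have t: "0 \<le> t" using assms by simp
  have [measurable]: "N t \<in> measurable M (count_space UNIV)" "N s \<in> measurable M (count_space UNIV)"
    "W t \<in> borel_measurable M" "W s \<in> borel_measurable M" using assms adapted by auto
  note [measurable] = B1 B2
  define SS where "SS n d \<omega> = (\<Sum>i = Suc n..n + d. \<eta> i \<omega>)" for n d :: nat and \<omega>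
  have [measurable]: "SS n d \<in> borel_measurable M" for n d
    unfolding SS_def by (intro borel_measurable_sum eta_measurable) auto
  define EA where "EA = {\<omega>\<in>space M. W t \<omega> - W s \<omega> \<in> B1}"
  define EB where "EB n d = {\<omega>\<in>space M. N s \<omega> = n \<and> N t \<omega> = n + d}" for n d
  define EC where "EC n d = {\<omega>\<in>space M. SS n d \<omega> \<in> B2}" for n d
  have [measurable]: "EA \<in> sets M" "EB n d \<in> sets M" "EC n d \<in> sets M" for n d
    unfolding EA_def EB_def EC_def by measurable
  have ga: "EA \<in> generated_sets M W {0..}"
  proof -
    have "(\<lambda>\<omega>. W t \<omega> - W s \<omega>) -` B1 \<inter> space M \<in> generated_sets M W {0..}"
      using assms by (intro generated_sets_preimage[where L=borel]) (auto intro: adapted)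
    also have "(\<lambda>\<omega>. W t \<omega> - W s \<omega>) -` B1 \<inter> space M = EA" by (auto simp: EA_def)
    finally show ?thesis .
  qed
  have gb: "EB n d \<in> generated_sets M (\<lambda>t \<omega>. real (N t \<omega>)) {0..}" for n d
  proof -
    have "(\<lambda>\<omega>. (real (N s \<omega>), real (N t \<omega>))) -` ({real n} \<times> {real (n + d)}) \<inter> space M \<in> generated_sets M (\<lambda>t \<omega>. real (N t \<omega>)) {0..}"
    proof (rule generated_sets_preimage[where L="borel \<Otimes>\<^sub>M borel"])
      show "(\<lambda>\<omega>. real (N i \<omega>)) \<in> borel_measurable M" if "i \<in> {0..}" for i
        using adapted(2)[of i] that by simp
    next
      fix K assume "\<And>i. i \<in> {0..} \<Longrightarrow> (\<lambda>\<omega>. real (N i \<omega>)) \<in> borel_measurable K"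
      then show "(\<lambda>\<omega>. (real (N s \<omega>), real (N t \<omega>))) \<in> measurable K (borel \<Otimes>\<^sub>M borel)"
        using assms t by (intro measurable_Pair) auto
    next
      show "{real n} \<times> {real (n + d)} \<in> sets (borel \<Otimes>\<^sub>M borel)" by (rule pair_measureI) auto
    qed
    also have "(\<lambda>\<omega>. (real (N s \<omega>), real (N t \<omega>))) -` ({real n} \<times> {real (n + d)}) \<inter> space M = EB n d"
      by (auto simp: EB_def)
    finally show ?thesis .
  qed
  have ge: "EC n d \<in> generated_sets M \<eta> {1..}" for n d
  proof -
    have "SS n d -` B2 \<inter> space M \<in> generated_sets M \<eta> {1..}"
      unfolding SS_def by (intro generated_sets_preimage[where L=borel] borel_measurable_sum eta_measurable B2) auto
    also have "SS n d -` B2 \<inter> space M = EC n d" by (auto simp: EC_def)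
    finally show ?thesis .
  qed
  have ee: "emeasure M (EC n d) = emeasure (convolution_power \<nu> d) B2" for n d
  proof -
    have "emeasure (distr M borel (SS n d)) B2 = emeasure M (SS n d -` B2 \<inter> space M)"
      by (rule emeasure_distr) auto
    also have "SS n d -` B2 \<inter> space M = EC n d" by (auto simp: EC_def)
    finally show ?thesis using eta_sum_law[of n d] by (simp add: SS_def[abs_def])
  qed
  have Jd: "J t \<omega> - J s \<omega> = SS (N s \<omega>) (N t \<omega> - N s \<omega>) \<omega>" if "\<omega> \<in> space M" for \<omega>
    using J_diff[OF that, of s t] N_mono[OF that, of s t] assms by (simp add: SS_def jump_integral_def)
  have step: "emeasure M (\<Union>n. EA \<inter> EB n d \<inter> EC n d)
      = emeasure M EA * emeasure (convolution_power \<nu> d) B2 * ennreal (pmf (poisson_pmf (lam * (t - s))) d)" for d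
  proof -
    have "emeasure M (\<Union>n. EA \<inter> EB n d \<inter> EC n d) = (\<integral>\<^sup>+n. emeasure M (EA \<inter> EB n d \<inter> EC n d) \<partial>count_space UNIV)"
      by (rule emeasure_UN_countable) (auto simp: disjoint_family_on_def EB_def)
    also have "\<dots> = (\<integral>\<^sup>+n. (emeasure M EA * emeasure (convolution_power \<nu> d) B2) * emeasure M (EB n d) \<partial>count_space UNIV)"
      by (intro nn_integral_cong) (simp add: noise_indep[OF ga gb ge] ee mult_ac)
    also have "\<dots> = (emeasure M EA * emeasure (convolution_power \<nu> d) B2) * (\<integral>\<^sup>+n. emeasure M (EB n d) \<partial>count_space UNIV)"
      by (rule nn_integral_cmult) simp
    also have "(\<integral>\<^sup>+n. emeasure M (EB n d) \<partial>count_space UNIV) = emeasure M (\<Union>n. EB n d)"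
      by (rule emeasure_UN_countable[symmetric]) (auto simp: disjoint_family_on_def EB_def)
    also have "(\<Union>n. EB n d) = {\<omega>\<in>space M. N t \<omega> - N s \<omega> = d}"
      using N_mono[of _ s t] assms by (force simp: EB_def)
    finally show ?thesis using N_increment_law assms by simp
  qed
  have "{\<omega>\<in>space M. W t \<omega> - W s \<omega> \<in> B1 \<and> J t \<omega> - J s \<omega> \<in> B2} = (\<Union>d. \<Union>n. EA \<inter> EB n d \<inter> EC n d)"
  proof (intro set_eqI iffI)
    fix \<omega> assume w: "\<omega> \<in> {\<omega>\<in>space M. W t \<omega> - W s \<omega> \<in> B1 \<and> J t \<omega> - J s \<omega> \<in> B2}"
    then have "N s \<omega> \<le> N t \<omega>" using N_mono assms by auto
    then have "\<omega> \<in> EA \<inter> EB (N s \<omega>) (N t \<omega> - N s \<omega>) \<inter> EC (N s \<omega>) (N t \<omega> - N s \<omega>)"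
      using w Jd by (auto simp: EA_def EB_def EC_def)
    then show "\<omega> \<in> (\<Union>d. \<Union>n. EA \<inter> EB n d \<inter> EC n d)" by blast
  qed (auto simp: EA_def EB_def EC_def Jd)
  then have "emeasure M {\<omega>\<in>space M. W t \<omega> - W s \<omega> \<in> B1 \<and> J t \<omega> - J s \<omega> \<in> B2}
     = (\<integral>\<^sup>+d. emeasure M (\<Union>n. EA \<inter> EB n d \<inter> EC n d) \<partial>count_space UNIV)"
    by (simp only:) (rule emeasure_UN_countable, auto simp: disjoint_family_on_def EB_def)
  also have "\<dots> = (\<integral>\<^sup>+d. emeasure M EA * (ennreal (pmf (poisson_pmf (lam * (t - s))) d) * emeasure (convolution_power \<nu> d) B2) \<partial>count_space UNIV)"
    by (intro nn_integral_cong) (simp only: step mult_ac)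
  also have "\<dots> = emeasure M EA * (\<integral>\<^sup>+d. ennreal (pmf (poisson_pmf (lam * (t - s))) d) * emeasure (convolution_power \<nu> d) B2 \<partial>count_space UNIV)"
    by (rule nn_integral_cmult) simp
  also have "(\<integral>\<^sup>+d. ennreal (pmf (poisson_pmf (lam * (t - s))) d) * emeasure (convolution_power \<nu> d) B2 \<partial>count_space UNIV)
     = (\<integral>\<^sup>+d. \<integral>\<^sup>+x. indicator B2 x \<partial>convolution_power \<nu> d \<partial>measure_pmf (poisson_pmf (lam * (t - s))))"
    by (simp only: nn_integral_measure_pmf) simp
  also have "\<dots> = (\<integral>\<^sup>+x. indicator B2 x \<partial>compound_poisson \<nu> (lam * (t - s)))"
    by (rule nn_integral_compound_poisson[symmetric]) measurable
  also have "\<dots> = emeasure (compound_poisson \<nu> (lam * (t - s))) B2" by simp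
  finally show ?thesis by (simp add: EA_def)
qed

definition increment :: "real \<Rightarrow> real \<Rightarrow> 'a \<Rightarrow> real \<times> real" where
  "increment s t \<omega> = (W t \<omega> - W s \<omega>, J t \<omega> - J s \<omega>)"

lemma increment_measurable: "0 \<le> s \<Longrightarrow> s \<le> t \<Longrightarrow> increment s t \<in> measurable (F t) (borel \<Otimes>\<^sub>M borel)"
  unfolding increment_def
  by (intro measurable_Pair borel_measurable_diff adapted_F F_mono_measurable[where s=s and t=t]) auto

lemma increment_law:
  assumes "0 \<le> s" "s < t"
  shows "distr M (borel \<Otimes>\<^sub>M borel) (increment s t)
     = density lborel (normal_density 0 (sqrt (t - s))) \<Otimes>\<^sub>M compound_poisson \<nu> (lam * (t - s))"
    and "distr M borel (\<lambda>\<omega>. J t \<omega> - J s \<omega>) = compound_poisson \<nu> (lam * (t - s))"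
proof -
  have t: "0 \<le> t" using assms by simp
  have [measurable]: "W t \<in> borel_measurable M" "W s \<in> borel_measurable M" "J t \<in> borel_measurable M" "J s \<in> borel_measurable M"
    using assms adapted by auto
  have inc [measurable]: "increment s t \<in> measurable M (borel \<Otimes>\<^sub>M borel)"
    unfolding increment_def by measurable
  let ?D = "density lborel (normal_density 0 (sqrt (t - s)))" and ?C = "compound_poisson \<nu> (lam * (t - s))"
  interpret C: prob_space ?C by (rule prob_space_compound_poisson)
  interpret D: prob_space ?D using assms by (intro prob_space_normal_density) auto
  have "distributed M lborel (\<lambda>\<omega>. W t \<omega> - W s \<omega>) (normal_density 0 (sqrt (t - s)))"
    using noise' assms by blast
  then have WD: "distr M lborel (\<lambda>\<omega>. W t \<omega> - W s \<omega>) = ?D" by (simp add: distributed_def)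
  have WB: "emeasure M {\<omega>\<in>space M. W t \<omega> - W s \<omega> \<in> B} = emeasure ?D B" if [measurable]: "B \<in> sets borel" for B
  proof -
    have "emeasure (distr M lborel (\<lambda>\<omega>. W t \<omega> - W s \<omega>)) B = emeasure M ((\<lambda>\<omega>. W t \<omega> - W s \<omega>) -` B \<inter> space M)"
      by (rule emeasure_distr) auto
    also have "(\<lambda>\<omega>. W t \<omega> - W s \<omega>) -` B \<inter> space M = {\<omega>\<in>space M. W t \<omega> - W s \<omega> \<in> B}" by auto
    finally show ?thesis unfolding WD by simp
  qed
  show "distr M (borel \<Otimes>\<^sub>M borel) (increment s t) = ?D \<Otimes>\<^sub>M ?C"
  proof (rule pair_measure_eqI[symmetric])
    show "sigma_finite_measure ?D" "sigma_finite_measure ?C" ..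
    show "sets (?D \<Otimes>\<^sub>M ?C) = sets (distr M (borel \<Otimes>\<^sub>M borel) (increment s t))"
      by (simp cong: sets_pair_measure_cong)
    fix A B assume "A \<in> sets ?D" "B \<in> sets ?C"
    then have A [measurable]: "A \<in> sets borel" "B \<in> sets borel" by auto
    have "emeasure (distr M (borel \<Otimes>\<^sub>M borel) (increment s t)) (A \<times> B) = emeasure M (increment s t -` (A \<times> B) \<inter> space M)"
      by (rule emeasure_distr) auto
    also have "increment s t -` (A \<times> B) \<inter> space M = {\<omega>\<in>space M. W t \<omega> - W s \<omega> \<in> A \<and> J t \<omega> - J s \<omega> \<in> B}"
      by (auto simp: increment_def)
    also have "emeasure M \<dots> = emeasure ?D A * emeasure ?C B"
      using jump_increment_joint[OF assms A] WB[OF A(1)] by simp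
    finally show "emeasure ?D A * emeasure ?C B = emeasure (distr M (borel \<Otimes>\<^sub>M borel) (increment s t)) (A \<times> B)" ..
  qed
  show "distr M borel (\<lambda>\<omega>. J t \<omega> - J s \<omega>) = ?C"
  proof (rule measure_eqI)
    fix B assume "B \<in> sets (distr M borel (\<lambda>\<omega>. J t \<omega> - J s \<omega>))"
    then have B [measurable]: "B \<in> sets borel" by simp
    have "emeasure (distr M borel (\<lambda>\<omega>. J t \<omega> - J s \<omega>)) B = emeasure M ((\<lambda>\<omega>. J t \<omega> - J s \<omega>) -` B \<inter> space M)"
      by (rule emeasure_distr) auto
    also have "(\<lambda>\<omega>. J t \<omega> - J s \<omega>) -` B \<inter> space M = {\<omega>\<in>space M. W t \<omega> - W s \<omega> \<in> UNIV \<and> J t \<omega> - J s \<omega> \<in> B}" by auto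
    also have "emeasure M \<dots> = emeasure ?C B"
      using jump_increment_joint[OF assms _ B, of UNIV] by (simp add: emeasure_space_1)
    finally show "emeasure (distr M borel (\<lambda>\<omega>. J t \<omega> - J s \<omega>)) B = emeasure ?C B" .
  qed simp
qed

lemma increment_indep_set:
  assumes "0 \<le> s" "s < t"
  shows "indep_set (sets (F s)) {increment s t -` B \<inter> space M | B. B \<in> sets (borel \<Otimes>\<^sub>M borel)}"
proof -
  let ?D = "\<lambda>\<omega>. (W t \<omega> - W s \<omega>, real (N t \<omega>) - real (N s \<omega>), J t \<omega> - J s \<omega>)"
  have ind: "indep_set (sets (F s)) {?D -` B \<inter> space M | B. B \<in> sets borel}"
    using noise' assms by blast
  have 2: "increment s t -` A \<inter> space M \<in> {?D -` B \<inter> space M | B. B \<in> sets borel}" if A: "A \<in> sets (borel \<Otimes>\<^sub>M borel)" for A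
  proof -
    have "(\<lambda>x :: real \<times> real \<times> real. (fst x, snd (snd x))) \<in> measurable (borel \<Otimes>\<^sub>M borel \<Otimes>\<^sub>M borel) (borel \<Otimes>\<^sub>M borel)"
      by measurable
    from measurable_sets[OF this A] have "{x :: real \<times> real \<times> real. (fst x, snd (snd x)) \<in> A} \<in> sets (borel \<Otimes>\<^sub>M borel \<Otimes>\<^sub>M borel)"
      by (simp add: vimage_def space_pair_measure)
    then have "{x :: real \<times> real \<times> real. (fst x, snd (snd x)) \<in> A} \<in> sets borel" by (simp only: borel_prod)
    moreover have "increment s t -` A \<inter> space M = ?D -` {x :: real \<times> real \<times> real. (fst x, snd (snd x)) \<in> A} \<inter> space M"
      by (auto simp: increment_def)
    ultimately show ?thesis by blast
  qed
  then have "{increment s t -` B \<inter> space M | B. B \<in> sets (borel \<Otimes>\<^sub>M borel)} \<subseteq> {?D -` B \<inter> space M | B. B \<in> sets borel}"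
    by blast
  with ind show ?thesis by (rule indep_set_subsets[OF _ order_refl])
qed

text \<open>Independence of the past, in the form in which Fubini's theorem can be applied.\<close>

lemma increment_joint_law:
  assumes "0 \<le> s" "s < t" and X: "X \<in> measurable (F s) S"
  shows "distr M (S \<Otimes>\<^sub>M (borel \<Otimes>\<^sub>M borel)) (\<lambda>\<omega>. (X \<omega>, increment s t \<omega>)) = distr M S X \<Otimes>\<^sub>M distr M (borel \<Otimes>\<^sub>M borel) (increment s t)"
proof (rule pair_measure_eqI[symmetric])
  have [measurable]: "X \<in> measurable M S" by (rule F_measurable[OF X])
  have [measurable]: "increment s t \<in> measurable M (borel \<Otimes>\<^sub>M borel)"
    using assms by (intro F_measurable[OF increment_measurable]) auto
  interpret X: prob_space "distr M S X" by (rule prob_space_distr) simp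
  interpret I: prob_space "distr M (borel \<Otimes>\<^sub>M borel) (increment s t)" by (rule prob_space_distr) simp
  show "sigma_finite_measure (distr M S X)" "sigma_finite_measure (distr M (borel \<Otimes>\<^sub>M borel) (increment s t))" ..
  show "sets (distr M S X \<Otimes>\<^sub>M distr M (borel \<Otimes>\<^sub>M borel) (increment s t)) = sets (distr M (S \<Otimes>\<^sub>M (borel \<Otimes>\<^sub>M borel)) (\<lambda>\<omega>. (X \<omega>, increment s t \<omega>)))"
    by (simp cong: sets_pair_measure_cong)
  fix A B assume "A \<in> sets (distr M S X)" "B \<in> sets (distr M (borel \<Otimes>\<^sub>M borel) (increment s t))"
  then have A [measurable]: "A \<in> sets S" "B \<in> sets (borel \<Otimes>\<^sub>M borel)" by auto
  have a: "X -` A \<inter> space M \<in> sets (F s)" using measurable_sets[OF X A(1)] by simp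
  have "emeasure (distr M (S \<Otimes>\<^sub>M (borel \<Otimes>\<^sub>M borel)) (\<lambda>\<omega>. (X \<omega>, increment s t \<omega>))) (A \<times> B)
     = emeasure M ((\<lambda>\<omega>. (X \<omega>, increment s t \<omega>)) -` (A \<times> B) \<inter> space M)"
    by (rule emeasure_distr) auto
  also have "(\<lambda>\<omega>. (X \<omega>, increment s t \<omega>)) -` (A \<times> B) \<inter> space M = (X -` A \<inter> space M) \<inter> (increment s t -` B \<inter> space M)" by auto
  also have "emeasure M \<dots> = emeasure M (X -` A \<inter> space M) * emeasure M (increment s t -` B \<inter> space M)"
  proof -
    have "prob ((X -` A \<inter> space M) \<inter> (increment s t -` B \<inter> space M)) = prob (X -` A \<inter> space M) * prob (increment s t -` B \<inter> space M)"
      using increment_indep_set[OF assms(1,2)] a A(2) unfolding indep_sets2_eq by blast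
    then show ?thesis by (simp add: emeasure_eq_measure ennreal_mult)
  qed
  also have "\<dots> = emeasure (distr M S X) A * emeasure (distr M (borel \<Otimes>\<^sub>M borel) (increment s t)) B"
    by (simp add: emeasure_distr)
  finally show "emeasure (distr M S X) A * emeasure (distr M (borel \<Otimes>\<^sub>M borel) (increment s t)) B
     = emeasure (distr M (S \<Otimes>\<^sub>M (borel \<Otimes>\<^sub>M borel)) (\<lambda>\<omega>. (X \<omega>, increment s t \<omega>))) (A \<times> B)" ..
qed

lemma increment_indep_var:
  assumes "0 \<le> s" "s < t" and z: "z \<in> borel_measurable (F s)" and g: "g \<in> borel_measurable (borel \<Otimes>\<^sub>M borel)"
  shows "indep_var borel z borel (\<lambda>\<omega>. g (increment s t \<omega>))"
  unfolding indep_var_eq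
proof (intro conjI)
  have inc: "increment s t \<in> measurable M (borel \<Otimes>\<^sub>M borel)"
    using assms by (intro F_measurable[OF increment_measurable]) auto
  show "z \<in> borel_measurable M" by (rule F_measurable[OF z])
  show "(\<lambda>\<omega>. g (increment s t \<omega>)) \<in> borel_measurable M" using inc g by measurable
  have 1: "sigma_sets (space M) {z -` A \<inter> space M | A. A \<in> sets borel} \<subseteq> sets (F s)"
    using measurable_sets[OF z] by (intro sets.sigma_sets_subset[of _ "F s", simplified]) auto
  have 2: "sigma_sets (space M) {(\<lambda>\<omega>. g (increment s t \<omega>)) -` A \<inter> space M | A. A \<in> sets borel}
      \<subseteq> {increment s t -` B \<inter> space M | B. B \<in> sets (borel \<Otimes>\<^sub>M borel)}"
  proof
    fix E assume "E \<in> sigma_sets (space M) {(\<lambda>\<omega>. g (increment s t \<omega>)) -` A \<inter> space M | A. A \<in> sets borel}"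
    then have "E \<in> sets (vimage_algebra (space M) (\<lambda>\<omega>. g (increment s t \<omega>)) borel)"
      by (simp add: sets_vimage_algebra)
    then obtain A where A: "A \<in> sets borel" and E: "E = (\<lambda>\<omega>. g (increment s t \<omega>)) -` A \<inter> space M"
      by (subst (asm) sets_vimage_algebra2) auto
    have "g -` A \<in> sets (borel \<Otimes>\<^sub>M borel)" using measurable_sets[OF g A] by (simp add: space_pair_measure)
    moreover have "E = increment s t -` (g -` A) \<inter> space M" unfolding E by auto
    ultimately show "E \<in> {increment s t -` B \<inter> space M | B. B \<in> sets (borel \<Otimes>\<^sub>M borel)}" by blast
  qed
  show "indep_set (sigma_sets (space M) {z -` A \<inter> space M | A. A \<in> sets borel})
     (sigma_sets (space M) {(\<lambda>\<omega>. g (increment s t \<omega>)) -` A \<inter> space M | A. A \<in> sets borel})"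
    by (rule indep_set_subsets[OF increment_indep_set[OF assms(1,2)] 1 2])
qed

lemma increment_moments:
  assumes "0 \<le> s" "s \<le> t"
  shows "integrable M (\<lambda>\<omega>. J t \<omega> - J s \<omega>)" "\<E> (\<lambda>\<omega>. J t \<omega> - J s \<omega>) = lam * \<eta>1 * (t - s)"
    "integrable M (\<lambda>\<omega>. (J t \<omega> - J s \<omega>)\<^sup>2)" "\<E> (\<lambda>\<omega>. (J t \<omega> - J s \<omega>)\<^sup>2) = lam * \<eta>2 * (t - s) + (lam * \<eta>1 * (t - s))\<^sup>2"
    "integrable M (\<lambda>\<omega>. W t \<omega> - W s \<omega>)" "\<E> (\<lambda>\<omega>. W t \<omega> - W s \<omega>) = 0"
    "integrable M (\<lambda>\<omega>. (W t \<omega> - W s \<omega>)\<^sup>2)" "\<E> (\<lambda>\<omega>. (W t \<omega> - W s \<omega>)\<^sup>2) = t - s"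
proof -
  have "(integrable M (\<lambda>\<omega>. J t \<omega> - J s \<omega>) \<and> \<E> (\<lambda>\<omega>. J t \<omega> - J s \<omega>) = lam * \<eta>1 * (t - s))
   \<and> (integrable M (\<lambda>\<omega>. (J t \<omega> - J s \<omega>)\<^sup>2) \<and> \<E> (\<lambda>\<omega>. (J t \<omega> - J s \<omega>)\<^sup>2) = lam * \<eta>2 * (t - s) + (lam * \<eta>1 * (t - s))\<^sup>2)
   \<and> (integrable M (\<lambda>\<omega>. W t \<omega> - W s \<omega>) \<and> \<E> (\<lambda>\<omega>. W t \<omega> - W s \<omega>) = 0)
   \<and> (integrable M (\<lambda>\<omega>. (W t \<omega> - W s \<omega>)\<^sup>2) \<and> \<E> (\<lambda>\<omega>. (W t \<omega> - W s \<omega>)\<^sup>2) = t - s)" (is ?goal)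
proof (cases "s = t")
  case False
  then have st: "0 \<le> s" "s < t" using assms by auto
  have [measurable]: "W t \<in> borel_measurable M" "W s \<in> borel_measurable M" "J t \<in> borel_measurable M" "J s \<in> borel_measurable M"
    using assms adapted by auto
  have L: "0 < lam * (t - s)" using st rate_pos by simp
  note cp = compound_poisson_moments[OF L, folded increment_law(2)[OF st]]
  have jm: "(\<lambda>\<omega>. J t \<omega> - J s \<omega>) \<in> borel_measurable M" by measurable
  have J: "integrable M (\<lambda>\<omega>. J t \<omega> - J s \<omega>)" "integrable M (\<lambda>\<omega>. (J t \<omega> - J s \<omega>)\<^sup>2)"
    using integrable_distr[OF jm cp(1)] integrable_distr[OF jm cp(3)] by auto
  have J1: "\<E> (\<lambda>\<omega>. J t \<omega> - J s \<omega>) = lam * \<eta>1 * (t - s)"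
    using cp(2) by (subst (asm) integral_distr[OF jm]) (auto simp: mult_ac)
  have J2: "\<E> (\<lambda>\<omega>. (J t \<omega> - J s \<omega>)\<^sup>2) = lam * \<eta>2 * (t - s) + (lam * \<eta>1 * (t - s))\<^sup>2"
    using cp(4) by (subst (asm) integral_distr[OF jm]) (auto simp: mult_ac)
  have D: "distributed M lborel (\<lambda>\<omega>. W t \<omega> - W s \<omega>) (normal_density 0 (sqrt (t - s)))"
    using noise' st by blast
  have sp: "0 < sqrt (t - s)" using st by simp
  have W1: "integrable M (\<lambda>\<omega>. W t \<omega> - W s \<omega>)"
    using distributed_integrable[OF D, of "\<lambda>x. x"] integrable_normal_moment_nz_1[OF sp, of 0] by simp
  have W2: "integrable M (\<lambda>\<omega>. (W t \<omega> - W s \<omega>)\<^sup>2)"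
    using distributed_integrable[OF D, of "\<lambda>x. x\<^sup>2"] integrable_normal_moment[OF sp, of 0 2] by simp
  have W3: "\<E> (\<lambda>\<omega>. W t \<omega> - W s \<omega>) = 0" by (rule normal_distributed_expectation[OF sp D])
  have W4: "\<E> (\<lambda>\<omega>. (W t \<omega> - W s \<omega>)\<^sup>2) = t - s"
    using normal_distributed_variance[OF sp D] sp W3 by simp
  show ?goal using J J1 J2 W1 W2 W3 W4 by blast
qed auto
  then show "integrable M (\<lambda>\<omega>. J t \<omega> - J s \<omega>)" "\<E> (\<lambda>\<omega>. J t \<omega> - J s \<omega>) = lam * \<eta>1 * (t - s)"
    "integrable M (\<lambda>\<omega>. (J t \<omega> - J s \<omega>)\<^sup>2)" "\<E> (\<lambda>\<omega>. (J t \<omega> - J s \<omega>)\<^sup>2) = lam * \<eta>2 * (t - s) + (lam * \<eta>1 * (t - s))\<^sup>2"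
    "integrable M (\<lambda>\<omega>. W t \<omega> - W s \<omega>)" "\<E> (\<lambda>\<omega>. W t \<omega> - W s \<omega>) = 0"
    "integrable M (\<lambda>\<omega>. (W t \<omega> - W s \<omega>)\<^sup>2)" "\<E> (\<lambda>\<omega>. (W t \<omega> - W s \<omega>)\<^sup>2) = t - s"
    by blast+
qed

lemma increment_uncorrelated:
  assumes "0 \<le> s" "s \<le> t" and z: "z \<in> borel_measurable (F s)" "integrable M z"
  shows "integrable M (\<lambda>\<omega>. z \<omega> * (J t \<omega> - J s \<omega>))"
    and "\<E> (\<lambda>\<omega>. z \<omega> * (J t \<omega> - J s \<omega>)) = \<E> z * (lam * \<eta>1 * (t - s))"
    and "integrable M (\<lambda>\<omega>. z \<omega> * (W t \<omega> - W s \<omega>))"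
    and "\<E> (\<lambda>\<omega>. z \<omega> * (W t \<omega> - W s \<omega>)) = 0"
proof -
  have "integrable M (\<lambda>\<omega>. z \<omega> * (J t \<omega> - J s \<omega>)) \<and> \<E> (\<lambda>\<omega>. z \<omega> * (J t \<omega> - J s \<omega>)) = \<E> z * (lam * \<eta>1 * (t - s))
   \<and> integrable M (\<lambda>\<omega>. z \<omega> * (W t \<omega> - W s \<omega>)) \<and> \<E> (\<lambda>\<omega>. z \<omega> * (W t \<omega> - W s \<omega>)) = 0"
  proof (cases "s = t")
    case False
    then have st: "0 \<le> s" "s < t" using assms by auto
    have i: "indep_var borel z borel (\<lambda>\<omega>. J t \<omega> - J s \<omega>)" "indep_var borel z borel (\<lambda>\<omega>. W t \<omega> - W s \<omega>)"
      using increment_indep_var[OF st z(1) measurable_snd] increment_indep_var[OF st z(1) measurable_fst] by (auto simp: increment_def)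
    note m = increment_moments[OF assms(1,2)]
    show ?thesis
      using indep_var_lebesgue_integral[OF i(1) z(2) m(1)] indep_var_integrable[OF i(1) z(2) m(1)]
        indep_var_lebesgue_integral[OF i(2) z(2) m(5)] indep_var_integrable[OF i(2) z(2) m(5)] m by auto
  qed auto
  then show "integrable M (\<lambda>\<omega>. z \<omega> * (J t \<omega> - J s \<omega>))"
    "\<E> (\<lambda>\<omega>. z \<omega> * (J t \<omega> - J s \<omega>)) = \<E> z * (lam * \<eta>1 * (t - s))"
    "integrable M (\<lambda>\<omega>. z \<omega> * (W t \<omega> - W s \<omega>))"
    "\<E> (\<lambda>\<omega>. z \<omega> * (W t \<omega> - W s \<omega>)) = 0" by auto
qed

lemma W_continuous: "\<omega> \<in> space M \<Longrightarrow> continuous_on {0..} (\<lambda>t. W t \<omega>)"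
  using noise' by blast

text \<open>The counting process is monotone, right-continuous and integer-valued, hence piecewise constant,
  and \<open>J\<close> changes only when it does.\<close>

lemma J_cadlag:
  assumes \<omega>: "\<omega> \<in> space M" and "0 \<le> a"
  shows "cadlag_on a b' (\<lambda>t. J t \<omega>)"
  unfolding cadlag_on_def
proof safe
  fix u assume u: "u \<in> {a..<b'}"
  have "continuous (at_right u) (\<lambda>s. real (N s \<omega>))" using noise' \<omega> u assms by auto
  then have "((\<lambda>s. real (N s \<omega>)) \<longlongrightarrow> real (N u \<omega>)) (at_right u)" by (simp add: continuous_within)
  then have "eventually (\<lambda>s. dist (real (N s \<omega>)) (real (N u \<omega>)) < 1) (at_right u)" by (rule tendstoD) simp
  then have "eventually (\<lambda>s. J s \<omega> = J u \<omega>) (at_right u)"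
  proof eventually_elim
    case (elim s)
    then have "real (N s \<omega>) < real (N u \<omega> + 1)" "real (N u \<omega>) < real (N s \<omega> + 1)"
      by (auto simp: dist_real_def)
    then have "N s \<omega> = N u \<omega>" unfolding of_nat_less_iff by simp
    then show ?case by (simp add: J_def jump_integral_def)
  qed
  then show "((\<lambda>t. J t \<omega>) \<longlongrightarrow> J u \<omega>) (at_right u)" by (rule tendsto_eventually)
next
  fix u assume u: "u \<in> {a<..b'}"
  let ?K = "Max ((\<lambda>s. N s \<omega>) ` {0..<u})"
  have fin: "finite ((\<lambda>s. N s \<omega>) ` {0..<u})"
    by (rule finite_subset[of _ "{..N u \<omega>}"]) (use N_mono[OF \<omega>] in auto)
  have "?K \<in> (\<lambda>s. N s \<omega>) ` {0..<u}" using u assms fin by (intro Max_in) auto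
  then obtain s0 where s0: "0 \<le> s0" "s0 < u" "N s0 \<omega> = ?K" by auto
  have "eventually (\<lambda>s. J s \<omega> = J s0 \<omega>) (at_left u)"
    unfolding eventually_at_left_field
  proof (intro exI[of _ s0] conjI allI impI s0)
    fix s assume s: "s0 < s" "s < u"
    then have "N s \<omega> \<le> ?K" using fin s0 by (intro Max_ge) auto
    moreover have "?K \<le> N s \<omega>" using N_mono[OF \<omega>, of s0 s] s s0 by simp
    ultimately show "J s \<omega> = J s0 \<omega>" using s0 by (simp add: J_def jump_integral_def)
  qed
  then show "\<exists>l. ((\<lambda>t. J t \<omega>) \<longlongrightarrow> l) (at_left u)" by (intro exI tendsto_eventually)
qed

end

section \<open>Expectations of time integrals\<close>

context prob_space
begin

text \<open>All exchanges of expectation and time integral below go through joint integrability of the process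
  on \<open>[a, b] \<times> M\<close>.\<close>

lemma Fubini_Icc:
  fixes g :: "real \<Rightarrow> 'a \<Rightarrow> real"
  assumes "integrable (lborel \<Otimes>\<^sub>M M) (\<lambda>(r, \<omega>). indicator {a..b} r * g r \<omega>)"
  shows "AE \<omega> in M. L1_on {a..b} (\<lambda>r. g r \<omega>)"
    and "integrable M (\<lambda>\<omega>. LBINT r:{a..b}. g r \<omega>)"
    and "\<E> (\<lambda>\<omega>. LBINT r:{a..b}. g r \<omega>) = (LBINT r:{a..b}. \<E> (g r))"
    and "L1_on {a..b} (\<lambda>r. \<E> (g r))"
    and "AE r in lborel. r \<in> {a..b} \<longrightarrow> integrable M (g r)"
proof -
  interpret pair_sigma_finite lborel M ..
  show "AE \<omega> in M. L1_on {a..b} (\<lambda>r. g r \<omega>)"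
    using AE_integrable_snd[OF assms] by (simp add: set_integrable_def)
  show "integrable M (\<lambda>\<omega>. LBINT r:{a..b}. g r \<omega>)"
    using integrable_snd[OF assms] by (simp add: set_lebesgue_integral_def)
  show "\<E> (\<lambda>\<omega>. LBINT r:{a..b}. g r \<omega>) = (LBINT r:{a..b}. \<E> (g r))"
    using Fubini_integral[OF assms] by (simp add: set_lebesgue_integral_def)
  show "L1_on {a..b} (\<lambda>r. \<E> (g r))"
    using integrable_fst[OF assms] by (simp add: set_integrable_def)
  show "AE r in lborel. r \<in> {a..b} \<longrightarrow> integrable M (g r)"
    using AE_integrable_fst[OF assms]
  proof eventually_elim
    case (elim r)
    then show ?case by (cases "r \<in> {a..b}") (auto simp: indicator_def)
  qed
qed

lemma integrable_pair_Icc: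
  fixes g :: "real \<Rightarrow> 'a \<Rightarrow> real"
  assumes [measurable]: "jointly_measurable M g"
    and "\<And>r. r \<in> {a..b} \<Longrightarrow> integrable M (g r)"
    and "\<And>r. r \<in> {a..b} \<Longrightarrow> \<E> (\<lambda>\<omega>. \<bar>g r \<omega>\<bar>) \<le> K"
  shows "integrable (lborel \<Otimes>\<^sub>M M) (\<lambda>(r, \<omega>). indicator {a..b} r * g r \<omega>)"
proof -
  interpret pair_sigma_finite lborel M ..
  show ?thesis
  proof (rule Fubini_integrable)
    show "(\<lambda>(r, \<omega>). indicator {a..b} r * g r \<omega>) \<in> borel_measurable (lborel \<Otimes>\<^sub>M M)" by measurable
    have e: "(LINT \<omega>|M. norm (case (r, \<omega>) of (r, \<omega>) \<Rightarrow> indicator {a..b} r * g r \<omega>)) = indicator {a..b} r *\<^sub>R \<E> (\<lambda>\<omega>. \<bar>g r \<omega>\<bar>)" for r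
      by (cases "r \<in> {a..b}") auto
    have "L1_on {a..b} (\<lambda>r. \<E> (\<lambda>\<omega>. \<bar>g r \<omega>\<bar>))"
    proof (rule set_integrable_bounded_Icc[where B=K])
      show "(\<lambda>v. indicator {a..b} v * \<E> (\<lambda>\<omega>. \<bar>g v \<omega>\<bar>)) \<in> borel_measurable borel" by measurable
      show "\<bar>\<E> (\<lambda>\<omega>. \<bar>g v \<omega>\<bar>)\<bar> \<le> K" if "v \<in> {a..b}" for v
        using assms(3)[OF that] by (simp add: integral_nonneg_AE abs_of_nonneg)
    qed
    then show "integrable lborel (\<lambda>r. LINT \<omega>|M. norm (case (r, \<omega>) of (r, \<omega>) \<Rightarrow> indicator {a..b} r * g r \<omega>))"
      unfolding e by (simp add: set_integrable_def)
    show "AE r in lborel. integrable M (\<lambda>\<omega>. case (r, \<omega>) of (r, \<omega>) \<Rightarrow> indicator {a..b} r * g r \<omega>)"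
      using assms(2) by (intro AE_I2) (auto simp: indicator_def)
  qed
qed

lemma integrable_square_imp_integrable:
  fixes X :: "'a \<Rightarrow> real"
  assumes "X \<in> borel_measurable M" "integrable M (\<lambda>\<omega>. (X \<omega>)\<^sup>2)"
  shows "integrable M X"
proof (rule Bochner_Integration.integrable_bound[of M "\<lambda>\<omega>. 1 + (X \<omega>)\<^sup>2"])
  have "\<bar>x\<bar> \<le> 1 + x\<^sup>2" for x :: real
    using sum_squares_bound[of 1 "\<bar>x\<bar>"] abs_ge_zero[of x] by (simp del: abs_ge_zero)
  then show "AE \<omega> in M. norm (X \<omega>) \<le> norm (1 + (X \<omega>)\<^sup>2)" by auto
qed (use assms in auto)

lemma integrable_mult_squares:
  fixes X Y :: "'a \<Rightarrow> real"
  assumes [measurable]: "X \<in> borel_measurable M" "Y \<in> borel_measurable M"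
    and "integrable M (\<lambda>\<omega>. (X \<omega>)\<^sup>2)" "integrable M (\<lambda>\<omega>. (Y \<omega>)\<^sup>2)"
  shows "integrable M (\<lambda>\<omega>. X \<omega> * Y \<omega>)"
    and "\<E> (\<lambda>\<omega>. \<bar>X \<omega> * Y \<omega>\<bar>) \<le> \<E> (\<lambda>\<omega>. (X \<omega>)\<^sup>2) + \<E> (\<lambda>\<omega>. (Y \<omega>)\<^sup>2)"
proof -
  have *: "\<bar>x * y\<bar> \<le> x\<^sup>2 + y\<^sup>2" for x y :: real
  proof -
    have "2 * \<bar>x * y\<bar> \<le> x\<^sup>2 + y\<^sup>2" using sum_squares_bound[of "\<bar>x\<bar>" "\<bar>y\<bar>"] by (simp add: abs_mult mult.assoc)
    then show ?thesis using abs_ge_zero[of "x * y"] by linarith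
  qed
  have s: "integrable M (\<lambda>\<omega>. (X \<omega>)\<^sup>2 + (Y \<omega>)\<^sup>2)" using assms by auto
  show i: "integrable M (\<lambda>\<omega>. X \<omega> * Y \<omega>)"
  proof (rule Bochner_Integration.integrable_bound[OF s])
    show "AE \<omega> in M. norm (X \<omega> * Y \<omega>) \<le> norm ((X \<omega>)\<^sup>2 + (Y \<omega>)\<^sup>2)"
      using * by (intro AE_I2) simp
  qed measurable
  have "\<E> (\<lambda>\<omega>. \<bar>X \<omega> * Y \<omega>\<bar>) \<le> \<E> (\<lambda>\<omega>. (X \<omega>)\<^sup>2 + (Y \<omega>)\<^sup>2)"
    by (rule integral_mono[OF integrable_abs[OF i] s *])
  then show "\<E> (\<lambda>\<omega>. \<bar>X \<omega> * Y \<omega>\<bar>) \<le> \<E> (\<lambda>\<omega>. (X \<omega>)\<^sup>2) + \<E> (\<lambda>\<omega>. (Y \<omega>)\<^sup>2)"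
    using assms by simp
qed

text \<open>Integration in time commutes with the inner product of \<open>L\<^sup>2\<close>.\<close>

lemma time_integral_L2:
  fixes X :: "real \<Rightarrow> 'a \<Rightarrow> real" and k :: "real \<Rightarrow> real"
  assumes ab: "a \<le> b" and X [measurable]: "jointly_measurable M X"
    and k [measurable]: "k \<in> borel_measurable borel" and kC: "\<And>r. r \<in> {a..b} \<Longrightarrow> \<bar>k r\<bar> \<le> C"
    and X2: "\<And>r. r \<in> {a..b} \<Longrightarrow> integrable M (\<lambda>\<omega>. (X r \<omega>)\<^sup>2)"
    and XK: "\<And>r. r \<in> {a..b} \<Longrightarrow> \<E> (\<lambda>\<omega>. (X r \<omega>)\<^sup>2) \<le> K"
  defines "I \<equiv> \<lambda>\<omega>. LBINT r:{a..b}. k r * X r \<omega>"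
  shows "I \<in> borel_measurable M"
    and "integrable M (\<lambda>\<omega>. (I \<omega>)\<^sup>2)"
    and "\<E> (\<lambda>\<omega>. (I \<omega>)\<^sup>2) \<le> (b - a) * ((b - a) * (C\<^sup>2 * K))"
    and "z \<in> borel_measurable M \<Longrightarrow> integrable M (\<lambda>\<omega>. (z \<omega>)\<^sup>2) \<Longrightarrow> integrable M (\<lambda>\<omega>. z \<omega> * I \<omega>)"
    and "z \<in> borel_measurable M \<Longrightarrow> integrable M (\<lambda>\<omega>. (z \<omega>)\<^sup>2) \<Longrightarrow>
      \<E> (\<lambda>\<omega>. z \<omega> * I \<omega>) = (LBINT r:{a..b}. k r * \<E> (\<lambda>\<omega>. z \<omega> * X r \<omega>))"
proof -
  have Xr [measurable]: "X r \<in> borel_measurable M" for r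
    using measurable_compose[OF measurable_Pair1' X] by simp
  show I [measurable]: "I \<in> borel_measurable M"
    unfolding I_def set_lebesgue_integral_def by measurable
  let ?h = "\<lambda>r \<omega>. k r * X r \<omega>"
  have h2: "integrable M (\<lambda>\<omega>. (?h r \<omega>)\<^sup>2)" "\<E> (\<lambda>\<omega>. (?h r \<omega>)\<^sup>2) \<le> C\<^sup>2 * K" if r: "r \<in> {a..b}" for r
  proof -
    show "integrable M (\<lambda>\<omega>. (?h r \<omega>)\<^sup>2)" using X2[OF r] by (simp add: power_mult_distrib)
    have "\<E> (\<lambda>\<omega>. (?h r \<omega>)\<^sup>2) = (k r)\<^sup>2 * \<E> (\<lambda>\<omega>. (X r \<omega>)\<^sup>2)" by (simp add: power_mult_distrib)
    also have "\<dots> \<le> C\<^sup>2 * K"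
    proof (rule mult_mono)
      show "(k r)\<^sup>2 \<le> C\<^sup>2" using power_mono[OF kC[OF r], of 2] by simp
      show "\<E> (\<lambda>\<omega>. (X r \<omega>)\<^sup>2) \<le> K" by (rule XK[OF r])
    qed simp_all
    finally show "\<E> (\<lambda>\<omega>. (?h r \<omega>)\<^sup>2) \<le> C\<^sup>2 * K" .
  qed
  have p2: "integrable (lborel \<Otimes>\<^sub>M M) (\<lambda>(r, \<omega>). indicator {a..b} r * (?h r \<omega>)\<^sup>2)"
  proof (rule integrable_pair_Icc[where K="C\<^sup>2 * K"])
    fix r assume r: "r \<in> {a..b}"
    show "integrable M (\<lambda>\<omega>. (?h r \<omega>)\<^sup>2)" by (rule h2(1)[OF r])
    show "\<E> (\<lambda>\<omega>. \<bar>(?h r \<omega>)\<^sup>2\<bar>) \<le> C\<^sup>2 * K" using h2(2)[OF r] by simp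
  qed measurable
  have p1: "integrable (lborel \<Otimes>\<^sub>M M) (\<lambda>(r, \<omega>). indicator {a..b} r * ?h r \<omega>)"
  proof (rule integrable_pair_Icc[where K="1 + C\<^sup>2 * K"])
    fix r assume r: "r \<in> {a..b}"
    show "integrable M (?h r)" by (rule integrable_square_imp_integrable[OF _ h2(1)[OF r]]) simp
    have "\<E> (\<lambda>\<omega>. \<bar>1 * ?h r \<omega>\<bar>) \<le> \<E> (\<lambda>\<omega>. 1\<^sup>2) + \<E> (\<lambda>\<omega>. (?h r \<omega>)\<^sup>2)"
      by (rule integrable_mult_squares(2)[OF _ _ _ h2(1)[OF r]]) simp_all
    then show "\<E> (\<lambda>\<omega>. \<bar>?h r \<omega>\<bar>) \<le> 1 + C\<^sup>2 * K" using h2(2)[OF r] by (simp add: prob_space)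
  qed simp
  have le: "AE \<omega> in M. (I \<omega>)\<^sup>2 \<le> (b - a) * (LBINT r:{a..b}. (?h r \<omega>)\<^sup>2)"
    using Fubini_Icc(1)[OF p1] Fubini_Icc(1)[OF p2]
  proof eventually_elim
    case (elim \<omega>)
    show ?case unfolding I_def by (rule set_integral_square_le[OF ab elim])
  qed
  have q: "integrable M (\<lambda>\<omega>. (b - a) * (LBINT r:{a..b}. (?h r \<omega>)\<^sup>2))"
    using Fubini_Icc(2)[OF p2] by simp
  show I2: "integrable M (\<lambda>\<omega>. (I \<omega>)\<^sup>2)"
  proof (rule Bochner_Integration.integrable_bound[OF q])
    show "AE \<omega> in M. norm ((I \<omega>)\<^sup>2) \<le> norm ((b - a) * (LBINT r:{a..b}. (?h r \<omega>)\<^sup>2))"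
      using le
    proof eventually_elim
      case (elim \<omega>)
      then show ?case unfolding real_norm_def using zero_le_power2[of "I \<omega>"] by linarith
    qed
  qed measurable
  have "\<E> (\<lambda>\<omega>. (I \<omega>)\<^sup>2) \<le> \<E> (\<lambda>\<omega>. (b - a) * (LBINT r:{a..b}. (?h r \<omega>)\<^sup>2))"
    by (rule integral_mono_AE[OF I2 q le])
  also have "\<dots> = (b - a) * (LBINT r:{a..b}. \<E> (\<lambda>\<omega>. (?h r \<omega>)\<^sup>2))"
    using Fubini_Icc(3)[OF p2] by simp
  also have "(LBINT r:{a..b}. \<E> (\<lambda>\<omega>. (?h r \<omega>)\<^sup>2)) \<le> (LBINT r:{a..b}. C\<^sup>2 * K)"
    by (rule set_integral_mono[OF Fubini_Icc(4)[OF p2]])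
      (auto intro!: borel_integrable_atLeastAtMost' continuous_intros h2)
  also have "(LBINT r:{a..b}. C\<^sup>2 * K) = (b - a) * (C\<^sup>2 * K)"
    using ab by (simp add: set_lebesgue_integral_def)
  finally show "\<E> (\<lambda>\<omega>. (I \<omega>)\<^sup>2) \<le> (b - a) * ((b - a) * (C\<^sup>2 * K))"
    using ab by (simp add: mult_left_mono)
  assume z [measurable]: "z \<in> borel_measurable M" and z2: "integrable M (\<lambda>\<omega>. (z \<omega>)\<^sup>2)"
  show "integrable M (\<lambda>\<omega>. z \<omega> * I \<omega>)" by (intro integrable_mult_squares z2 I2) auto
  have pz: "integrable (lborel \<Otimes>\<^sub>M M) (\<lambda>(r, \<omega>). indicator {a..b} r * (z \<omega> * ?h r \<omega>))"
  proof (rule integrable_pair_Icc[where K="\<E> (\<lambda>\<omega>. (z \<omega>)\<^sup>2) + C\<^sup>2 * K"])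
    fix r assume r: "r \<in> {a..b}"
    show "integrable M (\<lambda>\<omega>. z \<omega> * ?h r \<omega>)" by (intro integrable_mult_squares z2 h2 r) auto
    show "\<E> (\<lambda>\<omega>. \<bar>z \<omega> * ?h r \<omega>\<bar>) \<le> \<E> (\<lambda>\<omega>. (z \<omega>)\<^sup>2) + C\<^sup>2 * K"
    proof -
      have "\<E> (\<lambda>\<omega>. \<bar>z \<omega> * ?h r \<omega>\<bar>) \<le> \<E> (\<lambda>\<omega>. (z \<omega>)\<^sup>2) + \<E> (\<lambda>\<omega>. (?h r \<omega>)\<^sup>2)"
        by (rule integrable_mult_squares(2)[OF z _ z2 h2(1)[OF r]]) measurable
      then show ?thesis using h2(2)[OF r] by linarith
    qed
  qed measurable
  have "\<E> (\<lambda>\<omega>. z \<omega> * I \<omega>) = \<E> (\<lambda>\<omega>. LBINT r:{a..b}. z \<omega> * ?h r \<omega>)"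
    unfolding I_def by (simp only: set_integral_mult_right)
  also have "\<dots> = (LBINT r:{a..b}. \<E> (\<lambda>\<omega>. z \<omega> * ?h r \<omega>))"
    by (rule Fubini_Icc(3)[OF pz])
  also have "\<dots> = (LBINT r:{a..b}. k r * \<E> (\<lambda>\<omega>. z \<omega> * X r \<omega>))"
  proof -
    have "\<E> (\<lambda>\<omega>. z \<omega> * ?h r \<omega>) = k r * \<E> (\<lambda>\<omega>. z \<omega> * X r \<omega>)" for r
      unfolding mult.left_commute[of "z _" "k r"] by (rule integral_mult_right_zero)
    then show ?thesis by (simp only:)
  qed
  finally show "\<E> (\<lambda>\<omega>. z \<omega> * I \<omega>) = (LBINT r:{a..b}. k r * \<E> (\<lambda>\<omega>. z \<omega> * X r \<omega>))" .
qed

end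

lemma exp_linear_integral:
  fixes r :: real
  assumes "a \<le> u" "r \<noteq> 0"
  shows "L1_on {a..u} (\<lambda>s. exp (- r * (u - s)) * (s - a))"
    and "(LBINT s:{a..u}. exp (- r * (u - s)) * (s - a)) = (exp (- r * (u - a)) - 1 + r * (u - a)) / r\<^sup>2"
proof -
  let ?F = "\<lambda>s. exp (- r * (u - s)) * ((s - a) / r - 1 / r\<^sup>2)" and ?f = "\<lambda>s. exp (- r * (u - s)) * (s - a)"
  have d: "(?F has_real_derivative ?f x) (at x within {a..u})" for x
    using assms(2) by (auto intro!: derivative_eq_intros simp: field_simps power2_eq_square)
  have c: "continuous_on {a..u} ?f" by (intro continuous_intros)
  show "L1_on {a..u} ?f" by (rule FTC_set_integral(1)[OF assms(1) d c])
  have "?F u = ?F a + (LBINT s:{a..u}. ?f s)" by (rule FTC_set_integral(2)[OF assms(1) d c])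
  then have "(LBINT s:{a..u}. ?f s) = ?F u - ?F a" by linarith
  also have "\<dots> = (exp (- r * (u - a)) - 1 + r * (u - a)) / r\<^sup>2"
    using assms(2) by (simp add: add_divide_distrib diff_divide_distrib power2_eq_square)
  finally show "(LBINT s:{a..u}. ?f s) = (exp (- r * (u - a)) - 1 + r * (u - a)) / r\<^sup>2" .
qed

lemma exp_integral:
  fixes r :: real
  assumes "a \<le> u" "r \<noteq> 0"
  shows "L1_on {a..u} (\<lambda>s. exp (- r * (u - s)))"
    and "(LBINT s:{a..u}. exp (- r * (u - s))) = (1 - exp (- r * (u - a))) / r"
proof -
  let ?F = "\<lambda>s. exp (- r * (u - s)) / r" and ?f = "\<lambda>s. exp (- r * (u - s))"
  have d: "(?F has_real_derivative ?f x) (at x within {a..u})" for x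
    using assms(2) by (auto intro!: derivative_eq_intros simp: field_simps)
  have c: "continuous_on {a..u} ?f" by (intro continuous_intros)
  show "L1_on {a..u} ?f" by (rule FTC_set_integral(1)[OF assms(1) d c])
  have "?F u = ?F a + (LBINT s:{a..u}. ?f s)" by (rule FTC_set_integral(2)[OF assms(1) d c])
  then show "(LBINT s:{a..u}. ?f s) = (1 - exp (- r * (u - a))) / r"
    using assms(2) by (simp add: field_simps)
qed

lemma exp_bound_Icc:
  fixes r :: real
  assumes r: "r \<in> {a..u}"
  shows "\<bar>exp (- x * (u - r))\<bar> \<le> exp (\<bar>x\<bar> * (u - a))"
proof -
  have "- x * (u - r) \<le> \<bar>x\<bar> * (u - r)" using r by (intro mult_right_mono abs_ge_minus_self) auto
  also have "\<dots> \<le> \<bar>x\<bar> * (u - a)" using r by (intro mult_left_mono) auto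
  finally show ?thesis by (simp only: abs_exp_cancel exp_le_cancel_iff)
qed

section \<open>The market trading speed\<close>

context liquidation_noise
begin

text \<open>The solution of the equation for the market trading speed; integration by parts has removed the
  integral with respect to the jump process.\<close>

definition mu_path :: "real \<Rightarrow> real \<Rightarrow> real \<Rightarrow> 'a \<Rightarrow> real" where
  "mu_path t \<mu> u \<omega> = \<mu> + (J u \<omega> - J t \<omega>)
     - \<kappa> * (LBINT r:{t..u}. exp (- \<kappa> * (u - r)) * (\<mu> + (J r \<omega> - J t \<omega>)))"

definition mu_mean :: "real \<Rightarrow> real \<Rightarrow> real \<Rightarrow> real" where
  "mu_mean t \<mu> u = exp (- \<kappa> * (u - t)) * \<mu> + lam * \<eta>1 * ((1 - exp (- \<kappa> * (u - t))) / \<kappa>)"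

definition mu_second :: "real \<Rightarrow> real \<Rightarrow> real \<Rightarrow> real" where
  "mu_second t \<mu> u = (mu_mean t \<mu> u)\<^sup>2 + lam * \<eta>2 * ((1 - exp (- (2 * \<kappa>) * (u - t))) / (2 * \<kappa>))"

lemma mu_path_unique:
  assumes "t \<le> u" and m: "L1_on {t..u} m"
    and eq: "\<And>r. r \<in> {t..u} \<Longrightarrow> m r = \<mu> - \<kappa> * (LBINT s:{t..r}. m s) + (J r \<omega> - J t \<omega>)"
  shows "m u = mu_path t \<mu> u \<omega>"
proof -
  have "m r = (\<mu> + (J r \<omega> - J t \<omega>)) - \<kappa> * (LBINT s:{t..r}. m s)" if "r \<in> {t..u}" for r
    using eq[OF that] by linarith
  from linear_integral_equation[OF assms(1) m this]
  have I: "(LBINT s:{t..u}. m s) = (LBINT s:{t..u}. exp (- \<kappa> * (u - s)) * (\<mu> + (J s \<omega> - J t \<omega>)))" .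
  have "u \<in> {t..u}" using assms(1) by simp
  from eq[OF this] show ?thesis unfolding I mu_path_def by linarith
qed

lemma mu_mean_deriv: "(mu_mean t \<mu> has_real_derivative lam * \<eta>1 - \<kappa> * mu_mean t \<mu> u) (at u within X)"
proof -
  have "(mu_mean t \<mu> has_real_derivative - \<kappa> * exp (- \<kappa> * (u - t)) * \<mu> + lam * \<eta>1 * exp (- \<kappa> * (u - t))) (at u within X)"
    unfolding mu_mean_def[abs_def] using \<kappa>_nz by (auto intro!: derivative_eq_intros)
  moreover have "- \<kappa> * exp (- \<kappa> * (u - t)) * \<mu> + lam * \<eta>1 * exp (- \<kappa> * (u - t)) = lam * \<eta>1 - \<kappa> * mu_mean t \<mu> u"
    using \<kappa>_nz by (simp add: mu_mean_def field_simps)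
  ultimately show ?thesis by simp
qed

lemma mu_mean_continuous: "continuous_on X (mu_mean t \<mu>)"
  by (intro continuous_at_imp_continuous_on ballI DERIV_isCont[OF mu_mean_deriv])

lemma mu_second_deriv:
  "(mu_second t \<mu> has_real_derivative lam * \<eta>2 + 2 * lam * \<eta>1 * mu_mean t \<mu> u - 2 * \<kappa> * mu_second t \<mu> u) (at u within X)"
proof -
  have "(mu_second t \<mu> has_real_derivative 2 * mu_mean t \<mu> u * (lam * \<eta>1 - \<kappa> * mu_mean t \<mu> u)
      + lam * \<eta>2 * exp (- (2 * \<kappa>) * (u - t))) (at u within X)"
    unfolding mu_second_def[abs_def] using \<kappa>_nz by (auto intro!: derivative_eq_intros mu_mean_deriv)
  moreover have "2 * mu_mean t \<mu> u * (lam * \<eta>1 - \<kappa> * mu_mean t \<mu> u) + lam * \<eta>2 * exp (- (2 * \<kappa>) * (u - t))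
     = lam * \<eta>2 + 2 * lam * \<eta>1 * mu_mean t \<mu> u - 2 * \<kappa> * mu_second t \<mu> u"
    using \<kappa>_nz by (simp add: mu_second_def field_simps power2_eq_square)
  ultimately show ?thesis by simp
qed

lemma mu_second_continuous: "continuous_on X (mu_second t \<mu>)"
  by (intro continuous_at_imp_continuous_on ballI DERIV_isCont[OF mu_second_deriv])

text \<open>The compensated jump process.\<close>

definition Jc :: "real \<Rightarrow> real \<Rightarrow> 'a \<Rightarrow> real" where
  "Jc t u \<omega> = J u \<omega> - J t \<omega> - lam * \<eta>1 * (u - t)"

text \<open>The increments are centred and independent, so that the covariance is the variance at the earlier
  time.\<close>

lemma Jc_covariance:
  assumes "0 \<le> t" "t \<le> r" "r \<le> u"
  shows "integrable M (\<lambda>\<omega>. (Jc t u \<omega>)\<^sup>2)" and "\<E> (Jc t u) = 0"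
    and "\<E> (\<lambda>\<omega>. (Jc t u \<omega>)\<^sup>2) = lam * \<eta>2 * (u - t)"
    and "\<E> (\<lambda>\<omega>. Jc t u \<omega> * Jc t r \<omega>) = lam * \<eta>2 * (r - t)"
proof -
  have sq: "integrable M (\<lambda>\<omega>. (Jc t u \<omega>)\<^sup>2) \<and> integrable M (Jc t u) \<and> \<E> (Jc t u) = 0
      \<and> \<E> (\<lambda>\<omega>. (Jc t u \<omega>)\<^sup>2) = lam * \<eta>2 * (u - t)" if "t \<le> u" for u
  proof -
    note m = increment_moments[OF assms(1) that]
    define e where "e = lam * \<eta>1 * (u - t)"
    have J: "Jc t u \<omega> = (J u \<omega> - J t \<omega>) - e" for \<omega> by (simp add: Jc_def e_def)
    have J2: "(Jc t u \<omega>)\<^sup>2 = 1 * (J u \<omega> - J t \<omega>)\<^sup>2 + (- 2 * e) * (J u \<omega> - J t \<omega>) + e\<^sup>2" for \<omega>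
      by (simp add: J power2_eq_square algebra_simps)
    have "integrable M (\<lambda>\<omega>. (Jc t u \<omega>)\<^sup>2)" unfolding J2 by (intro integral_quadratic m)
    moreover have "integrable M (Jc t u)" "\<E> (Jc t u) = 0"
      unfolding J[abs_def] using m(1,2) by (auto simp: prob_space e_def)
    moreover have "\<E> (\<lambda>\<omega>. (Jc t u \<omega>)\<^sup>2) = 1 * (lam * \<eta>2 * (u - t) + e\<^sup>2) + (- 2 * e) * e + e\<^sup>2"
      unfolding J2 integral_quadratic(2)[OF m(1,3)] m(2,4) e_def by simp
    ultimately show ?thesis by (simp add: power2_eq_square)
  qed
  have u: "t \<le> u" using assms by simp
  show "integrable M (\<lambda>\<omega>. (Jc t u \<omega>)\<^sup>2)" "\<E> (Jc t u) = 0"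
    "\<E> (\<lambda>\<omega>. (Jc t u \<omega>)\<^sup>2) = lam * \<eta>2 * (u - t)" using sq[OF u] by auto
  have r0: "0 \<le> r" using assms by simp
  have ad: "Jc t r \<in> borel_measurable (F r)"
    unfolding Jc_def[abs_def] using assms r0
    by (intro borel_measurable_diff borel_measurable_const adapted_F F_mono_measurable[where s=t and t=r]) auto
  note un = increment_uncorrelated[OF r0 assms(3) ad, OF sq[OF assms(2), THEN conjunct2, THEN conjunct1]]
  have e: "Jc t u \<omega> * Jc t r \<omega> = (Jc t r \<omega>)\<^sup>2 + (Jc t r \<omega> * (J u \<omega> - J r \<omega>) - lam * \<eta>1 * (u - r) * Jc t r \<omega>)" for \<omega>
    by (simp add: Jc_def power2_eq_square algebra_simps)
  show "\<E> (\<lambda>\<omega>. Jc t u \<omega> * Jc t r \<omega>) = lam * \<eta>2 * (r - t)"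
    unfolding e using sq[OF assms(2)] un(1,2) by simp
qed

lemma J_joint_measurable:
  assumes "0 \<le> a" "a \<le> u"
  shows "(\<lambda>(r, \<omega>). J (clamp_Icc a u r) \<omega>) \<in> borel_measurable (borel \<Otimes>\<^sub>M F u)"
  using assms by (intro cadlag_joint_measurable J_cadlag F_mono_measurable[OF adapted_F(3)]) auto

lemma W_joint_measurable:
  assumes "0 \<le> a" "a \<le> u"
  shows "(\<lambda>(r, \<omega>). W (clamp_Icc a u r) \<omega>) \<in> borel_measurable (borel \<Otimes>\<^sub>M F u)"
  using assms
  by (intro cadlag_joint_measurable continuous_imp_cadlag F_mono_measurable[OF adapted_F(1)] continuous_on_subset[OF W_continuous]) auto

lemma pair_F_measurable: "f \<in> measurable (borel \<Otimes>\<^sub>M F u) L \<Longrightarrow> f \<in> measurable (borel \<Otimes>\<^sub>M M) L"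
proof -
  assume f: "f \<in> measurable (borel \<Otimes>\<^sub>M F u) L"
  have "(\<lambda>\<omega>. \<omega>) \<in> measurable M (F u)" by (rule measurable_from_subalg[OF subalg[of u] measurable_ident_sets[OF refl]])
  then have "(\<lambda>x. (fst x, snd x)) \<in> measurable (borel \<Otimes>\<^sub>M M) (borel \<Otimes>\<^sub>M F u)"
    by (intro measurable_Pair measurable_fst measurable_compose[OF measurable_snd]) auto
  from measurable_compose[OF this f] show "f \<in> measurable (borel \<Otimes>\<^sub>M M) L" by simp
qed

text \<open>Compensating the jumps separates the mean from the fluctuation, as the equation is linear.\<close>

lemma mu_path_centered:
  assumes "0 \<le> t" "t \<le> u" "\<omega> \<in> space M"
  shows "mu_path t \<mu> u \<omega> = mu_mean t \<mu> u + (Jc t u \<omega> - \<kappa> * (LBINT r:{t..u}. exp (- \<kappa> * (u - r)) * Jc t r \<omega>))"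
proof -
  define h where "h r = \<mu> + lam * \<eta>1 * (r - t)" for r
  have mm: "L1_on {t..u} (mu_mean t \<mu>)"
    by (intro borel_integrable_atLeastAtMost' mu_mean_continuous)
  have eq: "mu_mean t \<mu> r = h r - \<kappa> * (LBINT s:{t..r}. mu_mean t \<mu> s)" if r: "r \<in> {t..u}" for r
  proof -
    have c: "continuous_on X (\<lambda>s. lam * \<eta>1 - \<kappa> * mu_mean t \<mu> s)" for X by (intro continuous_intros mu_mean_continuous)
    have "mu_mean t \<mu> r = mu_mean t \<mu> t + (LBINT s:{t..r}. lam * \<eta>1 - \<kappa> * mu_mean t \<mu> s)"
      using r by (intro FTC_set_integral(2)[OF _ mu_mean_deriv c]) auto
    also have "(LBINT s:{t..r}. lam * \<eta>1 - \<kappa> * mu_mean t \<mu> s) = (LBINT s:{t..r}. lam * \<eta>1) - (LBINT s:{t..r}. \<kappa> * mu_mean t \<mu> s)"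
      by (intro set_integral_diff borel_integrable_atLeastAtMost' continuous_intros mu_mean_continuous)
    also have "(LBINT s:{t..r}. lam * \<eta>1) = lam * \<eta>1 * (r - t)"
      using r by (simp add: set_lebesgue_integral_def)
    finally show ?thesis by (simp add: h_def) (simp add: mu_mean_def)
  qed
  have mean: "mu_mean t \<mu> u = h u - \<kappa> * (LBINT r:{t..u}. exp (- \<kappa> * (u - r)) * h r)"
    using eq[of u] linear_integral_equation[OF assms(2) mm eq] assms(2) by simp
  have "L1_on {t..u} (\<lambda>r. J r \<omega>)"
    using assms by (intro cadlag_set_integrable J_cadlag) auto
  then have "L1_on {t..u} (\<lambda>r. exp (- \<kappa> * (u - r)) * Jc t r \<omega>)"
    if "True"
  proof -
    have cJ: "cadlag_on t u (\<lambda>r. exp (- \<kappa> * (u - r)))" "cadlag_on t u (\<lambda>r. - J t \<omega> - lam * \<eta>1 * (r - t))"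
      by (intro continuous_imp_cadlag continuous_intros)+
    have "cadlag_on t u (\<lambda>r. exp (- \<kappa> * (u - r)) * (J r \<omega> + (- J t \<omega> - lam * \<eta>1 * (r - t))))"
      using assms by (intro cadlag_on_compose2[where h="(*)"] cadlag_on_compose2[where h="(+)"] cJ J_cadlag) (auto intro!: continuous_intros)
    then show ?thesis unfolding Jc_def using assms(2) by (intro cadlag_set_integrable) (simp_all add: algebra_simps)
  qed
  then have i: "L1_on {t..u} (\<lambda>r. exp (- \<kappa> * (u - r)) * Jc t r \<omega>)" by simp
  have ih: "L1_on {t..u} (\<lambda>r. exp (- \<kappa> * (u - r)) * h r)"
    unfolding h_def by (intro borel_integrable_atLeastAtMost' continuous_intros)
  have "(LBINT r:{t..u}. exp (- \<kappa> * (u - r)) * (\<mu> + (J r \<omega> - J t \<omega>)))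
    = (LBINT r:{t..u}. exp (- \<kappa> * (u - r)) * h r + exp (- \<kappa> * (u - r)) * Jc t r \<omega>)"
    by (simp add: h_def Jc_def distrib_left[symmetric])
  also have "\<dots> = (LBINT r:{t..u}. exp (- \<kappa> * (u - r)) * h r) + (LBINT r:{t..u}. exp (- \<kappa> * (u - r)) * Jc t r \<omega>)"
    by (rule set_integral_add(2)[OF ih i])
  finally show ?thesis unfolding mu_path_def mean by (simp add: h_def Jc_def algebra_simps)
qed

text \<open>The variance of the fluctuation \<open>J\<^sub>u - \<kappa> A\<close>, with \<open>A\<close> the
  weighted time integral of the compensated jumps, is found by Fubini from the covariance
  \<open>\<theta> (min r v - t)\<close>: the second moment of \<open>A\<close> is twice an integral over a
  triangle, on which \<open>min r v\<close> is the inner variable.\<close>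

lemma mu_path_moments:
  assumes "0 \<le> t" "t \<le> u"
  shows "integrable M (\<lambda>\<omega>. (mu_path t \<mu> u \<omega>)\<^sup>2)"
    and "\<E> (mu_path t \<mu> u) = mu_mean t \<mu> u"
    and "\<E> (\<lambda>\<omega>. (mu_path t \<mu> u \<omega>)\<^sup>2) = mu_second t \<mu> u"
proof -
  define Jh where "Jh r = Jc t (clamp_Icc t u r)" for r
  define k where "k r = exp (- \<kappa> * (u - r))" for r
  define A where "A \<omega> = (LBINT r:{t..u}. k r * Jh r \<omega>)" for \<omega>
  define \<theta> where "\<theta> = lam * \<eta>2"
  have Jm [measurable]: "jointly_measurable M Jh"
  proof -
    note [measurable] = pair_F_measurable[OF J_joint_measurable[OF assms]] adapted(3)[OF assms(1)]
    have [measurable]: "clamp_Icc t u \<in> borel_measurable borel" unfolding clamp_Icc_def[abs_def] by measurable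
    show ?thesis unfolding Jh_def Jc_def by measurable
  qed
  have Jr [measurable]: "Jh r \<in> borel_measurable M" for r
    using measurable_compose[OF measurable_Pair1' Jm] by simp
  have Jeq: "Jh r = Jc t r" if "r \<in> {t..u}" for r using that by (simp add: Jh_def)
  have km [measurable]: "k \<in> borel_measurable borel" unfolding k_def[abs_def] by measurable
  have kC: "\<bar>k r\<bar> \<le> exp (\<bar>\<kappa>\<bar> * (u - t))" if "r \<in> {t..u}" for r
    unfolding k_def by (rule exp_bound_Icc[OF that])
  have th: "0 \<le> \<theta>" unfolding \<theta>_def using eta2_nonneg rate_pos by simp
  have cov: "\<E> (\<lambda>\<omega>. Jh v \<omega> * Jh r \<omega>) = \<theta> * (r - t)" if "t \<le> r" "r \<le> v" "v \<le> u" for r v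
    using Jc_covariance(4)[of t r v] assms that by (simp add: Jeq \<theta>_def)
  have J2: "integrable M (\<lambda>\<omega>. (Jh r \<omega>)\<^sup>2)" "\<E> (\<lambda>\<omega>. (Jh r \<omega>)\<^sup>2) = \<theta> * (r - t)" "\<E> (Jh r) = 0"
    "\<E> (\<lambda>\<omega>. (Jh r \<omega>)\<^sup>2) \<le> \<theta> * (u - t)" if "r \<in> {t..u}" for r
    using Jc_covariance[of t r r] assms that th by (auto simp: Jeq \<theta>_def intro!: mult_left_mono)
  define B where "B v \<omega> = (LBINT r:{t..v}. k r * Jh r \<omega>)" for v \<omega>
  have l2: "B v \<in> borel_measurable M" "integrable M (\<lambda>\<omega>. (B v \<omega>)\<^sup>2)"
    "\<E> (\<lambda>\<omega>. (B v \<omega>)\<^sup>2) \<le> (v - t) * ((v - t) * ((exp (\<bar>\<kappa>\<bar> * (u - t)))\<^sup>2 * (\<theta> * (u - t))))"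
    "\<And>z. z \<in> borel_measurable M \<Longrightarrow> integrable M (\<lambda>\<omega>. (z \<omega>)\<^sup>2) \<Longrightarrow>
      \<E> (\<lambda>\<omega>. z \<omega> * B v \<omega>) = (LBINT r:{t..v}. k r * \<E> (\<lambda>\<omega>. z \<omega> * Jh r \<omega>))" if "t \<le> v" "v \<le> u" for v
    using time_integral_L2[OF that(1) Jm km, of "exp (\<bar>\<kappa>\<bar> * (u - t))" "\<theta> * (u - t)", folded B_def] kC J2 that by auto
  have AB: "A = B u" by (simp add: A_def B_def fun_eq_iff)
  have cross: "\<E> (\<lambda>\<omega>. Jh v \<omega> * B v \<omega>) = \<theta> * (LBINT r:{t..v}. k r * (r - t))" if v: "t \<le> v" "v \<le> u" for v
  proof -
    have "\<E> (\<lambda>\<omega>. Jh v \<omega> * B v \<omega>) = (LBINT r:{t..v}. k r * \<E> (\<lambda>\<omega>. Jh v \<omega> * Jh r \<omega>))"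
      using J2 v by (intro l2 v) auto
    also have "\<dots> = (LBINT r:{t..v}. \<theta> * (k r * (r - t)))"
      using cov v by (intro set_lebesgue_integral_cong) auto
    finally show ?thesis by simp
  qed
  have ki: "L1_on {t..u} k" unfolding k_def[abs_def] by (rule exp_integral(1)[OF assms(2) \<kappa>_nz])
  have kri: "L1_on {t..u} (\<lambda>r. k r * (r - t))"
    unfolding k_def[abs_def] by (rule exp_linear_integral(1)[OF assms(2) \<kappa>_nz])
  have path: "L1_on {t..u} (\<lambda>r. k r * Jh r \<omega>)" if "\<omega> \<in> space M" for \<omega>
  proof (rule set_integrable_transfer)
    have cJ: "cadlag_on t u (\<lambda>r. exp (- \<kappa> * (u - r)))" "cadlag_on t u (\<lambda>r. - J t \<omega> - lam * \<eta>1 * (r - t))"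
      by (intro continuous_imp_cadlag continuous_intros)+
    have "cadlag_on t u (\<lambda>r. exp (- \<kappa> * (u - r)) * (J r \<omega> + (- J t \<omega> - lam * \<eta>1 * (r - t))))"
      using assms that by (intro cadlag_on_compose2[where h="(*)"] cadlag_on_compose2[where h="(+)"] cJ J_cadlag) (auto intro!: continuous_intros)
    then show "L1_on {t..u} (\<lambda>r. exp (- \<kappa> * (u - r)) * (J r \<omega> + (- J t \<omega> - lam * \<eta>1 * (r - t))))"
      using assms(2) by (intro cadlag_set_integrable)
  qed (simp add: k_def Jeq Jc_def)
  \<comment> \<open>The square of the integral is twice the integral over a triangle.\<close>
  have tri: "(A \<omega>)\<^sup>2 = 2 * (LBINT v:{t..u}. k v * (Jh v \<omega> * B v \<omega>))" if "\<omega> \<in> space M" for \<omega>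
    using set_integral_triangle(3)[OF path[OF that] path[OF that]]
    by (simp add: A_def B_def power2_eq_square mult.assoc)
  have EA2: "\<E> (\<lambda>\<omega>. (A \<omega>)\<^sup>2) = 2 * (LBINT v:{t..u}. k v * (\<theta> * (LBINT r:{t..v}. k r * (r - t))))"
  proof -
    define Kb where "Kb = \<theta> * (u - t) + (u - t) * ((u - t) * ((exp (\<bar>\<kappa>\<bar> * (u - t)))\<^sup>2 * (\<theta> * (u - t))))"
    have bnd: "integrable M (\<lambda>\<omega>. Jh v \<omega> * B v \<omega>)" "\<E> (\<lambda>\<omega>. \<bar>Jh v \<omega> * B v \<omega>\<bar>) \<le> Kb" if v: "v \<in> {t..u}" for v
    proof -
      have v': "t \<le> v" "v \<le> u" using v by auto
      show "integrable M (\<lambda>\<omega>. Jh v \<omega> * B v \<omega>)"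
        using l2[OF v'] J2[OF v] by (intro integrable_mult_squares) auto
      have "\<E> (\<lambda>\<omega>. \<bar>Jh v \<omega> * B v \<omega>\<bar>) \<le> \<E> (\<lambda>\<omega>. (Jh v \<omega>)\<^sup>2) + \<E> (\<lambda>\<omega>. (B v \<omega>)\<^sup>2)"
        using l2[OF v'] J2[OF v] by (intro integrable_mult_squares) auto
      also have "\<dots> \<le> Kb"
      proof -
        have "(v - t) * ((v - t) * ((exp (\<bar>\<kappa>\<bar> * (u - t)))\<^sup>2 * (\<theta> * (u - t)))) \<le> (u - t) * ((u - t) * ((exp (\<bar>\<kappa>\<bar> * (u - t)))\<^sup>2 * (\<theta> * (u - t))))"
          using v th by (intro mult_mono) auto
        then show ?thesis using l2(3)[OF v'] J2(4)[OF v] unfolding Kb_def by linarith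
      qed
      finally show "\<E> (\<lambda>\<omega>. \<bar>Jh v \<omega> * B v \<omega>\<bar>) \<le> Kb" .
    qed
    have Bm [measurable]: "(\<lambda>(v, \<omega>). B v \<omega>) \<in> borel_measurable (borel \<Otimes>\<^sub>M M)"
    proof -
      have [measurable]: "Measurable.pred ((borel \<Otimes>\<^sub>M M) \<Otimes>\<^sub>M borel) (\<lambda>x :: (real \<times> 'a) \<times> real. snd x \<le> fst (fst x))" by measurable
      show ?thesis
        unfolding B_def set_lebesgue_integral_def indicator_def atLeastAtMost_iff by measurable
    qed
    have p: "integrable (lborel \<Otimes>\<^sub>M M) (\<lambda>(v, \<omega>). indicator {t..u} v * (k v * (Jh v \<omega> * B v \<omega>)))"
    proof (rule integrable_pair_Icc[where K="exp (\<bar>\<kappa>\<bar> * (u - t)) * Kb"])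
      fix v assume v: "v \<in> {t..u}"
      show "integrable M (\<lambda>\<omega>. k v * (Jh v \<omega> * B v \<omega>))" using bnd[OF v] by simp
      have "\<E> (\<lambda>\<omega>. \<bar>k v * (Jh v \<omega> * B v \<omega>)\<bar>) = \<bar>k v\<bar> * \<E> (\<lambda>\<omega>. \<bar>Jh v \<omega> * B v \<omega>\<bar>)"
        by (subst abs_mult) (rule integral_mult_right_zero)
      also have "\<dots> \<le> exp (\<bar>\<kappa>\<bar> * (u - t)) * Kb"
        using kC[OF v] bnd[OF v] by (intro mult_mono) (auto intro: integral_nonneg_AE)
      finally show "\<E> (\<lambda>\<omega>. \<bar>k v * (Jh v \<omega> * B v \<omega>)\<bar>) \<le> exp (\<bar>\<kappa>\<bar> * (u - t)) * Kb" .
    qed measurable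
    have "\<E> (\<lambda>\<omega>. (A \<omega>)\<^sup>2) = \<E> (\<lambda>\<omega>. 2 * (LBINT v:{t..u}. k v * (Jh v \<omega> * B v \<omega>)))"
      by (intro Bochner_Integration.integral_cong tri) auto
    also have "\<dots> = 2 * (LBINT v:{t..u}. \<E> (\<lambda>\<omega>. k v * (Jh v \<omega> * B v \<omega>)))"
      by (simp add: Fubini_Icc(3)[OF p])
    also have "(LBINT v:{t..u}. \<E> (\<lambda>\<omega>. k v * (Jh v \<omega> * B v \<omega>))) = (LBINT v:{t..u}. k v * (\<theta> * (LBINT r:{t..v}. k r * (r - t))))"
      using cross by (intro set_lebesgue_integral_cong) auto
    finally show ?thesis .
  qed
  have swap: "(LBINT v:{t..u}. k v * (\<theta> * (LBINT r:{t..v}. k r * (r - t))))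
      = \<theta> * (LBINT r:{t..u}. k r * (r - t) * ((1 - k r) / \<kappa>))"
  proof -
    have "(LBINT v:{t..u}. k v * (\<theta> * (LBINT r:{t..v}. k r * (r - t)))) = \<theta> * (LBINT v:{t..u}. k v * (LBINT r:{t..v}. k r * (r - t)))"
      by (subst set_integral_mult_right[symmetric]) (simp add: mult.left_commute)
    also have "(LBINT v:{t..u}. k v * (LBINT r:{t..v}. k r * (r - t))) = (LBINT r:{t..u}. k r * (r - t) * (LBINT v:{r..u}. k v))"
      by (rule set_integral_triangle(2)[OF ki kri])
    also have "\<dots> = (LBINT r:{t..u}. k r * (r - t) * ((1 - k r) / \<kappa>))"
      using exp_integral(2)[OF _ \<kappa>_nz] by (intro set_lebesgue_integral_cong) (auto simp: k_def)
    finally show ?thesis .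
  qed
  have k2: "(k r)\<^sup>2 = exp (- (2 * \<kappa>) * (u - r))" for r by (simp add: k_def exp_double[symmetric] power2_eq_square exp_add[symmetric])
  have nz2: "2 * \<kappa> \<noteq> 0" using \<kappa>_nz by simp
  have split: "(LBINT r:{t..u}. k r * (r - t) * ((1 - k r) / \<kappa>))
     = ((LBINT r:{t..u}. k r * (r - t)) - (LBINT r:{t..u}. exp (- (2 * \<kappa>) * (u - r)) * (r - t))) / \<kappa>"
  proof -
    have "(LBINT r:{t..u}. k r * (r - t) * ((1 - k r) / \<kappa>)) = (LBINT r:{t..u}. (k r * (r - t) - exp (- (2 * \<kappa>) * (u - r)) * (r - t)) / \<kappa>)"
      unfolding k2[symmetric]
    proof (intro set_lebesgue_integral_cong allI impI)
      fix r
      have "k r * (r - t) - (k r)\<^sup>2 * (r - t) = k r * (r - t) * (1 - k r)"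
        by (simp add: power2_eq_square algebra_simps)
      then show "k r * (r - t) * ((1 - k r) / \<kappa>) = (k r * (r - t) - (k r)\<^sup>2 * (r - t)) / \<kappa>" by simp
    qed simp
    also have "\<dots> = (LBINT r:{t..u}. k r * (r - t) - exp (- (2 * \<kappa>) * (u - r)) * (r - t)) / \<kappa>"
      by (rule set_integral_divide_zero)
    also have "(LBINT r:{t..u}. k r * (r - t) - exp (- (2 * \<kappa>) * (u - r)) * (r - t))
      = (LBINT r:{t..u}. k r * (r - t)) - (LBINT r:{t..u}. exp (- (2 * \<kappa>) * (u - r)) * (r - t))"
      by (rule set_integral_diff(2)[OF kri exp_linear_integral(1)[OF assms(2) nz2]])
    finally show ?thesis .
  qed
  define K where "K \<omega> = Jh u \<omega> - \<kappa> * A \<omega>" for \<omega>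
  have uu: "u \<in> {t..u}" using assms by simp
  have A: "A \<in> borel_measurable M" "integrable M (\<lambda>\<omega>. (A \<omega>)\<^sup>2)" unfolding AB using l2[of u] assms by auto
  have EA: "\<E> A = 0"
  proof -
    have "\<E> (\<lambda>\<omega>. 1 * B u \<omega>) = (LBINT r:{t..u}. k r * \<E> (\<lambda>\<omega>. 1 * Jh r \<omega>))"
      using assms by (intro l2) auto
    also have "\<dots> = (LBINT r:{t..u}. 0)" using J2(3) by (intro set_lebesgue_integral_cong) auto
    finally show ?thesis by (simp add: AB)
  qed
  have iJA: "integrable M (\<lambda>\<omega>. Jh u \<omega> * A \<omega>)" by (intro integrable_mult_squares A J2(1)[OF uu]) auto
  have Ksq: "(K \<omega>)\<^sup>2 = (Jh u \<omega>)\<^sup>2 - 2 * \<kappa> * (Jh u \<omega> * A \<omega>) + \<kappa>\<^sup>2 * (A \<omega>)\<^sup>2" for \<omega>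
    by (simp add: K_def power2_eq_square algebra_simps)
  have K2: "integrable M (\<lambda>\<omega>. (K \<omega>)\<^sup>2)" unfolding Ksq using J2(1)[OF uu] iJA A by auto
  have Ki: "integrable M K" "\<E> K = 0"
  proof -
    have i: "integrable M (Jh u)" "integrable M A"
      by (rule integrable_square_imp_integrable[OF Jr J2(1)[OF uu]], rule integrable_square_imp_integrable[OF A])
    show "integrable M K" "\<E> K = 0" unfolding K_def[abs_def] using i J2(3)[OF uu] EA by auto
  qed
  have EK: "\<E> (\<lambda>\<omega>. (K \<omega>)\<^sup>2) = \<theta> * ((1 - exp (- (2 * \<kappa>) * (u - t))) / (2 * \<kappa>))"
  proof -
    have "\<E> (\<lambda>\<omega>. (K \<omega>)\<^sup>2) = \<E> (\<lambda>\<omega>. (Jh u \<omega>)\<^sup>2) - 2 * \<kappa> * \<E> (\<lambda>\<omega>. Jh u \<omega> * A \<omega>) + \<kappa>\<^sup>2 * \<E> (\<lambda>\<omega>. (A \<omega>)\<^sup>2)"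
      unfolding Ksq using J2(1)[OF uu] iJA A by simp
    also have "\<E> (\<lambda>\<omega>. (Jh u \<omega>)\<^sup>2) = \<theta> * (u - t)" by (rule J2(2)[OF uu])
    also have "\<E> (\<lambda>\<omega>. Jh u \<omega> * A \<omega>) = \<theta> * (LBINT r:{t..u}. k r * (r - t))"
      unfolding AB using assms by (intro cross) auto
    also have "\<E> (\<lambda>\<omega>. (A \<omega>)\<^sup>2) = 2 * (\<theta> * (((LBINT r:{t..u}. k r * (r - t)) - (LBINT r:{t..u}. exp (- (2 * \<kappa>) * (u - r)) * (r - t))) / \<kappa>))"
      unfolding EA2 swap split by simp
    also have "\<theta> * (u - t) - 2 * \<kappa> * (\<theta> * x) + \<kappa>\<^sup>2 * (2 * (\<theta> * ((x - y) / \<kappa>))) = \<theta> * ((u - t) - 2 * \<kappa> * y)" for x y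
      using \<kappa>_nz by (simp add: power2_eq_square field_simps)
    also have "(LBINT r:{t..u}. exp (- (2 * \<kappa>) * (u - r)) * (r - t)) = (exp (- (2 * \<kappa>) * (u - t)) - 1 + 2 * \<kappa> * (u - t)) / (2 * \<kappa>)\<^sup>2"
      by (rule exp_linear_integral(2)[OF assms(2) nz2])
    also have "(u - t) - 2 * \<kappa> * ((exp (- (2 * \<kappa>) * (u - t)) - 1 + 2 * \<kappa> * (u - t)) / (2 * \<kappa>)\<^sup>2) = (1 - exp (- (2 * \<kappa>) * (u - t))) / (2 * \<kappa>)"
      using \<kappa>_nz by (simp add: power2_eq_square field_simps)
    finally show ?thesis .
  qed
  have mp: "mu_path t \<mu> u \<omega> = mu_mean t \<mu> u + K \<omega>" if "\<omega> \<in> space M" for \<omega>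
  proof -
    have "(LBINT r:{t..u}. exp (- \<kappa> * (u - r)) * Jc t r \<omega>) = A \<omega>"
      unfolding A_def by (intro set_lebesgue_integral_cong) (auto simp: k_def Jeq)
    then show ?thesis using mu_path_centered[OF assms that] Jeq[OF uu] by (simp add: K_def)
  qed
  have sq: "(mu_mean t \<mu> u + K \<omega>)\<^sup>2 = 1 * (K \<omega>)\<^sup>2 + (2 * mu_mean t \<mu> u) * K \<omega> + (mu_mean t \<mu> u)\<^sup>2" for \<omega>
    by (simp add: power2_eq_square algebra_simps)
  have "integrable M (\<lambda>\<omega>. (mu_path t \<mu> u \<omega>)\<^sup>2) \<longleftrightarrow> integrable M (\<lambda>\<omega>. 1 * (K \<omega>)\<^sup>2 + (2 * mu_mean t \<mu> u) * K \<omega> + (mu_mean t \<mu> u)\<^sup>2)"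
    by (intro Bochner_Integration.integrable_cong refl) (simp only: mp sq)
  then show "integrable M (\<lambda>\<omega>. (mu_path t \<mu> u \<omega>)\<^sup>2)" using integral_quadratic(1)[OF Ki(1) K2] by blast
  have "\<E> (mu_path t \<mu> u) = \<E> (\<lambda>\<omega>. mu_mean t \<mu> u + K \<omega>)"
    by (intro Bochner_Integration.integral_cong refl mp)
  then show "\<E> (mu_path t \<mu> u) = mu_mean t \<mu> u" using Ki by (simp add: prob_space)
  have "\<E> (\<lambda>\<omega>. (mu_path t \<mu> u \<omega>)\<^sup>2) = \<E> (\<lambda>\<omega>. 1 * (K \<omega>)\<^sup>2 + (2 * mu_mean t \<mu> u) * K \<omega> + (mu_mean t \<mu> u)\<^sup>2)"
    by (intro Bochner_Integration.integral_cong refl) (simp only: mp sq)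
  also have "\<dots> = mu_second t \<mu> u"
    unfolding integral_quadratic(2)[OF Ki(1) K2] Ki(2) EK mu_second_def \<theta>_def by simp
  finally show "\<E> (\<lambda>\<omega>. (mu_path t \<mu> u \<omega>)\<^sup>2) = mu_second t \<mu> u" .
qed

end

section \<open>The payoff along a path\<close>

lemma set_integrable_mult_bounded:
  fixes f g :: "real \<Rightarrow> real"
  assumes f: "L1_on {a..d} f" and g: "L1_on {a..d} g"
    and B: "\<And>r. r \<in> {a..d} \<Longrightarrow> \<bar>g r\<bar> \<le> B"
  shows "L1_on {a..d} (\<lambda>r. g r * f r)"
proof (rule set_integrable_bound[OF set_integrable_mult_right[of B, OF f]])
  have "(\<lambda>r. indicator {a..d} r *\<^sub>R f r) \<in> borel_measurable lborel" "(\<lambda>r. indicator {a..d} r *\<^sub>R g r) \<in> borel_measurable lborel"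
    using f g by (auto simp: set_integrable_def)
  then have "(\<lambda>r. (indicator {a..d} r *\<^sub>R g r) * (indicator {a..d} r *\<^sub>R f r)) \<in> borel_measurable lborel" by measurable
  also have "(\<lambda>r. (indicator {a..d} r *\<^sub>R g r) * (indicator {a..d} r *\<^sub>R f r)) = (\<lambda>r. indicator {a..d} r *\<^sub>R (g r * f r))"
    by (auto simp: indicator_def fun_eq_iff)
  finally show "set_borel_measurable lborel {a..d} (\<lambda>r. g r * f r)" by (simp add: set_borel_measurable_def)
  show "AE r in lborel. r \<in> {a..d} \<longrightarrow> norm (g r * f r) \<le> norm (B * f r)"
  proof (intro AE_I2 impI)
    fix r assume "r \<in> {a..d}"
    from B[OF this] have "\<bar>g r\<bar> * \<bar>f r\<bar> \<le> \<bar>B\<bar> * \<bar>f r\<bar>" by (intro mult_right_mono) auto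
    then show "norm (g r * f r) \<le> norm (B * f r)" by (simp add: abs_mult)
  qed
qed

lemma set_integrable_const_Icc: "L1_on {a..d} (\<lambda>_::real. C::real)"
  by (intro borel_integrable_atLeastAtMost' continuous_intros)

lemma set_integral_const_Icc: "a \<le> d \<Longrightarrow> (LBINT r:{a..d}. C) = (d - a) * (C::real)" for a d :: real
  by (simp add: set_lebesgue_integral_def)

lemma indefinite_integral_bounded:
  fixes f :: "real \<Rightarrow> real"
  assumes f: "L1_on {a..d} f" and r: "r \<in> {a..d}"
  shows "\<bar>LBINT s:{a..r}. f s\<bar> \<le> (LBINT s:{a..d}. \<bar>f s\<bar>)"
    and "\<bar>LBINT s:{r..d}. f s\<bar> \<le> (LBINT s:{a..d}. \<bar>f s\<bar>)"
proof -
  have *: "\<bar>LINT s:X|lborel. f s\<bar> \<le> (LBINT s:{a..d}. \<bar>f s\<bar>)" if X: "X \<subseteq> {a..d}" "X \<in> sets lborel" for X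
  proof -
    have fX: "L1_on X f" using f X by (intro set_integrable_subset[OF f]) auto
    have "\<bar>LINT s:X|lborel. f s\<bar> \<le> (LINT s:X|lborel. \<bar>f s\<bar>)"
      using integral_abs_bound[of lborel "\<lambda>s. indicator X s *\<^sub>R f s"]
      by (simp add: set_lebesgue_integral_def abs_mult)
    also have "\<dots> \<le> (LBINT s:{a..d}. \<bar>f s\<bar>)"
      unfolding set_lebesgue_integral_def
      using set_integrable_abs[OF fX] set_integrable_abs[OF f] X
      by (intro integral_mono) (auto simp: set_integrable_def indicator_def)
    finally show ?thesis .
  qed
  show "\<bar>LBINT s:{a..r}. f s\<bar> \<le> (LBINT s:{a..d}. \<bar>f s\<bar>)" "\<bar>LBINT s:{r..d}. f s\<bar> \<le> (LBINT s:{a..d}. \<bar>f s\<bar>)"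
    using r by (auto intro!: *)
qed

lemma indefinite_integral_integrable:
  fixes f :: "real \<Rightarrow> real"
  assumes f: "L1_on {a..d} f"
  shows "L1_on {a..d} (\<lambda>r. LBINT s:{a..r}. f s)"
    and "L1_on {a..d} (\<lambda>r. LBINT s:{r..d}. f s)"
  using set_integral_triangle(1)[OF set_integrable_const_Icc[of a d 1] f]
    set_integral_triangle(4)[OF set_integrable_const_Icc[of a d 1] f] by simp_all

context liquidation_model
begin

text \<open>Along a path, the payoff is a constant minus a square, plus a linear term whose coefficient
  \<open>\<zeta>\<close> looks into the future of the noise. \<open>K\<close> and \<open>R\<close> stand for the rates of the cost of temporary impact and of the
  running penalty, \<open>m\<close> for the market trading speed.\<close>

lemma payoff_identity:
  fixes u K R m w :: "real \<Rightarrow> real" and q :: real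
  assumes t: "t \<in> {0..T}"
    and u: "L1_on {t..T} u" and u2: "L1_on {t..T} (\<lambda>r. (u r)\<^sup>2)"
    and K: "L1_on {t..T} K" and R: "L1_on {t..T} R"
    and m: "L1_on {t..T} m" and mB: "\<And>r. r \<in> {t..T} \<Longrightarrow> \<bar>m r\<bar> \<le> B"
    and w: "L1_on {t..T} w" and wB: "\<And>r. r \<in> {t..T} \<Longrightarrow> \<bar>w r\<bar> \<le> B'"
  defines "Q \<equiv> \<lambda>r. q - (LBINT s:{t..r}. u s)"
  defines "\<xi> \<equiv> \<lambda>r. 2 * \<phi> * \<rho> * m r - \<sigma> * (w T - w r)"
  defines "\<Xi> \<equiv> \<lambda>s. LBINT r:{s..T}. \<xi> r"
  defines "\<zeta> \<equiv> \<lambda>s. \<xi> s - p s / c * \<Xi> s"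
  defines "z \<equiv> \<lambda>r. u r - p r * Q r / c"
  shows "x + (LBINT r:{t..T}. (S - b * (LBINT s:{t..r}. u s) + \<sigma> * (w r - w t)) * u r - K r)
     + Q T * ((S - b * (LBINT s:{t..T}. u s) + \<sigma> * (w T - w t)) - \<alpha> * Q T) - (LBINT r:{t..T}. R r)
   = x + q * S - (b / 2 + p t) * q\<^sup>2 + \<sigma> * q * (w T - w t) + p t * q * \<Xi> t / c
     + (LBINT r:{t..T}. z r * \<zeta> r - c * (z r)\<^sup>2)
     - (LBINT r:{t..T}. K r + R r - c * (u r)\<^sup>2 + 2 * \<phi> * \<rho> * m r * u r)"
    and "L1_on {t..T} z" and "L1_on {t..T} (\<lambda>r. (z r)\<^sup>2)"
    and "L1_on {t..T} (\<lambda>r. z r * \<zeta> r)"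
proof -
  have tT: "t \<le> T" using t by simp
  let ?U = "\<lambda>r. LBINT s:{t..r}. u s"
  have sub: "{t..T} \<subseteq> {0..T}" using t by auto
  note add = set_integral_add and diff = set_integral_diff
  have mu: "L1_on {t..T} (\<lambda>r. m r * u r)" by (rule set_integrable_mult_bounded[OF u m mB])
  have wu: "L1_on {t..T} (\<lambda>r. w r * u r)" by (rule set_integrable_mult_bounded[OF u w wB])
  have \<xi>: "L1_on {t..T} \<xi>"
    unfolding \<xi>_def by (intro diff set_integrable_mult_right m w set_integrable_const_Icc)
  have \<xi>u: "L1_on {t..T} (\<lambda>r. \<xi> r * u r)"
  proof (rule set_integrable_transfer)
    show "L1_on {t..T} (\<lambda>r. 2 * \<phi> * \<rho> * (m r * u r) - (\<sigma> * w T * u r - \<sigma> * (w r * u r)))"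
      by (intro diff set_integrable_mult_right mu wu u)
  qed (simp add: \<xi>_def algebra_simps)
  have mu_int: "L1_on {t..T} (\<lambda>r. - u r)" using set_integrable_mult_right[of "-1", OF u] by simp
  have Q: "Q r = Q t + (LBINT s:{t..r}. - u s)" if "r \<in> {t..T}" for r
    using set_integral_uminus[OF set_integrable_Icc_subset[OF u, of t r]] that by (simp add: Q_def)
  have Qt: "Q t = q" by (simp add: Q_def)
  note QQ = product_rule_integrals[OF tT mu_int mu_int Q Q]
  have Qu: "L1_on {t..T} (\<lambda>r. Q r * u r)"
    using set_integrable_mult_right[of "-1", OF QQ(2)] by simp
  have QQ2: "(Q T)\<^sup>2 = q\<^sup>2 - 2 * (LBINT r:{t..T}. Q r * u r)"
  proof -
    have "(LBINT r:{t..T}. - u r * Q r + Q r * - u r) = (LBINT r:{t..T}. (- 2) * (Q r * u r))"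
      by (intro set_lebesgue_integral_cong) auto
    also have "\<dots> = (- 2) * (LBINT r:{t..T}. Q r * u r)" by (rule set_integral_mult_right)
    finally show ?thesis using QQ(3) unfolding Qt power2_eq_square by linarith
  qed
  have pc: "continuous_on {t..T} p" by (rule p_continuous[OF sub])
  have pint: "L1_on {t..T} p" by (rule borel_integrable_atLeastAtMost'[OF pc])
  obtain pB where pB: "\<And>r. r \<in> {t..T} \<Longrightarrow> \<bar>p r\<bar> \<le> pB"
    using compact_imp_bounded[OF compact_continuous_image[OF pc compact_Icc]] unfolding bounded_iff real_norm_def by blast
  have dp: "(p has_real_derivative (p r)\<^sup>2 / c) (at r within {t..s})" if "r \<in> {t..s}" "s \<in> {t..T}" for r s
    using that t by (intro p_deriv) auto
  have dpc: "continuous_on {t..s} (\<lambda>r. (p r)\<^sup>2 / c)" if "s \<in> {t..T}" for s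
    using c_pos that sub by (intro continuous_intros p_continuous) auto
  have pI: "p r = p t + (LBINT s:{t..r}. (p s)\<^sup>2 / c)" if "r \<in> {t..T}" for r
    using that by (intro FTC_set_integral(2)[OF _ dp dpc]) auto
  have p2: "L1_on {t..T} (\<lambda>r. (p r)\<^sup>2 / c)"
    by (intro borel_integrable_atLeastAtMost' dpc) (use tT in auto)
  have zeq: "(p r)\<^sup>2 / c * Q r + p r * - u r = - (p r * z r)" for r
    using c_pos by (simp add: z_def power2_eq_square algebra_simps)
  have pQ: "p r * Q r = p t * q - (LBINT s:{t..r}. p s * z s)" and pzr: "L1_on {t..r} (\<lambda>s. p s * z s)"
    if r: "r \<in> {t..T}" for r
  proof -
    have r': "t \<le> r" "r \<le> T" using r by auto
    note pr = product_rule_integrals[OF r'(1) set_integrable_Icc_subset[OF p2 order_refl r'(2)] set_integrable_Icc_subset[OF mu_int order_refl r'(2)],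
        where F=p and G=Q]
    have e: "p s = p t + (LBINT s:{t..s}. (p s)\<^sup>2 / c)" "Q s = Q t + (LBINT s:{t..s}. - u s)" if "s \<in> {t..r}" for s
      using pI[of s] Q[of s] that r' by auto
    have "L1_on {t..r} (\<lambda>s. - (p s * z s))"
      using add(1)[OF pr(1,2)[OF e]] unfolding zeq by simp
    then show i: "L1_on {t..r} (\<lambda>s. p s * z s)" using set_integrable_mult_right[of "-1"] by fastforce
    have "p r * Q r = p t * Q t + (LBINT s:{t..r}. - (p s * z s))"
      using pr(3)[OF e] unfolding zeq by simp
    then show "p r * Q r = p t * q - (LBINT s:{t..r}. p s * z s)"
      unfolding set_integral_uminus[OF i] Qt by simp
  qed
  have pz: "L1_on {t..T} (\<lambda>s. p s * z s)" using pzr[of T] tT by simp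
  have Qi: "L1_on {t..T} Q"
    unfolding Q_def by (intro diff set_integrable_const_Icc indefinite_integral_integrable u)
  have pQi: "L1_on {t..T} (\<lambda>r. p r * Q r)"
    by (rule set_integrable_mult_bounded[OF Qi pint pB])
  show z: "L1_on {t..T} z"
    unfolding z_def by (intro diff u set_integrable_divide pQi)
  \<comment> \<open>\<open>c (u\<^sup>2 - z\<^sup>2) = p Q (u + z)\<close> is the derivative of \<open>- p Q\<^sup>2\<close>\<close>
  have mpz: "L1_on {t..T} (\<lambda>s. - (p s * z s))" using set_integrable_mult_right[of "-1", OF pz] by simp
  have pQF: "p r * Q r = p t * Q t + (LBINT s:{t..r}. - (p s * z s))" if "r \<in> {t..T}" for r
    using pQ[OF that] unfolding set_integral_uminus[OF pzr[OF that]] Qt by simp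
  note pQQ = product_rule_integrals[OF tT mpz mu_int, where F="\<lambda>r. p r * Q r" and G=Q, OF pQF Q]
  have sq: "- (p r * z r) * Q r + p r * Q r * - u r = - (c * (u r)\<^sup>2 - c * (z r)\<^sup>2)" for r
  proof -
    define y where "y = p r * Q r / c"
    have y: "p r * Q r = c * y" using c_pos by (simp add: y_def)
    have "- (p r * z r) * Q r + p r * Q r * - u r = - (p r * Q r) * (z r + u r)" by (simp add: algebra_simps)
    also have "\<dots> = - (c * (u r)\<^sup>2 - c * (z r)\<^sup>2)"
    proof -
      have zy: "z r = u r - y" by (simp add: z_def y_def)
      show ?thesis unfolding y zy by (simp add: algebra_simps power2_eq_square)
    qed
    finally show ?thesis .
  qed
  have dsq: "L1_on {t..T} (\<lambda>r. - (c * (u r)\<^sup>2 - c * (z r)\<^sup>2))"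
    using add(1)[OF pQQ(1,2)] unfolding sq by simp
  have cz2: "L1_on {t..T} (\<lambda>r. c * (z r)\<^sup>2)"
    using add(1)[OF dsq set_integrable_mult_right[of c, OF u2]] by simp
  then show z2: "L1_on {t..T} (\<lambda>r. (z r)\<^sup>2)"
    using c_pos by simp
  have cu2: "L1_on {t..T} (\<lambda>r. c * (u r)\<^sup>2)" using u2 by simp
  have pT: "p T * (Q T)\<^sup>2 = p t * q\<^sup>2 - ((LBINT r:{t..T}. c * (u r)\<^sup>2) - (LBINT r:{t..T}. c * (z r)\<^sup>2))"
  proof -
    have "p T * Q T * Q T = p t * Q t * Q t + (LBINT r:{t..T}. - (c * (u r)\<^sup>2 - c * (z r)\<^sup>2))"
      using pQQ(3) unfolding sq .
    also have "(LBINT r:{t..T}. - (c * (u r)\<^sup>2 - c * (z r)\<^sup>2)) = - (LBINT r:{t..T}. c * (u r)\<^sup>2 - c * (z r)\<^sup>2)"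
      by (rule set_integral_uminus[OF diff(1)[OF cu2 cz2]])
    also have "(LBINT r:{t..T}. c * (u r)\<^sup>2 - c * (z r)\<^sup>2) = (LBINT r:{t..T}. c * (u r)\<^sup>2) - (LBINT r:{t..T}. c * (z r)\<^sup>2)"
      by (rule diff(2)[OF cu2 cz2])
    finally show ?thesis by (simp add: Qt power2_eq_square mult.assoc)
  qed
  \<comment> \<open>As \<open>p Q\<close> is a primitive of \<open>- p z\<close>, Fubini turns the integral of \<open>\<xi> p Q\<close> into one of \<open>\<Xi> p z\<close>.\<close>
  have \<xi>B: "\<bar>\<xi> r\<bar> \<le> \<bar>2 * \<phi> * \<rho>\<bar> * B + \<bar>\<sigma>\<bar> * (B' + B')" if r: "r \<in> {t..T}" for r
  proof -
    have "\<bar>\<xi> r\<bar> \<le> \<bar>2 * \<phi> * \<rho> * m r\<bar> + \<bar>\<sigma> * (w T - w r)\<bar>" unfolding \<xi>_def by (rule abs_triangle_ineq4)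
    also have "\<bar>2 * \<phi> * \<rho> * m r\<bar> \<le> \<bar>2 * \<phi> * \<rho>\<bar> * B"
      unfolding abs_mult[of "2 * \<phi> * \<rho>"] using mB[OF r] by (intro mult_left_mono) auto
    also have "\<bar>\<sigma> * (w T - w r)\<bar> \<le> \<bar>\<sigma>\<bar> * (B' + B')"
      unfolding abs_mult[of \<sigma>] using wB[OF r] wB[of T] tT by (intro mult_left_mono) auto
    finally show ?thesis by simp
  qed
  have \<xi>z: "L1_on {t..T} (\<lambda>r. \<xi> r * z r)"
    by (rule set_integrable_mult_bounded[OF z \<xi> \<xi>B])
  have \<Xi>B: "\<bar>\<Xi> r\<bar> \<le> (LBINT s:{t..T}. \<bar>\<xi> s\<bar>)" if "r \<in> {t..T}" for r
    unfolding \<Xi>_def by (rule indefinite_integral_bounded(2)[OF \<xi> that])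
  have \<Xi>i: "L1_on {t..T} \<Xi>"
    unfolding \<Xi>_def by (intro indefinite_integral_integrable \<xi>)
  have \<Xi>pz: "L1_on {t..T} (\<lambda>r. \<Xi> r * (p r * z r))"
    by (rule set_integrable_mult_bounded[OF pz \<Xi>i \<Xi>B])
  have z\<zeta>: "z r * \<zeta> r = \<xi> r * z r - \<Xi> r * (p r * z r) / c" for r
    by (simp add: \<zeta>_def algebra_simps)
  show z\<zeta>i: "L1_on {t..T} (\<lambda>r. z r * \<zeta> r)"
    unfolding z\<zeta> by (intro diff \<xi>z set_integrable_divide \<Xi>pz)
  have \<xi>pQ: "L1_on {t..T} (\<lambda>r. \<xi> r * (LBINT s:{t..r}. p s * z s))"
    by (rule set_integral_triangle(1)[OF \<xi> pz])
  have lin: "(LBINT r:{t..T}. \<xi> r * u r) = p t * q * \<Xi> t / c + (LBINT r:{t..T}. z r * \<zeta> r)"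
  proof -
    have "(LBINT r:{t..T}. \<xi> r * u r) = (LBINT r:{t..T}. \<xi> r * z r + (p t * q / c * \<xi> r - (\<xi> r * (LBINT s:{t..r}. p s * z s)) / c))"
    proof (intro set_lebesgue_integral_cong allI impI)
      fix r assume r: "r \<in> {t..T}"
      define y where "y = (LBINT s:{t..r}. p s * z s)"
      have "u r = z r + p r * Q r / c" by (simp add: z_def)
      then have ur: "u r = z r + (p t * q - y) / c" unfolding pQ[OF r] y_def .
      have "\<xi> r * (z r + (p t * q - y) / c) = \<xi> r * z r + (p t * q / c * \<xi> r - \<xi> r * y / c)"
        by (simp add: ring_distribs diff_divide_distrib)
      then show "\<xi> r * u r = \<xi> r * z r + (p t * q / c * \<xi> r - (\<xi> r * (LBINT s:{t..r}. p s * z s)) / c)"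
        unfolding ur y_def .
    qed simp
    also have "\<dots> = (LBINT r:{t..T}. \<xi> r * z r) + (p t * q / c * (LBINT r:{t..T}. \<xi> r) - (LBINT r:{t..T}. \<xi> r * (LBINT s:{t..r}. p s * z s)) / c)"
      by (subst add(2)[OF \<xi>z], intro diff set_integrable_mult_right set_integrable_divide \<xi> \<xi>pQ)
        (subst diff(2), intro set_integrable_mult_right \<xi>, intro set_integrable_divide \<xi>pQ, simp)
    also have "(LBINT r:{t..T}. \<xi> r * (LBINT s:{t..r}. p s * z s)) = (LBINT r:{t..T}. \<Xi> r * (p r * z r))"
      unfolding set_integral_triangle(2)[OF \<xi> pz] by (simp add: \<Xi>_def mult.commute)
    finally have 1: "(LBINT r:{t..T}. \<xi> r * u r) = (LBINT r:{t..T}. \<xi> r * z r) + (p t * q / c * \<Xi> t - (LBINT r:{t..T}. \<Xi> r * (p r * z r)) / c)"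
      by (simp add: \<Xi>_def)
    have "(LBINT r:{t..T}. z r * \<zeta> r) = (LBINT r:{t..T}. \<xi> r * z r) - (LBINT r:{t..T}. \<Xi> r * (p r * z r) / c)"
      unfolding z\<zeta> by (rule diff(2)[OF \<xi>z set_integrable_divide]) (use \<Xi>pz in simp)
    then show ?thesis unfolding 1 by simp
  qed
  have UQ: "?U r = q - Q r" for r by (simp add: Q_def)
  let ?Iu = "LBINT r:{t..T}. u r" and ?IQ = "LBINT r:{t..T}. Q r * u r" and ?Iw = "LBINT r:{t..T}. w r * u r"
    and ?Im = "LBINT r:{t..T}. m r * u r" and ?IK = "LBINT r:{t..T}. K r" and ?IR = "LBINT r:{t..T}. R r"
    and ?Iu2 = "LBINT r:{t..T}. c * (u r)\<^sup>2" and ?Iz2 = "LBINT r:{t..T}. c * (z r)\<^sup>2"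
    and ?Iz = "LBINT r:{t..T}. z r * \<zeta> r"
  have X: "(LBINT r:{t..T}. (S - b * ?U r + \<sigma> * (w r - w t)) * u r - K r)
    = (S - b * q - \<sigma> * w t) * ?Iu + (b * ?IQ + (\<sigma> * ?Iw - ?IK))"
  proof -
    have "(LBINT r:{t..T}. (S - b * ?U r + \<sigma> * (w r - w t)) * u r - K r)
      = (LBINT r:{t..T}. (S - b * q - \<sigma> * w t) * u r + (b * (Q r * u r) + (\<sigma> * (w r * u r) - K r)))"
      unfolding UQ by (intro set_lebesgue_integral_cong) (auto simp: algebra_simps)
    also have "\<dots> = (LBINT r:{t..T}. (S - b * q - \<sigma> * w t) * u r) + (LBINT r:{t..T}. b * (Q r * u r) + (\<sigma> * (w r * u r) - K r))"
      by (intro add(2) diff(1) add(1) set_integrable_mult_right u Qu wu K)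
    also have "(LBINT r:{t..T}. b * (Q r * u r) + (\<sigma> * (w r * u r) - K r)) = (LBINT r:{t..T}. b * (Q r * u r)) + (LBINT r:{t..T}. \<sigma> * (w r * u r) - K r)"
      by (intro add(2) diff(1) set_integrable_mult_right Qu wu K)
    also have "(LBINT r:{t..T}. \<sigma> * (w r * u r) - K r) = (LBINT r:{t..T}. \<sigma> * (w r * u r)) - ?IK"
      by (intro diff(2) set_integrable_mult_right wu K)
    finally show ?thesis by simp
  qed
  have KR: "(LBINT r:{t..T}. K r + R r - c * (u r)\<^sup>2 + 2 * \<phi> * \<rho> * m r * u r) = ?IK + ?IR - ?Iu2 + 2 * \<phi> * \<rho> * ?Im"
  proof -
    have "(LBINT r:{t..T}. K r + R r - c * (u r)\<^sup>2 + 2 * \<phi> * \<rho> * m r * u r) = (LBINT r:{t..T}. (K r + R r - c * (u r)\<^sup>2) + 2 * \<phi> * \<rho> * (m r * u r))"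
      by (simp add: mult.assoc)
    also have "\<dots> = (LBINT r:{t..T}. K r + R r - c * (u r)\<^sup>2) + (LBINT r:{t..T}. 2 * \<phi> * \<rho> * (m r * u r))"
      by (intro add(2) diff(1) add(1) set_integrable_mult_right mu K R u2)
    also have "(LBINT r:{t..T}. K r + R r - c * (u r)\<^sup>2) = (LBINT r:{t..T}. K r + R r) - ?Iu2"
      by (intro diff(2) add(1) K R cu2)
    also have "(LBINT r:{t..T}. K r + R r) = ?IK + ?IR" by (rule add(2)[OF K R])
    finally show ?thesis by simp
  qed
  have xi: "(LBINT r:{t..T}. \<xi> r * u r) = 2 * \<phi> * \<rho> * ?Im - (\<sigma> * w T * ?Iu - \<sigma> * ?Iw)"
  proof -
    have "(LBINT r:{t..T}. \<xi> r * u r) = (LBINT r:{t..T}. 2 * \<phi> * \<rho> * (m r * u r) - (\<sigma> * w T * u r - \<sigma> * (w r * u r)))"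
      by (intro set_lebesgue_integral_cong) (auto simp: \<xi>_def algebra_simps)
    also have "\<dots> = (LBINT r:{t..T}. 2 * \<phi> * \<rho> * (m r * u r)) - (LBINT r:{t..T}. \<sigma> * w T * u r - \<sigma> * (w r * u r))"
      by (intro diff set_integrable_mult_right mu u wu)
    also have "(LBINT r:{t..T}. \<sigma> * w T * u r - \<sigma> * (w r * u r)) = (LBINT r:{t..T}. \<sigma> * w T * u r) - (LBINT r:{t..T}. \<sigma> * (w r * u r))"
      by (intro diff set_integrable_mult_right u wu)
    finally show ?thesis by simp
  qed
  have zz: "(LBINT r:{t..T}. z r * \<zeta> r - c * (z r)\<^sup>2) = ?Iz - ?Iz2" by (rule diff(2)[OF z\<zeta>i cz2])
  have IuQ: "?Iu = q - Q T" by (simp add: Q_def)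
  have key: "?IQ = (q\<^sup>2 - (Q T)\<^sup>2) / 2" using QQ2 by simp
  have "\<alpha> = p T + b / 2" by (simp add: p_T)
  have fin: "p T * (Q T)\<^sup>2 = p t * q\<^sup>2 - (?Iu2 - ?Iz2)" by (rule pT)
  have lin': "2 * \<phi> * \<rho> * ?Im - (\<sigma> * w T * (q - Q T) - \<sigma> * ?Iw) = p t * q * \<Xi> t / c + ?Iz"
    using lin xi unfolding IuQ by simp
  have "x + ((S - b * q - \<sigma> * w t) * (q - Q T) + (b * ((q\<^sup>2 - (Q T)\<^sup>2) / 2) + (\<sigma> * ?Iw - ?IK)))
     + Q T * ((S - b * (q - Q T) + \<sigma> * (w T - w t)) - (p T + b / 2) * Q T) - ?IR
   = x + q * S - b / 2 * q\<^sup>2 + \<sigma> * q * (w T - w t) - p T * (Q T)\<^sup>2 + (\<sigma> * ?Iw - \<sigma> * w T * (q - Q T)) - ?IK - ?IR"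
    by (simp add: field_simps power2_eq_square)
  also have "\<dots> = x + q * S - (b / 2 + p t) * q\<^sup>2 + \<sigma> * q * (w T - w t) + p t * q * \<Xi> t / c + (?Iz - ?Iz2)
     - (?IK + ?IR - ?Iu2 + 2 * \<phi> * \<rho> * ?Im)"
    unfolding fin using lin' by (simp add: algebra_simps)
  finally show "x + (LBINT r:{t..T}. (S - b * (LBINT s:{t..r}. u s) + \<sigma> * (w r - w t)) * u r - K r)
     + Q T * ((S - b * (LBINT s:{t..T}. u s) + \<sigma> * (w T - w t)) - \<alpha> * Q T) - (LBINT r:{t..T}. R r)
   = x + q * S - (b / 2 + p t) * q\<^sup>2 + \<sigma> * q * (w T - w t) + p t * q * \<Xi> t / c
     + (LBINT r:{t..T}. z r * \<zeta> r - c * (z r)\<^sup>2)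
     - (LBINT r:{t..T}. K r + R r - c * (u r)\<^sup>2 + 2 * \<phi> * \<rho> * m r * u r)"
    unfolding X KR zz key \<open>\<alpha> = p T + b / 2\<close> unfolding IuQ .
qed

text \<open>The running cost of a density exceeds that of the normal density with the same mean by
  \<open>\<gamma>\<close> times the relative entropy.\<close>

lemma running_cost:
  fixes f :: "real \<Rightarrow> real" and S \<mu> :: real
  assumes fm: "(\<lambda>v. indicator \<A> v * f v) \<in> borel_measurable borel"
    and f0: "\<And>v. v \<in> \<A> \<Longrightarrow> 0 \<le> f v" and fi: "L1_on \<A> f" and f1: "(LBINT v:\<A>. f v) = 1"
    and v1: "L1_on \<A> (\<lambda>v. v * f v)"
    and v2: "L1_on \<A> (\<lambda>v. (S - k * v) * v * f v)"
    and R: "L1_on \<A> (\<lambda>v. (\<phi> * (v - \<rho> * \<mu>)\<^sup>2 + \<gamma> * ln (f v)) * f v)"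
  defines "m \<equiv> LBINT v:\<A>. v * f v"
  shows "S * m - (LBINT v:\<A>. (S - k * v) * v * f v) + (LBINT v:\<A>. (\<phi> * (v - \<rho> * \<mu>)\<^sup>2 + \<gamma> * ln (f v)) * f v)
      = c * m\<^sup>2 - 2 * \<phi> * \<rho> * \<mu> * m + \<phi> * \<rho>\<^sup>2 * \<mu>\<^sup>2 + entropy_const + \<gamma> * (LBINT v:\<A>. kl_integrand m sd f v)"
    and "0 \<le> (LBINT v:\<A>. kl_integrand m sd f v)"
proof -
  note add = set_integral_add and diff = set_integral_diff
  let ?h = "normal_density m sd"
  have hi: "L1_on \<A> ?h"
    using sd_pos unfolding set_integrable_def by (intro integrable_mult_indicator) auto
  have h1: "(LBINT v:\<A>. ?h v) = 1"
  proof -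
    have "(LBINT v:\<A>. ?h v) = (LINT v|lborel. ?h v)"
      unfolding set_lebesgue_integral_def using A_full
      by (intro integral_cong_AE) (auto elim!: eventually_mono)
    then show ?thesis using sd_pos by simp
  qed
  let ?C1 = "2 * c * m - 2 * \<phi> * \<rho> * \<mu>" and ?C0 = "\<phi> * \<rho>\<^sup>2 * \<mu>\<^sup>2 - c * m\<^sup>2 + entropy_const"
  have e: "S * (v * f v) - (S - k * v) * v * f v + (\<phi> * (v - \<rho> * \<mu>)\<^sup>2 + \<gamma> * ln (f v)) * f v
     = ?C1 * (v * f v) + ?C0 * f v + \<gamma> * (f v - ?h v) + \<gamma> * kl_integrand m sd f v" for v
  proof -
    have "S * (v * f v) - (S - k * v) * v * f v + (\<phi> * (v - \<rho> * \<mu>)\<^sup>2 + \<gamma> * ln (f v)) * f v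
      = (c * (v - m)\<^sup>2 + \<gamma> * ln (f v)) * f v + ?C1 * (v * f v) + (\<phi> * \<rho>\<^sup>2 * \<mu>\<^sup>2 - c * m\<^sup>2) * f v"
      unfolding c_def by (simp add: power2_eq_square algebra_simps)
    also have "(c * (v - m)\<^sup>2 + \<gamma> * ln (f v)) * f v = entropy_const * f v + \<gamma> * (f v - ?h v) + \<gamma> * kl_integrand m sd f v"
      unfolding entropy_const_def by (rule quadratic_plus_entropy[OF c_pos \<gamma>_pos])
    finally show ?thesis by (simp add: algebra_simps)
  qed
  have tot: "L1_on \<A> (\<lambda>v. S * (v * f v) - (S - k * v) * v * f v + (\<phi> * (v - \<rho> * \<mu>)\<^sup>2 + \<gamma> * ln (f v)) * f v)"
    by (intro add diff set_integrable_mult_right v1 v2 R)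
  have rest: "L1_on \<A> (\<lambda>v. ?C1 * (v * f v) + ?C0 * f v + \<gamma> * (f v - ?h v))"
    by (intro add diff set_integrable_mult_right v1 fi hi)
  have gkl: "L1_on \<A> (\<lambda>v. \<gamma> * kl_integrand m sd f v)"
    using diff(1)[OF tot rest] unfolding e by simp
  have "(LBINT v:\<A>. S * (v * f v) - (S - k * v) * v * f v + (\<phi> * (v - \<rho> * \<mu>)\<^sup>2 + \<gamma> * ln (f v)) * f v)
     = (LBINT v:\<A>. ?C1 * (v * f v) + ?C0 * f v + \<gamma> * (f v - ?h v)) + (LBINT v:\<A>. \<gamma> * kl_integrand m sd f v)"
    unfolding e by (rule add(2)[OF rest gkl])
  also have "(LBINT v:\<A>. ?C1 * (v * f v) + ?C0 * f v + \<gamma> * (f v - ?h v))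
     = (LBINT v:\<A>. ?C1 * (v * f v) + ?C0 * f v) + (LBINT v:\<A>. \<gamma> * (f v - ?h v))"
    by (intro add(2) add(1) diff set_integrable_mult_right v1 fi hi)
  also have "(LBINT v:\<A>. ?C1 * (v * f v) + ?C0 * f v) = (LBINT v:\<A>. ?C1 * (v * f v)) + (LBINT v:\<A>. ?C0 * f v)"
    by (intro add(2) set_integrable_mult_right v1 fi)
  also have "(LBINT v:\<A>. \<gamma> * (f v - ?h v)) = \<gamma> * ((LBINT v:\<A>. f v) - (LBINT v:\<A>. ?h v))"
    by (simp only: set_integral_mult_right diff(2)[OF fi hi])
  finally have R1: "(LBINT v:\<A>. S * (v * f v) - (S - k * v) * v * f v + (\<phi> * (v - \<rho> * \<mu>)\<^sup>2 + \<gamma> * ln (f v)) * f v)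
     = ?C1 * m + ?C0 + \<gamma> * (LBINT v:\<A>. kl_integrand m sd f v)"
    unfolding set_integral_mult_right f1 h1 m_def[symmetric] by simp
  have "(LBINT v:\<A>. S * (v * f v) - (S - k * v) * v * f v + (\<phi> * (v - \<rho> * \<mu>)\<^sup>2 + \<gamma> * ln (f v)) * f v)
     = (LBINT v:\<A>. S * (v * f v) - (S - k * v) * v * f v) + (LBINT v:\<A>. (\<phi> * (v - \<rho> * \<mu>)\<^sup>2 + \<gamma> * ln (f v)) * f v)"
    by (intro add(2) diff set_integrable_mult_right v1 v2 R)
  also have "(LBINT v:\<A>. S * (v * f v) - (S - k * v) * v * f v) = (LBINT v:\<A>. S * (v * f v)) - (LBINT v:\<A>. (S - k * v) * v * f v)"
    by (intro diff(2) set_integrable_mult_right v1 v2)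
  also have "(LBINT v:\<A>. S * (v * f v)) = S * m" unfolding m_def by (rule set_integral_mult_right)
  finally have R2: "?C1 * m + ?C0 + \<gamma> * (LBINT v:\<A>. kl_integrand m sd f v)
     = S * m - (LBINT v:\<A>. (S - k * v) * v * f v) + (LBINT v:\<A>. (\<phi> * (v - \<rho> * \<mu>)\<^sup>2 + \<gamma> * ln (f v)) * f v)"
    unfolding R1 .
  have "?C1 * m + ?C0 = c * m\<^sup>2 - 2 * \<phi> * \<rho> * \<mu> * m + \<phi> * \<rho>\<^sup>2 * \<mu>\<^sup>2 + entropy_const"
    by (simp add: algebra_simps power2_eq_square)
  then show "S * m - (LBINT v:\<A>. (S - k * v) * v * f v) + (LBINT v:\<A>. (\<phi> * (v - \<rho> * \<mu>)\<^sup>2 + \<gamma> * ln (f v)) * f v)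
      = c * m\<^sup>2 - 2 * \<phi> * \<rho> * \<mu> * m + \<phi> * \<rho>\<^sup>2 * \<mu>\<^sup>2 + entropy_const + \<gamma> * (LBINT v:\<A>. kl_integrand m sd f v)"
    using R2 by linarith
  show "0 \<le> (LBINT v:\<A>. kl_integrand m sd f v)"
    unfolding set_lebesgue_integral_def
    using f0 sd_pos by (intro integral_nonneg_AE AE_I2) (auto simp: indicator_def intro!: kl_integrand_nonneg)
qed

end

section \<open>Verification\<close>

context liquidation_noise
begin

text \<open>The three variables are linear in the increments of the noise after \<open>r\<close>, which are
  centred and independent of the past. They are the random parts of \<open>\<zeta>\<close> at time
  \<open>r\<close>.\<close>

lemma future_uncorrelated:
  assumes r: "r \<in> {0..T}" and z: "z \<in> borel_measurable (F r)" and z2: "integrable M (\<lambda>\<omega>. (z \<omega>)\<^sup>2)"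
  shows "integrable M (\<lambda>\<omega>. z \<omega> * (W T \<omega> - W r \<omega>))" "\<E> (\<lambda>\<omega>. z \<omega> * (W T \<omega> - W r \<omega>)) = 0"
    "integrable M (\<lambda>\<omega>. z \<omega> * (LBINT s:{r..T}. W T \<omega> - W s \<omega>))"
    "\<E> (\<lambda>\<omega>. z \<omega> * (LBINT s:{r..T}. W T \<omega> - W s \<omega>)) = 0"
    "integrable M (\<lambda>\<omega>. z \<omega> * (LBINT s:{r..T}. exp (- \<kappa> * (T - s)) * Jc r s \<omega>))"
    "\<E> (\<lambda>\<omega>. z \<omega> * (LBINT s:{r..T}. exp (- \<kappa> * (T - s)) * Jc r s \<omega>)) = 0"
proof -
  have r0: "0 \<le> r" "r \<le> T" using r by auto
  have zM: "z \<in> borel_measurable M" by (rule F_measurable[OF z])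
  have zi: "integrable M z" by (rule integrable_square_imp_integrable[OF zM z2])
  show "integrable M (\<lambda>\<omega>. z \<omega> * (W T \<omega> - W r \<omega>))" "\<E> (\<lambda>\<omega>. z \<omega> * (W T \<omega> - W r \<omega>)) = 0"
    by (rule increment_uncorrelated[OF r0 z zi])+
  have cl [measurable]: "clamp_Icc a d \<in> borel_measurable borel" for a d unfolding clamp_Icc_def[abs_def] by measurable
  note [measurable] = pair_F_measurable[OF J_joint_measurable[OF r0]] pair_F_measurable[OF W_joint_measurable[OF r0]]
    adapted(3)[OF r0(1)] adapted(1)[of T]
  have WT [measurable]: "W T \<in> borel_measurable M" using T_pos by (intro adapted) simp
  define X where "X s \<omega> = W T \<omega> - W (clamp_Icc r T s) \<omega>" for s \<omega>
  define X' where "X' s \<omega> = J (clamp_Icc r T s) \<omega> - J r \<omega> - lam * \<eta>1 * (s - r)" for s \<omega>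
  have Xm: "(\<lambda>(s, \<omega>). X s \<omega>) \<in> borel_measurable (borel \<Otimes>\<^sub>M M)" unfolding X_def by measurable
  have X'm: "(\<lambda>(s, \<omega>). X' s \<omega>) \<in> borel_measurable (borel \<Otimes>\<^sub>M M)" unfolding X'_def by measurable
  have X2: "integrable M (\<lambda>\<omega>. (X s \<omega>)\<^sup>2)" "\<E> (\<lambda>\<omega>. (X s \<omega>)\<^sup>2) \<le> T"
    "\<E> (\<lambda>\<omega>. z \<omega> * X s \<omega>) = 0" if s: "s \<in> {r..T}" for s
  proof -
    have s0: "0 \<le> s" "s \<le> T" using s r by auto
    have e: "X s = (\<lambda>\<omega>. W T \<omega> - W s \<omega>)" using s by (simp add: X_def[abs_def])
    show "integrable M (\<lambda>\<omega>. (X s \<omega>)\<^sup>2)" unfolding e by (rule increment_moments(7)[OF s0])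
    show "\<E> (\<lambda>\<omega>. (X s \<omega>)\<^sup>2) \<le> T" unfolding e increment_moments(8)[OF s0] using s0 by simp
    have "z \<in> borel_measurable (F s)" using s by (intro F_mono_measurable[OF z]) auto
    then show "\<E> (\<lambda>\<omega>. z \<omega> * X s \<omega>) = 0" unfolding e by (rule increment_uncorrelated(4)[OF s0 _ zi])
  qed
  have th: "0 \<le> lam * \<eta>2" using eta2_nonneg rate_pos by simp
  have X'2: "integrable M (\<lambda>\<omega>. (X' s \<omega>)\<^sup>2)" "\<E> (\<lambda>\<omega>. (X' s \<omega>)\<^sup>2) \<le> lam * \<eta>2 * T"
    "\<E> (\<lambda>\<omega>. z \<omega> * X' s \<omega>) = 0" if s: "s \<in> {r..T}" for s
  proof -
    have rs: "r \<le> s" using s by simp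
    have e: "X' s = Jc r s" using s by (simp add: X'_def[abs_def] Jc_def[abs_def])
    show "integrable M (\<lambda>\<omega>. (X' s \<omega>)\<^sup>2)" unfolding e by (rule Jc_covariance(1)[OF r0(1) rs order_refl])
    have "lam * \<eta>2 * (s - r) \<le> lam * \<eta>2 * T" using s r th by (intro mult_left_mono) auto
    then show "\<E> (\<lambda>\<omega>. (X' s \<omega>)\<^sup>2) \<le> lam * \<eta>2 * T"
      unfolding e Jc_covariance(3)[OF r0(1) rs order_refl] .
    note u = increment_uncorrelated[OF r0(1) rs z zi]
    have "\<E> (\<lambda>\<omega>. z \<omega> * X' s \<omega>) = \<E> (\<lambda>\<omega>. z \<omega> * (J s \<omega> - J r \<omega>) - lam * \<eta>1 * (s - r) * z \<omega>)"
      unfolding e Jc_def by (intro Bochner_Integration.integral_cong) (auto simp: algebra_simps)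
    also have "\<dots> = \<E> (\<lambda>\<omega>. z \<omega> * (J s \<omega> - J r \<omega>)) - \<E> (\<lambda>\<omega>. lam * \<eta>1 * (s - r) * z \<omega>)"
      by (intro Bochner_Integration.integral_diff u integrable_mult_right zi)
    finally show "\<E> (\<lambda>\<omega>. z \<omega> * X' s \<omega>) = 0" unfolding u by simp
  qed
  have o: "(\<lambda>_::real. 1::real) \<in> borel_measurable borel" by simp
  have km: "(\<lambda>s. exp (- \<kappa> * (T - s))) \<in> borel_measurable borel" by measurable
  have e1: "(LBINT s:{r..T}. W T \<omega> - W s \<omega>) = (LBINT s:{r..T}. 1 * X s \<omega>)" for \<omega>
    by (intro set_lebesgue_integral_cong) (auto simp: X_def)
  have e2: "(LBINT s:{r..T}. exp (- \<kappa> * (T - s)) * Jc r s \<omega>) = (LBINT s:{r..T}. exp (- \<kappa> * (T - s)) * X' s \<omega>)" for \<omega>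
    by (intro set_lebesgue_integral_cong) (auto simp: X'_def Jc_def)
  have z1: "(LBINT s:{r..T}. 1 * \<E> (\<lambda>\<omega>. z \<omega> * X s \<omega>)) = (LBINT s:{r..T}. 0)"
    by (intro set_lebesgue_integral_cong) (auto simp: X2)
  have z2': "(LBINT s:{r..T}. exp (- \<kappa> * (T - s)) * \<E> (\<lambda>\<omega>. z \<omega> * X' s \<omega>)) = (LBINT s:{r..T}. 0)"
    by (intro set_lebesgue_integral_cong) (auto simp: X'2)
  note L1 = time_integral_L2(4,5)[OF r0(2) Xm o, of 1 T z, OF _ X2(1,2) zM z2]
  note L2 = time_integral_L2(4,5)[OF r0(2) X'm km exp_bound_Icc X'2(1,2) zM z2]
  show "integrable M (\<lambda>\<omega>. z \<omega> * (LBINT s:{r..T}. W T \<omega> - W s \<omega>))"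
    "\<E> (\<lambda>\<omega>. z \<omega> * (LBINT s:{r..T}. W T \<omega> - W s \<omega>)) = 0"
    unfolding e1 using L1 z1 by auto
  show "integrable M (\<lambda>\<omega>. z \<omega> * (LBINT s:{r..T}. exp (- \<kappa> * (T - s)) * Jc r s \<omega>))"
    "\<E> (\<lambda>\<omega>. z \<omega> * (LBINT s:{r..T}. exp (- \<kappa> * (T - s)) * Jc r s \<omega>)) = 0"
    unfolding e2 using L2 z2' by auto
qed

text \<open>Along the moment equations of \<open>\<mu>\<close>, the function
  \<open>- (a2 E \<mu>\<^sup>2 + a1 E \<mu> + a0)\<close> has the integrand as its derivative.\<close>

lemma speed_value_eq:
  assumes t: "t \<in> {0..T}"
  shows "(LBINT r:{t..T}. g2 r * mu_second t \<mu> r + g1 r * mu_mean t \<mu> r + g0 r) = speed_value t \<mu>"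
proof -
  have tT: "t \<le> T" and sub: "{t..T} \<subseteq> {0..T}" using t by auto
  let ?G = "\<lambda>r. g2 r * mu_second t \<mu> r + g1 r * mu_mean t \<mu> r + g0 r"
  let ?F = "\<lambda>r. - (a2 r * mu_second t \<mu> r + a1 r * mu_mean t \<mu> r + a0 r)"
  have d: "(?F has_real_derivative ?G r) (at r within {t..T})" if r: "r \<in> {t..T}" for r
  proof -
    have r': "r \<in> {0..T}" using r sub by auto
    note a = a_deriv[OF r', THEN DERIV_subset, OF sub]
    have "(?F has_real_derivative - (((2 * \<kappa> * a2 r - g2 r) * mu_second t \<mu> r + (lam * \<eta>2 + 2 * lam * \<eta>1 * mu_mean t \<mu> r - 2 * \<kappa> * mu_second t \<mu> r) * a2 r)
       + ((\<kappa> * a1 r - (g1 r + 2 * lam * \<eta>1 * a2 r)) * mu_mean t \<mu> r + (lam * \<eta>1 - \<kappa> * mu_mean t \<mu> r) * a1 r)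
       + (- (g0 r + lam * \<eta>1 * a1 r + lam * \<eta>2 * a2 r)))) (at r within {t..T})"
      by (intro DERIV_minus DERIV_add DERIV_mult a mu_second_deriv mu_mean_deriv)
    then show ?thesis by (rule DERIV_cong) (simp add: algebra_simps)
  qed
  have c: "continuous_on {t..T} ?G"
    by (intro continuous_intros mu_second_continuous mu_mean_continuous continuous_on_subset[OF _ sub] g_continuous)
  have "?F T = ?F t + (LBINT r:{t..T}. ?G r)" by (rule FTC_set_integral(2)[OF tT d c])
  moreover have "?F T = 0" by (simp add: a_T)
  moreover have "?F t = - speed_value t \<mu>" by (simp add: speed_value_def mu_mean_def mu_second_def)
  ultimately show ?thesis by simp
qed

end

lemma borel_measurable_state [measurable]:
  "cash \<in> borel_measurable borel" "midprice \<in> borel_measurable borel"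
  "speed \<in> borel_measurable borel" "inventory \<in> borel_measurable borel"
  by (auto intro!: borel_measurable_continuous_onI continuous_intros
      simp: cash_def midprice_def speed_def inventory_def case_prod_unfold)

lemma continuous_on_state: "continuous_on UNIV cash" "continuous_on UNIV midprice"
  "continuous_on UNIV speed" "continuous_on UNIV inventory"
  by (auto intro!: continuous_intros simp: cash_def midprice_def speed_def inventory_def case_prod_unfold)

text \<open>A weak solution, started at time \<open>t0\<close>, for an arbitrary admissible policy.\<close>

locale controlled = liquidation_noise P M F W N \<eta>
  for P :: model and M :: "'a measure" and F W N \<eta> +
  fixes \<pi> :: policy and t0 x0 S0 m0 q0 :: real and Y :: "real \<Rightarrow> 'a \<Rightarrow> state"
  assumes adm: "\<pi> \<in> admissible_policies TYPE('a) P" and t0: "t0 \<in> {0..T_of P}"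
    and sol: "weak_solution P \<pi> t0 (x0, S0, m0, q0) M F W N \<eta> Y"
begin

lemma t0_nonneg: "0 \<le> t0" and t0_le: "t0 \<le> T" and I0: "{t0..T} \<subseteq> {0..T}"
  using t0 by auto

text \<open>Extension by \<open>0\<close>, which makes the policy measurable on the whole space.\<close>

definition ext_policy :: "real \<times> state \<times> real \<Rightarrow> real" where
  "ext_policy z = indicator ({0..T} \<times> UNIV \<times> \<A>) z * (case z of (t, y, v) \<Rightarrow> \<pi> t y v)"

lemma ext_policy_measurable [measurable]: "ext_policy \<in> borel_measurable (borel \<Otimes>\<^sub>M borel \<Otimes>\<^sub>M borel)"
proof -
  have "(\<lambda>(t, y, v). \<pi> t y v) \<in> borel_measurable (restrict_space borel ({0..T} \<times> UNIV \<times> \<A>))"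
    using adm by (simp add: admissible_policies_def)
  moreover have "{0..T} \<times> (UNIV :: state set) \<times> \<A> \<in> sets borel"
    by (intro borel_Times) auto
  ultimately have "(\<lambda>z. indicator ({0..T} \<times> UNIV \<times> \<A>) z *\<^sub>R (case z of (t, y, v) \<Rightarrow> \<pi> t y v)) \<in> borel_measurable borel"
    by (subst (asm) borel_measurable_restrict_space_iff) auto
  then show ?thesis by (simp add: ext_policy_def[abs_def] borel_prod)
qed

lemma ext_policy_eq: "t \<in> {0..T} \<Longrightarrow> ext_policy (t, y, v) = indicator \<A> v * \<pi> t y v"
  by (auto simp: ext_policy_def indicator_def)

lemma density:
  assumes "t \<in> {0..T}"
  shows "v \<in> \<A> \<Longrightarrow> 0 \<le> \<pi> t y v" "L1_on \<A> (\<pi> t y)" "(LBINT v:\<A>. \<pi> t y v) = 1"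
  using adm assms unfolding admissible_policies_def by blast+

definition mrate :: "real \<times> state \<Rightarrow> real" where
  "mrate z = (\<integral>v. v * ext_policy (fst z, snd z, v) \<partial>lborel)"
definition crate :: "real \<times> state \<Rightarrow> real" where
  "crate z = (\<integral>v. (midprice (snd z) - k * v) * v * ext_policy (fst z, snd z, v) \<partial>lborel)"
definition rrate :: "real \<times> state \<Rightarrow> real" where
  "rrate z = (\<integral>v. (\<phi> * (v - \<rho> * speed (snd z))\<^sup>2 + \<gamma> * ln (ext_policy (fst z, snd z, v))) * ext_policy (fst z, snd z, v) \<partial>lborel)"

lemma rates_measurable [measurable]: "mrate \<in> borel_measurable (borel \<Otimes>\<^sub>M borel)"
  "crate \<in> borel_measurable (borel \<Otimes>\<^sub>M borel)" "rrate \<in> borel_measurable (borel \<Otimes>\<^sub>M borel)"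
  unfolding mrate_def[abs_def] crate_def[abs_def] rrate_def[abs_def] by measurable

lemma rates_eq:
  assumes "t \<in> {0..T}"
  shows "mrate (t, y) = mean_rate P \<pi> t y" "crate (t, y) = cash_rate P \<pi> t y"
    "rrate (t, y) = (LBINT v:\<A>. (\<phi> * (v - \<rho> * speed y)\<^sup>2 + \<gamma> * ln (\<pi> t y v)) * \<pi> t y v)"
  unfolding mrate_def crate_def rrate_def mean_rate_def cash_rate_def set_lebesgue_integral_def fst_conv snd_conv ext_policy_eq[OF assms]
  by (intro Bochner_Integration.integral_cong refl, simp add: indicator_def)+

text \<open>The growth condition on admissible policies: the running cost is integrable over the actions, and
  bounded along a path because cadlag paths are bounded.\<close>

lemma running_cost_bound:
  obtains C r where "0 < C" "1 \<le> r"
    "\<And>t y. t \<in> {0..T} \<Longrightarrow> \<bar>rrate (t, y)\<bar> \<le> C * (1 + norm y powr r)"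
    "\<And>t y. t \<in> {0..T} \<Longrightarrow> L1_on \<A> (\<lambda>v. (\<phi> * (v - \<rho> * speed y)\<^sup>2 + \<gamma> * ln (\<pi> t y v)) * \<pi> t y v)"
proof -
  obtain C r where C: "0 < C" "1 \<le> r" and le: "\<And>t y. t \<in> {0..T} \<Longrightarrow>
     (\<integral>\<^sup>+v\<in>\<A>. ennreal (\<bar>\<phi> * (v - \<rho> * speed y)\<^sup>2 + \<gamma> * ln (\<pi> t y v)\<bar> * \<pi> t y v) \<partial>lborel) \<le> ennreal (C * (1 + norm y powr r))"
    using adm unfolding admissible_policies_def by blast
  show ?thesis
  proof (rule that[OF C])
    fix t y assume t: "t \<in> {0..T}"
    let ?f = "\<lambda>v. indicator \<A> v * ((\<phi> * (v - \<rho> * speed y)\<^sup>2 + \<gamma> * ln (\<pi> t y v)) * \<pi> t y v)"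
    have f: "?f v = (\<phi> * (v - \<rho> * speed y)\<^sup>2 + \<gamma> * ln (ext_policy (t, y, v))) * ext_policy (t, y, v)" for v
      unfolding ext_policy_eq[OF t] by (simp add: indicator_def)
    have [measurable]: "(\<lambda>v. ext_policy (t, y, v)) \<in> borel_measurable borel" by measurable
    have fm: "?f \<in> borel_measurable lborel" unfolding f by measurable
    have "(\<integral>\<^sup>+v. ennreal (norm (?f v)) \<partial>lborel) = (\<integral>\<^sup>+v\<in>\<A>. ennreal (\<bar>\<phi> * (v - \<rho> * speed y)\<^sup>2 + \<gamma> * ln (\<pi> t y v)\<bar> * \<pi> t y v) \<partial>lborel)"
      using density(1)[OF t] by (intro nn_integral_cong) (auto simp: indicator_def abs_mult)
    also have "\<dots> \<le> ennreal (C * (1 + norm y powr r))" by (rule le[OF t])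
    finally have n: "(\<integral>\<^sup>+v. ennreal (norm (?f v)) \<partial>lborel) \<le> ennreal (C * (1 + norm y powr r))" .
    then have fi: "integrable lborel ?f"
      using fm by (intro integrableI_bounded) (auto simp: top_unique less_top[symmetric])
    then show "L1_on \<A> (\<lambda>v. (\<phi> * (v - \<rho> * speed y)\<^sup>2 + \<gamma> * ln (\<pi> t y v)) * \<pi> t y v)"
      by (simp add: set_integrable_def)
    have "rrate (t, y) = (\<integral>v. ?f v \<partial>lborel)"
      unfolding rates_eq[OF t] set_lebesgue_integral_def by simp
    then have "ennreal \<bar>rrate (t, y)\<bar> \<le> (\<integral>\<^sup>+v. ennreal (norm (?f v)) \<partial>lborel)"
      using integral_norm_bound_ennreal[OF fi] by simp
    also note n
    finally show "\<bar>rrate (t, y)\<bar> \<le> C * (1 + norm y powr r)"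
      using C by (subst (asm) ennreal_le_iff) (auto intro!: mult_nonneg_nonneg add_nonneg_nonneg)
  qed
qed

lemma Y_F: "u \<in> {t0..T} \<Longrightarrow> Y u \<in> borel_measurable (F u)"
  and Y_cadlag: "\<omega> \<in> space M \<Longrightarrow> cadlag_on t0 T (\<lambda>u. Y u \<omega>)"
  and Y_eq: "AE \<omega> in M. state_equation P \<pi> t0 (x0, S0, m0, q0) (\<lambda>u. W u \<omega>) (\<lambda>u. N u \<omega>) (\<lambda>i. \<eta> i \<omega>) (\<lambda>u. Y u \<omega>)"
  using sol unfolding weak_solution_def by blast+

definition Yc :: "real \<Rightarrow> 'a \<Rightarrow> state" where "Yc r = Y (clamp_Icc t0 T r)"

lemma Yc_measurable [measurable]: "jointly_measurable M Yc"
  unfolding Yc_def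
  by (intro cadlag_joint_measurable t0_le Y_cadlag F_measurable[OF Y_F])

lemma Yc_measurable_pair: "(\<lambda>z. (clamp_Icc t0 T (fst z), Yc (fst z) (snd z))) \<in> measurable (borel \<Otimes>\<^sub>M M) (borel \<Otimes>\<^sub>M borel)"
  using Yc_measurable by (simp add: case_prod_unfold)

lemma Yc_eq: "r \<in> {t0..T} \<Longrightarrow> Yc r = Y r" by (simp add: Yc_def)

text \<open>The processes of the verification argument. Time is clamped to \<open>[t0, T]\<close>, which makes
  each of them jointly measurable. The process \<open>z\<close> measures the deviation from trading at the
  rate \<open>p Q / c\<close>; \<open>\<zeta>\<close> multiplies it in the payoff, and \<open>\<zeta>b\<close>
  is the prediction of \<open>\<zeta>\<close> from the present.\<close>

definition u where "u r \<omega> = mrate (clamp_Icc t0 T r, Yc r \<omega>)"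
definition R where "R r \<omega> = rrate (clamp_Icc t0 T r, Yc r \<omega>)"
definition CR where "CR r \<omega> = crate (clamp_Icc t0 T r, Yc r \<omega>)"
definition m where "m r \<omega> = speed (Yc r \<omega>)"
definition Q where "Q r \<omega> = inventory (Yc r \<omega>)"
definition SS where "SS r \<omega> = midprice (Yc r \<omega>)"
definition Wc where "Wc r = W (clamp_Icc t0 T r)"
definition z where "z r \<omega> = u r \<omega> - p (clamp_Icc t0 T r) * Q r \<omega> / c"
definition \<xi> where "\<xi> r \<omega> = 2 * \<phi> * \<rho> * m r \<omega> - \<sigma> * (W T \<omega> - Wc r \<omega>)"
definition \<Xi> where "\<Xi> s \<omega> = (LBINT r:{s..T}. \<xi> r \<omega>)"
definition \<zeta> where "\<zeta> s \<omega> = \<xi> s \<omega> - p (clamp_Icc t0 T s) / c * \<Xi> s \<omega>"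
definition \<zeta>b where "\<zeta>b s \<omega> = drift_gain (clamp_Icc t0 T s) (m s \<omega>)"

lemma W_T_measurable [measurable]: "W T \<in> borel_measurable M"
  using T_pos by (intro adapted) simp

lemma Wc_measurable [measurable]: "jointly_measurable M Wc"
  unfolding Wc_def by (rule pair_F_measurable[OF W_joint_measurable[OF t0_nonneg t0_le]])

lemma u_measurable [measurable]: "jointly_measurable M u"
  and R_measurable [measurable]: "jointly_measurable M R"
  and CR_measurable [measurable]: "jointly_measurable M CR"
  unfolding u_def R_def CR_def case_prod_unfold
  by (rule measurable_compose[OF Yc_measurable_pair], measurable)+

lemma m_measurable [measurable]: "jointly_measurable M m"
  and Q_measurable [measurable]: "jointly_measurable M Q"
  and SS_measurable [measurable]: "jointly_measurable M SS"
  unfolding m_def Q_def SS_def using Yc_measurable by (auto simp: case_prod_unfold)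

lemma z_measurable [measurable]: "jointly_measurable M z"
  and \<xi>_measurable [measurable]: "jointly_measurable M \<xi>"
  and \<zeta>b_measurable [measurable]: "jointly_measurable M \<zeta>b"
  unfolding z_def \<xi>_def \<zeta>b_def by measurable

lemma \<Xi>_measurable [measurable]: "jointly_measurable M \<Xi>"
  unfolding \<Xi>_def set_lebesgue_integral_def indicator_def atLeastAtMost_iff by measurable

lemma \<zeta>_measurable [measurable]: "jointly_measurable M \<zeta>"
  unfolding \<zeta>_def by measurable

lemma section_measurable: "jointly_measurable M X \<Longrightarrow> X r \<in> borel_measurable M"
  for X :: "real \<Rightarrow> 'a \<Rightarrow> real"
  using measurable_compose[OF measurable_Pair1', of r borel "\<lambda>(r, \<omega>). X r \<omega>" M borel] by simp

lemma z_F: "r \<in> {t0..T} \<Longrightarrow> z r \<in> borel_measurable (F r)"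
  unfolding z_def u_def Q_def by (simp add: Yc_eq) (intro borel_measurable_diff borel_measurable_divide borel_measurable_times borel_measurable_const
    measurable_compose[OF _ rates_measurable(1)] measurable_Pair measurable_const Y_F measurable_compose[OF Y_F borel_measurable_state(4)], auto)


text \<open>The costs of a policy beyond its mean rate, and those that no policy avoids. The relative entropy
  is taken with respect to the normal density whose mean is the mean trading rate of the policy itself, not
  that of the optimal policy.\<close>

abbreviation "relative_entropy r \<omega> \<equiv> LBINT v:\<A>. kl_integrand (u r \<omega>) sd (\<pi> r (Y r \<omega>)) v"
abbreviation "idle_cost r \<omega> \<equiv> \<phi> * \<rho>\<^sup>2 * (m r \<omega>)\<^sup>2 + entropy_const"
abbreviation "reward \<omega> \<equiv> payoff P \<pi> t0 (\<lambda>u. Y u \<omega>)"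

text \<open>What remains of the running cost after \<open>c u\<^sup>2\<close> and its linear counterpart have
  been moved into the square: a term independent of the policy plus a relative entropy.\<close>

definition D where
  "D r \<omega> = (SS r \<omega> * u r \<omega> - CR r \<omega>) + R r \<omega> - c * (u r \<omega>)\<^sup>2 + 2 * \<phi> * \<rho> * m r \<omega> * u r \<omega>"

definition base where
  "base \<omega> = x0 + q0 * S0 - (b / 2 + p t0) * q0\<^sup>2 + \<sigma> * q0 * (W T \<omega> - W t0 \<omega>) + p t0 * q0 * \<Xi> t0 \<omega> / c"


text \<open>Almost every path satisfies the state equation, so that the deterministic identity applies to it,
  with the integrals over the actions evaluated at almost every time. The rate \<open>u\<close> is square
  integrable on the path because the relative entropy is non-negative, which bounds \<open>c u\<^sup>2\<close>
  by rates of cost that are integrable.\<close>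

lemma path_identity:
  "AE \<omega> in M.
     (\<forall>r\<in>{t0..T}. m r \<omega> = mu_path t0 m0 r \<omega>) \<and>
     L1_on {t0..T} (\<lambda>r. m r \<omega>) \<and>
     L1_on {t0..T} (\<lambda>r. (m r \<omega>)\<^sup>2) \<and>
     L1_on {t0..T} (\<lambda>r. \<xi> r \<omega>) \<and>
     L1_on {t0..T} (\<lambda>r. (\<zeta> r \<omega>)\<^sup>2) \<and>
     L1_on {t0..T} (\<lambda>r. (\<zeta>b r \<omega>)\<^sup>2) \<and>
     L1_on {t0..T} (\<lambda>r. (z r \<omega>)\<^sup>2) \<and>
     L1_on {t0..T} (\<lambda>r. z r \<omega> * \<zeta> r \<omega>) \<and>
     L1_on {t0..T} (\<lambda>r. D r \<omega>) \<and>
     (AE r in lborel. r \<in> {t0..T} \<longrightarrow>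
        D r \<omega> = idle_cost r \<omega> + \<gamma> * relative_entropy r \<omega> \<and>
        0 \<le> relative_entropy r \<omega>) \<and>
     reward \<omega> = base \<omega> + (LBINT r:{t0..T}. z r \<omega> * \<zeta> r \<omega> - c * (z r \<omega>)\<^sup>2)
       - (LBINT r:{t0..T}. D r \<omega>)"
  using Y_eq AE_space
proof eventually_elim
  case (elim \<omega>)
  have \<omega>: "\<omega> \<in> space M" by (rule elim(2))
  note tT = t0_le
  have I: "r \<in> {0..T}" if "r \<in> {t0..T}" for r using that I0 by auto
  define Yw where "Yw r = Y r \<omega>" for r
  have uY: "u r \<omega> = mean_rate P \<pi> r (Yw r)" and CRY: "CR r \<omega> = cash_rate P \<pi> r (Yw r)"
    and RY: "R r \<omega> = (LBINT v:\<A>. (\<phi> * (v - \<rho> * speed (Yw r))\<^sup>2 + \<gamma> * ln (\<pi> r (Yw r) v)) * \<pi> r (Yw r) v)"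
    and mY: "m r \<omega> = speed (Yw r)" and QY: "Q r \<omega> = inventory (Yw r)" and SY: "SS r \<omega> = midprice (Yw r)"
    and WY: "Wc r \<omega> = W r \<omega>" if r: "r \<in> {t0..T}" for r
    using r rates_eq[OF I[OF r]] by (auto simp: u_def CR_def R_def m_def Q_def SS_def Wc_def Yc_eq Yw_def)
  have se: "AE r in lborel. r \<in> {t0..T} \<longrightarrow>
        L1_on \<A> (\<lambda>v. v * \<pi> r (Yw r) v) \<and>
        L1_on \<A> (\<lambda>v. (midprice (Yw r) - k * v) * v * \<pi> r (Yw r) v)"
    and mri: "L1_on {t0..T} (\<lambda>r. mean_rate P \<pi> r (Yw r))"
    and cri: "L1_on {t0..T} (\<lambda>r. cash_rate P \<pi> r (Yw r))"
    and seq: "\<And>s. s \<in> {t0..T} \<Longrightarrow> inventory (Yw s) = q0 - (LBINT r:{t0..s}. mean_rate P \<pi> r (Yw r)) \<and>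
        midprice (Yw s) = S0 - b * (LBINT r:{t0..s}. mean_rate P \<pi> r (Yw r)) + \<sigma> * (W s \<omega> - W t0 \<omega>) \<and>
        cash (Yw s) = x0 + (LBINT r:{t0..s}. cash_rate P \<pi> r (Yw r)) \<and>
        speed (Yw s) = m0 - \<kappa> * (LBINT r:{t0..s}. speed (Yw r)) + jump_integral (\<lambda>r. N r \<omega>) (\<lambda>i. \<eta> i \<omega>) t0 s"
    using elim(1) unfolding state_equation_def Yw_def
    by (auto simp: inventory_def[of] midprice_def cash_def speed_def)
  have cad: "cadlag_on t0 T Yw" unfolding Yw_def[abs_def] by (rule Y_cadlag[OF \<omega>])
  note cads = cadlag_on_continuous[OF cad continuous_on_state(2)] cadlag_on_continuous[OF cad continuous_on_state(3)]
  have mi: "L1_on {t0..T} (\<lambda>r. m r \<omega>)"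
    using cadlag_set_integrable[OF tT cads(2)] by (rule set_integrable_transfer) (simp add: mY)
  obtain B where B: "\<bar>m r \<omega>\<bar> \<le> B" if "r \<in> {t0..T}" for r
    using cadlag_bounded[OF cads(2)] mY by (metis real_norm_def)
  have Wcad: "cadlag_on t0 T (\<lambda>r. W r \<omega>)"
    by (intro continuous_imp_cadlag continuous_on_subset[OF W_continuous[OF \<omega>]]) (use t0_nonneg in auto)
  have Wi: "L1_on {t0..T} (\<lambda>r. W r \<omega>)" by (rule cadlag_set_integrable[OF tT Wcad])
  obtain B' where B': "\<bar>W r \<omega>\<bar> \<le> B'" if "r \<in> {t0..T}" for r
    using cadlag_bounded[OF Wcad] by (metis real_norm_def)
  have ui: "L1_on {t0..T} (\<lambda>r. u r \<omega>)"
    using mri by (rule set_integrable_transfer) (simp add: uY)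
  have CRi: "L1_on {t0..T} (\<lambda>r. CR r \<omega>)"
    using cri by (rule set_integrable_transfer) (simp add: CRY)
  have Si: "L1_on {t0..T} (\<lambda>r. SS r \<omega>)"
    using cadlag_set_integrable[OF tT cads(1)] by (rule set_integrable_transfer) (simp add: SY)
  obtain B2 where B2: "\<bar>SS r \<omega>\<bar> \<le> B2" if "r \<in> {t0..T}" for r
    using cadlag_bounded[OF cads(1)] SY by (metis real_norm_def)
  have Sui: "L1_on {t0..T} (\<lambda>r. SS r \<omega> * u r \<omega>)" by (rule set_integrable_mult_bounded[OF ui Si B2])
  have Ki: "L1_on {t0..T} (\<lambda>r. SS r \<omega> * u r \<omega> - CR r \<omega>)"
    by (intro set_integral_diff CRi set_integrable_mult_bounded[OF ui Si B2])
  have Ri: "L1_on {t0..T} (\<lambda>r. R r \<omega>)"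
  proof -
    obtain C e where C: "0 < C" "1 \<le> e" "\<And>t y. t \<in> {0..T} \<Longrightarrow> \<bar>rrate (t, y)\<bar> \<le> C * (1 + norm y powr e)"
      by (rule running_cost_bound) blast
    obtain B3 where B3: "\<And>r. r \<in> {t0..T} \<Longrightarrow> norm (Yw r) \<le> B3" by (rule cadlag_bounded[OF cad]) blast
    show ?thesis
    proof (rule set_integrable_bounded_Icc)
      have "(\<lambda>r. R r \<omega>) \<in> borel_measurable borel"
        using measurable_compose[OF measurable_Pair2'[OF \<omega>] R_measurable] by simp
      then show "(\<lambda>r. indicator {t0..T} r * R r \<omega>) \<in> borel_measurable borel" by measurable
      fix r assume r: "r \<in> {t0..T}"
      have "\<bar>R r \<omega>\<bar> \<le> C * (1 + norm (Yw r) powr e)"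
        using C(3)[OF I[OF r], of "Yw r"] r by (simp add: R_def Yc_eq Yw_def)
      also have "\<dots> \<le> C * (1 + B3 powr e)"
        using B3[OF r] C by (intro mult_left_mono add_left_mono powr_mono2) auto
      finally show "\<bar>R r \<omega>\<bar> \<le> C * (1 + B3 powr e)" .
    qed
  qed
  let ?kl = "\<lambda>r. LBINT v:\<A>. kl_integrand (u r \<omega>) sd (\<pi> r (Y r \<omega>)) v"
  have kl: "AE r in lborel. r \<in> {t0..T} \<longrightarrow> (SS r \<omega> * u r \<omega> - CR r \<omega>) + R r \<omega>
      = c * (u r \<omega>)\<^sup>2 - 2 * \<phi> * \<rho> * m r \<omega> * u r \<omega> + \<phi> * \<rho>\<^sup>2 * (m r \<omega>)\<^sup>2 + entropy_const + \<gamma> * ?kl r \<and> 0 \<le> ?kl r"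
    using se
  proof eventually_elim
    case (elim r)
    show ?case
    proof
      assume r: "r \<in> {t0..T}"
      note r' = I[OF r]
      have fm: "(\<lambda>v. indicator \<A> v * \<pi> r (Yw r) v) \<in> borel_measurable borel"
        unfolding ext_policy_eq[OF r', symmetric] by measurable
      obtain C e where Rint: "\<And>t y. t \<in> {0..T} \<Longrightarrow> L1_on \<A> (\<lambda>v. (\<phi> * (v - \<rho> * speed y)\<^sup>2 + \<gamma> * ln (\<pi> t y v)) * \<pi> t y v)"
        by (rule running_cost_bound) blast
      have v1: "L1_on \<A> (\<lambda>v. v * \<pi> r (Yw r) v)"
        and v2: "L1_on \<A> (\<lambda>v. (midprice (Yw r) - k * v) * v * \<pi> r (Yw r) v)" using elim r by auto
      note rc = running_cost[OF fm density(1)[OF r'] density(2,3)[OF r'] v1 v2 Rint[OF r']]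
      show "(SS r \<omega> * u r \<omega> - CR r \<omega>) + R r \<omega>
      = c * (u r \<omega>)\<^sup>2 - 2 * \<phi> * \<rho> * m r \<omega> * u r \<omega> + \<phi> * \<rho>\<^sup>2 * (m r \<omega>)\<^sup>2 + entropy_const + \<gamma> * ?kl r \<and> 0 \<le> ?kl r"
        using rc unfolding uY[OF r] CRY[OF r] RY[OF r] mY[OF r] SY[OF r] mean_rate_def cash_rate_def Yw_def
        by blast
    qed
  qed
  have mui: "L1_on {t0..T} (\<lambda>r. m r \<omega> * u r \<omega>)" by (rule set_integrable_mult_bounded[OF ui mi B])
  have m2i: "L1_on {t0..T} (\<lambda>r. (m r \<omega>)\<^sup>2)"
    using set_integrable_mult_bounded[OF mi mi B] by (simp add: power2_eq_square)
  let ?tot = "\<lambda>r. (SS r \<omega> * u r \<omega> - CR r \<omega>) + R r \<omega> + (2 * \<phi> * \<rho> * (m r \<omega> * u r \<omega>) - \<phi> * \<rho>\<^sup>2 * (m r \<omega>)\<^sup>2 - entropy_const)"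
  have toti: "L1_on {t0..T} ?tot"
    by (intro set_integral_add set_integral_diff Sui CRi Ri set_integrable_mult_right mui m2i set_integrable_const_Icc)
  have u2i: "L1_on {t0..T} (\<lambda>r. (u r \<omega>)\<^sup>2)"
  proof (rule set_integrable_bound[OF set_integrable_mult_right[of "1 / c", OF toti]])
    have "(\<lambda>r. u r \<omega>) \<in> borel_measurable borel"
      using measurable_compose[OF measurable_Pair2'[OF \<omega>] u_measurable] by simp
    then show "set_borel_measurable lborel {t0..T} (\<lambda>r. (u r \<omega>)\<^sup>2)" unfolding set_borel_measurable_def by measurable
    show "AE r in lborel. r \<in> {t0..T} \<longrightarrow> norm ((u r \<omega>)\<^sup>2) \<le> norm (1 / c * ?tot r)"
      using kl
    proof eventually_elim
      case (elim r)
      show ?case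
      proof
        assume r: "r \<in> {t0..T}"
        have "?tot r = c * (u r \<omega>)\<^sup>2 + \<gamma> * ?kl r" and kl0: "0 \<le> ?kl r" using elim r by (auto simp: algebra_simps)
        then have "1 / c * ?tot r = (u r \<omega>)\<^sup>2 + \<gamma> / c * ?kl r" using c_pos by (simp add: field_simps)
        moreover have "0 \<le> \<gamma> / c * ?kl r" using c_pos \<gamma>_pos kl0 by auto
        ultimately show "norm ((u r \<omega>)\<^sup>2) \<le> norm (1 / c * ?tot r)" by simp
      qed
    qed
  qed
  define Qp where "Qp r = q0 - (LBINT s:{t0..r}. u s \<omega>)" for r
  have Ur: "(LBINT s:{t0..r}. mean_rate P \<pi> s (Yw s)) = (LBINT s:{t0..r}. u s \<omega>)" if "r \<in> {t0..T}" for r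
    using that by (intro set_lebesgue_integral_cong) (auto simp: uY)
  have Qe: "Q r \<omega> = Qp r" if r: "r \<in> {t0..T}" for r using seq[OF r] Ur[OF r] QY[OF r] by (simp add: Qp_def)
  have Se: "SS r \<omega> = S0 - b * (LBINT s:{t0..r}. u s \<omega>) + \<sigma> * (W r \<omega> - W t0 \<omega>)" if r: "r \<in> {t0..T}" for r
    using seq[OF r] Ur[OF r] SY[OF r] by simp
  define \<xi>p where "\<xi>p r = 2 * \<phi> * \<rho> * m r \<omega> - \<sigma> * (W T \<omega> - W r \<omega>)" for r
  have \<xi>e: "\<xi> r \<omega> = \<xi>p r" if "r \<in> {t0..T}" for r using that WY[OF that] by (simp add: \<xi>_def \<xi>p_def)
  have \<Xi>e: "\<Xi> s \<omega> = (LBINT r:{s..T}. \<xi>p r)" if "s \<in> {t0..T}" for s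
    unfolding \<Xi>_def using that by (intro set_lebesgue_integral_cong) (auto simp: \<xi>e)
  have \<zeta>e: "\<zeta> s \<omega> = \<xi>p s - p s / c * (LBINT r:{s..T}. \<xi>p r)" if "s \<in> {t0..T}" for s
    using that by (simp add: \<zeta>_def \<xi>e \<Xi>e)
  have ze: "z r \<omega> = u r \<omega> - p r * Qp r / c" if "r \<in> {t0..T}" for r
    using that by (simp add: z_def Qe)
  note pid1 = payoff_identity(1)[OF t0 ui u2i Ki Ri mi B Wi B', where q=q0 and x=x0 and S=S0, folded Qp_def \<xi>p_def]
  note pid = payoff_identity(2-4)[OF t0 ui u2i Ki Ri mi B Wi B', where q=q0, folded Qp_def \<xi>p_def]
  have zi: "L1_on {t0..T} (\<lambda>r. (z r \<omega>)\<^sup>2)"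
  proof (rule set_integrable_transfer[OF pid(2)])
    fix r assume r: "r \<in> {t0..T}"
    show "(u r \<omega> - p r * Qp r / c)\<^sup>2 = (z r \<omega>)\<^sup>2" unfolding ze[OF r] by (rule refl)
  qed
  have z\<zeta>i: "L1_on {t0..T} (\<lambda>r. z r \<omega> * \<zeta> r \<omega>)"
  proof (rule set_integrable_transfer[OF pid(3)])
    fix r assume r: "r \<in> {t0..T}"
    show "(u r \<omega> - p r * Qp r / c) * (\<xi>p r - p r / c * (LBINT s:{r..T}. \<xi>p s)) = z r \<omega> * \<zeta> r \<omega>"
      unfolding ze[OF r] \<zeta>e[OF r] by (rule refl)
  qed
  have \<xi>i: "L1_on {t0..T} \<xi>p"
    unfolding \<xi>p_def by (intro set_integral_diff set_integrable_mult_right mi Wi set_integrable_const_Icc)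
  then have \<xi>i': "L1_on {t0..T} (\<lambda>r. \<xi> r \<omega>)" by (rule set_integrable_transfer) (simp add: \<xi>e)
  have \<xi>B: "\<bar>\<xi>p r\<bar> \<le> \<bar>2 * \<phi> * \<rho>\<bar> * B + \<bar>\<sigma>\<bar> * (B' + B')" if r: "r \<in> {t0..T}" for r
  proof -
    have "\<bar>\<xi>p r\<bar> \<le> \<bar>2 * \<phi> * \<rho> * m r \<omega>\<bar> + \<bar>\<sigma> * (W T \<omega> - W r \<omega>)\<bar>" unfolding \<xi>p_def by (rule abs_triangle_ineq4)
    also have "\<bar>2 * \<phi> * \<rho> * m r \<omega>\<bar> \<le> \<bar>2 * \<phi> * \<rho>\<bar> * B"
      unfolding abs_mult[of "2 * \<phi> * \<rho>"] using B[OF r] by (intro mult_left_mono) auto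
    also have "\<bar>\<sigma> * (W T \<omega> - W r \<omega>)\<bar> \<le> \<bar>\<sigma>\<bar> * (B' + B')"
      unfolding abs_mult[of \<sigma>] using B'[OF r] B'[of T] tT by (intro mult_left_mono) auto
    finally show ?thesis by simp
  qed
  have pc: "continuous_on {t0..T} p" by (rule p_continuous[OF I0])
  obtain pB where pB: "\<And>r. r \<in> {t0..T} \<Longrightarrow> \<bar>p r\<bar> \<le> pB"
    using compact_imp_bounded[OF compact_continuous_image[OF pc compact_Icc]] unfolding bounded_iff real_norm_def by blast
  obtain B4 where B4: "\<bar>\<zeta> r \<omega>\<bar> \<le> B4" if "r \<in> {t0..T}" for r
  proof
    fix r assume r: "r \<in> {t0..T}"
    have "\<bar>\<zeta> r \<omega>\<bar> \<le> \<bar>\<xi>p r\<bar> + \<bar>p r / c * (LBINT s:{r..T}. \<xi>p s)\<bar>" unfolding \<zeta>e[OF r] by (rule abs_triangle_ineq4)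
    also have "\<bar>p r / c * (LBINT s:{r..T}. \<xi>p s)\<bar> \<le> (pB / c) * (LBINT s:{t0..T}. \<bar>\<xi>p s\<bar>)"
      unfolding abs_mult using pB[OF r] c_pos indefinite_integral_bounded(2)[OF \<xi>i r]
      by (intro mult_mono) (auto simp: divide_right_mono)
    finally show "\<bar>\<zeta> r \<omega>\<bar> \<le> (\<bar>2 * \<phi> * \<rho>\<bar> * B + \<bar>\<sigma>\<bar> * (B' + B')) + (pB / c) * (LBINT s:{t0..T}. \<bar>\<xi>p s\<bar>)"
      using \<xi>B[OF r] by linarith
  qed
  have sq: "L1_on {t0..T} (\<lambda>r. (X r \<omega>)\<^sup>2)"
    if X: "jointly_measurable M X" and XB: "\<And>r. r \<in> {t0..T} \<Longrightarrow> \<bar>X r \<omega>\<bar> \<le> BX" for X :: "real \<Rightarrow> 'a \<Rightarrow> real" and BX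
  proof (rule set_integrable_bounded_Icc)
    have "(\<lambda>r. X r \<omega>) \<in> borel_measurable borel"
      using measurable_compose[OF measurable_Pair2'[OF \<omega>] X] by simp
    then show "(\<lambda>r. indicator {t0..T} r * (X r \<omega>)\<^sup>2) \<in> borel_measurable borel" by measurable
    show "\<bar>(X r \<omega>)\<^sup>2\<bar> \<le> BX\<^sup>2" if "r \<in> {t0..T}" for r
      using power_mono[OF XB[OF that], of 2] by simp
  qed
  have \<zeta>2i: "L1_on {t0..T} (\<lambda>r. (\<zeta> r \<omega>)\<^sup>2)" by (rule sq[OF \<zeta>_measurable B4])
  have lb: "bounded (l\<^sub>1 P ` {t0..T})" "bounded (l\<^sub>0 P ` {t0..T})"
    by (intro compact_imp_bounded compact_continuous_image continuous_on_subset[OF _ I0] l_continuous compact_Icc)+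
  obtain b1 b0 where b1: "\<And>r. r \<in> {t0..T} \<Longrightarrow> \<bar>l\<^sub>1 P r\<bar> \<le> b1" and b0: "\<And>r. r \<in> {t0..T} \<Longrightarrow> \<bar>l\<^sub>0 P r\<bar> \<le> b0"
    using lb unfolding bounded_iff real_norm_def by blast
  have "\<bar>\<zeta>b r \<omega>\<bar> \<le> (\<bar>2 * \<phi> * \<rho>\<bar> + b1) * B + b0" if r: "r \<in> {t0..T}" for r
  proof -
    have "\<zeta>b r \<omega> = (2 * \<phi> * \<rho> - l\<^sub>1 P r) * m r \<omega> - l\<^sub>0 P r" using r by (simp add: \<zeta>b_def drift_gain_eq)
    then have "\<bar>\<zeta>b r \<omega>\<bar> \<le> \<bar>2 * \<phi> * \<rho> - l\<^sub>1 P r\<bar> * \<bar>m r \<omega>\<bar> + \<bar>l\<^sub>0 P r\<bar>" by (metis abs_mult abs_triangle_ineq4)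
    also have "\<bar>2 * \<phi> * \<rho> - l\<^sub>1 P r\<bar> * \<bar>m r \<omega>\<bar> \<le> (\<bar>2 * \<phi> * \<rho>\<bar> + b1) * B"
      using b1[OF r] B[OF r] by (intro mult_mono) auto
    finally show ?thesis using b0[OF r] by linarith
  qed
  then have \<zeta>b2i: "L1_on {t0..T} (\<lambda>r. (\<zeta>b r \<omega>)\<^sup>2)" by (rule sq[OF \<zeta>b_measurable])
  have Di: "L1_on {t0..T} (\<lambda>r. D r \<omega>)"
    unfolding D_def mult.assoc[of _ "m _ \<omega>"]
    by (intro set_integral_add set_integral_diff set_integrable_mult_right mui u2i Ri Sui CRi)
  have mm: "m r \<omega> = mu_path t0 m0 r \<omega>" if r: "r \<in> {t0..T}" for r
  proof (rule mu_path_unique)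
    show "t0 \<le> r" using r by simp
    show "L1_on {t0..r} (\<lambda>r. m r \<omega>)" using r by (intro set_integrable_Icc_subset[OF mi]) auto
    fix s assume s: "s \<in> {t0..r}"
    then have s': "s \<in> {t0..T}" using r by auto
    have "(LBINT r:{t0..s}. speed (Yw r)) = (LBINT r:{t0..s}. m r \<omega>)"
      using s' by (intro set_lebesgue_integral_cong) (auto simp: mY)
    then show "m s \<omega> = m0 - \<kappa> * (LBINT s:{t0..s}. m s \<omega>) + (J s \<omega> - J t0 \<omega>)"
      using seq[OF s'] mY[OF s'] J_diff[OF \<omega> t0_nonneg, of s] s by simp
  qed
  have TT: "T \<in> {t0..T}" using tT by simp
  have cashT: "cash (Yw T) = x0 + (LBINT r:{t0..T}. (S0 - b * (LBINT s:{t0..r}. u s \<omega>) + \<sigma> * (W r \<omega> - W t0 \<omega>)) * u r \<omega> - (SS r \<omega> * u r \<omega> - CR r \<omega>))"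
  proof -
    have "(LBINT r:{t0..T}. cash_rate P \<pi> r (Yw r)) = (LBINT r:{t0..T}. (S0 - b * (LBINT s:{t0..r}. u s \<omega>) + \<sigma> * (W r \<omega> - W t0 \<omega>)) * u r \<omega> - (SS r \<omega> * u r \<omega> - CR r \<omega>))"
      by (intro set_lebesgue_integral_cong) (auto simp: CRY Se[symmetric])
    then show ?thesis using seq[OF TT] by simp
  qed
  have Rint: "(LBINT s:{t0..T}. LBINT v:\<A>. (\<phi> * (v - \<rho> * speed (Yw s))\<^sup>2 + \<gamma> * ln (\<pi> s (Yw s) v)) * \<pi> s (Yw s) v)
     = (LBINT r:{t0..T}. R r \<omega>)"
    by (intro set_lebesgue_integral_cong) (auto simp: RY)
  have QT: "inventory (Yw T) = Qp T" using QY[OF TT] Qe[OF TT] by simp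
  have ST: "midprice (Yw T) = S0 - b * (LBINT s:{t0..T}. u s \<omega>) + \<sigma> * (W T \<omega> - W t0 \<omega>)"
    using SY[OF TT] Se[OF TT] by simp
  have "payoff P \<pi> t0 Yw = x0 + (LBINT r:{t0..T}. (S0 - b * (LBINT s:{t0..r}. u s \<omega>) + \<sigma> * (W r \<omega> - W t0 \<omega>)) * u r \<omega> - (SS r \<omega> * u r \<omega> - CR r \<omega>))
     + Qp T * ((S0 - b * (LBINT s:{t0..T}. u s \<omega>) + \<sigma> * (W T \<omega> - W t0 \<omega>)) - \<alpha> * Qp T) - (LBINT r:{t0..T}. R r \<omega>)"
    unfolding payoff_def Rint cashT QT ST ..
  also note pid1
  also have "(LBINT r:{t0..T}. \<xi>p r) = \<Xi> t0 \<omega>" using \<Xi>e[of t0] tT by simp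
  finally have "payoff P \<pi> t0 Yw = base \<omega> + (LBINT r:{t0..T}. (u r \<omega> - p r * Qp r / c) * (\<xi>p r - p r / c * (LBINT s:{r..T}. \<xi>p s)) - c * (u r \<omega> - p r * Qp r / c)\<^sup>2)
       - (LBINT r:{t0..T}. D r \<omega>)"
    unfolding D_def base_def .
  also have "(LBINT r:{t0..T}. (u r \<omega> - p r * Qp r / c) * (\<xi>p r - p r / c * (LBINT s:{r..T}. \<xi>p s)) - c * (u r \<omega> - p r * Qp r / c)\<^sup>2)
     = (LBINT r:{t0..T}. z r \<omega> * \<zeta> r \<omega> - c * (z r \<omega>)\<^sup>2)"
  proof (intro set_lebesgue_integral_cong allI impI)
    fix r assume r: "r \<in> {t0..T}"
    show "(u r \<omega> - p r * Qp r / c) * (\<xi>p r - p r / c * (LBINT s:{r..T}. \<xi>p s)) - c * (u r \<omega> - p r * Qp r / c)\<^sup>2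
       = z r \<omega> * \<zeta> r \<omega> - c * (z r \<omega>)\<^sup>2"
      unfolding ze[OF r] \<zeta>e[OF r] by (rule refl)
  qed simp
  finally have pay: "reward \<omega> = base \<omega> + (LBINT r:{t0..T}. z r \<omega> * \<zeta> r \<omega> - c * (z r \<omega>)\<^sup>2)
       - (LBINT r:{t0..T}. D r \<omega>)" unfolding Yw_def[abs_def] .
  have Dkl: "AE r in lborel. r \<in> {t0..T} \<longrightarrow>
        D r \<omega> = idle_cost r \<omega> + \<gamma> * ?kl r \<and> 0 \<le> ?kl r"
    using kl by eventually_elim (auto simp: D_def)
  show ?case
    using mm mi m2i \<xi>i' \<zeta>2i \<zeta>b2i zi z\<zeta>i Di Dkl pay by blast
qed

end

text \<open>Tonelli: a non-negative process is jointly integrable once its path integrals have an integrable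
  bound.\<close>

lemma (in prob_space) integrable_pair_of_path_integrals:
  fixes g :: "real \<Rightarrow> 'a \<Rightarrow> real"
  assumes g [measurable]: "jointly_measurable M g"
    and nonneg: "\<And>r \<omega>. 0 \<le> g r \<omega>"
    and path: "AE \<omega> in M. L1_on {a..d} (\<lambda>r. g r \<omega>)"
    and B: "integrable M B" and le: "AE \<omega> in M. (LBINT r:{a..d}. g r \<omega>) \<le> B \<omega>"
  shows "integrable (lborel \<Otimes>\<^sub>M M) (\<lambda>(r, \<omega>). indicator {a..d} r * g r \<omega>)"
proof -
  interpret P: pair_sigma_finite M lborel ..
  interpret P': pair_sigma_finite lborel M ..
  have gm [measurable]: "(\<lambda>(\<omega>, r). g r \<omega>) \<in> borel_measurable (M \<Otimes>\<^sub>M borel)"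
    by measurable
  have "integrable (M \<Otimes>\<^sub>M lborel) (\<lambda>(\<omega>, r). indicator {a..d} r * g r \<omega>)"
  proof (rule P.Fubini_integrable)
    show "(\<lambda>(\<omega>, r). indicator {a..d} r * g r \<omega>) \<in> borel_measurable (M \<Otimes>\<^sub>M lborel)" by measurable
    show "AE \<omega> in M. integrable lborel (\<lambda>r. case (\<omega>, r) of (\<omega>, r) \<Rightarrow> indicator {a..d} r * g r \<omega>)"
      using path by (simp add: set_integrable_def)
    show "integrable M (\<lambda>\<omega>. LINT r|lborel. norm (case (\<omega>, r) of (\<omega>, r) \<Rightarrow> indicator {a..d} r * g r \<omega>))"
    proof (rule Bochner_Integration.integrable_bound[OF B])
      show "(\<lambda>\<omega>. LINT r|lborel. norm (case (\<omega>, r) of (\<omega>, r) \<Rightarrow> indicator {a..d} r * g r \<omega>)) \<in> borel_measurable M" by measurable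
      show "AE \<omega> in M. norm (LINT r|lborel. norm (case (\<omega>, r) of (\<omega>, r) \<Rightarrow> indicator {a..d} r * g r \<omega>)) \<le> norm (B \<omega>)"
        using le
      proof eventually_elim
        case (elim \<omega>)
        have e: "(LINT r|lborel. norm (case (\<omega>, r) of (\<omega>, r) \<Rightarrow> indicator {a..d} r * g r \<omega>)) = (LBINT r:{a..d}. g r \<omega>)"
          using nonneg by (simp add: set_lebesgue_integral_def abs_mult)
        have "0 \<le> (LBINT r:{a..d}. g r \<omega>)"
          unfolding set_lebesgue_integral_def using nonneg by (intro integral_nonneg_AE) auto
        then show ?case using elim unfolding e by simp
      qed
    qed
  qed
  from P.integrable_product_swap[OF this] show ?thesis by (simp add: case_prod_unfold)
qed

context controlled
begin

lemma mu_second_bound: obtains B where "0 \<le> B" "\<And>r. r \<in> {t0..T} \<Longrightarrow> mu_second t0 m0 r \<le> B"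
proof -
  have "bounded (mu_second t0 m0 ` {t0..T})"
    by (intro compact_imp_bounded compact_continuous_image mu_second_continuous compact_Icc)
  then obtain B where "\<And>r. r \<in> {t0..T} \<Longrightarrow> \<bar>mu_second t0 m0 r\<bar> \<le> B" unfolding bounded_iff real_norm_def by blast
  note B = this
  show ?thesis
  proof (rule that)
    show "mu_second t0 m0 r \<le> \<bar>B\<bar>" if "r \<in> {t0..T}" for r using B[OF that] by linarith
  qed simp
qed

lemma m_moments:
  assumes r: "r \<in> {t0..T}"
  shows "integrable M (\<lambda>\<omega>. (m r \<omega>)\<^sup>2)" "integrable M (m r)" "\<E> (m r) = mu_mean t0 m0 r"
    "\<E> (\<lambda>\<omega>. (m r \<omega>)\<^sup>2) = mu_second t0 m0 r"
proof -
  note mp = mu_path_moments[OF t0_nonneg, of r m0]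
  have r': "t0 \<le> r" using r by simp
  have e: "AE \<omega> in M. m r \<omega> = mu_path t0 m0 r \<omega>"
    using path_identity by eventually_elim (use r in blast)
  have mm [measurable]: "m r \<in> borel_measurable M" by (rule section_measurable[OF m_measurable])
  have pm [measurable]: "mu_path t0 m0 r \<in> borel_measurable M"
  proof -
    note [measurable] = pair_F_measurable[OF J_joint_measurable[OF t0_nonneg r']] adapted(3)[OF t0_nonneg]
    have [measurable]: "J r \<in> borel_measurable M" using r t0_nonneg by (intro adapted) auto
    have "mu_path t0 m0 r = (\<lambda>\<omega>. m0 + (J r \<omega> - J t0 \<omega>) - \<kappa> * (LBINT s:{t0..r}. exp (- \<kappa> * (r - s)) * (m0 + (J (clamp_Icc t0 r s) \<omega> - J t0 \<omega>))))"
      unfolding mu_path_def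
      by (intro ext arg_cong2[where f="(-)"] refl arg_cong2[where f="(*)"] set_lebesgue_integral_cong) auto
    also have "\<dots> \<in> borel_measurable M" unfolding set_lebesgue_integral_def by measurable
    finally show ?thesis .
  qed
  have e2: "AE \<omega> in M. (m r \<omega>)\<^sup>2 = (mu_path t0 m0 r \<omega>)\<^sup>2" using e by eventually_elim simp
  show i: "integrable M (\<lambda>\<omega>. (m r \<omega>)\<^sup>2)"
    by (rule integrable_cong_AE_imp[OF mp(1)[OF r']]) (use e2 in \<open>auto elim!: eventually_mono\<close>)
  show "integrable M (m r)" by (rule integrable_square_imp_integrable[OF mm i])
  show "\<E> (m r) = mu_mean t0 m0 r"
    using integral_cong_AE[OF mm pm e] mp(2)[OF r'] by simp
  show "\<E> (\<lambda>\<omega>. (m r \<omega>)\<^sup>2) = mu_second t0 m0 r"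
    using integral_cong_AE[OF _ _ e2] mp(3)[OF r'] by simp
qed

lemma W_moments:
  assumes r: "r \<in> {t0..T}"
  shows "integrable M (\<lambda>\<omega>. (W T \<omega> - Wc r \<omega>)\<^sup>2)" "\<E> (\<lambda>\<omega>. (W T \<omega> - Wc r \<omega>)\<^sup>2) \<le> T"
    "integrable M (\<lambda>\<omega>. W T \<omega> - Wc r \<omega>)" "\<E> (\<lambda>\<omega>. W T \<omega> - Wc r \<omega>) = 0"
proof -
  have r0: "0 \<le> r" "r \<le> T" using r t0_nonneg by auto
  have e: "Wc r = W r" using r by (simp add: Wc_def)
  show "integrable M (\<lambda>\<omega>. (W T \<omega> - Wc r \<omega>)\<^sup>2)" "\<E> (\<lambda>\<omega>. (W T \<omega> - Wc r \<omega>)\<^sup>2) \<le> T"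
    "integrable M (\<lambda>\<omega>. W T \<omega> - Wc r \<omega>)" "\<E> (\<lambda>\<omega>. W T \<omega> - Wc r \<omega>) = 0"
    unfolding e using increment_moments[OF r0] r0 by auto
qed

lemma square_diff_le: "(x - y)\<^sup>2 \<le> 2 * x\<^sup>2 + 2 * y\<^sup>2" for x y :: real
  using sum_squares_bound[of x "- y"] by (simp add: power2_diff)

lemma diff_square_moment:
  fixes X X' :: "'a \<Rightarrow> real"
  assumes [measurable]: "X \<in> borel_measurable M" "X' \<in> borel_measurable M"
    and X: "integrable M (\<lambda>\<omega>. (X \<omega>)\<^sup>2)" and X': "integrable M (\<lambda>\<omega>. (X' \<omega>)\<^sup>2)"
  shows "integrable M (\<lambda>\<omega>. (X \<omega> - X' \<omega>)\<^sup>2)"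
    and "\<E> (\<lambda>\<omega>. (X \<omega> - X' \<omega>)\<^sup>2) \<le> 2 * \<E> (\<lambda>\<omega>. (X \<omega>)\<^sup>2) + 2 * \<E> (\<lambda>\<omega>. (X' \<omega>)\<^sup>2)"
proof -
  have s: "integrable M (\<lambda>\<omega>. 2 * (X \<omega>)\<^sup>2 + 2 * (X' \<omega>)\<^sup>2)" using X X' by simp
  show i: "integrable M (\<lambda>\<omega>. (X \<omega> - X' \<omega>)\<^sup>2)"
    by (rule Bochner_Integration.integrable_bound[OF s]) (use square_diff_le in auto)
  show "\<E> (\<lambda>\<omega>. (X \<omega> - X' \<omega>)\<^sup>2) \<le> 2 * \<E> (\<lambda>\<omega>. (X \<omega>)\<^sup>2) + 2 * \<E> (\<lambda>\<omega>. (X' \<omega>)\<^sup>2)"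
    using integral_mono[OF i s square_diff_le] X X' by simp
qed

lemma \<xi>_moments:
  obtains K where "0 \<le> K" "\<And>r. r \<in> {t0..T} \<Longrightarrow> integrable M (\<lambda>\<omega>. (\<xi> r \<omega>)\<^sup>2)"
    "\<And>r. r \<in> {t0..T} \<Longrightarrow> \<E> (\<lambda>\<omega>. (\<xi> r \<omega>)\<^sup>2) \<le> K"
proof -
  obtain B where B: "0 \<le> B" "\<And>r. r \<in> {t0..T} \<Longrightarrow> mu_second t0 m0 r \<le> B" by (rule mu_second_bound) blast
  note [measurable] = section_measurable[OF m_measurable] section_measurable[OF Wc_measurable]
  show ?thesis
  proof (rule that)
    show "0 \<le> 2 * ((2 * \<phi> * \<rho>)\<^sup>2 * B) + 2 * (\<sigma>\<^sup>2 * T)" using B T_pos by (intro add_nonneg_nonneg mult_nonneg_nonneg) auto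
    fix r assume r: "r \<in> {t0..T}"
    have i: "integrable M (\<lambda>\<omega>. (2 * \<phi> * \<rho> * m r \<omega>)\<^sup>2)" "integrable M (\<lambda>\<omega>. (\<sigma> * (W T \<omega> - Wc r \<omega>))\<^sup>2)"
      unfolding power_mult_distrib[of "2 * \<phi> * \<rho>"] power_mult_distrib[of \<sigma>]
      by (intro integrable_mult_right m_moments W_moments r)+
    have e: "\<E> (\<lambda>\<omega>. (2 * \<phi> * \<rho> * m r \<omega>)\<^sup>2) \<le> (2 * \<phi> * \<rho>)\<^sup>2 * B" "\<E> (\<lambda>\<omega>. (\<sigma> * (W T \<omega> - Wc r \<omega>))\<^sup>2) \<le> \<sigma>\<^sup>2 * T"
      unfolding power_mult_distrib[of "2 * \<phi> * \<rho>"] power_mult_distrib[of \<sigma>] integral_mult_right_zero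
      using B(2)[OF r] m_moments(4)[OF r] W_moments(2)[OF r] by (auto intro!: mult_left_mono)
    show "integrable M (\<lambda>\<omega>. (\<xi> r \<omega>)\<^sup>2)" unfolding \<xi>_def by (rule diff_square_moment(1)[OF _ _ i]) measurable
    have "\<E> (\<lambda>\<omega>. (\<xi> r \<omega>)\<^sup>2) \<le> 2 * \<E> (\<lambda>\<omega>. (2 * \<phi> * \<rho> * m r \<omega>)\<^sup>2) + 2 * \<E> (\<lambda>\<omega>. (\<sigma> * (W T \<omega> - Wc r \<omega>))\<^sup>2)"
      unfolding \<xi>_def by (rule diff_square_moment(2)[OF _ _ i]) measurable
    then show "\<E> (\<lambda>\<omega>. (\<xi> r \<omega>)\<^sup>2) \<le> 2 * ((2 * \<phi> * \<rho>)\<^sup>2 * B) + 2 * (\<sigma>\<^sup>2 * T)"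
      using e by linarith
  qed
qed

lemma \<Xi>_moments:
  obtains K where "0 \<le> K" "\<And>s. s \<in> {t0..T} \<Longrightarrow> integrable M (\<lambda>\<omega>. (\<Xi> s \<omega>)\<^sup>2)"
    "\<And>s. s \<in> {t0..T} \<Longrightarrow> \<E> (\<lambda>\<omega>. (\<Xi> s \<omega>)\<^sup>2) \<le> K"
proof -
  obtain K where K: "0 \<le> K" "\<And>r. r \<in> {t0..T} \<Longrightarrow> integrable M (\<lambda>\<omega>. (\<xi> r \<omega>)\<^sup>2)"
    "\<And>r. r \<in> {t0..T} \<Longrightarrow> \<E> (\<lambda>\<omega>. (\<xi> r \<omega>)\<^sup>2) \<le> K" by (rule \<xi>_moments) blast
  show ?thesis
  proof (rule that)
    show "0 \<le> T * (T * K)" using T_pos K by auto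
    fix s assume s: "s \<in> {t0..T}"
    have o: "(\<lambda>_::real. 1::real) \<in> borel_measurable borel" by simp
    have K': "integrable M (\<lambda>\<omega>. (\<xi> r \<omega>)\<^sup>2)" "\<E> (\<lambda>\<omega>. (\<xi> r \<omega>)\<^sup>2) \<le> K" if "r \<in> {s..T}" for r
      using K(2,3)[of r] s that by auto
    have sT: "s \<le> T" using s by simp
    have b: "\<bar>1::real\<bar> \<le> 1" by simp
    note L = time_integral_L2(2,3)[OF sT \<xi>_measurable o b K']
    have e: "\<Xi> s \<omega> = (LBINT r:{s..T}. 1 * \<xi> r \<omega>)" for \<omega> by (simp add: \<Xi>_def)
    show "integrable M (\<lambda>\<omega>. (\<Xi> s \<omega>)\<^sup>2)" unfolding e by (rule L(1))
    have "\<E> (\<lambda>\<omega>. (\<Xi> s \<omega>)\<^sup>2) \<le> (T - s) * ((T - s) * (1\<^sup>2 * K))" unfolding e by (rule L(2))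
    also have "\<dots> \<le> T * (T * K)" using s t0_nonneg K by (intro mult_mono) auto
    finally show "\<E> (\<lambda>\<omega>. (\<Xi> s \<omega>)\<^sup>2) \<le> T * (T * K)" .
  qed
qed

lemma \<zeta>_moments:
  obtains K where "\<And>s. s \<in> {t0..T} \<Longrightarrow> integrable M (\<lambda>\<omega>. (\<zeta> s \<omega>)\<^sup>2)"
    "\<And>s. s \<in> {t0..T} \<Longrightarrow> \<E> (\<lambda>\<omega>. (\<zeta> s \<omega>)\<^sup>2) \<le> K"
proof -
  obtain K1 where K1: "0 \<le> K1" "\<And>r. r \<in> {t0..T} \<Longrightarrow> integrable M (\<lambda>\<omega>. (\<xi> r \<omega>)\<^sup>2)"
    "\<And>r. r \<in> {t0..T} \<Longrightarrow> \<E> (\<lambda>\<omega>. (\<xi> r \<omega>)\<^sup>2) \<le> K1" by (rule \<xi>_moments) blast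
  obtain K2 where K2: "0 \<le> K2" "\<And>r. r \<in> {t0..T} \<Longrightarrow> integrable M (\<lambda>\<omega>. (\<Xi> r \<omega>)\<^sup>2)"
    "\<And>r. r \<in> {t0..T} \<Longrightarrow> \<E> (\<lambda>\<omega>. (\<Xi> r \<omega>)\<^sup>2) \<le> K2" by (rule \<Xi>_moments) blast
  obtain pB where pB: "\<And>r. r \<in> {t0..T} \<Longrightarrow> \<bar>p r\<bar> \<le> pB"
    using compact_imp_bounded[OF compact_continuous_image[OF p_continuous[OF I0] compact_Icc]] unfolding bounded_iff real_norm_def by blast
  note [measurable] = section_measurable[OF \<xi>_measurable] section_measurable[OF \<Xi>_measurable]
  show ?thesis
  proof (rule that)
    fix s assume s: "s \<in> {t0..T}"
    have e: "\<zeta> s = (\<lambda>\<omega>. \<xi> s \<omega> - p s / c * \<Xi> s \<omega>)" using s by (simp add: \<zeta>_def fun_eq_iff)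
    have i: "integrable M (\<lambda>\<omega>. (p s / c * \<Xi> s \<omega>)\<^sup>2)"
      unfolding power_mult_distrib by (intro integrable_mult_right K2 s)
    have "(p s / c)\<^sup>2 \<le> (pB / c)\<^sup>2"
    proof -
      have "\<bar>p s / c\<bar> \<le> pB / c" using pB[OF s] c_pos by (simp add: divide_right_mono)
      from power_mono[OF this abs_ge_zero, of 2] show ?thesis unfolding power2_abs .
    qed
    then have "\<E> (\<lambda>\<omega>. (p s / c * \<Xi> s \<omega>)\<^sup>2) \<le> (pB / c)\<^sup>2 * K2"
      unfolding power_mult_distrib[of "p s / c"] integral_mult_right_zero using K2(1) K2(3)[OF s]
      by (intro mult_mono) (auto intro: integral_nonneg_AE)
    moreover have "\<E> (\<lambda>\<omega>. (\<zeta> s \<omega>)\<^sup>2) \<le> 2 * \<E> (\<lambda>\<omega>. (\<xi> s \<omega>)\<^sup>2) + 2 * \<E> (\<lambda>\<omega>. (p s / c * \<Xi> s \<omega>)\<^sup>2)"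
      unfolding e by (rule diff_square_moment(2)[OF _ _ K1(2)[OF s] i]) measurable
    ultimately show "\<E> (\<lambda>\<omega>. (\<zeta> s \<omega>)\<^sup>2) \<le> 2 * K1 + 2 * ((pB / c)\<^sup>2 * K2)"
      using K1(3)[OF s] by linarith
    show "integrable M (\<lambda>\<omega>. (\<zeta> s \<omega>)\<^sup>2)"
      unfolding e by (rule diff_square_moment(1)[OF _ _ K1(2)[OF s] i]) measurable
  qed
qed

lemma \<zeta>b_moments:
  obtains K where "\<And>s. s \<in> {t0..T} \<Longrightarrow> integrable M (\<lambda>\<omega>. (\<zeta>b s \<omega>)\<^sup>2)"
    "\<And>s. s \<in> {t0..T} \<Longrightarrow> \<E> (\<lambda>\<omega>. (\<zeta>b s \<omega>)\<^sup>2) \<le> K"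
proof -
  obtain B where B: "0 \<le> B" "\<And>r. r \<in> {t0..T} \<Longrightarrow> mu_second t0 m0 r \<le> B" by (rule mu_second_bound) blast
  have lb: "bounded ((\<lambda>r. (2 * \<phi> * \<rho> - l\<^sub>1 P r)\<^sup>2) ` {t0..T})" "bounded ((\<lambda>r. (l\<^sub>0 P r)\<^sup>2) ` {t0..T})"
    by (intro compact_imp_bounded compact_continuous_image continuous_intros continuous_on_subset[OF _ I0] l_continuous compact_Icc)+
  obtain b1 b0 where b1: "\<And>r. r \<in> {t0..T} \<Longrightarrow> \<bar>(2 * \<phi> * \<rho> - l\<^sub>1 P r)\<^sup>2\<bar> \<le> b1" and b0: "\<And>r. r \<in> {t0..T} \<Longrightarrow> \<bar>(l\<^sub>0 P r)\<^sup>2\<bar> \<le> b0"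
    using lb unfolding bounded_iff real_norm_def by blast
  note b1 = b1[unfolded abs_power2] and b0 = b0[unfolded abs_power2]
  note [measurable] = section_measurable[OF m_measurable]
  show ?thesis
  proof (rule that)
    fix s assume s: "s \<in> {t0..T}"
    have e: "\<zeta>b s = (\<lambda>\<omega>. (2 * \<phi> * \<rho> - l\<^sub>1 P s) * m s \<omega> - l\<^sub>0 P s)" using s by (simp add: \<zeta>b_def fun_eq_iff drift_gain_eq)
    have i: "integrable M (\<lambda>\<omega>. ((2 * \<phi> * \<rho> - l\<^sub>1 P s) * m s \<omega>)\<^sup>2)" "integrable M (\<lambda>\<omega>. (l\<^sub>0 P s)\<^sup>2)"
      unfolding power_mult_distrib by (intro integrable_mult_right m_moments s) simp
    have "0 \<le> b1" using b1[OF s] by (meson order_trans zero_le_power2)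
    then have "(2 * \<phi> * \<rho> - l\<^sub>1 P s)\<^sup>2 * mu_second t0 m0 s \<le> b1 * B"
    proof (intro mult_mono)
      show "0 \<le> mu_second t0 m0 s" unfolding m_moments(4)[OF s, symmetric] by simp
    qed (use b1 B(2) s in auto)
    moreover have "\<E> (\<lambda>\<omega>. (\<zeta>b s \<omega>)\<^sup>2) \<le> 2 * \<E> (\<lambda>\<omega>. ((2 * \<phi> * \<rho> - l\<^sub>1 P s) * m s \<omega>)\<^sup>2) + 2 * \<E> (\<lambda>\<omega>. (l\<^sub>0 P s)\<^sup>2)"
      unfolding e by (rule diff_square_moment(2)[OF _ _ i]) measurable
    ultimately show "\<E> (\<lambda>\<omega>. (\<zeta>b s \<omega>)\<^sup>2) \<le> 2 * (b1 * B) + 2 * b0"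
      unfolding power_mult_distrib[of "_ - _"] integral_mult_right_zero m_moments(4)[OF s] using b0[OF s] by (simp add: prob_space)
    show "integrable M (\<lambda>\<omega>. (\<zeta>b s \<omega>)\<^sup>2)"
      unfolding e by (rule diff_square_moment(1)[OF _ _ i]) measurable
  qed
qed

lemma pairs:
  "integrable (lborel \<Otimes>\<^sub>M M) (\<lambda>(r, \<omega>). indicator {t0..T} r * (\<zeta> r \<omega>)\<^sup>2)"
  "integrable (lborel \<Otimes>\<^sub>M M) (\<lambda>(r, \<omega>). indicator {t0..T} r * (\<zeta>b r \<omega>)\<^sup>2)"
  "integrable (lborel \<Otimes>\<^sub>M M) (\<lambda>(r, \<omega>). indicator {t0..T} r * (idle_cost r \<omega>))"
  "integrable (lborel \<Otimes>\<^sub>M M) (\<lambda>(r, \<omega>). indicator {t0..T} r * m r \<omega>)"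
proof -
  obtain K1 where K1: "\<And>s. s \<in> {t0..T} \<Longrightarrow> integrable M (\<lambda>\<omega>. (\<zeta> s \<omega>)\<^sup>2)"
    "\<And>s. s \<in> {t0..T} \<Longrightarrow> \<E> (\<lambda>\<omega>. (\<zeta> s \<omega>)\<^sup>2) \<le> K1" by (rule \<zeta>_moments) blast
  show "integrable (lborel \<Otimes>\<^sub>M M) (\<lambda>(r, \<omega>). indicator {t0..T} r * (\<zeta> r \<omega>)\<^sup>2)"
    by (rule integrable_pair_Icc[where K=K1]) (use K1 in \<open>auto\<close>)
  obtain K2 where K2: "\<And>s. s \<in> {t0..T} \<Longrightarrow> integrable M (\<lambda>\<omega>. (\<zeta>b s \<omega>)\<^sup>2)"
    "\<And>s. s \<in> {t0..T} \<Longrightarrow> \<E> (\<lambda>\<omega>. (\<zeta>b s \<omega>)\<^sup>2) \<le> K2" by (rule \<zeta>b_moments) blast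
  show "integrable (lborel \<Otimes>\<^sub>M M) (\<lambda>(r, \<omega>). indicator {t0..T} r * (\<zeta>b r \<omega>)\<^sup>2)"
    by (rule integrable_pair_Icc[where K=K2]) (use K2 in \<open>auto\<close>)
  obtain B where B: "0 \<le> B" "\<And>r. r \<in> {t0..T} \<Longrightarrow> mu_second t0 m0 r \<le> B" by (rule mu_second_bound) blast
  have m2: "integrable (lborel \<Otimes>\<^sub>M M) (\<lambda>(r, \<omega>). indicator {t0..T} r * (m r \<omega>)\<^sup>2)"
    by (rule integrable_pair_Icc[where K=B]) (use m_moments B in \<open>auto\<close>)
  have c1: "integrable (lborel \<Otimes>\<^sub>M M) (\<lambda>(r, \<omega>). indicator {t0..T} r * entropy_const)"
    by (rule integrable_pair_Icc[where K="\<bar>entropy_const\<bar>"]) (auto simp: prob_space)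
  show "integrable (lborel \<Otimes>\<^sub>M M) (\<lambda>(r, \<omega>). indicator {t0..T} r * (idle_cost r \<omega>))"
    using Bochner_Integration.integrable_add[OF integrable_mult_right[OF m2, of "\<phi> * \<rho>\<^sup>2"] c1]
    by (rule back_subst[where P="integrable _"]) (auto simp: fun_eq_iff algebra_simps)
  show "integrable (lborel \<Otimes>\<^sub>M M) (\<lambda>(r, \<omega>). indicator {t0..T} r * m r \<omega>)"
  proof (rule integrable_pair_Icc[where K="1 + B"])
    fix r assume r: "r \<in> {t0..T}"
    show "integrable M (m r)" by (rule m_moments[OF r])
    have "\<E> (\<lambda>\<omega>. \<bar>1 * m r \<omega>\<bar>) \<le> \<E> (\<lambda>\<omega>. 1\<^sup>2) + \<E> (\<lambda>\<omega>. (m r \<omega>)\<^sup>2)"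
      by (rule integrable_mult_squares(2)) (use section_measurable[OF m_measurable] m_moments[OF r] in auto)
    then show "\<E> (\<lambda>\<omega>. \<bar>m r \<omega>\<bar>) \<le> 1 + B" using m_moments(4)[OF r] B(2)[OF r] by (simp add: prob_space)
  qed simp
qed

text \<open>Among the terms linear in the noise only the expected integral of \<open>\<mu>\<close> survives;
  it produces \<open>w\<^sub>1\<close>.\<close>

lemma base_expectation:
  "integrable M base"
  "\<E> base = x0 + q0 * S0 + w\<^sub>1 P t0 m0 * q0 + w\<^sub>2 P t0 m0 * q0\<^sup>2"
proof -
  have WT: "integrable M (\<lambda>\<omega>. W T \<omega> - W t0 \<omega>)" "\<E> (\<lambda>\<omega>. W T \<omega> - W t0 \<omega>) = 0"
    using increment_moments[OF t0_nonneg t0_le] by auto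
  have Tc: "t0 \<in> {t0..T}" using t0_le by simp
  obtain K where K: "0 \<le> K" "\<And>s. s \<in> {t0..T} \<Longrightarrow> integrable M (\<lambda>\<omega>. (\<Xi> s \<omega>)\<^sup>2)"
    "\<And>s. s \<in> {t0..T} \<Longrightarrow> \<E> (\<lambda>\<omega>. (\<Xi> s \<omega>)\<^sup>2) \<le> K" by (rule \<Xi>_moments) blast
  have Xi: "integrable M (\<Xi> t0)"
    by (rule integrable_square_imp_integrable[OF section_measurable[OF \<Xi>_measurable] K(2)[OF Tc]])
  have "\<E> (\<Xi> t0) = 2 * \<phi> * \<rho> * (speed_weight t0 * m0 + jump_weight t0)"
  proof -
    obtain K1 where K1: "0 \<le> K1" "\<And>r. r \<in> {t0..T} \<Longrightarrow> integrable M (\<lambda>\<omega>. (\<xi> r \<omega>)\<^sup>2)"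
      "\<And>r. r \<in> {t0..T} \<Longrightarrow> \<E> (\<lambda>\<omega>. (\<xi> r \<omega>)\<^sup>2) \<le> K1" by (rule \<xi>_moments) blast
    have o: "(\<lambda>_::real. 1::real) \<in> borel_measurable borel" by simp
    have b: "\<bar>1::real\<bar> \<le> 1" by simp
    have one: "(\<lambda>_. 1::real) \<in> borel_measurable M" "integrable M (\<lambda>_. (1::real)\<^sup>2)" by simp_all
    have "\<E> (\<lambda>\<omega>. 1 * (LBINT r:{t0..T}. 1 * \<xi> r \<omega>)) = (LBINT r:{t0..T}. 1 * \<E> (\<lambda>\<omega>. 1 * \<xi> r \<omega>))"
      by (rule time_integral_L2(5)[OF t0_le \<xi>_measurable o b K1(2,3) one])
    then have "\<E> (\<Xi> t0) = (LBINT r:{t0..T}. \<E> (\<xi> r))"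
      unfolding mult_1 \<Xi>_def[abs_def] .
    also have "\<dots> = (LBINT r:{t0..T}. 2 * \<phi> * \<rho> * mu_mean t0 m0 r)"
    proof (intro set_lebesgue_integral_cong allI impI)
      fix r assume r: "r \<in> {t0..T}"
      have i: "integrable M (\<lambda>\<omega>. 2 * \<phi> * \<rho> * m r \<omega>)" "integrable M (\<lambda>\<omega>. \<sigma> * (W T \<omega> - Wc r \<omega>))"
        by (rule integrable_mult_right[OF m_moments(2)[OF r]], rule integrable_mult_right[OF W_moments(3)[OF r]])
      have "\<E> (\<xi> r) = \<E> (\<lambda>\<omega>. 2 * \<phi> * \<rho> * m r \<omega>) - \<E> (\<lambda>\<omega>. \<sigma> * (W T \<omega> - Wc r \<omega>))"
        unfolding \<xi>_def[abs_def] by (rule Bochner_Integration.integral_diff[OF i])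
      also have "\<dots> = 2 * \<phi> * \<rho> * \<E> (m r) - \<sigma> * \<E> (\<lambda>\<omega>. W T \<omega> - Wc r \<omega>)"
        unfolding integral_mult_right_zero ..
      finally show "\<E> (\<xi> r) = 2 * \<phi> * \<rho> * mu_mean t0 m0 r"
        unfolding m_moments(3)[OF r] W_moments(4)[OF r] by simp
    qed simp
    also have "\<dots> = 2 * \<phi> * \<rho> * (LBINT r:{t0..T}. mu_mean t0 m0 r)" by (rule set_integral_mult_right)
    also have "(LBINT r:{t0..T}. mu_mean t0 m0 r) = speed_weight t0 * m0 + jump_weight t0"
    proof -
      let ?F = "\<lambda>r. - (exp (- \<kappa> * (r - t0)) / \<kappa>) * m0 + lam * \<eta>1 * ((r - t0) / \<kappa> + exp (- \<kappa> * (r - t0)) / \<kappa>\<^sup>2)"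
      have d: "(?F has_real_derivative mu_mean t0 m0 r) (at r within {t0..T})" for r
        unfolding mu_mean_def using \<kappa>_nz
        by (auto intro!: derivative_eq_intros simp: power2_eq_square diff_divide_distrib)
      have "?F T = ?F t0 + (LBINT r:{t0..T}. mu_mean t0 m0 r)"
        by (rule FTC_set_integral(2)[OF t0_le d mu_mean_continuous])
      then have "(LBINT r:{t0..T}. mu_mean t0 m0 r) = ?F T - ?F t0" by linarith
      also have "\<dots> = speed_weight t0 * m0 + jump_weight t0"
        using \<kappa>_nz by (simp add: speed_weight_def jump_weight_def diff_divide_distrib add_divide_distrib power2_eq_square ring_distribs)
      finally show ?thesis .
    qed
    finally show ?thesis .
  qed
  then have pX: "p t0 * q0 * \<E> (\<Xi> t0) / c = w\<^sub>1 P t0 m0 * q0" unfolding w1_eq by simp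
  define C where "C = x0 + q0 * S0 - (b / 2 + p t0) * q0\<^sup>2"
  have b: "base = (\<lambda>\<omega>. C + \<sigma> * q0 * (W T \<omega> - W t0 \<omega>) + p t0 * q0 / c * \<Xi> t0 \<omega>)" by (simp add: base_def fun_eq_iff C_def)
  have i: "integrable M (\<lambda>\<omega>. C + \<sigma> * q0 * (W T \<omega> - W t0 \<omega>))" "integrable M (\<lambda>\<omega>. p t0 * q0 / c * \<Xi> t0 \<omega>)"
    by (intro Bochner_Integration.integrable_add integrable_mult_right WT integrable_const Xi)+
  show "integrable M base" unfolding b by (rule Bochner_Integration.integrable_add[OF i])
  have "\<E> base = \<E> (\<lambda>\<omega>. C + \<sigma> * q0 * (W T \<omega> - W t0 \<omega>)) + \<E> (\<lambda>\<omega>. p t0 * q0 / c * \<Xi> t0 \<omega>)"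
    unfolding b by (rule Bochner_Integration.integral_add[OF i])
  also have "\<E> (\<lambda>\<omega>. C + \<sigma> * q0 * (W T \<omega> - W t0 \<omega>)) = C"
    using WT by (subst Bochner_Integration.integral_add) (auto simp: prob_space)
  also have "\<E> (\<lambda>\<omega>. p t0 * q0 / c * \<Xi> t0 \<omega>) = w\<^sub>1 P t0 m0 * q0" using pX by simp
  finally show "\<E> base = x0 + q0 * S0 + w\<^sub>1 P t0 m0 * q0 + w\<^sub>2 P t0 m0 * q0\<^sup>2"
    by (simp add: C_def w2_eq algebra_simps)
qed

text \<open>By variation of constants, the integral of \<open>\<mu>\<close> over \<open>[r, T]\<close> is a
  function of \<open>\<mu>\<^sub>r\<close> plus a weighted integral of the jumps after \<open>r\<close>; so
  \<open>\<zeta>\<close> differs from \<open>\<zeta>b\<close> by variables that are orthogonal to the past.\<close>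

lemma \<zeta>_predictable:
  assumes r: "r \<in> {t0..T}" and X: "X \<in> borel_measurable (F r)" and X2: "integrable M (\<lambda>\<omega>. (X \<omega>)\<^sup>2)"
  shows "\<E> (\<lambda>\<omega>. X \<omega> * \<zeta> r \<omega>) = \<E> (\<lambda>\<omega>. X \<omega> * \<zeta>b r \<omega>)"
proof -
  have r0: "r \<in> {0..T}" "0 \<le> r" "r \<le> T" using r I0 by auto
  note fu = future_uncorrelated[OF r0(1) X X2]
  have XM [measurable]: "X \<in> borel_measurable M" by (rule F_measurable[OF X])
  note [measurable] = section_measurable[OF \<zeta>b_measurable] section_measurable[OF \<zeta>_measurable]
  let ?IW = "\<lambda>\<omega>. LBINT s:{r..T}. W T \<omega> - W s \<omega>"
  let ?IJ = "\<lambda>\<omega>. LBINT s:{r..T}. exp (- \<kappa> * (T - s)) * Jc r s \<omega>"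
  let ?C = "2 * \<phi> * \<rho> * (p r / c)" and ?C' = "p r / c * \<sigma>"
  have e: "AE \<omega> in M. \<zeta> r \<omega> = \<zeta>b r \<omega> - \<sigma> * (W T \<omega> - W r \<omega>) + ?C' * ?IW \<omega> - ?C * ?IJ \<omega>"
    using path_identity AE_space
  proof eventually_elim
    case (elim \<omega>)
    have \<omega>: "\<omega> \<in> space M" by (rule elim(2))
    have mi: "L1_on {t0..T} (\<lambda>r. m r \<omega>)" and mp: "\<And>s. s \<in> {t0..T} \<Longrightarrow> m s \<omega> = mu_path t0 m0 s \<omega>" using elim(1) by auto
    have mir: "L1_on {r..T} (\<lambda>r. m r \<omega>)" using r by (intro set_integrable_Icc_subset[OF mi]) auto
    have Wi: "L1_on {r..T} (\<lambda>s. W T \<omega> - W s \<omega>)"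
      by (intro set_integral_diff set_integrable_const_Icc cadlag_set_integrable r0 continuous_imp_cadlag continuous_on_subset[OF W_continuous[OF \<omega>]]) (use r0 in auto)
    have Jcad: "cadlag_on r T (\<lambda>s. J s \<omega>)" by (rule J_cadlag[OF \<omega> r0(2)])
    have "(LBINT s:{r..T}. m s \<omega>) = (LBINT s:{r..T}. exp (- \<kappa> * (T - s)) * (m r \<omega> + (J s \<omega> - J r \<omega>)))"
    proof (rule linear_integral_equation[OF r0(3) mir])
      fix s assume s: "s \<in> {r..T}"
      have I: "m v \<omega> = m0 + (J v \<omega> - J t0 \<omega>) - \<kappa> * (LBINT s:{t0..v}. m s \<omega>)" if v: "v \<in> {t0..T}" for v
      proof -
        have "L1_on {t0..v} (\<lambda>s. m0 + (J s \<omega> - J t0 \<omega>))"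
          using v by (intro set_integral_add set_integral_diff set_integrable_const_Icc cadlag_set_integrable J_cadlag[OF \<omega>] t0_nonneg) auto
        note ls = linear_integral_equation_solves(2)[OF _ this, of \<kappa>]
        have "(LBINT r:{t0..v}. m r \<omega>) = (LBINT r:{t0..v}. (m0 + (J r \<omega> - J t0 \<omega>)) - \<kappa> * (LBINT s:{t0..r}. exp (- \<kappa> * (r - s)) * (m0 + (J s \<omega> - J t0 \<omega>))))"
          using v mp by (intro set_lebesgue_integral_cong) (auto simp: mu_path_def)
        then show ?thesis using ls v unfolding mp[OF v] mu_path_def by simp
      qed
      have "(LBINT v:{t0..s}. m v \<omega>) = (LBINT v:{t0..r}. m v \<omega>) + (LBINT v:{r..s}. m v \<omega>)"
        using r s by (intro set_integral_Icc_split set_integrable_Icc_subset[OF mi]) auto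
      then show "m s \<omega> = (m r \<omega> + (J s \<omega> - J r \<omega>)) - \<kappa> * (LBINT s:{r..s}. m s \<omega>)"
        using I[of s] I[OF r] r s by (simp add: algebra_simps)
    qed
    also have "\<dots> = (LBINT s:{r..T}. m r \<omega> * exp (- \<kappa> * (T - s)) + (lam * \<eta>1 * (exp (- \<kappa> * (T - s)) * (s - r)) + exp (- \<kappa> * (T - s)) * Jc r s \<omega>))"
      by (intro set_lebesgue_integral_cong) (auto simp: Jc_def algebra_simps)
    also have "\<dots> = m r \<omega> * ((1 - exp (- \<kappa> * (T - r))) / \<kappa>) + (lam * \<eta>1 * ((exp (- \<kappa> * (T - r)) - 1 + \<kappa> * (T - r)) / \<kappa>\<^sup>2) + ?IJ \<omega>)"
    proof -
      have cJ: "cadlag_on r T (\<lambda>s. exp (- \<kappa> * (T - s)))" "cadlag_on r T (\<lambda>s. - J r \<omega> - lam * \<eta>1 * (s - r))"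
        by (intro continuous_imp_cadlag continuous_intros)+
      have "cadlag_on r T (\<lambda>s. exp (- \<kappa> * (T - s)) * (J s \<omega> + (- J r \<omega> - lam * \<eta>1 * (s - r))))"
        by (intro cadlag_on_compose2[where h="(*)"] cadlag_on_compose2[where h="(+)"] cJ Jcad) (auto intro!: continuous_intros)
      from cadlag_set_integrable[OF r0(3) this] have i3: "L1_on {r..T} (\<lambda>s. exp (- \<kappa> * (T - s)) * Jc r s \<omega>)"
        by (rule set_integrable_transfer) (simp add: Jc_def)
      note i1 = exp_integral[OF r0(3) \<kappa>_nz] and i2 = exp_linear_integral[OF r0(3) \<kappa>_nz]
      have i2': "L1_on {r..T} (\<lambda>s. lam * \<eta>1 * (exp (- \<kappa> * (T - s)) * (s - r)))" by (rule set_integrable_mult_right[OF i2(1)])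
      show ?thesis
        unfolding set_integral_add(2)[OF set_integrable_mult_right[OF i1(1)] set_integral_add(1)[OF i2' i3]]
          set_integral_add(2)[OF i2' i3] set_integral_mult_right i1(2) i2(2) ..
    qed
    also have "\<dots> = speed_weight r * m r \<omega> + jump_weight r + ?IJ \<omega>"
      by (simp add: speed_weight_def jump_weight_def)
    finally have Im: "(LBINT s:{r..T}. m s \<omega>) = speed_weight r * m r \<omega> + jump_weight r + ?IJ \<omega>" .
    have "\<Xi> r \<omega> = (LBINT s:{r..T}. 2 * \<phi> * \<rho> * m s \<omega> - \<sigma> * (W T \<omega> - W s \<omega>))"
      unfolding \<Xi>_def using r by (intro set_lebesgue_integral_cong) (auto simp: \<xi>_def Wc_def)
    also have "\<dots> = 2 * \<phi> * \<rho> * (LBINT s:{r..T}. m s \<omega>) - \<sigma> * ?IW \<omega>"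
      by (subst set_integral_diff(2)[OF set_integrable_mult_right[OF mir] set_integrable_mult_right[OF Wi]]) (simp only: set_integral_mult_right)
    finally have Xi: "\<Xi> r \<omega> = 2 * \<phi> * \<rho> * (speed_weight r * m r \<omega> + jump_weight r + ?IJ \<omega>) - \<sigma> * ?IW \<omega>" unfolding Im .
    have "\<zeta> r \<omega> = 2 * \<phi> * \<rho> * m r \<omega> - \<sigma> * (W T \<omega> - W r \<omega>) - p r / c * \<Xi> r \<omega>"
      using r by (simp add: \<zeta>_def \<xi>_def Wc_def)
    moreover have "\<zeta>b r \<omega> = 2 * \<phi> * \<rho> * m r \<omega> - 2 * \<phi> * \<rho> * (p r / c) * (speed_weight r * m r \<omega> + jump_weight r)"
      using r by (simp add: \<zeta>b_def drift_gain_def w1_eq)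
    moreover define y where "y = p r / c"
    ultimately show ?case unfolding Xi y_def[symmetric] by (simp add: ring_distribs)
  qed
  obtain K where K: "\<And>s. s \<in> {t0..T} \<Longrightarrow> integrable M (\<lambda>\<omega>. (\<zeta>b s \<omega>)\<^sup>2)" by (rule \<zeta>b_moments) blast
  have X\<zeta>b: "integrable M (\<lambda>\<omega>. X \<omega> * \<zeta>b r \<omega>)"
    by (rule integrable_mult_squares(1)[OF XM _ X2 K[OF r]]) measurable
  obtain K where K': "\<And>s. s \<in> {t0..T} \<Longrightarrow> integrable M (\<lambda>\<omega>. (\<zeta> s \<omega>)\<^sup>2)" by (rule \<zeta>_moments) blast
  have X\<zeta>: "integrable M (\<lambda>\<omega>. X \<omega> * \<zeta> r \<omega>)"
    by (rule integrable_mult_squares(1)[OF XM _ X2 K'[OF r]]) measurable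
  let ?G = "\<lambda>\<omega>. X \<omega> * \<zeta>b r \<omega> + (?C' * (X \<omega> * ?IW \<omega>) - \<sigma> * (X \<omega> * (W T \<omega> - W r \<omega>)) - ?C * (X \<omega> * ?IJ \<omega>))"
  have iG: "integrable M ?G"
    by (intro Bochner_Integration.integrable_add Bochner_Integration.integrable_diff integrable_mult_right X\<zeta>b fu)
  have "\<E> (\<lambda>\<omega>. X \<omega> * \<zeta> r \<omega>) = expectation ?G"
  proof (rule integral_cong_AE)
    show "AE \<omega> in M. X \<omega> * \<zeta> r \<omega> = ?G \<omega>"
      using e
    proof eventually_elim
      case (elim \<omega>)
      show ?case unfolding elim by (simp add: algebra_simps)
    qed
  qed (use X\<zeta> iG in auto)
  also have "\<dots> = \<E> (\<lambda>\<omega>. X \<omega> * \<zeta>b r \<omega>) + (?C' * 0 - \<sigma> * 0 - ?C * 0)"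
    by (subst Bochner_Integration.integral_add, intro X\<zeta>b, intro Bochner_Integration.integrable_diff integrable_mult_right fu)
      (subst Bochner_Integration.integral_diff, intro Bochner_Integration.integrable_diff integrable_mult_right fu, intro integrable_mult_right fu,
       subst Bochner_Integration.integral_diff, intro integrable_mult_right fu, intro integrable_mult_right fu, simp only: integral_mult_right_zero fu)
  finally show ?thesis by simp
qed

text \<open>The payoff after the square with the predicted gain has been completed, without the square itself
  and without the relative entropy: both are non-negative and vanish for the optimal policy. The difference of
  \<open>z \<zeta>\<close> and \<open>z \<zeta>b\<close> has expectation \<open>0\<close>, so that
  \<open>H\<close> has the same expectation for all policies with square integrable \<open>z\<close>.\<close>

definition H where
  "H \<omega> = base \<omega> + (LBINT r:{t0..T}. z r \<omega> * \<zeta> r \<omega> - z r \<omega> * \<zeta>b r \<omega>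
     + ((\<zeta>b r \<omega>)\<^sup>2 / (4 * c) - (idle_cost r \<omega>)))"

lemma H_expectation:
  assumes z2: "integrable (lborel \<Otimes>\<^sub>M M) (\<lambda>(r, \<omega>). indicator {t0..T} r * (z r \<omega>)\<^sup>2)"
  shows "integrable M H" and "\<E> H = candidate t0 x0 S0 m0 q0"
proof -
  have prod: "integrable (lborel \<Otimes>\<^sub>M M) (\<lambda>(r, \<omega>). indicator {t0..T} r * (X r \<omega> * Y r \<omega>))"
    if [measurable]: "jointly_measurable M X" "jointly_measurable M Y"
      and X: "integrable (lborel \<Otimes>\<^sub>M M) (\<lambda>(r, \<omega>). indicator {t0..T} r * (X r \<omega>)\<^sup>2)"
      and Y: "integrable (lborel \<Otimes>\<^sub>M M) (\<lambda>(r, \<omega>). indicator {t0..T} r * (Y r \<omega>)\<^sup>2)" for X Y :: "real \<Rightarrow> 'a \<Rightarrow> real"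
  proof (rule Bochner_Integration.integrable_bound[OF Bochner_Integration.integrable_add[OF X Y]])
    show "(\<lambda>(r, \<omega>). indicator {t0..T} r * (X r \<omega> * Y r \<omega>)) \<in> borel_measurable (lborel \<Otimes>\<^sub>M M)" by measurable
    have *: "\<bar>x * y\<bar> \<le> x\<^sup>2 + y\<^sup>2" for x y :: real
    proof -
      have "2 * \<bar>x * y\<bar> \<le> x\<^sup>2 + y\<^sup>2" using sum_squares_bound[of "\<bar>x\<bar>" "\<bar>y\<bar>"] by (simp add: abs_mult mult.assoc)
      then show ?thesis using abs_ge_zero[of "x * y"] by linarith
    qed
    show "AE p in lborel \<Otimes>\<^sub>M M. norm (case p of (r, \<omega>) \<Rightarrow> indicator {t0..T} r * (X r \<omega> * Y r \<omega>))
       \<le> norm ((case p of (r, \<omega>) \<Rightarrow> indicator {t0..T} r * (X r \<omega>)\<^sup>2) + (case p of (r, \<omega>) \<Rightarrow> indicator {t0..T} r * (Y r \<omega>)\<^sup>2))"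
      using * by (intro AE_I2) (auto simp: indicator_def split: prod.split)
  qed
  note z\<zeta> = prod[OF z_measurable \<zeta>_measurable z2 pairs(1)]
  note z\<zeta>b = prod[OF z_measurable \<zeta>b_measurable z2 pairs(2)]
  let ?g = "\<lambda>r \<omega>. z r \<omega> * \<zeta> r \<omega> - z r \<omega> * \<zeta>b r \<omega> + ((\<zeta>b r \<omega>)\<^sup>2 / (4 * c) - (idle_cost r \<omega>))"
  have g: "integrable (lborel \<Otimes>\<^sub>M M) (\<lambda>(r, \<omega>). indicator {t0..T} r * ?g r \<omega>)"
    using Bochner_Integration.integrable_add[OF Bochner_Integration.integrable_diff[OF z\<zeta> z\<zeta>b]
        Bochner_Integration.integrable_diff[OF integrable_mult_right[OF pairs(2), of "1 / (4 * c)"] pairs(3)]]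
    by (rule back_subst[where P="integrable _"]) (auto simp: fun_eq_iff algebra_simps)
  show "integrable M H" unfolding H_def[abs_def]
    by (intro Bochner_Integration.integrable_add base_expectation Fubini_Icc(2)[OF g])
  have "\<E> H = \<E> base + (LBINT r:{t0..T}. \<E> (?g r))"
    unfolding H_def[abs_def] by (subst Bochner_Integration.integral_add[OF base_expectation(1) Fubini_Icc(2)[OF g]]) (simp only: Fubini_Icc(3)[OF g])
  also have "(LBINT r:{t0..T}. \<E> (?g r)) = (LBINT r:{t0..T}. g2 r * mu_second t0 m0 r + g1 r * mu_mean t0 m0 r + g0 r)"
  proof (rule set_lebesgue_integral_cong_AE)
    show "(\<lambda>r. \<E> (?g r)) \<in> borel_measurable lborel" by measurable
    show "AE r\<in>{t0..T} in lborel. \<E> (?g r) = g2 r * mu_second t0 m0 r + g1 r * mu_mean t0 m0 r + g0 r"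
      using Fubini_Icc(5)[OF z2] Fubini_Icc(5)[OF z\<zeta>] Fubini_Icc(5)[OF z\<zeta>b]
    proof eventually_elim
      case (elim r)
      show ?case
      proof
        assume r: "r \<in> {t0..T}"
        have i: "integrable M (\<lambda>\<omega>. (z r \<omega>)\<^sup>2)" "integrable M (\<lambda>\<omega>. z r \<omega> * \<zeta> r \<omega>)" "integrable M (\<lambda>\<omega>. z r \<omega> * \<zeta>b r \<omega>)"
          using elim r by auto
        have q: "(\<zeta>b r \<omega>)\<^sup>2 / (4 * c) - (idle_cost r \<omega>) = g2 r * (m r \<omega>)\<^sup>2 + g1 r * m r \<omega> + g0 r" for \<omega>
          using g_eq[of r "m r \<omega>"] r by (simp add: \<zeta>b_def)
        have "\<E> (?g r) = \<E> (\<lambda>\<omega>. z r \<omega> * \<zeta> r \<omega> - z r \<omega> * \<zeta>b r \<omega>) + \<E> (\<lambda>\<omega>. g2 r * (m r \<omega>)\<^sup>2 + g1 r * m r \<omega> + g0 r)"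
          unfolding q by (intro Bochner_Integration.integral_add Bochner_Integration.integrable_diff i integral_quadratic(1) m_moments r)
        also have "\<E> (\<lambda>\<omega>. z r \<omega> * \<zeta> r \<omega> - z r \<omega> * \<zeta>b r \<omega>) = 0"
          using \<zeta>_predictable[OF r z_F[OF r] i(1)] i(2,3) by simp
        also have "\<E> (\<lambda>\<omega>. g2 r * (m r \<omega>)\<^sup>2 + g1 r * m r \<omega> + g0 r) = g2 r * mu_second t0 m0 r + g1 r * mu_mean t0 m0 r + g0 r"
          unfolding integral_quadratic(2)[OF m_moments(2)[OF r] m_moments(1)[OF r]] m_moments(3)[OF r] m_moments(4)[OF r] ..
        finally show "\<E> (?g r) = g2 r * mu_second t0 m0 r + g1 r * mu_mean t0 m0 r + g0 r" by simp
      qed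
    qed
    show "(\<lambda>r. g2 r * mu_second t0 m0 r + g1 r * mu_mean t0 m0 r + g0 r) \<in> borel_measurable lborel"
    proof -
      have [measurable]: "mu_second t0 m0 \<in> borel_measurable borel" "mu_mean t0 m0 \<in> borel_measurable borel"
        by (intro borel_measurable_continuous_onI mu_second_continuous mu_mean_continuous)+
      show ?thesis unfolding g2_def[abs_def] g1_def[abs_def] g0_def[abs_def] by measurable
    qed
  qed simp
  also have "\<dots> = speed_value t0 m0" by (rule speed_value_eq[OF t0])
  finally show "\<E> H = candidate t0 x0 S0 m0 q0"
    unfolding base_expectation(2) candidate_def by simp
qed

lemma payoff_measurable [measurable]: "reward \<in> borel_measurable M"
proof -
  have TT: "T \<in> {t0..T}" using t0_le by simp
  have [measurable]: "Y T \<in> borel_measurable M" by (rule F_measurable[OF Y_F[OF TT]])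
  have e: "(LBINT s:{t0..T}. LBINT v:\<A>. (\<phi> * (v - \<rho> * speed (Y s \<omega>))\<^sup>2 + \<gamma> * ln (\<pi> s (Y s \<omega>) v)) * \<pi> s (Y s \<omega>) v)
     = (LBINT r:{t0..T}. R r \<omega>)" for \<omega>
  proof (intro set_lebesgue_integral_cong allI impI)
    fix s assume s: "s \<in> {t0..T}"
    then have "s \<in> {0..T}" using I0 by blast
    from rates_eq(3)[OF this, of "Y s \<omega>"] s
    show "(LBINT v:\<A>. (\<phi> * (v - \<rho> * speed (Y s \<omega>))\<^sup>2 + \<gamma> * ln (\<pi> s (Y s \<omega>) v)) * \<pi> s (Y s \<omega>) v) = R s \<omega>"
      by (simp add: R_def Yc_eq)
  qed simp
  show ?thesis
    unfolding payoff_def e unfolding set_lebesgue_integral_def by measurable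
qed

text \<open>The payoff and \<open>H\<close> differ by a square and a relative entropy.\<close>

lemma payoff_H:
  "AE \<omega> in M. reward \<omega> \<le> H \<omega>"
  "(\<And>r \<omega>. r \<in> {t0..T} \<Longrightarrow> z r \<omega> = \<zeta>b r \<omega> / (2 * c)) \<Longrightarrow>
   (\<And>r \<omega>. r \<in> {t0..T} \<Longrightarrow> relative_entropy r \<omega> = 0) \<Longrightarrow>
   AE \<omega> in M. reward \<omega> = H \<omega>"
proof -
  have main: "AE \<omega> in M. reward \<omega> = H \<omega> - (LBINT r:{t0..T}. c * (z r \<omega> - \<zeta>b r \<omega> / (2 * c))\<^sup>2)
      - (LBINT r:{t0..T}. D r \<omega> - (idle_cost r \<omega>)) \<and>
      (AE r in lborel. r \<in> {t0..T} \<longrightarrow> D r \<omega> - (idle_cost r \<omega>) = \<gamma> * relative_entropy r \<omega> \<and>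
        0 \<le> relative_entropy r \<omega>)"
    using path_identity AE_space
  proof eventually_elim
    case (elim \<omega>)
    have m2: "L1_on {t0..T} (\<lambda>r. (m r \<omega>)\<^sup>2)" and b2: "L1_on {t0..T} (\<lambda>r. (\<zeta>b r \<omega>)\<^sup>2)"
      and z2: "L1_on {t0..T} (\<lambda>r. (z r \<omega>)\<^sup>2)" and z\<zeta>: "L1_on {t0..T} (\<lambda>r. z r \<omega> * \<zeta> r \<omega>)"
      and Di: "L1_on {t0..T} (\<lambda>r. D r \<omega>)"
      and Dk: "AE r in lborel. r \<in> {t0..T} \<longrightarrow>
        D r \<omega> = idle_cost r \<omega> + \<gamma> * relative_entropy r \<omega> \<and>
        0 \<le> relative_entropy r \<omega>"
      and pay: "reward \<omega> = base \<omega> + (LBINT r:{t0..T}. z r \<omega> * \<zeta> r \<omega> - c * (z r \<omega>)\<^sup>2)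
       - (LBINT r:{t0..T}. D r \<omega>)" using elim(1) by blast+
    have path_m: "(\<lambda>r. X r \<omega>) \<in> borel_measurable borel" if "jointly_measurable M X" for X :: "real \<Rightarrow> 'a \<Rightarrow> real"
      using measurable_compose[OF measurable_Pair2'[OF elim(2)] that] by simp
    note [measurable] = path_m[OF z_measurable] path_m[OF \<zeta>b_measurable]
    have zb: "L1_on {t0..T} (\<lambda>r. z r \<omega> * \<zeta>b r \<omega>)"
    proof (rule set_integrable_bound[OF set_integral_add(1)[OF z2 b2]])
      show "set_borel_measurable lborel {t0..T} (\<lambda>r. z r \<omega> * \<zeta>b r \<omega>)" unfolding set_borel_measurable_def by measurable
      have *: "\<bar>x * y\<bar> \<le> x\<^sup>2 + y\<^sup>2" for x y :: real
      proof -
        have "2 * \<bar>x * y\<bar> \<le> x\<^sup>2 + y\<^sup>2" using sum_squares_bound[of "\<bar>x\<bar>" "\<bar>y\<bar>"] by (simp add: abs_mult mult.assoc)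
        then show ?thesis using abs_ge_zero[of "x * y"] by linarith
      qed
      show "AE r in lborel. r \<in> {t0..T} \<longrightarrow> norm (z r \<omega> * \<zeta>b r \<omega>) \<le> norm ((z r \<omega>)\<^sup>2 + (\<zeta>b r \<omega>)\<^sup>2)"
        using * by (intro AE_I2) auto
    qed
    let ?g = "\<lambda>r. z r \<omega> * \<zeta> r \<omega> - z r \<omega> * \<zeta>b r \<omega> + ((\<zeta>b r \<omega>)\<^sup>2 / (4 * c) - (idle_cost r \<omega>))"
    let ?s = "\<lambda>r. c * (z r \<omega> - \<zeta>b r \<omega> / (2 * c))\<^sup>2" and ?m = "\<lambda>r. idle_cost r \<omega>"
    have mi: "L1_on {t0..T} ?m" by (intro set_integral_add set_integrable_mult_right m2 set_integrable_const_Icc)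
    have gi: "L1_on {t0..T} ?g"
      by (intro set_integral_add set_integral_diff z\<zeta> zb set_integrable_divide b2 set_integrable_mult_right m2 set_integrable_const_Icc)
    have s_eq: "z r \<omega> * \<zeta> r \<omega> - c * (z r \<omega>)\<^sup>2 = ?g r + ?m r - ?s r" for r
    proof -
      define y where "y = \<zeta>b r \<omega> / (2 * c)"
      have y: "\<zeta>b r \<omega> = 2 * c * y" "(\<zeta>b r \<omega>)\<^sup>2 / (4 * c) = c * y\<^sup>2" using c_pos by (auto simp: y_def power2_eq_square)
      show ?thesis unfolding y_def[symmetric] y(2) unfolding y(1) by (simp add: power2_eq_square algebra_simps)
    qed
    have si: "L1_on {t0..T} ?s"
    proof (rule set_integrable_transfer)
      show "L1_on {t0..T} (\<lambda>r. ?g r + ?m r - (z r \<omega> * \<zeta> r \<omega> - c * (z r \<omega>)\<^sup>2))"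
        by (rule set_integral_diff(1)[OF set_integral_add(1)[OF gi mi] set_integral_diff(1)[OF z\<zeta> set_integrable_mult_right[OF z2]]])
    qed (simp add: s_eq)
    have "(LBINT r:{t0..T}. z r \<omega> * \<zeta> r \<omega> - c * (z r \<omega>)\<^sup>2) = (LBINT r:{t0..T}. ?g r) + (LBINT r:{t0..T}. ?m r) - (LBINT r:{t0..T}. ?s r)"
      unfolding s_eq set_integral_diff(2)[OF set_integral_add(1)[OF gi mi] si] set_integral_add(2)[OF gi mi] ..
    moreover have "(LBINT r:{t0..T}. D r \<omega> - ?m r) = (LBINT r:{t0..T}. D r \<omega>) - (LBINT r:{t0..T}. ?m r)"
      by (rule set_integral_diff(2)[OF Di mi])
    ultimately have "reward \<omega> = H \<omega> - (LBINT r:{t0..T}. ?s r) - (LBINT r:{t0..T}. D r \<omega> - ?m r)"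
      unfolding pay H_def by simp
    moreover have "AE r in lborel. r \<in> {t0..T} \<longrightarrow> D r \<omega> - ?m r = \<gamma> * relative_entropy r \<omega> \<and>
        0 \<le> relative_entropy r \<omega>"
      using Dk by eventually_elim auto
    ultimately show ?case by blast
  qed
  show "AE \<omega> in M. reward \<omega> \<le> H \<omega>"
    using main
  proof eventually_elim
    case (elim \<omega>)
    have 1: "0 \<le> (LBINT r:{t0..T}. c * (z r \<omega> - \<zeta>b r \<omega> / (2 * c))\<^sup>2)"
      unfolding set_lebesgue_integral_def using c_pos by (intro integral_nonneg_AE AE_I2) auto
    have 2: "0 \<le> (LBINT r:{t0..T}. D r \<omega> - (idle_cost r \<omega>))"
      unfolding set_lebesgue_integral_def
    proof (intro integral_nonneg_AE)
      show "AE r in lborel. 0 \<le> indicator {t0..T} r *\<^sub>R (D r \<omega> - (idle_cost r \<omega>))"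
        using elim[THEN conjunct2]
      proof eventually_elim
        case (elim r)
        then show ?case using \<gamma>_pos by (cases "r \<in> {t0..T}") auto
      qed
    qed
    show ?case using elim 1 2 by linarith
  qed
  assume z: "\<And>r \<omega>. r \<in> {t0..T} \<Longrightarrow> z r \<omega> = \<zeta>b r \<omega> / (2 * c)"
    and kl: "\<And>r \<omega>. r \<in> {t0..T} \<Longrightarrow> relative_entropy r \<omega> = 0"
  show "AE \<omega> in M. reward \<omega> = H \<omega>"
    using main
  proof eventually_elim
    case (elim \<omega>)
    have 1: "(LBINT r:{t0..T}. c * (z r \<omega> - \<zeta>b r \<omega> / (2 * c))\<^sup>2) = (LBINT r:{t0..T}. 0)"
      using z by (intro set_lebesgue_integral_cong) auto
    have 2: "(LBINT r:{t0..T}. D r \<omega> - (idle_cost r \<omega>)) = 0"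
      unfolding set_lebesgue_integral_def
    proof (rule integral_eq_zero_AE)
      show "AE r in lborel. indicator {t0..T} r *\<^sub>R (D r \<omega> - (idle_cost r \<omega>)) = 0"
        using elim[THEN conjunct2]
      proof eventually_elim
        case (elim r)
        then show ?case using kl[of r \<omega>] by (cases "r \<in> {t0..T}") auto
      qed
    qed
    show ?case using elim 1 2 by simp
  qed
qed

text \<open>Completing the square with \<open>\<zeta>\<close> itself bounds the payoff, path by path, by an
  integrable variable minus half of the integral of \<open>c z\<^sup>2\<close>. Therefore the value is
  \<open>- \<infinity>\<close> or \<open>z\<close> is square integrable on \<open>[t0, T] \<times> M\<close>,
  and only in the latter case is the comparison of \<open>\<zeta>\<close> with its prediction needed.\<close>

lemma payoff_upper_bound:
  "ext_integral M reward \<le> ereal (candidate t0 x0 S0 m0 q0)"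
proof -
  define Bd where "Bd \<omega> = base \<omega> + (1 / (2 * c) * (LBINT r:{t0..T}. (\<zeta> r \<omega>)\<^sup>2) - (LBINT r:{t0..T}. idle_cost r \<omega>))" for \<omega>
  have Bi: "integrable M Bd"
    unfolding Bd_def by (intro Bochner_Integration.integrable_add Bochner_Integration.integrable_diff base_expectation integrable_mult_right Fubini_Icc(2) pairs)
  have bound: "AE \<omega> in M. reward \<omega> \<le> Bd \<omega> - c / 2 * (LBINT r:{t0..T}. (z r \<omega>)\<^sup>2)"
    using path_identity
  proof eventually_elim
    case (elim \<omega>)
    have m2: "L1_on {t0..T} (\<lambda>r. (m r \<omega>)\<^sup>2)" and \<zeta>2: "L1_on {t0..T} (\<lambda>r. (\<zeta> r \<omega>)\<^sup>2)"
      and z2: "L1_on {t0..T} (\<lambda>r. (z r \<omega>)\<^sup>2)" and z\<zeta>: "L1_on {t0..T} (\<lambda>r. z r \<omega> * \<zeta> r \<omega>)"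
      and Di: "L1_on {t0..T} (\<lambda>r. D r \<omega>)"
      and Dk: "AE r in lborel. r \<in> {t0..T} \<longrightarrow>
        D r \<omega> = idle_cost r \<omega> + \<gamma> * relative_entropy r \<omega> \<and>
        0 \<le> relative_entropy r \<omega>"
      and pay: "reward \<omega> = base \<omega> + (LBINT r:{t0..T}. z r \<omega> * \<zeta> r \<omega> - c * (z r \<omega>)\<^sup>2)
       - (LBINT r:{t0..T}. D r \<omega>)" using elim by blast+
    have mi: "L1_on {t0..T} (\<lambda>r. idle_cost r \<omega>)"
      by (intro set_integral_add set_integrable_mult_right m2 set_integrable_const_Icc)
    \<comment> \<open>Half of the quadratic term absorbs the linear one; the other half is kept to control \<open>z\<close>.\<close>
    have "(LBINT r:{t0..T}. z r \<omega> * \<zeta> r \<omega> - c * (z r \<omega>)\<^sup>2) \<le> (LBINT r:{t0..T}. 1 / (2 * c) * (\<zeta> r \<omega>)\<^sup>2 - c / 2 * (z r \<omega>)\<^sup>2)"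
    proof (rule set_integral_mono)
      show "L1_on {t0..T} (\<lambda>r. z r \<omega> * \<zeta> r \<omega> - c * (z r \<omega>)\<^sup>2)"
        "L1_on {t0..T} (\<lambda>r. 1 / (2 * c) * (\<zeta> r \<omega>)\<^sup>2 - c / 2 * (z r \<omega>)\<^sup>2)"
        by (intro set_integral_diff set_integrable_mult_right z\<zeta> z2 \<zeta>2)+
      fix r
      define y where "y = \<zeta> r \<omega> / c"
      have y: "\<zeta> r \<omega> = c * y" using c_pos by (simp add: y_def)
      have "0 \<le> c / 2 * (z r \<omega> - y)\<^sup>2" using c_pos by simp
      moreover have "1 / (2 * c) * (c * y)\<^sup>2 = c / 2 * y\<^sup>2" using c_pos by (simp add: power2_eq_square)
      ultimately show "z r \<omega> * \<zeta> r \<omega> - c * (z r \<omega>)\<^sup>2 \<le> 1 / (2 * c) * (\<zeta> r \<omega>)\<^sup>2 - c / 2 * (z r \<omega>)\<^sup>2"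
        unfolding y by (simp add: power2_eq_square algebra_simps)
    qed
    also have "\<dots> = 1 / (2 * c) * (LBINT r:{t0..T}. (\<zeta> r \<omega>)\<^sup>2) - c / 2 * (LBINT r:{t0..T}. (z r \<omega>)\<^sup>2)"
      by (subst set_integral_diff(2)[OF set_integrable_mult_right[OF \<zeta>2] set_integrable_mult_right[OF z2]]) (simp only: set_integral_mult_right)
    finally have 1: "(LBINT r:{t0..T}. z r \<omega> * \<zeta> r \<omega> - c * (z r \<omega>)\<^sup>2)
       \<le> 1 / (2 * c) * (LBINT r:{t0..T}. (\<zeta> r \<omega>)\<^sup>2) - c / 2 * (LBINT r:{t0..T}. (z r \<omega>)\<^sup>2)" .
    have 2: "(LBINT r:{t0..T}. idle_cost r \<omega>) \<le> (LBINT r:{t0..T}. D r \<omega>)"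
    proof (rule set_integral_mono_AE[OF mi Di])
      show "AE r\<in>{t0..T} in lborel. idle_cost r \<omega> \<le> D r \<omega>"
        using Dk by eventually_elim (use \<gamma>_pos in auto)
    qed
    show ?case unfolding pay Bd_def using 1 2 by linarith
  qed
  have z2path: "AE \<omega> in M. L1_on {t0..T} (\<lambda>r. (z r \<omega>)\<^sup>2)" using path_identity by eventually_elim blast
  have z2nn: "0 \<le> (LBINT r:{t0..T}. (z r \<omega>)\<^sup>2)" for \<omega>
    unfolding set_lebesgue_integral_def by (intro integral_nonneg_AE AE_I2) auto
  have le: "AE \<omega> in M. reward \<omega> \<le> Bd \<omega>"
    using bound
  proof eventually_elim
    case (elim \<omega>)
    have "0 \<le> c / 2 * (LBINT r:{t0..T}. (z r \<omega>)\<^sup>2)" using z2nn c_pos by auto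
    then show ?case using elim by linarith
  qed
  from ext_integral_bounded_above[OF payoff_measurable Bi le]
  show ?thesis
  proof
    assume i: "integrable M reward"
    have "integrable (lborel \<Otimes>\<^sub>M M) (\<lambda>(r, \<omega>). indicator {t0..T} r * (z r \<omega>)\<^sup>2)"
    proof (rule integrable_pair_of_path_integrals[OF _ _ z2path])
      show "integrable M (\<lambda>\<omega>. 2 / c * (Bd \<omega> - reward \<omega>))"
        by (intro integrable_mult_right Bochner_Integration.integrable_diff Bi i)
      show "AE \<omega> in M. (LBINT r:{t0..T}. (z r \<omega>)\<^sup>2) \<le> 2 / c * (Bd \<omega> - reward \<omega>)"
        using bound by eventually_elim (use c_pos in \<open>simp add: field_simps\<close>)
    qed auto
    note H = H_expectation[OF this]
    have "\<E> reward \<le> \<E> H"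
      by (rule integral_mono_AE[OF i H(1) payoff_H(1)])
    then show ?thesis unfolding ext_integral_integrable[OF i] H(2) by simp
  qed simp
qed

lemma payoff_optimal:
  assumes z: "\<And>r \<omega>. r \<in> {t0..T} \<Longrightarrow> z r \<omega> = \<zeta>b r \<omega> / (2 * c)"
    and kl: "\<And>r \<omega>. r \<in> {t0..T} \<Longrightarrow> relative_entropy r \<omega> = 0"
  shows "ext_integral M reward = ereal (candidate t0 x0 S0 m0 q0)"
proof -
  have "integrable (lborel \<Otimes>\<^sub>M M) (\<lambda>(r, \<omega>). indicator {t0..T} r * (z r \<omega>)\<^sup>2)"
    using integrable_mult_right[OF pairs(2), of "1 / (4 * c\<^sup>2)"]
  proof (rule back_subst[where P="integrable _"])
    have "1 / (4 * c\<^sup>2) * (indicator {t0..T} r * (\<zeta>b r \<omega>)\<^sup>2) = indicator {t0..T} r * (z r \<omega>)\<^sup>2" for r \<omega>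
      using z[of r \<omega>] by (cases "r \<in> {t0..T}") (auto simp: power_divide power_mult_distrib)
    then show "(\<lambda>x. 1 / (4 * c\<^sup>2) * (case x of (r, \<omega>) \<Rightarrow> indicator {t0..T} r * (\<zeta>b r \<omega>)\<^sup>2)) = (\<lambda>(r, \<omega>). indicator {t0..T} r * (z r \<omega>)\<^sup>2)"
      by (auto simp: fun_eq_iff)
  qed
  note H = H_expectation[OF this]
  have "ext_integral M reward = ext_integral M H"
    by (rule ext_integral_cong_AE[OF payoff_H(2)[OF z kl]])
  then show ?thesis unfolding ext_integral_integrable[OF H(1)] H(2) .
qed

end

section \<open>The Gaussian policy\<close>

subsection \<open>Its state as a functional of the noise\<close>

lemma cadlag_on_arith:
  fixes f g :: "real \<Rightarrow> real"
  assumes f: "cadlag_on a d f" and g: "cadlag_on a d g"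
  shows "cadlag_on a d (\<lambda>r. f r + g r)" "cadlag_on a d (\<lambda>r. f r - g r)" "cadlag_on a d (\<lambda>r. f r * g r)"
  by (rule cadlag_on_compose2[OF f g]; intro continuous_intros)+

lemma cadlag_on_cong: "cadlag_on a d f \<Longrightarrow> (\<And>r. r \<in> {a..d} \<Longrightarrow> f r = g r) \<Longrightarrow> a \<le> d \<Longrightarrow> cadlag_on a d g"
proof -
  assume f: "cadlag_on a d f" and e: "\<And>r. r \<in> {a..d} \<Longrightarrow> f r = g r" and "a \<le> d"
  show ?thesis unfolding cadlag_on_def
  proof (intro conjI ballI)
    fix u assume u: "u \<in> {a..<d}"
    have "(f \<longlongrightarrow> f u) (at_right u)" using f u by (auto simp: cadlag_on_def)
    moreover have "eventually (\<lambda>r. f r = g r) (at_right u)"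
      unfolding eventually_at_right_field using u e by (intro exI[of _ d]) auto
    ultimately show "(g \<longlongrightarrow> g u) (at_right u)"
      using e[of u] u Lim_transform_eventually[of f "f u" "at_right u" g] by simp
  next
    fix u assume u: "u \<in> {a<..d}"
    then obtain l where "(f \<longlongrightarrow> l) (at_left u)" using f unfolding cadlag_on_def by blast
    moreover have "eventually (\<lambda>r. f r = g r) (at_left u)"
      unfolding eventually_at_left_field using u e by (intro exI[of _ a]) auto
    ultimately show "\<exists>l. (g \<longlongrightarrow> l) (at_left u)"
      using Lim_transform_eventually[of f l "at_left u" g] by blast
  qed
qed

lemma continuous_on_indefinite_integral:
  fixes f :: "real \<Rightarrow> real"
  assumes f: "L1_on {a..d} f"
  shows "continuous_on {a..d} (\<lambda>u. LBINT r:{a..u}. f r)"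
proof -
  have "f integrable_on {a..d}" using set_borel_integral_eq_integral(1)[OF f] .
  then have "continuous_on {a..d} (\<lambda>u. integral {a..u} f)" by (rule indefinite_integral_continuous_1)
  moreover have "(LBINT r:{a..u}. f r) = integral {a..u} f" if "u \<in> {a..d}" for u
    using set_borel_integral_eq_integral(2)[OF set_integrable_Icc_subset[OF f]] that by auto
  ultimately show ?thesis by (subst continuous_on_cong[OF refl]) auto
qed

text \<open>Measurability of a primitive in time and scenario, at the level of the sigma-algebra of time
  \<open>d\<close>: together with the clamping of time this yields adapted solutions.\<close>

lemma integral_process_measurable:
  fixes g :: "real \<Rightarrow> 'b \<Rightarrow> real"
  assumes "a \<le> d" and g [measurable]: "(\<lambda>(r, \<omega>). g (clamp_Icc a d r) \<omega>) \<in> borel_measurable (borel \<Otimes>\<^sub>M L)"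
  shows "(\<lambda>(r, \<omega>). LBINT s:{a..clamp_Icc a d r}. g s \<omega>) \<in> borel_measurable (borel \<Otimes>\<^sub>M L)"
proof -
  have "(LBINT s:{a..clamp_Icc a d r}. g s \<omega>) = (LINT s|lborel. indicator {a..clamp_Icc a d r} s * g (clamp_Icc a d s) \<omega>)" for r \<omega>
    unfolding set_lebesgue_integral_def real_scaleR_def
  proof (intro Bochner_Integration.integral_cong refl)
    fix s
    show "indicator {a..clamp_Icc a d r} s * g s \<omega> = indicator {a..clamp_Icc a d r} s * g (clamp_Icc a d s) \<omega>"
      using clamp_Icc_bounds[OF \<open>a \<le> d\<close>, of r] by (cases "s \<in> {a..clamp_Icc a d r}") auto
  qed
  moreover have "(\<lambda>(r, \<omega>). LINT s|lborel. indicator {a..clamp_Icc a d r} s * g (clamp_Icc a d s) \<omega>) \<in> borel_measurable (borel \<Otimes>\<^sub>M L)"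
  proof -
    have "(\<lambda>x. (snd x, snd (fst x))) \<in> (borel \<Otimes>\<^sub>M L) \<Otimes>\<^sub>M lborel \<rightarrow>\<^sub>M (borel :: real measure) \<Otimes>\<^sub>M L" by measurable
    from measurable_compose[OF this g]
    have [measurable]: "(\<lambda>x. g (clamp_Icc a d (snd x)) (snd (fst x))) \<in> borel_measurable ((borel \<Otimes>\<^sub>M L) \<Otimes>\<^sub>M lborel)"
      by simp
    show ?thesis unfolding indicator_def atLeastAtMost_iff by measurable
  qed
  ultimately show ?thesis by simp
qed

lemma exp_kernel_factor:
  fixes h :: "real \<Rightarrow> real"
  shows "exp (- y * r) * (LBINT s:{a..r}. exp (y * s) * h s) = (LBINT s:{a..r}. exp (- y * (r - s)) * h s)"
proof -
  have e: "exp (- y * r) * (exp (y * s) * h s) = exp (- y * (r - s)) * h s" for s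
  proof -
    have "exp (- y * r) * exp (y * s) = exp (- y * (r - s))"
      unfolding exp_add[symmetric] by (simp add: algebra_simps)
    then show ?thesis by (simp add: mult.assoc[symmetric])
  qed
  show ?thesis unfolding set_integral_mult_right[symmetric] e ..
qed

context liquidation_model
begin

text \<open>The state under the Gaussian policy as a functional of the paths \<open>w\<close> and
  \<open>j\<close> of the noise since time \<open>t\<close>. The speed solves a linear equation on its own;
  then \<open>p Q\<close> has a known derivative, because \<open>p\<^sup>2 / c\<close> cancels the feedback of
  the inventory; price and cash follow by integration.\<close>

definition speed_path :: "real \<Rightarrow> real \<Rightarrow> (real \<Rightarrow> real) \<Rightarrow> real \<Rightarrow> real" where
  "speed_path t \<mu> j u = \<mu> + j u - \<kappa> * (exp (- \<kappa> * u) * (LBINT r:{t..u}. exp (\<kappa> * r) * (\<mu> + j r)))"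

definition excess_path :: "real \<Rightarrow> real \<Rightarrow> (real \<Rightarrow> real) \<Rightarrow> real \<Rightarrow> real" where
  "excess_path t \<mu> j r = drift_gain r (speed_path t \<mu> j r) / (2 * c)"

definition inventory_path :: "real \<Rightarrow> real \<Rightarrow> real \<Rightarrow> (real \<Rightarrow> real) \<Rightarrow> real \<Rightarrow> real" where
  "inventory_path t \<mu> q j u = (p t * q - (LBINT r:{t..u}. p r * excess_path t \<mu> j r)) / p u"

definition trade_path :: "real \<Rightarrow> real \<Rightarrow> real \<Rightarrow> (real \<Rightarrow> real) \<Rightarrow> real \<Rightarrow> real" where
  "trade_path t \<mu> q j r = mean_speed r (speed_path t \<mu> j r) (inventory_path t \<mu> q j r)"

definition price_path :: "real \<Rightarrow> real \<Rightarrow> real \<Rightarrow> real \<Rightarrow> (real \<Rightarrow> real) \<Rightarrow> (real \<Rightarrow> real) \<Rightarrow> real \<Rightarrow> real" where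
  "price_path t S \<mu> q w j u = S + b * (inventory_path t \<mu> q j u - q) + \<sigma> * w u"

definition cash_path :: "real \<Rightarrow> real \<Rightarrow> real \<Rightarrow> real \<Rightarrow> real \<Rightarrow> (real \<Rightarrow> real) \<Rightarrow> (real \<Rightarrow> real) \<Rightarrow> real \<Rightarrow> real" where
  "cash_path t x S \<mu> q w j u = x + (LINT r:{t..u}|lborel.
     price_path t S \<mu> q w j r * trade_path t \<mu> q j r - k * ((trade_path t \<mu> q j r)\<^sup>2 + sd\<^sup>2))"

definition gaussian_state :: "real \<Rightarrow> real \<Rightarrow> real \<Rightarrow> real \<Rightarrow> real \<Rightarrow> (real \<Rightarrow> real) \<Rightarrow> (real \<Rightarrow> real) \<Rightarrow> real \<Rightarrow> state" where
  "gaussian_state t x S \<mu> q w j u =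
     (cash_path t x S \<mu> q w j u, price_path t S \<mu> q w j u, speed_path t \<mu> j u, inventory_path t \<mu> q j u)"

lemma gaussian_state_measurable:
  fixes w j :: "real \<Rightarrow> 'b \<Rightarrow> real"
  assumes tu: "t \<le> u"
    and w [measurable]: "(\<lambda>(r, \<omega>). w (clamp_Icc t u r) \<omega>) \<in> borel_measurable (borel \<Otimes>\<^sub>M L)"
    and j [measurable]: "(\<lambda>(r, \<omega>). j (clamp_Icc t u r) \<omega>) \<in> borel_measurable (borel \<Otimes>\<^sub>M L)"
  shows "(\<lambda>(r, \<omega>). gaussian_state t x S \<mu> q (\<lambda>s. w s \<omega>) (\<lambda>s. j s \<omega>) (clamp_Icc t u r)) \<in> borel_measurable (borel \<Otimes>\<^sub>M L)"
proof -
  have "(\<lambda>(r, \<omega>). exp (\<kappa> * clamp_Icc t u r) * (\<mu> + j (clamp_Icc t u r) \<omega>)) \<in> borel_measurable (borel \<Otimes>\<^sub>M L)"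
    by measurable
  note [measurable] = integral_process_measurable[OF tu this]
  have [measurable]: "(\<lambda>(r, \<omega>). speed_path t \<mu> (\<lambda>s. j s \<omega>) (clamp_Icc t u r)) \<in> borel_measurable (borel \<Otimes>\<^sub>M L)"
    unfolding speed_path_def by measurable
  have [measurable]: "(\<lambda>(r, \<omega>). excess_path t \<mu> (\<lambda>s. j s \<omega>) (clamp_Icc t u r)) \<in> borel_measurable (borel \<Otimes>\<^sub>M L)"
    unfolding excess_path_def by measurable
  have "(\<lambda>(r, \<omega>). p (clamp_Icc t u r) * excess_path t \<mu> (\<lambda>s. j s \<omega>) (clamp_Icc t u r)) \<in> borel_measurable (borel \<Otimes>\<^sub>M L)"
    by measurable
  note [measurable] = integral_process_measurable[OF tu this]
  have [measurable]: "(\<lambda>(r, \<omega>). inventory_path t \<mu> q (\<lambda>s. j s \<omega>) (clamp_Icc t u r)) \<in> borel_measurable (borel \<Otimes>\<^sub>M L)"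
    unfolding inventory_path_def by measurable
  have [measurable]: "(\<lambda>(r, \<omega>). trade_path t \<mu> q (\<lambda>s. j s \<omega>) (clamp_Icc t u r)) \<in> borel_measurable (borel \<Otimes>\<^sub>M L)"
    unfolding trade_path_def by measurable
  have [measurable]: "(\<lambda>(r, \<omega>). price_path t S \<mu> q (\<lambda>s. w s \<omega>) (\<lambda>s. j s \<omega>) (clamp_Icc t u r)) \<in> borel_measurable (borel \<Otimes>\<^sub>M L)"
    unfolding price_path_def by measurable
  have "(\<lambda>(r, \<omega>). price_path t S \<mu> q (\<lambda>s. w s \<omega>) (\<lambda>s. j s \<omega>) (clamp_Icc t u r) * trade_path t \<mu> q (\<lambda>s. j s \<omega>) (clamp_Icc t u r)
      - k * ((trade_path t \<mu> q (\<lambda>s. j s \<omega>) (clamp_Icc t u r))\<^sup>2 + sd\<^sup>2)) \<in> borel_measurable (borel \<Otimes>\<^sub>M L)"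
    by measurable
  note [measurable] = integral_process_measurable[OF tu this]
  have [measurable]: "(\<lambda>(r, \<omega>). cash_path t x S \<mu> q (\<lambda>s. w s \<omega>) (\<lambda>s. j s \<omega>) (clamp_Icc t u r)) \<in> borel_measurable (borel \<Otimes>\<^sub>M L)"
    unfolding cash_path_def by measurable
  show ?thesis
    unfolding gaussian_state_def borel_prod[symmetric] by measurable
qed

text \<open>Used where a path of the noise is known on \<open>[t, u]\<close> only, because it has been
  reconstructed from its values there.\<close>

lemma gaussian_state_cong:
  assumes w: "\<And>r. r \<in> {t..u} \<Longrightarrow> w r = w' r" and j: "\<And>r. r \<in> {t..u} \<Longrightarrow> j r = j' r" and tu: "t \<le> u"
  shows "gaussian_state t x S \<mu> q w j u = gaussian_state t x S \<mu> q w' j' u"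
proof -
  have s: "speed_path t \<mu> j r = speed_path t \<mu> j' r" if r: "r \<in> {t..u}" for r
  proof -
    have "(LBINT s:{t..r}. exp (\<kappa> * s) * (\<mu> + j s)) = (LBINT s:{t..r}. exp (\<kappa> * s) * (\<mu> + j' s))"
      using r by (intro set_lebesgue_integral_cong) (auto simp: j)
    then show ?thesis unfolding speed_path_def by (simp add: j[OF r])
  qed
  have i: "inventory_path t \<mu> q j r = inventory_path t \<mu> q j' r" if r: "r \<in> {t..u}" for r
  proof -
    have "(LBINT s:{t..r}. p s * excess_path t \<mu> j s) = (LBINT s:{t..r}. p s * excess_path t \<mu> j' s)"
      using r by (intro set_lebesgue_integral_cong) (auto simp: excess_path_def s)
    then show ?thesis unfolding inventory_path_def by simp
  qed
  have pr: "price_path t S \<mu> q w j r = price_path t S \<mu> q w' j' r" if r: "r \<in> {t..u}" for r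
    unfolding price_path_def by (simp add: i[OF r] w[OF r])
  have tr: "trade_path t \<mu> q j r = trade_path t \<mu> q j' r" if r: "r \<in> {t..u}" for r
    unfolding trade_path_def by (simp add: i[OF r] s[OF r])
  have u: "u \<in> {t..u}" using tu by simp
  have "cash_path t x S \<mu> q w j u = cash_path t x S \<mu> q w' j' u"
    unfolding cash_path_def by (intro arg_cong2[of _ _ _ _ "(+)"] refl set_lebesgue_integral_cong) (auto simp: pr tr)
  then show ?thesis by (simp add: gaussian_state_def s[OF u] i[OF u] pr[OF u])
qed

text \<open>The state equation under the Gaussian policy, with the integrals over the actions evaluated.\<close>

definition gaussian_system :: "real \<Rightarrow> real \<Rightarrow> real \<Rightarrow> real \<Rightarrow> real \<Rightarrow> (real \<Rightarrow> real) \<Rightarrow> (real \<Rightarrow> real) \<Rightarrow> (real \<Rightarrow> state) \<Rightarrow> bool" where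
  "gaussian_system t x S \<mu> q w j Y \<longleftrightarrow> (\<forall>u\<in>{t..T}.
     inventory (Y u) = q - (LBINT r:{t..u}. mean_speed r (speed (Y r)) (inventory (Y r))) \<and>
     midprice (Y u) = S - b * (LBINT r:{t..u}. mean_speed r (speed (Y r)) (inventory (Y r))) + \<sigma> * w u \<and>
     cash (Y u) = x + (LBINT r:{t..u}. midprice (Y r) * mean_speed r (speed (Y r)) (inventory (Y r))
        - k * ((mean_speed r (speed (Y r)) (inventory (Y r)))\<^sup>2 + sd\<^sup>2)) \<and>
     speed (Y u) = \<mu> - \<kappa> * (LBINT r:{t..u}. speed (Y r)) + j u)"

lemma cadlag_drift:
  assumes t: "t \<in> {0..T}" and m: "cadlag_on t T m"
  shows "cadlag_on t T (\<lambda>r. drift_gain r (m r) / (2 * c))"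
proof -
  have sub: "{t..T} \<subseteq> {0..T}" using t by auto
  have l: "continuous_on {t..T} (l\<^sub>1 P)" "continuous_on {t..T} (l\<^sub>0 P)"
    by (rule continuous_on_subset[OF l_continuous(1) sub], rule continuous_on_subset[OF l_continuous(2) sub])
  have nz: "2 * c \<noteq> 0" using c_pos by simp
  have 1: "cadlag_on t T (\<lambda>r. (2 * \<phi> * \<rho> - l\<^sub>1 P r) / (2 * c))" "cadlag_on t T (\<lambda>r. l\<^sub>0 P r / (2 * c))"
    by (rule continuous_imp_cadlag, intro continuous_on_divide continuous_on_diff continuous_on_const l, use nz in simp)+
  have "cadlag_on t T (\<lambda>r. (2 * \<phi> * \<rho> - l\<^sub>1 P r) / (2 * c) * m r - l\<^sub>0 P r / (2 * c))"
    by (intro cadlag_on_arith 1 m)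
  moreover have "(2 * \<phi> * \<rho> - l\<^sub>1 P r) / (2 * c) * m r - l\<^sub>0 P r / (2 * c) = drift_gain r (m r) / (2 * c)" for r
    unfolding drift_gain_eq diff_divide_distrib[of "(2 * \<phi> * \<rho> - l\<^sub>1 P r) * m r"] times_divide_eq_left ..
  ultimately show ?thesis by simp
qed

lemma cadlag_p: "t \<in> {0..T} \<Longrightarrow> cadlag_on t T p" "t \<in> {0..T} \<Longrightarrow> cadlag_on t T (\<lambda>r. p r / c)"
  "t \<in> {0..T} \<Longrightarrow> continuous_on {t..T} (\<lambda>r. 1 / p r)"
proof -
  assume t: "t \<in> {0..T}"
  have p: "continuous_on {t..T} p" using t by (intro p_continuous) auto
  show "cadlag_on t T p" by (rule continuous_imp_cadlag[OF p])
  show "cadlag_on t T (\<lambda>r. p r / c)"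
    using c_pos by (intro continuous_imp_cadlag continuous_on_divide p continuous_on_const) simp
  show "continuous_on {t..T} (\<lambda>r. 1 / p r)"
    using t by (intro continuous_on_divide p continuous_on_const) (auto intro!: p_nz)
qed

text \<open>The product rule for \<open>(1 / p) (p Q)\<close> verifies the equation of the inventory, as
  \<open>1 / p\<close> has the derivative \<open>- 1 / c\<close>.\<close>

lemma gaussian_system_solution:
  assumes t: "t \<in> {0..T}" and w: "cadlag_on t T w" and j: "cadlag_on t T j"
  shows "cadlag_on t T (\<lambda>u. gaussian_state t x S \<mu> q w j u)"
    and "gaussian_system t x S \<mu> q w j (\<lambda>u. gaussian_state t x S \<mu> q w j u)"
proof -
  let ?m = "speed_path t \<mu> j" and ?Q = "inventory_path t \<mu> q j" and ?z = "excess_path t \<mu> j"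
  let ?h = "\<lambda>r. \<mu> + j r"
  have tT: "t \<le> T" using t by simp
  have const: "cadlag_on t T (\<lambda>_. C::real)" for C by (intro continuous_imp_cadlag continuous_intros)
  have h: "cadlag_on t T ?h" by (intro cadlag_on_arith const j)
  note hi = cadlag_set_integrable[OF tT h]
  let ?I = "\<lambda>r. LBINT s:{t..r}. exp (- \<kappa> * (r - s)) * ?h s"
  have I: "exp (- \<kappa> * r) * (LBINT s:{t..r}. exp (\<kappa> * s) * ?h s) = ?I r" for r
    by (rule exp_kernel_factor)
  have m_def: "?m r = ?h r - \<kappa> * ?I r" for r unfolding speed_path_def I ..
  have m_eq: "?m u = ?h u - \<kappa> * (LBINT r:{t..u}. ?m r)" if u: "u \<in> {t..T}" for u
  proof -
    have tu: "t \<le> u" "u \<le> T" using u by auto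
    have "?I u = (LBINT r:{t..u}. ?h r - \<kappa> * ?I r)"
      by (rule linear_integral_equation_solves(2)[OF tu(1) set_integrable_Icc_subset[OF hi order_refl tu(2)]])
    then show ?thesis unfolding m_def by simp
  qed
  have mi: "L1_on {t..T} ?m"
    unfolding m_def[abs_def] by (rule linear_integral_equation_solves(1)[OF tT hi])
  have m: "cadlag_on t T ?m"
  proof (rule cadlag_on_cong[OF _ _ tT])
    show "cadlag_on t T (\<lambda>u. ?h u - \<kappa> * (LBINT r:{t..u}. ?m r))"
      by (intro cadlag_on_arith(2) h continuous_imp_cadlag continuous_intros continuous_on_indefinite_integral mi)
  qed (rule m_eq[symmetric])
  have z: "cadlag_on t T ?z" unfolding excess_path_def[abs_def] by (rule cadlag_drift[OF t m])
  have pz: "L1_on {t..T} (\<lambda>r. p r * ?z r)"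
    by (intro cadlag_set_integrable tT cadlag_on_arith(3) cadlag_p t z)
  have Qc: "continuous_on {t..T} ?Q"
  proof -
    have "continuous_on {t..T} (\<lambda>u. (p t * q - (LBINT r:{t..u}. p r * ?z r)) * (1 / p u))"
      by (intro continuous_intros cadlag_p(3) t continuous_on_indefinite_integral pz)
    then show ?thesis unfolding inventory_path_def[abs_def] by simp
  qed
  note Q = continuous_imp_cadlag[OF Qc]
  have tr: "cadlag_on t T (trade_path t \<mu> q j)"
  proof -
    have "cadlag_on t T (\<lambda>r. p r / c * ?Q r + ?z r)"
      by (intro cadlag_on_arith cadlag_p t z Q)
    then show ?thesis unfolding trade_path_def[abs_def] mean_speed_def excess_path_def by simp
  qed
  have pr: "cadlag_on t T (price_path t S \<mu> q w j)"
    unfolding price_path_def[abs_def] by (intro cadlag_on_arith const Q w)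
  have cr: "cadlag_on t T (\<lambda>r. price_path t S \<mu> q w j r * trade_path t \<mu> q j r - k * ((trade_path t \<mu> q j r)\<^sup>2 + sd\<^sup>2))"
    unfolding power2_eq_square[of "trade_path t \<mu> q j _"] by (intro cadlag_on_arith const pr tr)
  have ca: "cadlag_on t T (cash_path t x S \<mu> q w j)"
    unfolding cash_path_def[abs_def]
    by (intro continuous_imp_cadlag continuous_intros continuous_on_indefinite_integral cadlag_set_integrable tT cr)
  show "cadlag_on t T (\<lambda>u. gaussian_state t x S \<mu> q w j u)"
    unfolding gaussian_state_def by (intro cadlag_on_Pair ca pr m Q)
  have Q_eq: "?Q u = q - (LBINT r:{t..u}. trade_path t \<mu> q j r)" if u: "u \<in> {t..T}" for u
  proof -
    have tu: "t \<le> u" "u \<le> T" using u by auto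
    have sub: "r \<in> {t..u} \<Longrightarrow> r \<in> {0..T}" for r using t tu by auto
    let ?F = "\<lambda>r. 1 / p r" and ?G = "\<lambda>r. p t * q - (LBINT s:{t..r}. p s * ?z s)"
    have fi: "L1_on {t..u} (\<lambda>_. - 1 / c)" by (rule set_integrable_const_Icc)
    have gi: "L1_on {t..u} (\<lambda>r. - (p r * ?z r))"
      using set_integrable_Icc_subset[OF pz order_refl tu(2)] by (simp add: set_integrable_def)
    have F: "?F r = ?F t + (LBINT s:{t..r}. - 1 / c)" if r: "r \<in> {t..u}" for r
    proof -
      have "(LBINT s:{t..r}. - 1 / c) = (r - t) * (- 1 / c)"
        using r by (intro set_integral_const_Icc) auto
      moreover have "1 / inverse y = y" for y :: real by (simp only: inverse_eq_divide divide_divide_eq_right mult_1 div_by_1)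
      ultimately show ?thesis unfolding p_def by (simp add: diff_divide_distrib)
    qed
    have G: "?G r = ?G t + (LBINT s:{t..r}. - (p s * ?z s))" if "r \<in> {t..u}" for r
    proof -
      have "(LBINT s:{t..r}. - (p s * ?z s)) = - (LBINT s:{t..r}. p s * ?z s)"
        by (simp add: set_lebesgue_integral_def)
      then show ?thesis by simp
    qed
    have "?F u * ?G u = ?F t * ?G t + (LBINT r:{t..u}. - 1 / c * ?G r + ?F r * - (p r * ?z r))"
      by (rule product_rule_integrals(3)[OF tu(1) fi gi F G])
    also have "(LBINT r:{t..u}. - 1 / c * ?G r + ?F r * - (p r * ?z r)) = (LBINT r:{t..u}. - trade_path t \<mu> q j r)"
    proof (intro set_lebesgue_integral_cong allI impI)
      fix r assume "r \<in> {t..u}"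
      from p_nz[OF sub[OF this]] show "- 1 / c * ?G r + ?F r * - (p r * ?z r) = - trade_path t \<mu> q j r"
        unfolding trade_path_def mean_speed_def excess_path_def[symmetric] inventory_path_def by simp
    qed simp
    also have "\<dots> = - (LBINT r:{t..u}. trade_path t \<mu> q j r)"
      by (simp add: set_lebesgue_integral_def)
    also have "?F t * ?G t = q" using p_nz[OF t] by simp
    finally show ?thesis by (simp add: inventory_path_def)
  qed
  show "gaussian_system t x S \<mu> q w j (\<lambda>u. gaussian_state t x S \<mu> q w j u)"
    unfolding gaussian_system_def
  proof (intro ballI conjI)
    fix u assume u: "u \<in> {t..T}"
    show "speed (gaussian_state t x S \<mu> q w j u) = \<mu> - \<kappa> * (LBINT r:{t..u}. speed (gaussian_state t x S \<mu> q w j r)) + j u"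
      using m_eq[OF u] by (simp add: speed_def gaussian_state_def)
    show "inventory (gaussian_state t x S \<mu> q w j u) = q - (LBINT r:{t..u}. mean_speed r (speed (gaussian_state t x S \<mu> q w j r)) (inventory (gaussian_state t x S \<mu> q w j r)))"
      "midprice (gaussian_state t x S \<mu> q w j u) = S - b * (LBINT r:{t..u}. mean_speed r (speed (gaussian_state t x S \<mu> q w j r)) (inventory (gaussian_state t x S \<mu> q w j r))) + \<sigma> * w u"
      using Q_eq[OF u] by (simp_all add: inventory_def speed_def midprice_def gaussian_state_def trade_path_def[symmetric] price_path_def)
    show "cash (gaussian_state t x S \<mu> q w j u) = x + (LBINT r:{t..u}. midprice (gaussian_state t x S \<mu> q w j r) * mean_speed r (speed (gaussian_state t x S \<mu> q w j r)) (inventory (gaussian_state t x S \<mu> q w j r))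
      - k * ((mean_speed r (speed (gaussian_state t x S \<mu> q w j r)) (inventory (gaussian_state t x S \<mu> q w j r)))\<^sup>2 + sd\<^sup>2))"
      by (simp add: inventory_def speed_def midprice_def cash_def gaussian_state_def trade_path_def[symmetric] cash_path_def)
  qed
qed

text \<open>Conversely, the product rule for \<open>p Q\<close> turns any solution into the explicit formula.\<close>

lemma gaussian_system_unique:
  assumes t: "t \<in> {0..T}" and Yc: "cadlag_on t T Y"
    and sys: "gaussian_system t x S \<mu> q w j Y" and u: "u \<in> {t..T}"
  shows "Y u = gaussian_state t x S \<mu> q w j u"
proof -
  let ?m = "\<lambda>r. speed (Y r)" and ?Q = "\<lambda>r. inventory (Y r)"
  let ?z = "\<lambda>r. drift_gain r (?m r) / (2 * c)" and ?tr = "\<lambda>r. mean_speed r (?m r) (?Q r)"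
  have tT: "t \<le> T" using t by simp
  have m: "cadlag_on t T ?m" and Q: "cadlag_on t T ?Q"
    by (rule cadlag_on_continuous[OF Yc]; rule continuous_on_state)+
  have z: "cadlag_on t T ?z" by (rule cadlag_drift[OF t m])
  have tr: "L1_on {t..T} ?tr"
  proof -
    have "cadlag_on t T (\<lambda>r. p r / c * ?Q r + ?z r)" by (intro cadlag_on_arith cadlag_p t z Q)
    from cadlag_set_integrable[OF tT this] show ?thesis unfolding mean_speed_def by simp
  qed
  have m_eq: "?m r = speed_path t \<mu> j r" if r: "r \<in> {t..T}" for r
  proof -
    have tr: "t \<le> r" "r \<le> T" using r by auto
    have eq: "?m s = (\<mu> + j s) - \<kappa> * (LBINT r:{t..s}. ?m r)" if "s \<in> {t..r}" for s
      using sys that tr unfolding gaussian_system_def by auto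
    have "(LBINT s:{t..r}. ?m s) = (LBINT s:{t..r}. exp (- \<kappa> * (r - s)) * (\<mu> + j s))"
      by (rule linear_integral_equation[OF tr(1) set_integrable_Icc_subset[OF cadlag_set_integrable[OF tT m] order_refl tr(2)] eq])
    also have "\<dots> = exp (- \<kappa> * r) * (LBINT s:{t..r}. exp (\<kappa> * s) * (\<mu> + j s))"
      by (rule exp_kernel_factor[symmetric])
    finally show ?thesis using eq[of r] tr by (simp add: speed_path_def)
  qed
  have Q_eq: "?Q r = inventory_path t \<mu> q j r" if r: "r \<in> {t..T}" for r
  proof -
    have tr': "t \<le> r" "r \<le> T" using r by auto
    have sub: "{t..r} \<subseteq> {0..T}" using t tr' by auto
    have rT: "r \<in> {0..T}" using t tr' by auto
    have pd: "(p has_real_derivative (p s)\<^sup>2 / c) (at s within X)" if "s \<in> {t..r}" for s X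
      using p_deriv that sub by blast
    have pc: "continuous_on {t..a} (\<lambda>s. (p s)\<^sup>2 / c)" if "a \<le> r" for a
      using c_pos sub that by (auto intro!: continuous_intros p_continuous)
    have F: "p s = p t + (LBINT a:{t..s}. (p a)\<^sup>2 / c)" if s: "s \<in> {t..r}" for s
      using s by (intro FTC_set_integral(2) pd pc) auto
    have fi: "L1_on {t..r} (\<lambda>a. (p a)\<^sup>2 / c)"
      by (rule FTC_set_integral(1)[OF tr'(1) pd pc]) auto
    have gi: "L1_on {t..r} (\<lambda>a. - ?tr a)"
      using set_integrable_Icc_subset[OF tr order_refl tr'(2)] by (simp add: set_integrable_def)
    have q: "?Q s = q - (LBINT a:{t..s}. ?tr a)" if "s \<in> {t..r}" for s
      using sys that tr' unfolding gaussian_system_def by auto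
    have q0: "?Q t = q" using q[of t] tr' by simp
    have G: "?Q s = ?Q t + (LBINT a:{t..s}. - ?tr a)" if "s \<in> {t..r}" for s
      unfolding q[OF that] q0 by (simp add: set_lebesgue_integral_def)
    have "p r * ?Q r = p t * ?Q t + (LBINT a:{t..r}. (p a)\<^sup>2 / c * ?Q a + p a * - ?tr a)"
      by (rule product_rule_integrals(3)[OF tr'(1) fi gi F G])
    also have "(LBINT a:{t..r}. (p a)\<^sup>2 / c * ?Q a + p a * - ?tr a) = (LBINT a:{t..r}. - (p a * excess_path t \<mu> j a))"
    proof (intro set_lebesgue_integral_cong allI impI)
      fix a assume "a \<in> {t..r}"
      then have "excess_path t \<mu> j a = ?z a" using m_eq[of a] tr' by (simp add: excess_path_def)
      then show "(p a)\<^sup>2 / c * ?Q a + p a * - ?tr a = - (p a * excess_path t \<mu> j a)"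
        by (simp add: mean_speed_def power2_eq_square ring_distribs)
    qed simp
    also have "\<dots> = - (LBINT a:{t..r}. p a * excess_path t \<mu> j a)" by (simp add: set_lebesgue_integral_def)
    finally show ?thesis unfolding q0 inventory_path_def using p_nz[OF rT] by (simp add: field_simps)
  qed
  have S_eq: "midprice (Y r) = price_path t S \<mu> q w j r" if r: "r \<in> {t..T}" for r
  proof -
    have "midprice (Y r) = S - b * (LBINT r:{t..r}. ?tr r) + \<sigma> * w r" "?Q r = q - (LBINT r:{t..r}. ?tr r)"
      using sys r unfolding gaussian_system_def by auto
    then show ?thesis unfolding price_path_def Q_eq[OF r, symmetric] by simp
  qed
  have "cash (Y u) = x + (LBINT r:{t..u}. midprice (Y r) * ?tr r - k * ((?tr r)\<^sup>2 + sd\<^sup>2))"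
    using sys u unfolding gaussian_system_def by auto
  also have "\<dots> = cash_path t x S \<mu> q w j u"
    unfolding cash_path_def using u
    by (intro arg_cong2[of _ _ _ _ "(+)"] refl set_lebesgue_integral_cong) (auto simp: S_eq trade_path_def m_eq Q_eq)
  finally have "cash (Y u) = cash_path t x S \<mu> q w j u" .
  moreover have "Y u = (cash (Y u), midprice (Y u), speed (Y u), inventory (Y u))"
    by (cases "Y u") (simp add: cash_def midprice_def speed_def inventory_def)
  ultimately show ?thesis using m_eq[OF u] Q_eq[OF u] S_eq[OF u] by (simp add: gaussian_state_def)
qed

end

context liquidation_noise
begin

subsection \<open>The law of the noise path\<close>

definition noise_path :: "real \<Rightarrow> real set \<Rightarrow> 'a \<Rightarrow> real \<Rightarrow> real \<times> real" where
  "noise_path t I \<omega> = (\<lambda>r\<in>I. increment t r \<omega>)"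

lemma increment_borel: "0 \<le> s \<Longrightarrow> s \<le> t \<Longrightarrow> increment s t \<in> borel_measurable (F t)"
  using increment_measurable unfolding borel_prod .

lemma noise_path_measurable:
  assumes "0 \<le> t" "I \<subseteq> {t..s}"
  shows "noise_path t I \<in> measurable (F s) (\<Pi>\<^sub>M r\<in>I. borel)"
  unfolding noise_path_def
proof (rule measurable_restrict)
  fix r assume "r \<in> I"
  with assms have "0 \<le> t" "t \<le> r" "r \<le> s" by auto
  then show "increment t r \<in> borel_measurable (F s)"
    using F_mono_measurable[OF increment_borel] by blast
qed

text \<open>The last coordinate is the one before plus an independent increment of known law; the right-hand
  side depends on the noise only through the law of the earlier coordinates.\<close>

lemma noise_path_step:
  assumes t: "0 \<le> t" and fin: "finite I" and I: "I \<subseteq> {t..}" and m: "\<And>r. r \<in> I \<Longrightarrow> r < m" "t < m"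
  defines "s \<equiv> if I = {} then t else Max I"
  shows "distr M (\<Pi>\<^sub>M r\<in>insert m I. borel) (noise_path t (insert m I)) =
    distr (distr M (\<Pi>\<^sub>M r\<in>I. borel) (noise_path t I)
        \<Otimes>\<^sub>M (density lborel (normal_density 0 (sqrt (m - s))) \<Otimes>\<^sub>M compound_poisson \<nu> (lam * (m - s))))
      (\<Pi>\<^sub>M r\<in>insert m I. borel) (\<lambda>z. (fst z)(m := (if I = {} then 0 else fst z s) + snd z))"
proof -
  let ?B = "borel :: (real \<times> real) measure"
  have ts: "t \<le> s" using I Max_in[OF fin] unfolding s_def by auto
  have sm: "s < m" using m fin by (auto simp: s_def)
  have s0: "0 \<le> s" using t ts by simp
  have Is: "I \<subseteq> {t..s}" using I fin by (auto simp: s_def)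
  have sI: "I \<noteq> {} \<Longrightarrow> s \<in> I" using fin by (simp add: s_def)
  have Xs: "noise_path t I \<in> measurable (F s) (\<Pi>\<^sub>M r\<in>I. ?B)" by (rule noise_path_measurable[OF t Is])
  have X: "noise_path t I \<in> measurable M (\<Pi>\<^sub>M r\<in>I. ?B)" by (rule F_measurable[OF Xs])
  have inc: "increment s m \<in> measurable M ?B" by (rule F_measurable[OF increment_borel[OF s0]]) (use sm in simp)
  let ?G = "\<lambda>z. (fst z)(m := (if I = {} then 0 else fst z s) + snd z)"
  have G: "?G \<in> measurable ((\<Pi>\<^sub>M r\<in>I. ?B) \<Otimes>\<^sub>M ?B) (\<Pi>\<^sub>M r\<in>insert m I. ?B)"
  proof (rule measurable_fun_upd[where J = I])
    show "(\<lambda>z. (if I = {} then 0 else fst z s) + snd z) \<in> borel_measurable ((\<Pi>\<^sub>M r\<in>I. ?B) \<Otimes>\<^sub>M ?B)"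
    proof (cases "I = {}")
      case False
      have "(\<lambda>z. fst z s) \<in> borel_measurable ((\<Pi>\<^sub>M r\<in>I. ?B) \<Otimes>\<^sub>M ?B)"
        using measurable_compose[OF measurable_fst measurable_component_singleton[OF sI[OF False]]] .
      then show ?thesis using False by simp
    qed simp
  qed auto
  have law: "distr M ?B (increment s m) = density lborel (normal_density 0 (sqrt (m - s))) \<Otimes>\<^sub>M compound_poisson \<nu> (lam * (m - s))"
    using increment_law(1)[OF s0 sm] unfolding borel_prod .
  have joint: "distr M ((\<Pi>\<^sub>M r\<in>I. ?B) \<Otimes>\<^sub>M ?B) (\<lambda>\<omega>. (noise_path t I \<omega>, increment s m \<omega>)) = distr M (\<Pi>\<^sub>M r\<in>I. ?B) (noise_path t I) \<Otimes>\<^sub>M distr M ?B (increment s m)"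
    using increment_joint_law[OF s0 sm Xs] unfolding borel_prod .
  have eq: "noise_path t (insert m I) \<omega> = ?G (noise_path t I \<omega>, increment s m \<omega>)" for \<omega>
  proof
    fix r
    have mI: "m \<notin> I" using m(1) by blast
    have 0: "increment t t \<omega> = 0" by (simp add: increment_def zero_prod_def)
    have sum: "increment t m \<omega> = increment t s \<omega> + increment s m \<omega>" by (simp add: increment_def)
    have at_s: "(if I = {} then 0 else noise_path t I \<omega> s) = increment t s \<omega>"
      using sI 0 by (auto simp: noise_path_def s_def)
    show "noise_path t (insert m I) \<omega> r = ?G (noise_path t I \<omega>, increment s m \<omega>) r"
    proof (cases "r = m")
      case True
      have n: "noise_path t (insert m I) \<omega> m = increment t m \<omega>" by (simp add: noise_path_def)
      show ?thesis unfolding True fun_upd_same fst_conv snd_conv at_s n sum ..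
    qed (auto simp: noise_path_def restrict_def)
  qed
  have "distr M (\<Pi>\<^sub>M r\<in>insert m I. ?B) (noise_path t (insert m I))
     = distr (distr M ((\<Pi>\<^sub>M r\<in>I. ?B) \<Otimes>\<^sub>M ?B) (\<lambda>\<omega>. (noise_path t I \<omega>, increment s m \<omega>))) (\<Pi>\<^sub>M r\<in>insert m I. ?B) ?G"
    using X inc by (subst distr_distr[OF G]) (auto intro!: distr_cong simp: eq)
  then show ?thesis unfolding joint law .
qed

lemma noise_path_start:
  "distr M (\<Pi>\<^sub>M r\<in>{t}. borel) (noise_path t {t}) = return (\<Pi>\<^sub>M r\<in>{t}. borel) (\<lambda>r\<in>{t}. 0)"
  "distr M (\<Pi>\<^sub>M r\<in>{}. borel) (noise_path t {}) = return (\<Pi>\<^sub>M r\<in>{}. borel) (\<lambda>r\<in>{}. 0)"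
proof -
  have "noise_path t {t} \<omega> = (\<lambda>r\<in>{t}. 0)" "noise_path t {} \<omega> = (\<lambda>r\<in>{}. 0)" for \<omega>
    unfolding noise_path_def by (rule restrict_ext, simp add: increment_def zero_prod_def)+
  note e = ext[OF this(1)] ext[OF this(2)]
  show "distr M (\<Pi>\<^sub>M r\<in>{t}. borel) (noise_path t {t}) = return (\<Pi>\<^sub>M r\<in>{t}. borel) (\<lambda>r\<in>{t}. 0)"
    "distr M (\<Pi>\<^sub>M r\<in>{}. borel) (noise_path t {}) = return (\<Pi>\<^sub>M r\<in>{}. borel) (\<lambda>r\<in>{}. 0)"
    unfolding e by (rule distr_const, simp add: space_PiM, rule distr_const, simp add: space_PiM restrict_def)
qed

end

context liquidation_model
begin

text \<open>The finite-dimensional laws agree by induction on the number of times, adding the largest time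
  last, and they determine a law on the product space.\<close>

lemma noise_path_law_unique:
  fixes M :: "'a measure" and M' :: "'a measure"
  assumes A: "driving_noise P M F W N \<eta>" and B: "driving_noise P M' F' W' N' \<eta>'" and t: "0 \<le> t"
  shows "distr M (\<Pi>\<^sub>M r\<in>{t..d}. borel) (liquidation_noise.noise_path W N \<eta> t {t..d})
    = distr M' (\<Pi>\<^sub>M r\<in>{t..d}. borel) (liquidation_noise.noise_path W' N' \<eta>' t {t..d})"
proof -
  interpret A: liquidation_noise P M F W N \<eta> by unfold_locales (rule A)
  interpret B: liquidation_noise P M' F' W' N' \<eta>' by unfold_locales (rule B)
  have fin: "distr M (\<Pi>\<^sub>M r\<in>I. borel) (A.noise_path t I) = distr M' (\<Pi>\<^sub>M r\<in>I. borel) (B.noise_path t I)"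
    if "finite I" "I \<subseteq> {t..}" for I
    using that
  proof (induction I rule: finite_linorder_max_induct)
    case empty
    show ?case unfolding A.noise_path_start B.noise_path_start ..
  next
    case (insert m I)
    show ?case
    proof (cases "t < m")
      case True
      have I: "I \<subseteq> {t..}" and lt: "\<And>r. r \<in> I \<Longrightarrow> r < m" using insert by auto
      note IH = insert(3)[OF I]
      show ?thesis
        using A.noise_path_step[OF t insert(1) I lt True] B.noise_path_step[OF t insert(1) I lt True]
        by (simp only: IH)
    next
      case False
      with insert have e: "insert m I = {t}" by force
      show ?thesis unfolding e by (simp only: A.noise_path_start(1) B.noise_path_start(1))
    qed
  qed
  have m: "A.noise_path t I \<in> measurable M (\<Pi>\<^sub>M r\<in>I. borel)" "B.noise_path t I \<in> measurable M' (\<Pi>\<^sub>M r\<in>I. borel)" if "I \<subseteq> {t..d}" for I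
    using A.F_measurable[OF A.noise_path_measurable[OF t that]] B.F_measurable[OF B.noise_path_measurable[OF t that]] .
  let ?E = "\<lambda>I A. prod_emb {t..d} (\<lambda>_. borel :: (real \<times> real) measure) I (Pi\<^sub>E I A)"
  show ?thesis
  proof (rule measure_eqI_PiM_infinite[where M = "\<lambda>_. borel" and I = "{t..d}"])
    fix A :: "real \<Rightarrow> (real \<times> real) set" and I assume I: "finite I" "I \<subseteq> {t..d}" and Ab: "\<And>i. i \<in> I \<Longrightarrow> A i \<in> sets borel"
    have E: "?E I A \<in> sets (\<Pi>\<^sub>M r\<in>{t..d}. borel)" using I Ab by (intro sets_PiM_I) auto
    have E': "Pi\<^sub>E I A \<in> sets (\<Pi>\<^sub>M r\<in>I. borel)" using I Ab by (intro sets_PiM_I_finite) auto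
    have vA: "A.noise_path t {t..d} -` ?E I A \<inter> space M = A.noise_path t I -` Pi\<^sub>E I A \<inter> space M"
      using I(2) by (auto simp: A.noise_path_def prod_emb_iff PiE_iff restrict_def extensional_def subset_eq)
    have vB: "B.noise_path t {t..d} -` ?E I A \<inter> space M' = B.noise_path t I -` Pi\<^sub>E I A \<inter> space M'"
      using I(2) by (auto simp: B.noise_path_def prod_emb_iff PiE_iff restrict_def extensional_def subset_eq)
    have "emeasure (distr M (\<Pi>\<^sub>M r\<in>{t..d}. borel) (A.noise_path t {t..d})) (?E I A) = emeasure (distr M (\<Pi>\<^sub>M r\<in>I. borel) (A.noise_path t I)) (Pi\<^sub>E I A)"
      by (simp only: emeasure_distr[OF m(1)[OF order_refl] E] emeasure_distr[OF m(1)[OF I(2)] E'] vA)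
    also have "\<dots> = emeasure (distr M' (\<Pi>\<^sub>M r\<in>I. borel) (B.noise_path t I)) (Pi\<^sub>E I A)"
      by (subst fin[OF I(1)]) (use I(2) in auto)
    also have "\<dots> = emeasure (distr M' (\<Pi>\<^sub>M r\<in>{t..d}. borel) (B.noise_path t {t..d})) (?E I A)"
      by (simp only: emeasure_distr[OF m(2)[OF order_refl] E] emeasure_distr[OF m(2)[OF I(2)] E'] vB)
    finally show "emeasure (distr M (\<Pi>\<^sub>M r\<in>{t..d}. borel) (A.noise_path t {t..d})) (?E I A)
      = emeasure (distr M' (\<Pi>\<^sub>M r\<in>{t..d}. borel) (B.noise_path t {t..d})) (?E I A)" .
  next
    show "finite_measure (distr M (\<Pi>\<^sub>M r\<in>{t..d}. borel) (A.noise_path t {t..d}))"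
      using A.prob_space_distr[OF m(1)[OF order_refl]] by (rule prob_space.finite_measure)
  qed simp_all
qed

subsection \<open>The Gaussian policy has a unique weak solution\<close>

lemma full_set_integral:
  assumes [measurable]: "f \<in> borel_measurable borel"
  shows "L1_on \<A> f \<longleftrightarrow> integrable lborel (f :: real \<Rightarrow> real)" "(LBINT v:\<A>. f v) = (\<integral>v. f v \<partial>lborel)"
proof -
  have e: "AE v in lborel. indicator \<A> v *\<^sub>R f v = f v" using A_full by eventually_elim simp
  show "L1_on \<A> f \<longleftrightarrow> integrable lborel f" unfolding set_integrable_def
    by (rule integrable_cong_AE[OF _ _ e]) measurable
  show "(LBINT v:\<A>. f v) = (\<integral>v. f v \<partial>lborel)" unfolding set_lebesgue_integral_def
    by (rule integral_cong_AE[OF _ _ e]) measurable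
qed

lemma gaussian_policy_state:
  "gaussian_policy P t y = normal_density (mean_speed t (speed y) (inventory y)) sd"
  by (cases y) (simp add: gaussian_policy_eq speed_def inventory_def)

text \<open>The action space has full measure, so that the integrals over the actions are moments of a normal
  law.\<close>

lemma gaussian_rates:
  shows "L1_on \<A> (\<lambda>v. v * gaussian_policy P t y v)"
    and "L1_on \<A> (\<lambda>v. (midprice y - k * v) * v * gaussian_policy P t y v)"
    and "mean_rate P (gaussian_policy P) t y = mean_speed t (speed y) (inventory y)"
    and "cash_rate P (gaussian_policy P) t y = midprice y * mean_speed t (speed y) (inventory y)
       - k * ((mean_speed t (speed y) (inventory y))\<^sup>2 + sd\<^sup>2)"
proof -
  let ?m = "mean_speed t (speed y) (inventory y)"
  note n1 = normal_first_moment[OF sd_pos, of ?m] and n2 = normal_second_moment[OF sd_pos, of ?m]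
  have n0: "integrable lborel (normal_density ?m sd)" "(\<integral>v. normal_density ?m sd v \<partial>lborel) = 1"
    using sd_pos by auto
  have e: "(midprice y - k * v) * v * normal_density ?m sd v = (midprice y - 2 * k * ?m) * (v * normal_density ?m sd v)
     - k * ((v - ?m)\<^sup>2 * normal_density ?m sd v) + k * ?m\<^sup>2 * normal_density ?m sd v" for v
    by (simp add: power2_eq_square algebra_simps)
  have i: "integrable lborel (\<lambda>v. (midprice y - 2 * k * ?m) * (v * normal_density ?m sd v))"
    "integrable lborel (\<lambda>v. k * ((v - ?m)\<^sup>2 * normal_density ?m sd v))"
    "integrable lborel (\<lambda>v. k * ?m\<^sup>2 * normal_density ?m sd v)"
    by (intro integrable_mult_right n0 n1 n2)+
  note i' = Bochner_Integration.integrable_diff[OF i(1,2)]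
  have I: "integrable lborel (\<lambda>v. (midprice y - k * v) * v * normal_density ?m sd v)"
    unfolding e by (rule Bochner_Integration.integrable_add[OF i' i(3)])
  have V: "(\<integral>v. (midprice y - k * v) * v * normal_density ?m sd v \<partial>lborel) = midprice y * ?m - k * (?m\<^sup>2 + sd\<^sup>2)"
    unfolding e Bochner_Integration.integral_add[OF i' i(3)] Bochner_Integration.integral_diff[OF i(1,2)]
      integral_mult_right_zero n0 n1 n2 by (simp add: power2_eq_square algebra_simps)
  show "L1_on \<A> (\<lambda>v. v * gaussian_policy P t y v)"
    "L1_on \<A> (\<lambda>v. (midprice y - k * v) * v * gaussian_policy P t y v)"
    unfolding gaussian_policy_state using n1(1) I by (simp_all add: full_set_integral)
  show "mean_rate P (gaussian_policy P) t y = ?m"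
    unfolding mean_rate_def gaussian_policy_state by (subst full_set_integral) (measurable, rule n1)
  show "cash_rate P (gaussian_policy P) t y = midprice y * ?m - k * (?m\<^sup>2 + sd\<^sup>2)"
    unfolding cash_rate_def gaussian_policy_state by (subst full_set_integral) (measurable, rule V)
qed

lemma cadlag_gaussian_rates:
  assumes t: "t \<in> {0..T}" and Y: "cadlag_on t T Y"
  shows "L1_on {t..T} (\<lambda>r. mean_rate P (gaussian_policy P) r (Y r))"
    and "L1_on {t..T} (\<lambda>r. cash_rate P (gaussian_policy P) r (Y r))"
proof -
  have tT: "t \<le> T" using t by simp
  note s = cadlag_on_continuous[OF Y continuous_on_state(2)] cadlag_on_continuous[OF Y continuous_on_state(3)] cadlag_on_continuous[OF Y continuous_on_state(4)]
  have const: "cadlag_on t T (\<lambda>_. C::real)" for C by (intro continuous_imp_cadlag continuous_intros)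
  have "cadlag_on t T (\<lambda>r. p r / c * inventory (Y r) + drift_gain r (speed (Y r)) / (2 * c))"
    by (intro cadlag_on_arith cadlag_p t cadlag_drift s)
  then have m: "cadlag_on t T (\<lambda>r. mean_speed r (speed (Y r)) (inventory (Y r)))"
    unfolding mean_speed_def by simp
  show "L1_on {t..T} (\<lambda>r. mean_rate P (gaussian_policy P) r (Y r))"
    unfolding gaussian_rates by (rule cadlag_set_integrable[OF tT m])
  show "L1_on {t..T} (\<lambda>r. cash_rate P (gaussian_policy P) r (Y r))"
    unfolding gaussian_rates power2_eq_square[of "mean_speed _ _ _"]
    by (intro cadlag_set_integrable[OF tT] cadlag_on_arith const m s)
qed

end

context liquidation_noise
begin

lemma gaussian_state_equation:
  assumes t: "t \<in> {0..T}" and \<omega>: "\<omega> \<in> space M" and Y: "cadlag_on t T Y"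
  shows "state_equation P (gaussian_policy P) t (x, S, \<mu>, q) (\<lambda>u. W u \<omega>) (\<lambda>u. N u \<omega>) (\<lambda>i. \<eta> i \<omega>) Y
     \<longleftrightarrow> gaussian_system t x S \<mu> q (\<lambda>u. W u \<omega> - W t \<omega>) (\<lambda>u. J u \<omega> - J t \<omega>) Y"
proof -
  have j: "jump_integral (\<lambda>u. N u \<omega>) (\<lambda>i. \<eta> i \<omega>) t u = J u \<omega> - J t \<omega>" if "u \<in> {t..T}" for u
    using J_diff[OF \<omega>, of t u] t that by simp
  have y: "cash (x, S, \<mu>, q) = x" "midprice (x, S, \<mu>, q) = S" "speed (x, S, \<mu>, q) = \<mu>" "inventory (x, S, \<mu>, q) = q"
    by (simp_all add: cash_def midprice_def speed_def inventory_def)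
  note ri = cadlag_gaussian_rates[OF t Y]
  show ?thesis
    unfolding state_equation_def gaussian_system_def y
    using gaussian_rates(1,2) ri[unfolded gaussian_rates(3,4)] by (simp add: j gaussian_rates(3,4))
qed

lemma gaussian_weak_solution:
  assumes t: "t \<in> {0..T}"
  shows "weak_solution P (gaussian_policy P) t (x, S, \<mu>, q) M F W N \<eta>
    (\<lambda>u \<omega>. gaussian_state t x S \<mu> q (\<lambda>r. W r \<omega> - W t \<omega>) (\<lambda>r. J r \<omega> - J t \<omega>) u)"
proof -
  let ?Y = "\<lambda>u \<omega>. gaussian_state t x S \<mu> q (\<lambda>r. W r \<omega> - W t \<omega>) (\<lambda>r. J r \<omega> - J t \<omega>) u"
  have t0: "0 \<le> t" using t by simp
  have const: "cadlag_on t T (\<lambda>_. C::real)" for C by (intro continuous_imp_cadlag continuous_intros)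
  have cadlag: "cadlag_on t T (\<lambda>r. W r \<omega> - W t \<omega>)" "cadlag_on t T (\<lambda>r. J r \<omega> - J t \<omega>)" if "\<omega> \<in> space M" for \<omega>
  proof -
    have "continuous_on {t..T} (\<lambda>r. W r \<omega>)" by (rule continuous_on_subset[OF W_continuous[OF that]]) (use t in auto)
    then show "cadlag_on t T (\<lambda>r. W r \<omega> - W t \<omega>)" by (intro cadlag_on_arith continuous_imp_cadlag[of _ _ "\<lambda>r. W r \<omega>"] const)
    show "cadlag_on t T (\<lambda>r. J r \<omega> - J t \<omega>)" by (intro cadlag_on_arith J_cadlag[OF that t0] const)
  qed
  have "?Y u \<in> borel_measurable (F u)" if u: "u \<in> {t..T}" for u
  proof -
    have tu: "t \<le> u" using u by simp
    have [measurable]: "W t \<in> borel_measurable (F u)" "J t \<in> borel_measurable (F u)"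
      using F_mono_measurable[OF adapted_F(1)[OF t0] tu] F_mono_measurable[OF adapted_F(3)[OF t0] tu] .
    note [measurable] = W_joint_measurable[OF t0 tu] J_joint_measurable[OF t0 tu]
    have 1: "(\<lambda>(r, \<omega>). W (clamp_Icc t u r) \<omega> - W t \<omega>) \<in> borel_measurable (borel \<Otimes>\<^sub>M F u)" by measurable
    have 2: "(\<lambda>(r, \<omega>). J (clamp_Icc t u r) \<omega> - J t \<omega>) \<in> borel_measurable (borel \<Otimes>\<^sub>M F u)" by measurable
    note g = gaussian_state_measurable[OF tu, of "\<lambda>r \<omega>. W r \<omega> - W t \<omega>" "F u" "\<lambda>r \<omega>. J r \<omega> - J t \<omega>", OF 1 2]
    have "(\<lambda>\<omega>. (u, \<omega>)) \<in> F u \<rightarrow>\<^sub>M (borel :: real measure) \<Otimes>\<^sub>M F u" by measurable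
    from measurable_compose[OF this g] show ?thesis using tu by simp
  qed
  moreover have "cadlag_on t T (\<lambda>u. ?Y u \<omega>)" if "\<omega> \<in> space M" for \<omega>
    by (rule gaussian_system_solution(1)[OF t cadlag[OF that]])
  moreover have "state_equation P (gaussian_policy P) t (x, S, \<mu>, q) (\<lambda>u. W u \<omega>) (\<lambda>u. N u \<omega>) (\<lambda>i. \<eta> i \<omega>) (\<lambda>u. ?Y u \<omega>)"
    if "\<omega> \<in> space M" for \<omega>
    unfolding gaussian_state_equation[OF t that gaussian_system_solution(1)[OF t cadlag[OF that]]]
    by (rule gaussian_system_solution(2)[OF t cadlag[OF that]])
  ultimately show ?thesis unfolding weak_solution_def using noise by (auto intro: AE_I2)
qed

end

context liquidation_model
begin

text \<open>On the product space a path is an arbitrary function of time. For cadlag paths the limit along the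
  grid gives back the path; in general it is some jointly measurable function, whatever value
  \<open>lim\<close> has where there is no convergence.\<close>

definition right_limit :: "real \<Rightarrow> (real \<Rightarrow> real \<times> real) \<Rightarrow> real \<Rightarrow> real \<times> real" where
  "right_limit t f r = lim (\<lambda>n. f (clamp_Icc t T (grid_above n r)))"

definition path_functional :: "real \<Rightarrow> real \<Rightarrow> real \<Rightarrow> real \<Rightarrow> real \<Rightarrow> (real \<Rightarrow> real \<times> real) \<Rightarrow> real \<Rightarrow> state" where
  "path_functional t x S \<mu> q f =
     (\<lambda>u\<in>{t..T}. gaussian_state t x S \<mu> q (\<lambda>r. fst (right_limit t f r)) (\<lambda>r. snd (right_limit t f r)) u)"

lemma path_functional_measurable:
  assumes t: "t \<in> {0..T}"
  shows "path_functional t x S \<mu> q \<in> measurable (\<Pi>\<^sub>M r\<in>{t..T}. borel) (\<Pi>\<^sub>M u\<in>{t..T}. borel)"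
  unfolding path_functional_def
proof (rule measurable_restrict)
  let ?L = "\<Pi>\<^sub>M r\<in>{t..T}. (borel :: (real \<times> real) measure)"
  fix u assume u: "u \<in> {t..T}"
  have tT: "t \<le> T" and tu: "t \<le> u" using t u by auto
  have g: "(\<lambda>z. snd z (clamp_Icc t T (grid_above n (fst z)))) \<in> borel_measurable ((borel :: real measure) \<Otimes>\<^sub>M ?L)" for n
  proof -
    have "(\<lambda>f. f r) \<in> ?L \<rightarrow>\<^sub>M borel" if "r \<in> {t..T}" for r using that by (rule measurable_component_singleton)
    from grid_joint_measurable[OF tT, where Y = "\<lambda>r f. f r" and M = ?L and N = borel and n = n, OF this]
    show ?thesis by (simp add: case_prod_unfold)
  qed
  have R: "(\<lambda>z. right_limit t (snd z) (fst z)) \<in> borel_measurable ((borel :: real measure) \<Otimes>\<^sub>M ?L)"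
    unfolding right_limit_def by (rule borel_measurable_lim_metric[OF g])
  have "(\<lambda>z. (clamp_Icc t u (fst z), snd z)) \<in> (borel :: real measure) \<Otimes>\<^sub>M ?L \<rightarrow>\<^sub>M (borel :: real measure) \<Otimes>\<^sub>M ?L"
    by (intro measurable_Pair measurable_compose[OF measurable_fst clamp_Icc_measurable] measurable_snd)
  from measurable_compose[OF this R]
  have Rc: "(\<lambda>z. right_limit t (snd z) (clamp_Icc t u (fst z))) \<in> (borel :: real measure) \<Otimes>\<^sub>M ?L \<rightarrow>\<^sub>M borel"
    by simp
  have fs: "(fst :: real \<times> real \<Rightarrow> real) \<in> borel_measurable borel" "(snd :: real \<times> real \<Rightarrow> real) \<in> borel_measurable borel"
    by (auto intro!: borel_measurable_continuous_onI continuous_intros)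
  have 1: "(\<lambda>(r, f). fst (right_limit t f (clamp_Icc t u r))) \<in> borel_measurable ((borel :: real measure) \<Otimes>\<^sub>M ?L)"
    and 2: "(\<lambda>(r, f). snd (right_limit t f (clamp_Icc t u r))) \<in> borel_measurable ((borel :: real measure) \<Otimes>\<^sub>M ?L)"
    unfolding case_prod_unfold
    by (rule measurable_compose[OF Rc fs(1)], rule measurable_compose[OF Rc fs(2)])
  note g = gaussian_state_measurable[OF tu, of "\<lambda>r f. fst (right_limit t f r)" ?L "\<lambda>r f. snd (right_limit t f r)", OF 1 2]
  have "(\<lambda>f. (u, f)) \<in> ?L \<rightarrow>\<^sub>M (borel :: real measure) \<Otimes>\<^sub>M ?L"
    by (intro measurable_Pair measurable_const measurable_ident_sets) auto
  from measurable_compose[OF this g]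
  show "(\<lambda>f. gaussian_state t x S \<mu> q (\<lambda>r. fst (right_limit t f r)) (\<lambda>r. snd (right_limit t f r)) u) \<in> borel_measurable ?L"
    using tu by simp
qed

end

context liquidation_noise
begin

text \<open>Uniqueness in law: pathwise uniqueness expresses every weak solution by the same measurable
  functional of its own noise.\<close>

lemma gaussian_path_law:
  assumes t: "t \<in> {0..T}" and sol: "weak_solution P (gaussian_policy P) t (x, S, \<mu>, q) M F W N \<eta> Y"
  shows "path_law t T M Y = distr (distr M (\<Pi>\<^sub>M r\<in>{t..T}. borel) (noise_path t {t..T})) (\<Pi>\<^sub>M u\<in>{t..T}. borel) (path_functional t x S \<mu> q)"
proof -
  have t0: "0 \<le> t" and tT: "t \<le> T" using t by auto
  have V: "noise_path t {t..T} \<in> measurable M (\<Pi>\<^sub>M r\<in>{t..T}. borel)"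
    by (rule F_measurable[OF noise_path_measurable[OF t0 order_refl]])
  have Ym: "(\<lambda>\<omega>. \<lambda>u\<in>{t..T}. Y u \<omega>) \<in> measurable M (\<Pi>\<^sub>M r\<in>{t..T}. borel)"
    using sol unfolding weak_solution_def by (intro measurable_restrict) (blast intro: F_measurable)
  have "AE \<omega> in M. state_equation P (gaussian_policy P) t (x, S, \<mu>, q) (\<lambda>u. W u \<omega>) (\<lambda>u. N u \<omega>) (\<lambda>i. \<eta> i \<omega>) (\<lambda>u. Y u \<omega>)"
    using sol by (simp add: weak_solution_def)
  then have "AE \<omega> in M. (\<lambda>u\<in>{t..T}. Y u \<omega>) = path_functional t x S \<mu> q (noise_path t {t..T} \<omega>)"
  proof (rule AE_mp[OF _ AE_I2], intro impI)
    fix \<omega> assume \<omega>: "\<omega> \<in> space M"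
      and eq: "state_equation P (gaussian_policy P) t (x, S, \<mu>, q) (\<lambda>u. W u \<omega>) (\<lambda>u. N u \<omega>) (\<lambda>i. \<eta> i \<omega>) (\<lambda>u. Y u \<omega>)"
    have Yc: "cadlag_on t T (\<lambda>u. Y u \<omega>)" using sol \<omega> by (simp add: weak_solution_def)
    have sys: "gaussian_system t x S \<mu> q (\<lambda>u. W u \<omega> - W t \<omega>) (\<lambda>u. J u \<omega> - J t \<omega>) (\<lambda>u. Y u \<omega>)"
      using eq unfolding gaussian_state_equation[OF t \<omega> Yc] .
    have const: "cadlag_on t T (\<lambda>_. C::real)" for C by (intro continuous_imp_cadlag continuous_intros)
    have "continuous_on {t..T} (\<lambda>r. W r \<omega>)" by (rule continuous_on_subset[OF W_continuous[OF \<omega>]]) (use t in auto)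
    then have "cadlag_on t T (\<lambda>r. increment t r \<omega>)" unfolding increment_def
      by (intro cadlag_on_Pair cadlag_on_arith continuous_imp_cadlag[of _ _ "\<lambda>r. W r \<omega>"] const J_cadlag[OF \<omega> t0])
    note lim = cadlag_grid_tendsto[OF tT this]
    have "noise_path t {t..T} \<omega> (clamp_Icc t T r) = increment t (clamp_Icc t T r) \<omega>" for r
      using clamp_Icc_bounds[OF tT] by (simp add: noise_path_def)
    with lim have rl: "right_limit t (noise_path t {t..T} \<omega>) r = increment t r \<omega>" if "r \<in> {t..T}" for r
      unfolding right_limit_def using that limI[OF lim, of r] by simp
    show "(\<lambda>u\<in>{t..T}. Y u \<omega>) = path_functional t x S \<mu> q (noise_path t {t..T} \<omega>)"
      unfolding path_functional_def
    proof (rule restrict_ext)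
      fix u assume u: "u \<in> {t..T}"
      have "Y u \<omega> = gaussian_state t x S \<mu> q (\<lambda>u. W u \<omega> - W t \<omega>) (\<lambda>u. J u \<omega> - J t \<omega>) u"
        by (rule gaussian_system_unique[OF t Yc sys u])
      also have "\<dots> = gaussian_state t x S \<mu> q (\<lambda>r. fst (right_limit t (noise_path t {t..T} \<omega>) r)) (\<lambda>r. snd (right_limit t (noise_path t {t..T} \<omega>) r)) u"
        using u by (intro gaussian_state_cong) (auto simp: rl increment_def)
      finally show "Y u \<omega> = gaussian_state t x S \<mu> q (\<lambda>r. fst (right_limit t (noise_path t {t..T} \<omega>) r)) (\<lambda>r. snd (right_limit t (noise_path t {t..T} \<omega>) r)) u" .
    qed
  qed
  then have "path_law t T M Y = distr M (\<Pi>\<^sub>M u\<in>{t..T}. borel) (\<lambda>\<omega>. path_functional t x S \<mu> q (noise_path t {t..T} \<omega>))"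
    unfolding path_law_def
    by (intro distr_cong_AE refl Ym measurable_compose[OF V path_functional_measurable[OF t]])
  also have "\<dots> = distr (distr M (\<Pi>\<^sub>M r\<in>{t..T}. borel) (noise_path t {t..T})) (\<Pi>\<^sub>M u\<in>{t..T}. borel) (path_functional t x S \<mu> q)"
    by (subst distr_distr[OF path_functional_measurable[OF t] V]) (simp add: comp_def)
  finally show ?thesis .
qed

end

context liquidation_model
begin

lemma gaussian_unique_weak_solution:
  fixes M :: "'a measure"
  assumes noise: "driving_noise P M F W N \<eta>" and t: "t \<in> {0..T}"
  shows "unique_weak_solution TYPE('a) P (gaussian_policy P) t y"
proof -
  obtain x S \<mu> q where y: "y = (x, S, \<mu>, q)" by (cases y) auto
  interpret A: liquidation_noise P M F W N \<eta> by unfold_locales (rule noise)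
  show ?thesis unfolding unique_weak_solution_def y
  proof (intro conjI allI impI)
    show "\<exists>(M::'a measure) F W N \<eta> Y. weak_solution P (gaussian_policy P) t (x, S, \<mu>, q) M F W N \<eta> Y"
      using A.gaussian_weak_solution[OF t] by blast
  next
    fix M1 M2 :: "'a measure" and F1 W1 N1 \<eta>1 Y1 F2 W2 N2 \<eta>2 Y2
    assume s1: "weak_solution P (gaussian_policy P) t (x, S, \<mu>, q) M1 F1 W1 N1 \<eta>1 Y1"
      and s2: "weak_solution P (gaussian_policy P) t (x, S, \<mu>, q) M2 F2 W2 N2 \<eta>2 Y2"
    then have n: "driving_noise P M1 F1 W1 N1 \<eta>1" "driving_noise P M2 F2 W2 N2 \<eta>2" by (simp_all add: weak_solution_def)
    have l1: "liquidation_noise P M1 F1 W1 N1 \<eta>1" and l2: "liquidation_noise P M2 F2 W2 N2 \<eta>2"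
      by (unfold_locales; rule n)+
    show "path_law t T M1 Y1 = path_law t T M2 Y2"
      unfolding liquidation_noise.gaussian_path_law[OF l1 t s1] liquidation_noise.gaussian_path_law[OF l2 t s2]
      using noise_path_law_unique[OF n] t by simp
  qed
qed

end

lemma state_norm: "\<bar>speed y - speed y'\<bar> \<le> norm (y - y')" "\<bar>inventory y - inventory y'\<bar> \<le> norm (y - y')"
  "\<bar>speed y\<bar> \<le> norm y" "\<bar>inventory y\<bar> \<le> norm y"
proof -
  have "\<bar>speed z\<bar> \<le> norm z \<and> \<bar>inventory z\<bar> \<le> norm z" for z :: state
  proof -
    obtain x S \<mu> q where z: "z = (x, S, \<mu>, q)" by (cases z) auto
    have "norm \<mu> \<le> norm (\<mu>, q)" "norm q \<le> norm (\<mu>, q)" "norm (\<mu>, q) \<le> norm (S, \<mu>, q)" "norm (S, \<mu>, q) \<le> norm z"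
      unfolding z by (rule norm_fst_le norm_snd_le)+
    then show ?thesis unfolding z by (simp add: speed_def inventory_def)
  qed note n = this
  have "speed (y - y') = speed y - speed y'" "inventory (y - y') = inventory y - inventory y'"
    by (cases y; cases y'; simp add: speed_def inventory_def)+
  with n[of "y - y'"] n[of y] show "\<bar>speed y - speed y'\<bar> \<le> norm (y - y')" "\<bar>inventory y - inventory y'\<bar> \<le> norm (y - y')"
    "\<bar>speed y\<bar> \<le> norm y" "\<bar>inventory y\<bar> \<le> norm y" by auto
qed

context liquidation_model
begin

subsection \<open>Admissibility of the Gaussian policy\<close>

abbreviation "mean t y \<equiv> mean_speed t (speed y) (inventory y)"

text \<open>The mean of the policy is affine in speed and inventory, with coefficients that are bounded
  because they are continuous on \<open>[0, T]\<close>.\<close>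

lemma mean_speed_coefficients:
  obtains L where "0 \<le> L" "\<And>t y y'. t \<in> {0..T} \<Longrightarrow> \<bar>mean t y - mean t y'\<bar> \<le> L * norm (y - y')"
    "\<And>t y. t \<in> {0..T} \<Longrightarrow> \<bar>mean t y\<bar> \<le> L * (1 + norm y)"
proof -
  have nz: "2 * c \<noteq> 0" using c_pos by simp
  have pc: "continuous_on {0..T} p" by (rule p_continuous) simp
  have bd: "\<exists>B. \<forall>t\<in>{0..T}. \<bar>f t\<bar> \<le> B" if "continuous_on {0..T} f" for f :: "real \<Rightarrow> real"
  proof -
    have "bounded (f ` {0..T})" by (rule compact_imp_bounded[OF compact_continuous_image[OF that compact_Icc]])
    then show ?thesis unfolding bounded_iff by auto
  qed
  have "continuous_on {0..T} (\<lambda>t. p t / c)"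
    using c_pos by (intro continuous_on_divide pc continuous_on_const) simp
  from bd[OF this] obtain B1 where B1: "\<And>t. t \<in> {0..T} \<Longrightarrow> \<bar>p t / c\<bar> \<le> B1" by blast
  have "continuous_on {0..T} (\<lambda>t. (2 * \<phi> * \<rho> - l\<^sub>1 P t) / (2 * c))"
    using nz by (intro continuous_on_divide continuous_on_diff continuous_on_const l_continuous) simp
  from bd[OF this] obtain B2 where B2: "\<And>t. t \<in> {0..T} \<Longrightarrow> \<bar>(2 * \<phi> * \<rho> - l\<^sub>1 P t) / (2 * c)\<bar> \<le> B2" by blast
  have "continuous_on {0..T} (\<lambda>t. l\<^sub>0 P t / (2 * c))"
    using nz by (intro continuous_on_divide continuous_on_const l_continuous) simp
  from bd[OF this] obtain B3 where B3: "\<And>t. t \<in> {0..T} \<Longrightarrow> \<bar>l\<^sub>0 P t / (2 * c)\<bar> \<le> B3" by blast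
  have T0: "0 \<in> {0..T}" using T_pos by simp
  have B0: "0 \<le> B1" "0 \<le> B2" "0 \<le> B3" using B1[OF T0] B2[OF T0] B3[OF T0] by linarith+
  have e: "mean t y = p t / c * inventory y + (2 * \<phi> * \<rho> - l\<^sub>1 P t) / (2 * c) * speed y - l\<^sub>0 P t / (2 * c)" for t y
    unfolding mean_speed_def drift_gain_eq diff_divide_distrib[of "(2 * \<phi> * \<rho> - l\<^sub>1 P t) * speed y"] by simp
  define L where "L = B1 + B2 + B3"
  show thesis
  proof
    show "0 \<le> L" using B0 by (simp add: L_def)
  next
    fix t y y' assume t: "t \<in> {0..T}"
    have "mean t y - mean t y' = p t / c * (inventory y - inventory y') + (2 * \<phi> * \<rho> - l\<^sub>1 P t) / (2 * c) * (speed y - speed y')"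
      unfolding e right_diff_distrib by linarith
    also have "\<bar>\<dots>\<bar> \<le> \<bar>p t / c\<bar> * \<bar>inventory y - inventory y'\<bar> + \<bar>(2 * \<phi> * \<rho> - l\<^sub>1 P t) / (2 * c)\<bar> * \<bar>speed y - speed y'\<bar>"
      unfolding abs_mult[symmetric] by (rule abs_triangle_ineq)
    also have "\<dots> \<le> B1 * norm (y - y') + B2 * norm (y - y')"
      by (intro add_mono mult_mono B1 B2 t state_norm B0 abs_ge_zero)
    also have "\<dots> \<le> L * norm (y - y')" using B0 by (simp add: L_def distrib_right)
    finally show "\<bar>mean t y - mean t y'\<bar> \<le> L * norm (y - y')" .
  next
    fix t y assume t: "t \<in> {0..T}"
    have "\<bar>mean t y\<bar> \<le> \<bar>p t / c * inventory y\<bar> + \<bar>(2 * \<phi> * \<rho> - l\<^sub>1 P t) / (2 * c) * speed y\<bar> + \<bar>l\<^sub>0 P t / (2 * c)\<bar>"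
      unfolding e by linarith
    also have "\<dots> \<le> B1 * norm y + B2 * norm y + B3"
      unfolding abs_mult by (intro add_mono mult_mono B1 B2 B3 t state_norm B0 abs_ge_zero)
    also have "\<dots> \<le> L * (1 + norm y)"
    proof -
      have "0 \<le> B3 * norm y" using B0 by simp
      then show ?thesis using B0 by (simp add: L_def algebra_simps)
    qed
    finally show "\<bar>mean t y\<bar> \<le> L * (1 + norm y)" .
  qed
qed

lemma mean_speed_continuous: "continuous_on ({0..T} \<times> UNIV) (\<lambda>(t, y). mean t y)"
proof -
  have nz: "2 * c \<noteq> 0" "c \<noteq> 0" using c_pos by simp_all
  have pc: "continuous_on {0..T} p" by (rule p_continuous) simp
  have f: "continuous_on ({0..T} \<times> (UNIV :: state set)) (\<lambda>z. h (fst z))" if "continuous_on {0..T} h" for h :: "real \<Rightarrow> real"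
    by (rule continuous_on_compose2[OF that continuous_on_fst[OF continuous_on_id]]) auto
  have s: "continuous_on ({0..T} \<times> UNIV) (\<lambda>z. h (snd z))" if "continuous_on UNIV h" for h :: "state \<Rightarrow> real"
    by (rule continuous_on_compose2[OF that continuous_on_snd[OF continuous_on_id]]) auto
  show ?thesis
    unfolding mean_speed_def drift_gain_eq case_prod_unfold
    by (intro continuous_on_add continuous_on_diff continuous_on_divide continuous_on_mult continuous_on_const
        f[OF pc] f[OF l_continuous(1)] f[OF l_continuous(2)] s continuous_on_state) (simp_all add: nz)
qed

lemma gaussian_policy_L1:
  "(LBINT v:\<A>. \<bar>gaussian_policy P t y v - gaussian_policy P t' y' v\<bar>) \<le> (2 + 2 / sd + 1 / sd\<^sup>2) * \<bar>mean t y - mean t' y'\<bar>"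
  unfolding gaussian_policy_state by (subst full_set_integral) (measurable, rule normal_density_shift_L1(2)[OF sd_pos])

text \<open>Under a normal law the running cost is at most quadratic in the mean, and the mean grows linearly
  in the state.\<close>

lemma gaussian_running_cost:
  obtains C where "0 < C" "\<And>t y. t \<in> {0..T} \<Longrightarrow>
    (\<integral>\<^sup>+v\<in>\<A>. ennreal (\<bar>\<phi> * (v - \<rho> * speed y)\<^sup>2 + \<gamma> * ln (gaussian_policy P t y v)\<bar> * gaussian_policy P t y v) \<partial>lborel)
      \<le> ennreal (C * (1 + norm y powr 2))"
proof -
  obtain L where L: "0 \<le> L" "\<And>t y. t \<in> {0..T} \<Longrightarrow> \<bar>mean t y\<bar> \<le> L * (1 + norm y)"
    by (rule mean_speed_coefficients) blast
  define a where "a = \<bar>\<gamma> * ln (sqrt (2 * pi * sd\<^sup>2))\<bar>"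
  define d where "d = \<gamma> / (2 * sd\<^sup>2)"
  define K where "K = L + \<bar>\<rho>\<bar>"
  \<comment> \<open>\<open>a\<close> and \<open>d\<close> come from the logarithm of the density, and \<open>\<bar>mean - \<rho> \<mu>\<bar>\<close> is at most \<open>K (1 + \<bar>y\<bar>)\<close>.\<close>
  define C where "C = 1 + (2 * \<bar>\<phi>\<bar> + d) * sd\<^sup>2 + a + 4 * \<bar>\<phi>\<bar> * K\<^sup>2"
  have d0: "0 \<le> d" "0 \<le> a" "0 \<le> K" using \<gamma>_pos L by (simp_all add: d_def a_def K_def)
  have C1: "1 \<le> C" using d0 by (simp add: C_def)
  show thesis
  proof
    show "0 < C" using C1 by simp
    fix t y assume t: "t \<in> {0..T}"
    let ?n = "normal_density (mean t y) sd"
    let ?e = "2 * \<bar>\<phi>\<bar> * (mean t y - \<rho> * speed y)\<^sup>2 + a"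
    let ?g = "\<lambda>v. (2 * \<bar>\<phi>\<bar> + d) * ((v - mean t y)\<^sup>2 * ?n v) + ?e * ?n v"
    note n2 = normal_second_moment[OF sd_pos, of "mean t y"]
    have n0: "integrable lborel ?n" "(\<integral>v. ?n v \<partial>lborel) = 1" using sd_pos by auto
    have i: "integrable lborel (\<lambda>v. (2 * \<bar>\<phi>\<bar> + d) * ((v - mean t y)\<^sup>2 * ?n v))" "integrable lborel (\<lambda>v. ?e * ?n v)"
      by (intro integrable_mult_right n2 n0)+
    have le: "\<bar>\<phi> * (v - \<rho> * speed y)\<^sup>2 + \<gamma> * ln (?n v)\<bar> * ?n v \<le> ?g v" for v
    proof -
      have "(v - \<rho> * speed y)\<^sup>2 \<le> 2 * (v - mean t y)\<^sup>2 + 2 * (mean t y - \<rho> * speed y)\<^sup>2"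
        using zero_le_power2[of "(v - mean t y) - (mean t y - \<rho> * speed y)"] by (simp add: power2_eq_square algebra_simps)
      then have 1: "\<bar>\<phi> * (v - \<rho> * speed y)\<^sup>2\<bar> \<le> \<bar>\<phi>\<bar> * (2 * (v - mean t y)\<^sup>2 + 2 * (mean t y - \<rho> * speed y)\<^sup>2)"
        by (simp add: abs_mult mult_left_mono)
      have l: "\<gamma> * ln (?n v) = - (\<gamma> * ln (sqrt (2 * pi * sd\<^sup>2))) - d * (v - mean t y)\<^sup>2"
        unfolding ln_normal_density[OF sd_pos] d_def right_diff_distrib by simp
      have 2: "\<bar>\<gamma> * ln (?n v)\<bar> \<le> a + d * (v - mean t y)\<^sup>2"
      proof -
        have "0 \<le> d * (v - mean t y)\<^sup>2" using d0 by simp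
        then show ?thesis unfolding l a_def by linarith
      qed
      have "\<bar>\<phi> * (v - \<rho> * speed y)\<^sup>2 + \<gamma> * ln (?n v)\<bar> \<le> (2 * \<bar>\<phi>\<bar> + d) * (v - mean t y)\<^sup>2 + ?e"
        using abs_triangle_ineq[of "\<phi> * (v - \<rho> * speed y)\<^sup>2" "\<gamma> * ln (?n v)"] 1 2 by (simp add: algebra_simps)
      then have "\<bar>\<phi> * (v - \<rho> * speed y)\<^sup>2 + \<gamma> * ln (?n v)\<bar> * ?n v \<le> ((2 * \<bar>\<phi>\<bar> + d) * (v - mean t y)\<^sup>2 + ?e) * ?n v"
        by (rule mult_right_mono) simp
      also have "\<dots> = ?g v" by (simp only: distrib_right mult.assoc)
      finally show ?thesis .
    qed
    have g0: "0 \<le> ?g v" for v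
      by (rule order_trans[OF _ le]) simp
    have gi: "integrable lborel ?g" by (rule Bochner_Integration.integrable_add[OF i])
    have gI: "(\<integral>v. ?g v \<partial>lborel) = (2 * \<bar>\<phi>\<bar> + d) * sd\<^sup>2 + ?e"
      unfolding Bochner_Integration.integral_add[OF i] integral_mult_right_zero n2 n0 by simp
    have "(\<integral>\<^sup>+v\<in>\<A>. ennreal (\<bar>\<phi> * (v - \<rho> * speed y)\<^sup>2 + \<gamma> * ln (gaussian_policy P t y v)\<bar> * gaussian_policy P t y v) \<partial>lborel)
      \<le> (\<integral>\<^sup>+v. ennreal (?g v) \<partial>lborel)"
    proof (rule nn_integral_mono)
      fix v
      show "ennreal (\<bar>\<phi> * (v - \<rho> * speed y)\<^sup>2 + \<gamma> * ln (gaussian_policy P t y v)\<bar> * gaussian_policy P t y v) * indicator \<A> v \<le> ennreal (?g v)"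
        unfolding gaussian_policy_state using ennreal_leI[OF le[of v]] by (cases "v \<in> \<A>") auto
    qed
    also have "\<dots> = ennreal ((2 * \<bar>\<phi>\<bar> + d) * sd\<^sup>2 + ?e)"
      unfolding gI[symmetric] by (rule nn_integral_eq_integral[OF gi]) (simp only: g0 AE_I2)
    also have "\<dots> \<le> ennreal (C * (1 + norm y powr 2))"
    proof (rule ennreal_leI)
      have n: "norm y powr 2 = (norm y)\<^sup>2" using powr_numeral[of "norm y" "num.Bit0 num.One"] by simp
      have "\<bar>mean t y - \<rho> * speed y\<bar> \<le> K * (1 + norm y)"
      proof -
        have "\<bar>mean t y - \<rho> * speed y\<bar> \<le> \<bar>mean t y\<bar> + \<bar>\<rho>\<bar> * \<bar>speed y\<bar>" unfolding abs_mult[symmetric] by linarith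
        also have "\<dots> \<le> L * (1 + norm y) + \<bar>\<rho>\<bar> * (1 + norm y)"
          using state_norm(3)[of y] by (intro add_mono L t mult_left_mono) auto
        finally show ?thesis by (simp add: K_def distrib_right)
      qed
      then have "(mean t y - \<rho> * speed y)\<^sup>2 \<le> (K * (1 + norm y))\<^sup>2" using abs_le_square_iff[of "mean t y - \<rho> * speed y" "K * (1 + norm y)"] d0 by simp
      also have "\<dots> \<le> K\<^sup>2 * (2 * (1 + (norm y)\<^sup>2))"
        unfolding power_mult_distrib
        by (rule mult_left_mono) (use zero_le_power2[of "norm y - 1"] in \<open>auto simp: power2_eq_square algebra_simps\<close>)
      finally have "2 * \<bar>\<phi>\<bar> * (mean t y - \<rho> * speed y)\<^sup>2 \<le> 2 * \<bar>\<phi>\<bar> * (K\<^sup>2 * (2 * (1 + (norm y)\<^sup>2)))" by (rule mult_left_mono) simp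
      also have "\<dots> = 4 * \<bar>\<phi>\<bar> * K\<^sup>2 * (1 + (norm y)\<^sup>2)" by simp
      finally have 1: "2 * \<bar>\<phi>\<bar> * (mean t y - \<rho> * speed y)\<^sup>2 \<le> 4 * \<bar>\<phi>\<bar> * K\<^sup>2 * (1 + (norm y)\<^sup>2)" .
      define X where "X = (2 * \<bar>\<phi>\<bar> + d) * sd\<^sup>2 + a"
      have "0 \<le> X" using d0 by (simp add: X_def)
      then have "X \<le> (1 + X) * (1 + (norm y)\<^sup>2)" by (simp add: algebra_simps)
      with 1 have "X + 2 * \<bar>\<phi>\<bar> * (mean t y - \<rho> * speed y)\<^sup>2 \<le> (1 + X + 4 * \<bar>\<phi>\<bar> * K\<^sup>2) * (1 + (norm y)\<^sup>2)"
        unfolding distrib_right[of "1 + X"] by linarith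
      moreover have "C = 1 + X + 4 * \<bar>\<phi>\<bar> * K\<^sup>2" by (simp add: C_def X_def)
      ultimately show "(2 * \<bar>\<phi>\<bar> + d) * sd\<^sup>2 + ?e \<le> C * (1 + norm y powr 2)" unfolding n X_def by simp
    qed
    finally show "(\<integral>\<^sup>+v\<in>\<A>. ennreal (\<bar>\<phi> * (v - \<rho> * speed y)\<^sup>2 + \<gamma> * ln (gaussian_policy P t y v)\<bar> * gaussian_policy P t y v) \<partial>lborel)
      \<le> ennreal (C * (1 + norm y powr 2))" .
  qed
qed

lemma gaussian_policy_admissible:
  fixes M :: "'a measure"
  assumes noise: "driving_noise P M F W N \<eta>"
  shows "gaussian_policy P \<in> admissible_policies TYPE('a) P"
proof -
  let ?K = "2 + 2 / sd + 1 / sd\<^sup>2"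
  have K: "0 < ?K" using sd_pos by (intro add_pos_pos divide_pos_pos zero_less_power) auto
  obtain L where L: "0 \<le> L" "\<And>t y y'. t \<in> {0..T} \<Longrightarrow> \<bar>mean t y - mean t y'\<bar> \<le> L * norm (y - y')"
    by (rule mean_speed_coefficients) blast
  have 1: "(\<lambda>(t, y, v). gaussian_policy P t y v) \<in> borel_measurable (restrict_space borel ({0..T} \<times> UNIV \<times> \<A>))"
  proof (rule measurable_restrict_space1)
    have "(\<lambda>z. gaussian_policy P (fst z) (fst (snd z)) (snd (snd z))) \<in> borel_measurable ((borel :: real measure) \<Otimes>\<^sub>M ((borel :: state measure) \<Otimes>\<^sub>M (borel :: real measure)))"
      unfolding gaussian_policy_state normal_density_def by measurable
    then show "(\<lambda>(t, y, v). gaussian_policy P t y v) \<in> borel_measurable borel"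
      unfolding borel_prod by (simp add: case_prod_unfold)
  qed
  have 2: "(\<forall>v\<in>\<A>. 0 \<le> gaussian_policy P t y v) \<and> L1_on \<A> (gaussian_policy P t y) \<and> (LBINT v:\<A>. gaussian_policy P t y v) = 1" for t y
    unfolding gaussian_policy_state using sd_pos by (simp add: full_set_integral)
  have 4: "((\<lambda>(t, y). LBINT v:\<A>. \<bar>gaussian_policy P t y v - gaussian_policy P t' y' v\<bar>) \<longlongrightarrow> 0) (at (t', y') within {0..T} \<times> UNIV)"
    if "t' \<in> {0..T}" for t' y'
  proof (rule tendsto_sandwich[of "\<lambda>_. 0" _ _ "\<lambda>(t, y). ?K * \<bar>mean t y - mean t' y'\<bar>"])
    have "((\<lambda>(t, y). mean t y) \<longlongrightarrow> mean t' y') (at (t', y') within {0..T} \<times> UNIV)"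
      using bspec[OF mean_speed_continuous[unfolded continuous_on_def], of "(t', y')"] that by simp
    then have "((\<lambda>z. ?K * \<bar>(case z of (t, y) \<Rightarrow> mean t y) - mean t' y'\<bar>) \<longlongrightarrow> ?K * \<bar>mean t' y' - mean t' y'\<bar>) (at (t', y') within {0..T} \<times> UNIV)"
      by (intro tendsto_intros)
    then show "((\<lambda>(t, y). ?K * \<bar>mean t y - mean t' y'\<bar>) \<longlongrightarrow> 0) (at (t', y') within {0..T} \<times> UNIV)"
      by (simp add: case_prod_unfold)
  next
    show "\<forall>\<^sub>F z in at (t', y') within {0..T} \<times> UNIV. 0 \<le> (case z of (t, y) \<Rightarrow> LBINT v:\<A>. \<bar>gaussian_policy P t y v - gaussian_policy P t' y' v\<bar>)"
      by (auto simp: case_prod_unfold set_lebesgue_integral_def intro!: always_eventually integral_nonneg_AE)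
    show "\<forall>\<^sub>F z in at (t', y') within {0..T} \<times> UNIV. (case z of (t, y) \<Rightarrow> LBINT v:\<A>. \<bar>gaussian_policy P t y v - gaussian_policy P t' y' v\<bar>)
      \<le> (case z of (t, y) \<Rightarrow> ?K * \<bar>mean t y - mean t' y'\<bar>)"
      unfolding case_prod_unfold by (intro always_eventually allI gaussian_policy_L1)
  qed simp
  have 5: "\<exists>C>0. \<forall>t\<in>{0..T}. \<forall>y y'. (LBINT v:\<A>. \<bar>gaussian_policy P t y v - gaussian_policy P t y' v\<bar>) \<le> C * norm (y - y')"
  \<comment> \<open>The Lipschitz constant has to be positive, and \<open>L\<close> may be \<open>0\<close>.\<close>
  proof (intro exI[of _ "?K * (L + 1)"] conjI ballI allI)
    show "0 < ?K * (L + 1)" using K L(1) by (intro mult_pos_pos) auto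
    fix t y y' assume t: "t \<in> {0..T}"
    have "\<bar>mean t y - mean t y'\<bar> \<le> (L + 1) * norm (y - y')" using L(2)[OF t, of y y'] by (simp add: distrib_right add_increasing2)
    then have "?K * \<bar>mean t y - mean t y'\<bar> \<le> ?K * ((L + 1) * norm (y - y'))" using K by (intro mult_left_mono) auto
    with gaussian_policy_L1[of t y t y'] show "(LBINT v:\<A>. \<bar>gaussian_policy P t y v - gaussian_policy P t y' v\<bar>) \<le> ?K * (L + 1) * norm (y - y')"
      unfolding mult.assoc[of ?K] by linarith
  qed
  have 6: "\<exists>C>0. \<exists>r\<ge>1. \<forall>t\<in>{0..T}. \<forall>y.
    (\<integral>\<^sup>+v\<in>\<A>. ennreal (\<bar>\<phi> * (v - \<rho> * speed y)\<^sup>2 + \<gamma> * ln (gaussian_policy P t y v)\<bar> * gaussian_policy P t y v) \<partial>lborel)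
      \<le> ennreal (C * (1 + norm y powr r))"
  proof -
    obtain C where C: "0 < C" "\<And>t y. t \<in> {0..T} \<Longrightarrow>
      (\<integral>\<^sup>+v\<in>\<A>. ennreal (\<bar>\<phi> * (v - \<rho> * speed y)\<^sup>2 + \<gamma> * ln (gaussian_policy P t y v)\<bar> * gaussian_policy P t y v) \<partial>lborel)
        \<le> ennreal (C * (1 + norm y powr 2))" by (rule gaussian_running_cost, rule that)
    show ?thesis by (rule exI[of _ C], intro conjI exI[of _ 2] ballI allI C) simp
  qed
  have 3: "unique_weak_solution TYPE('a) P (gaussian_policy P) t y" if "t \<in> {0..T}" for t y
    by (rule gaussian_unique_weak_solution[OF noise that])
  show ?thesis unfolding admissible_policies_def mem_Collect_eq
    by (intro conjI 1 5 6; intro ballI allI; (rule 2 | erule 3 | erule 4))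
qed

end

section \<open>The optimal value and the HJB equation\<close>

context liquidation_model
begin

lemma admissible_density:
  assumes "\<pi> \<in> admissible_policies TA P" "t \<in> {0..T}"
  shows "v \<in> \<A> \<Longrightarrow> 0 \<le> \<pi> t y v" "L1_on \<A> (\<pi> t y)" "(LBINT v:\<A>. \<pi> t y v) = 1"
    "unique_weak_solution TA P \<pi> t y"
proof -
  have "(\<forall>t\<in>{0..T}. \<forall>y. (\<forall>v\<in>\<A>. 0 \<le> \<pi> t y v) \<and> L1_on \<A> (\<pi> t y) \<and> (LBINT v:\<A>. \<pi> t y v) = 1)
     \<and> (\<forall>t\<in>{0..T}. \<forall>y. unique_weak_solution TA P \<pi> t y)"
    using assms(1) unfolding admissible_policies_def mem_Collect_eq by (elim conjE, intro conjI)
  with assms(2) show "v \<in> \<A> \<Longrightarrow> 0 \<le> \<pi> t y v" "L1_on \<A> (\<pi> t y)" "(LBINT v:\<A>. \<pi> t y v) = 1"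
    "unique_weak_solution TA P \<pi> t y"
    by blast+
qed

lemma kl_integrand_gaussian: "kl_integrand m sd (normal_density m sd) v = 0"
  by (simp add: kl_integrand_def)

context
  fixes V :: value_fun
  assumes V: "\<And>t x S \<mu> q. t \<in> {0..T} \<Longrightarrow> V t x S \<mu> q = candidate t x S \<mu> q"
begin

text \<open>The integrand is \<open>max_hamiltonian * \<pi>\<close>, plus a term of integral \<open>0\<close>,
  minus \<open>\<gamma>\<close> times the non-negative integrand of the relative entropy. A density of
  infinite relative entropy has the value \<open>- \<infinity>\<close>.\<close>

lemma hamiltonian_gap:
  assumes t: "t \<in> {0..T}"
    and f0: "\<And>v. v \<in> \<A> \<Longrightarrow> 0 \<le> \<pi> t (x, S, \<mu>, q) v"
    and fi: "L1_on \<A> (\<pi> t (x, S, \<mu>, q))" and f1: "(LBINT v:\<A>. \<pi> t (x, S, \<mu>, q) v) = 1"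
  shows "hamiltonian P V \<pi> t x S \<mu> q \<le> ereal (max_hamiltonian t \<mu> q)"
    and "hamiltonian P V \<pi> t x S \<mu> q = ereal (max_hamiltonian t \<mu> q) \<longleftrightarrow>
      (AE v in lborel. v \<in> \<A> \<longrightarrow> \<pi> t (x, S, \<mu>, q) v = gaussian_policy P t (x, S, \<mu>, q) v)"
proof -
  let ?f = "\<pi> t (x, S, \<mu>, q)" and ?m = "mean_speed t \<mu> q"
  let ?n = "normal_density ?m sd"
  let ?K = "max_hamiltonian t \<mu> q"
  define kl where "kl v = indicator \<A> v * kl_integrand ?m sd ?f v" for v
  define g where "g v = ?K * (indicator \<A> v * ?f v) - \<gamma> * (indicator \<A> v * ?f v - indicator \<A> v * ?n v)" for v
  have F: "integrable lborel (\<lambda>v. indicator \<A> v * ?f v)" "(\<integral>v. indicator \<A> v * ?f v \<partial>lborel) = 1"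
    using fi f1 by (simp_all add: set_integrable_def set_lebesgue_integral_def)
  have "L1_on \<A> ?n" "(LBINT v:\<A>. ?n v) = 1"
    using sd_pos by (simp_all add: full_set_integral)
  then have n: "integrable lborel (\<lambda>v. indicator \<A> v * ?n v)" "(\<integral>v. indicator \<A> v * ?n v \<partial>lborel) = 1"
    by (simp_all add: set_integrable_def set_lebesgue_integral_def)
  have g: "integrable lborel g" "(\<integral>v. g v \<partial>lborel) = ?K"
    unfolding g_def[abs_def] using F n by simp_all
  have [measurable]: "(\<lambda>v. indicator \<A> v * ?f v) \<in> borel_measurable borel"
    using borel_measurable_integrable[OF F(1)] by simp
  have "kl = (\<lambda>v. indicator \<A> v * kl_integrand ?m sd (\<lambda>v. indicator \<A> v * ?f v) v)"
    by (auto simp: kl_def kl_integrand_def indicator_def)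
  then have [measurable]: "kl \<in> borel_measurable borel" by (simp add: kl_integrand_def)
  have kl0: "0 \<le> kl v" for v
    unfolding kl_def using kl_integrand_nonneg[OF sd_pos, of ?f v ?m] f0[of v] by (cases "v \<in> \<A>") auto
  have D: "D\<^sub>x V t x S \<mu> q = 1" "D\<^sub>S V t x S \<mu> q = q" "D\<^sub>q V t x S \<mu> q = S + w\<^sub>1 P t \<mu> + 2 * w\<^sub>2 P t \<mu> * q"
    by (rule value_partials, erule V, rule t)+
  have h: "indicator \<A> v * (((S - k * v) * v * D\<^sub>x V t x S \<mu> q - v * D\<^sub>q V t x S \<mu> q - b * v * D\<^sub>S V t x S \<mu> q
       - \<gamma> * ln (?f v) - \<phi> * (v - \<rho> * \<mu>)\<^sup>2) * ?f v) = g v - \<gamma> * kl v" for v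
  proof -
    have m2: "2 * c * ?m = 2 * p t * q + drift_gain t \<mu>"
      unfolding mean_speed_def using c_pos by (simp add: field_simps)
    have "(S - k * v) * v * 1 - v * (S + w\<^sub>1 P t \<mu> + 2 * w\<^sub>2 P t \<mu> * q) - b * v * q - \<phi> * (v - \<rho> * \<mu>)\<^sup>2
        = v * (2 * p t * q + drift_gain t \<mu>) - c * v\<^sup>2 - \<phi> * \<rho>\<^sup>2 * \<mu>\<^sup>2"
      unfolding w2_eq drift_gain_def c_def by (simp add: power2_eq_square algebra_simps)
    also have "\<dots> = ?K + entropy_const - c * (v - ?m)\<^sup>2"
      unfolding m2[symmetric] max_hamiltonian_def by (simp add: power2_eq_square algebra_simps)
    finally have e: "(S - k * v) * v * 1 - v * (S + w\<^sub>1 P t \<mu> + 2 * w\<^sub>2 P t \<mu> * q) - b * v * q - \<phi> * (v - \<rho> * \<mu>)\<^sup>2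
        = ?K + entropy_const - c * (v - ?m)\<^sup>2" .
    have "((S - k * v) * v * 1 - v * (S + w\<^sub>1 P t \<mu> + 2 * w\<^sub>2 P t \<mu> * q) - b * v * q - \<gamma> * ln (?f v) - \<phi> * (v - \<rho> * \<mu>)\<^sup>2) * ?f v
        = (?K + entropy_const) * ?f v - (c * (v - ?m)\<^sup>2 + \<gamma> * ln (?f v)) * ?f v"
    proof -
      have "(S - k * v) * v * 1 - v * (S + w\<^sub>1 P t \<mu> + 2 * w\<^sub>2 P t \<mu> * q) - b * v * q - \<gamma> * ln (?f v) - \<phi> * (v - \<rho> * \<mu>)\<^sup>2
        = (?K + entropy_const) - (c * (v - ?m)\<^sup>2 + \<gamma> * ln (?f v))" using e by linarith
      then show ?thesis by (simp only: left_diff_distrib)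
    qed
    also have "\<dots> = ?K * ?f v - \<gamma> * (?f v - ?n v) - \<gamma> * kl_integrand ?m sd ?f v"
      unfolding quadratic_plus_entropy[OF c_pos \<gamma>_pos] entropy_const_def[symmetric] by (simp add: distrib_right)
    finally show ?thesis
      unfolding D g_def kl_def by (cases "v \<in> \<A>") simp_all
  qed
  have H: "hamiltonian P V \<pi> t x S \<mu> q = ext_integral lborel (\<lambda>v. g v - \<gamma> * kl v)"
    unfolding hamiltonian_def h ..
  have gm [measurable]: "g \<in> borel_measurable borel" using borel_measurable_integrable[OF g(1)] by simp
  have hm: "(\<lambda>v. g v - \<gamma> * kl v) \<in> borel_measurable lborel" by measurable
  have hle: "AE v in lborel. g v - \<gamma> * kl v \<le> g v" using \<gamma>_pos kl0 by simp
  have klg: "kl v = 0 \<longleftrightarrow> (v \<in> \<A> \<longrightarrow> ?f v = gaussian_policy P t (x, S, \<mu>, q) v)" for v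
    unfolding kl_def gaussian_policy_eq using kl_integrand_eq_0_iff[OF sd_pos, of ?f v ?m] f0[of v] by (cases "v \<in> \<A>") auto
  from ext_integral_bounded_above[OF hm g(1) hle]
  have "hamiltonian P V \<pi> t x S \<mu> q \<le> ereal ?K \<and> (hamiltonian P V \<pi> t x S \<mu> q = ereal ?K \<longrightarrow> (AE v in lborel. kl v = 0))"
  proof
    assume hi: "integrable lborel (\<lambda>v. g v - \<gamma> * kl v)"
    from Bochner_Integration.integrable_diff[OF g(1) hi] have "integrable lborel (\<lambda>v. \<gamma> * kl v)" by simp
    then have ki: "integrable lborel kl" using \<gamma>_pos by simp
    have "(\<integral>v. g v - \<gamma> * kl v \<partial>lborel) = ?K - \<gamma> * (\<integral>v. kl v \<partial>lborel)" using g ki by simp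
    then have Hk: "hamiltonian P V \<pi> t x S \<mu> q = ereal (?K - \<gamma> * (\<integral>v. kl v \<partial>lborel))"
      unfolding H ext_integral_integrable[OF hi] by simp
    have "0 \<le> (\<integral>v. kl v \<partial>lborel)" using kl0 by simp
    moreover have "(\<integral>v. kl v \<partial>lborel) = 0 \<Longrightarrow> AE v in lborel. kl v = 0"
      using integral_nonneg_eq_0_iff_AE[OF ki] kl0 by simp
    ultimately show ?thesis unfolding Hk using \<gamma>_pos by simp
  qed (simp add: H)
  moreover have "hamiltonian P V \<pi> t x S \<mu> q = ereal ?K" if "AE v in lborel. kl v = 0"
  proof -
    from that have "AE v in lborel. g v - \<gamma> * kl v = g v" by eventually_elim simp
    then show ?thesis unfolding H by (subst ext_integral_cong_AE) (auto simp: ext_integral_integrable g)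
  qed
  ultimately show "hamiltonian P V \<pi> t x S \<mu> q \<le> ereal ?K"
    "hamiltonian P V \<pi> t x S \<mu> q = ereal ?K \<longleftrightarrow>
      (AE v in lborel. v \<in> \<A> \<longrightarrow> ?f v = gaussian_policy P t (x, S, \<mu>, q) v)"
    unfolding klg by blast+
qed

lemma hamiltonian_supremum:
  assumes gauss: "gaussian_policy P \<in> admissible_policies TA P" and t: "t \<in> {0..T}"
  shows "(SUP \<pi>\<in>admissible_policies TA P. hamiltonian P V \<pi> t x S \<mu> q) = ereal (max_hamiltonian t \<mu> q)"
proof (rule antisym)
  show "(SUP \<pi>\<in>admissible_policies TA P. hamiltonian P V \<pi> t x S \<mu> q) \<le> ereal (max_hamiltonian t \<mu> q)"
    by (intro SUP_least hamiltonian_gap(1) t admissible_density)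
  have "hamiltonian P V (gaussian_policy P) t x S \<mu> q = ereal (max_hamiltonian t \<mu> q)"
    by (rule hamiltonian_gap(2)[THEN iffD2, of t "gaussian_policy P" x S \<mu> q])
      (simp_all add: t[simplified] admissible_density[OF gauss t])
  then show "ereal (max_hamiltonian t \<mu> q) \<le> (SUP \<pi>\<in>admissible_policies TA P. hamiltonian P V \<pi> t x S \<mu> q)"
    using SUP_upper[OF gauss, of "\<lambda>\<pi>. hamiltonian P V \<pi> t x S \<mu> q"] by simp
qed

lemma attains_HJB_sup_iff:
  assumes gauss: "gaussian_policy P \<in> admissible_policies TA P" and \<pi>: "\<pi> \<in> admissible_policies TA P" and t: "t \<in> {0..T}"
  shows "attains_HJB_sup TA P V \<pi> t x S \<mu> q \<longleftrightarrow>
    (AE v in lborel. v \<in> \<A> \<longrightarrow> \<pi> t (x, S, \<mu>, q) v = gaussian_policy P t (x, S, \<mu>, q) v)"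
  unfolding attains_HJB_sup_def hamiltonian_supremum[OF gauss t]
  by (rule hamiltonian_gap(2)[where \<pi> = \<pi> and x = x and S = S and \<mu> = \<mu> and q = q]) (rule t admissible_density[OF \<pi> t], assumption?)+

lemma value_solves_HJB:
  assumes gauss: "gaussian_policy P \<in> admissible_policies TA P"
  shows "solves_HJB TA P V"
  unfolding solves_HJB_def
proof (intro conjI ballI allI)
  show "HJB_regular P V" by (rule value_HJB_regular[OF V])
  fix t x S \<mu> q assume t: "t \<in> {0..<T}"
  then have "t \<in> {0..T}" by simp
  note sup = hamiltonian_supremum[OF gauss this]
  show "0 = ereal (D\<^sub>t P V t x S \<mu> q + 1 / 2 * \<sigma>\<^sup>2 * D\<^sub>S (D\<^sub>S V) t x S \<mu> q + generator P V t x S \<mu> q)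
      + (SUP \<pi>\<in>admissible_policies TA P. hamiltonian P V \<pi> t x S \<mu> q)"
    unfolding sup using value_PDE[OF V t, of x S \<mu> q] by (simp only: plus_ereal.simps(1) zero_ereal_def)
qed

end

lemma policy_value_solution:
  fixes \<pi> :: policy
  assumes "unique_weak_solution TYPE('a) P \<pi> t y"
  obtains M :: "'a measure" and F W N \<eta> Y where "weak_solution P \<pi> t y M F W N \<eta> Y"
    "policy_value TYPE('a) P \<pi> t y = ext_integral M (\<lambda>\<omega>. payoff P \<pi> t (\<lambda>u. Y u \<omega>))"
proof -
  let ?Q = "\<lambda>(M :: 'a measure, Y). \<exists>F W N \<eta>. weak_solution P \<pi> t y M F W N \<eta> Y"
  obtain M :: "'a measure" and Y where MY: "(SOME z. ?Q z) = (M, Y)" by (rule prod.exhaust)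
  have "\<exists>z. ?Q z" using assms unfolding unique_weak_solution_def by blast
  then have "?Q (M, Y)" unfolding MY[symmetric] by (rule someI_ex)
  then obtain F W N \<eta> where "weak_solution P \<pi> t y M F W N \<eta> Y" by auto
  moreover have "policy_value TYPE('a) P \<pi> t y = ext_integral M (\<lambda>\<omega>. payoff P \<pi> t (\<lambda>u. Y u \<omega>))"
    unfolding policy_value_def MY by simp
  ultimately show thesis by (rule that)
qed

lemma weak_solution_controlled:
  fixes M :: "'a measure"
  assumes "\<pi> \<in> admissible_policies TYPE('a) P" "t \<in> {0..T}" "weak_solution P \<pi> t (x, S, \<mu>, q) M F W N \<eta> Y"
  shows "controlled P M F W N \<eta> \<pi> t x S \<mu> q Y"
proof -
  interpret liquidation_noise P M F W N \<eta>
    by unfold_locales (use assms(3) in \<open>simp add: weak_solution_def\<close>)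
  show ?thesis by unfold_locales (rule assms)+
qed

text \<open>Any weak solution that the definition of the value may choose satisfies the bound.\<close>

lemma policy_value_le:
  assumes \<pi>: "\<pi> \<in> admissible_policies TYPE('a) P" and t: "t \<in> {0..T}"
  shows "policy_value TYPE('a) P \<pi> t (x, S, \<mu>, q) \<le> ereal (candidate t x S \<mu> q)"
proof -
  obtain M :: "'a measure" and F W N \<eta> Y where s: "weak_solution P \<pi> t (x, S, \<mu>, q) M F W N \<eta> Y"
    "policy_value TYPE('a) P \<pi> t (x, S, \<mu>, q) = ext_integral M (\<lambda>\<omega>. payoff P \<pi> t (\<lambda>u. Y u \<omega>))"
    by (rule policy_value_solution[OF admissible_density(4)[OF \<pi> t]])
  interpret controlled P M F W N \<eta> \<pi> t x S \<mu> q Y by (rule weak_solution_controlled[OF \<pi> t s(1)])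
  show ?thesis unfolding s(2) by (rule payoff_upper_bound)
qed

text \<open>The Gaussian policy has \<open>z = \<zeta>b / (2 c)\<close> by the choice of its mean, and no
  relative entropy because it is itself the normal density with its own mean.\<close>

lemma policy_value_gaussian:
  assumes \<pi>: "gaussian_policy P \<in> admissible_policies TYPE('a) P" and t: "t \<in> {0..T}"
  shows "policy_value TYPE('a) P (gaussian_policy P) t (x, S, \<mu>, q) = ereal (candidate t x S \<mu> q)"
proof -
  obtain M :: "'a measure" and F W N \<eta> Y where s: "weak_solution P (gaussian_policy P) t (x, S, \<mu>, q) M F W N \<eta> Y"
    "policy_value TYPE('a) P (gaussian_policy P) t (x, S, \<mu>, q) = ext_integral M (\<lambda>\<omega>. payoff P (gaussian_policy P) t (\<lambda>u. Y u \<omega>))"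
    by (rule policy_value_solution[OF admissible_density(4)[OF \<pi> t]])
  interpret controlled P M F W N \<eta> "gaussian_policy P" t x S \<mu> q Y by (rule weak_solution_controlled[OF \<pi> t s(1)])
  have u_eq: "u r \<omega> = mean_speed r (m r \<omega>) (Q r \<omega>)" if r: "r \<in> {t..T}" for r \<omega>
    using rates_eq(1)[of r] r t by (simp add: u_def m_def Q_def gaussian_rates)
  show ?thesis unfolding s(2)
  proof (rule payoff_optimal)
    fix r \<omega> assume r: "r \<in> {t..T}"
    then show "z r \<omega> = \<zeta>b r \<omega> / (2 * c)" unfolding z_def u_eq[OF r] \<zeta>b_def mean_speed_def by simp
    have "kl_integrand (u r \<omega>) sd (gaussian_policy P r (Y r \<omega>)) v = 0" for v
      unfolding u_eq[OF r] gaussian_policy_state m_def Q_def Yc_eq[OF r] by (rule kl_integrand_gaussian)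
    then show "(LBINT v:\<A>. kl_integrand (u r \<omega>) sd (gaussian_policy P r (Y r \<omega>)) v) = 0" by simp
  qed
qed

lemma optimal_value_eq:
  assumes \<pi>: "gaussian_policy P \<in> admissible_policies TYPE('a) P" and t: "t \<in> {0..T}"
  shows "optimal_value TYPE('a) P t x S \<mu> q = ereal (candidate t x S \<mu> q)"
  unfolding optimal_value_def
proof (rule antisym)
  show "(SUP \<pi>\<in>admissible_policies TYPE('a) P. policy_value TYPE('a) P \<pi> t (x, S, \<mu>, q)) \<le> ereal (candidate t x S \<mu> q)"
    by (intro SUP_least policy_value_le t)
  show "ereal (candidate t x S \<mu> q) \<le> (SUP \<pi>\<in>admissible_policies TYPE('a) P. policy_value TYPE('a) P \<pi> t (x, S, \<mu>, q))"
    using SUP_upper[OF \<pi>, of "\<lambda>\<pi>. policy_value TYPE('a) P \<pi> t (x, S, \<mu>, q)"] unfolding policy_value_gaussian[OF \<pi> t] .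
qed

end

theorem theorem2:
  fixes P :: model
    and M :: "'a measure" and F :: "real \<Rightarrow> 'a measure"
    and W :: "real \<Rightarrow> 'a \<Rightarrow> real" and N :: "real \<Rightarrow> 'a \<Rightarrow> nat" and \<eta> :: "nat \<Rightarrow> 'a \<Rightarrow> real"
    and V :: "real \<Rightarrow> real \<Rightarrow> real \<Rightarrow> real \<Rightarrow> real \<Rightarrow> real"
  assumes "0 < T_of P" and "0 \<le> b_of P" and "0 \<le> k_of P" and "0 < rate_of P" and "0 < \<gamma>_of P"
    and "\<kappa>_of P \<noteq> 0" and "0 < \<phi>_of P + k_of P"
    and "\<alpha>_of P \<noteq> 1 / 2 * b_of P"
    and "\<forall>t\<in>{0..T_of P}. (T_of P - t) / (k_of P + \<phi>_of P) + 1 / (\<alpha>_of P - 1 / 2 * b_of P) \<noteq> 0"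
    and "A_of P \<in> sets borel" and "AE v in lborel. v \<in> A_of P"
    and "prob_space (\<nu>_of P)" and "sets (\<nu>_of P) = sets borel" and "AE h in \<nu>_of P. 0 \<le> h"
    and "\<forall>n::nat. integrable (\<nu>_of P) (\<lambda>h. h ^ n)"
    and "driving_noise P M F W N \<eta>"
    and "V = (\<lambda>t x S \<mu> q. real_of_ereal (optimal_value TYPE('a) P t x S \<mu> q))"
  shows "(\<forall>t\<in>{0..T_of P}. \<forall>x S \<mu> q. \<bar>optimal_value TYPE('a) P t x S \<mu> q\<bar> \<noteq> \<infinity>)
    \<and> solves_HJB TYPE('a) P V \<and> terminal_condition P V
    \<and> gaussian_policy P \<in> admissible_policies TYPE('a) P
    \<and> (\<forall>t\<in>{0..<T_of P}. \<forall>x S \<mu> q. attains_HJB_sup TYPE('a) P V (gaussian_policy P) t x S \<mu> q)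
    \<and> (\<forall>\<pi>\<in>admissible_policies TYPE('a) P. \<forall>t\<in>{0..<T_of P}. \<forall>x S \<mu> q.
         attains_HJB_sup TYPE('a) P V \<pi> t x S \<mu> q \<longrightarrow>
         (AE v in lborel. v \<in> A_of P \<longrightarrow>
            \<pi> t (x, S, \<mu>, q) v = gaussian_policy P t (x, S, \<mu>, q) v))"
proof -
  interpret liquidation_model P
  proof (rule liquidation_model.intro)
    show "(T_of P - t) / (k_of P + \<phi>_of P) + 1 / (\<alpha>_of P - b_of P / 2) \<noteq> 0" if "t \<in> {0..T_of P}" for t
      using assms(9) that by simp
    show "integrable (\<nu>_of P) (\<lambda>h. h ^ n)" for n :: nat using assms(15) by simp
  qed (use assms in \<open>simp_all add: add.commute\<close>)
  have gauss: "gaussian_policy P \<in> admissible_policies TYPE('a) P"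
    by (rule gaussian_policy_admissible[OF assms(16)])
  note opt = optimal_value_eq[OF gauss]
  have V: "V t x S \<mu> q = candidate t x S \<mu> q" if "t \<in> {0..T_of P}" for t x S \<mu> q
    unfolding assms(17) opt[OF that] by simp
  have I: "t \<in> {0..T_of P}" if "t \<in> {0..<T_of P}" for t using that by simp
  have iff: "attains_HJB_sup TYPE('a) P V \<pi> t x S \<mu> q \<longleftrightarrow>
      (AE v in lborel. v \<in> A_of P \<longrightarrow> \<pi> t (x, S, \<mu>, q) v = gaussian_policy P t (x, S, \<mu>, q) v)"
    if "\<pi> \<in> admissible_policies TYPE('a) P" "t \<in> {0..<T_of P}" for \<pi> t x S \<mu> q
    by (rule attains_HJB_sup_iff[OF V gauss that(1) I[OF that(2)]])
  show ?thesis
  proof (intro conjI ballI allI impI)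
    show "\<bar>optimal_value TYPE('a) P t x S \<mu> q\<bar> \<noteq> \<infinity>" if "t \<in> {0..T_of P}" for t x S \<mu> q
      unfolding opt[OF that] by simp
    show "solves_HJB TYPE('a) P V" by (rule value_solves_HJB[OF V gauss])
    show "terminal_condition P V" unfolding terminal_condition_def
      using T_pos by (simp add: V candidate_terminal)
    show "attains_HJB_sup TYPE('a) P V (gaussian_policy P) t x S \<mu> q" if "t \<in> {0..<T_of P}" for t x S \<mu> q
      using iff[OF gauss that] by simp
    show "AE v in lborel. v \<in> A_of P \<longrightarrow> \<pi> t (x, S, \<mu>, q) v = gaussian_policy P t (x, S, \<mu>, q) v"
      if "\<pi> \<in> admissible_policies TYPE('a) P" "t \<in> {0..<T_of P}" "attains_HJB_sup TYPE('a) P V \<pi> t x S \<mu> q" for \<pi> t x S \<mu> q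
      using iff[OF that(1,2)] that(3) by simp
  qed (rule gauss)
qed

end
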